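(* Let $d\ge1$, $\beta>0$, $\kappa>0$, and let $p^{\beta,\kappa}(t,x,y)$ be the heat kernel of $\Delta-\kappa|x|^{-(2+2\beta)}$ on $\mathbb{R}^d_0:=\mathbb{R}^d\setminus\{0\}$. (i) If $d\ge 2$, there exist $c_1,c_2,c_3,c_4>0$ such that for all $t\ge 4$ and $x,y\in\mathbb{R}^d_0$, $$c_1\,q(c_2t,x,y)H_{d,\beta,\kappa}(t,|x|)H_{d,\beta,\kappa}(t,|y|)\le p^{\beta,\kappa}(t,x,y)\le c_3\,q(c_4t,x,y)H_{d,\beta,\kappa}(t,|x|)H_{d,\beta,\kappa}(t,|y|).$$ (ii) If $d=1$, the two-sided estimate in (i) holds (for suitable constants) for all $t\ge4$ and $x,y\in\mathbb{R}^1_0$ with $xy>0$.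
   Context: $q(t,x,y)=(4\pi t)^{-d/2}e^{-|x-y|^2/(4t)}$. The heat kernel $p^{\beta,\kappa}$ is the transition density of the process on $\mathbb{R}^d_0$ with semigroup $P_tf(x)=\mathbb{E}_x\big[e^{-\int_0^t \kappa|W_s|^{-(2+2\beta)}ds}f(W_t);\,t<\tau^W_{\mathbb{R}^d_0}\big]$, $W$ Brownian motion with generator $\Delta$ and $\tau^W_{\mathbb{R}^d_0}$ its exit time from $\mathbb{R}^d_0$. Notation: $\mathrm{Log}\,r:=\log(e-1+r)$ for $r\ge0$; $h_{\beta,\kappa}(r):=(r\wedge 1)^{-(d-2-\beta)/2}\exp\big(-\frac{\sqrt\kappa}{\beta(r\wedge1)^\beta}\big)$; and for $t,r>0$, $H_{d,\beta,\kappa}(t,r):=h_{\beta,\kappa}(r)$ if $d\ge3$; $H_{2,\beta,\kappa}(t,r):=1\wedge\frac{h_{\beta,\kappa}(r)\mathbf 1_{(0,1)}(r)+(\mathrm{Log}\,r)\mathbf 1_{[1,\infty)}(r)}{\mathrm{Log}\sqrt t}$; $H_{1,\beta,\kappa}(t,r):=1\wedge\frac{h_{\beta,\kappa}(r)\mathbf 1_{(0,1)}(r)+r\mathbf 1_{[1,\infty)}(r)}{\sqrt t}$. *)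

theory Defs
  imports "HOL-Probability.Probability"
begin

definition heat_q :: "real \<Rightarrow> 'a::euclidean_space \<Rightarrow> 'a \<Rightarrow> real" where
  "heat_q t x y = (4 * pi * t) powr (- real DIM('a) / 2) * exp (- (norm (x - y))\<^sup>2 / (4 * t))"

definition Logf :: "real \<Rightarrow> real" where
  "Logf r = ln (exp 1 - 1 + r)"

definition hfun :: "nat \<Rightarrow> real \<Rightarrow> real \<Rightarrow> real \<Rightarrow> real" where
  "hfun d \<beta> \<kappa> r = (min r 1) powr (- (real d - 2 - \<beta>) / 2) * exp (- sqrt \<kappa> / (\<beta> * (min r 1) powr \<beta>))"

definition Hfun :: "nat \<Rightarrow> real \<Rightarrow> real \<Rightarrow> real \<Rightarrow> real \<Rightarrow> real" where
  "Hfun d \<beta> \<kappa> t r =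
     (if d \<ge> 3 then hfun d \<beta> \<kappa> r
      else if d = 2 then min 1 ((if r < 1 then hfun d \<beta> \<kappa> r else Logf r) / Logf (sqrt t))
      else min 1 ((if r < 1 then hfun d \<beta> \<kappa> r else r) / sqrt t))"

text \<open>W is a Brownian motion with generator Laplacian (covariance 2tI) started at x under M.\<close>
definition is_BM :: "'b measure \<Rightarrow> (real \<Rightarrow> 'b \<Rightarrow> 'a::euclidean_space) \<Rightarrow> 'a \<Rightarrow> bool" where
  "is_BM M W x \<longleftrightarrow>
     prob_space M \<and>
     (\<forall>t\<ge>0. W t \<in> borel_measurable M) \<and>
     (\<forall>\<omega>\<in>space M. continuous_on {0..} (\<lambda>s. W s \<omega>)) \<and>
     (\<forall>\<omega>\<in>space M. W 0 \<omega> = x) \<and>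
     (\<forall>s t. 0 \<le> s \<and> s < t \<longrightarrow>
        distributed M lborel (\<lambda>\<omega>. W t \<omega> - W s \<omega>) (\<lambda>z. ennreal (heat_q (t - s) 0 z))) \<and>
     (\<forall>(ts :: nat \<Rightarrow> real) n. 0 \<le> ts 0 \<and> (\<forall>i<n. ts i < ts (Suc i)) \<longrightarrow>
        prob_space.indep_vars M (\<lambda>_. borel) (\<lambda>i \<omega>. W (ts (Suc i)) \<omega> - W (ts i) \<omega>) {..<n})"

text \<open>Exit time of the path from R^d minus the origin (infimum of empty set is infinity).\<close>
definition exit_time :: "(real \<Rightarrow> 'b \<Rightarrow> 'a::euclidean_space) \<Rightarrow> 'b \<Rightarrow> ereal" where
  "exit_time W \<omega> = (INF s \<in> {s. 0 \<le> s \<and> W s \<omega> = 0}. ereal s)"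

definition fk_weight :: "(real \<Rightarrow> 'b \<Rightarrow> 'a::euclidean_space) \<Rightarrow> real \<Rightarrow> real \<Rightarrow> real \<Rightarrow> 'b \<Rightarrow> ennreal" where
  "fk_weight W \<beta> \<kappa> t \<omega> =
     (let I = (\<integral>\<^sup>+ s. indicator {0..t} s * ennreal (\<kappa> * norm (W s \<omega>) powr (- (2 + 2 * \<beta>))) \<partial>lborel)
      in if I = \<infinity> then 0 else ennreal (exp (- enn2real I)))"

definition fk_semigroup :: "('a::euclidean_space \<Rightarrow> 'b measure) \<Rightarrow> (real \<Rightarrow> 'b \<Rightarrow> 'a) \<Rightarrow> real \<Rightarrow> real
     \<Rightarrow> real \<Rightarrow> ('a \<Rightarrow> ennreal) \<Rightarrow> 'a \<Rightarrow> ennreal" where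
  "fk_semigroup M W \<beta> \<kappa> t f x =
     (\<integral>\<^sup>+ \<omega>. fk_weight W \<beta> \<kappa> t \<omega> * indicator {\<omega>. ereal t < exit_time W \<omega>} \<omega> * f (W t \<omega>) \<partial>(M x))"

definition is_fk_density :: "('a::euclidean_space \<Rightarrow> 'b measure) \<Rightarrow> (real \<Rightarrow> 'b \<Rightarrow> 'a) \<Rightarrow> real \<Rightarrow> real
     \<Rightarrow> (real \<Rightarrow> 'a \<Rightarrow> 'a \<Rightarrow> real) \<Rightarrow> bool" where
  "is_fk_density M W \<beta> \<kappa> p \<longleftrightarrow>
     (\<forall>t>0. \<forall>x. x \<noteq> 0 \<longrightarrow> (\<forall>f \<in> borel_measurable borel.
        fk_semigroup M W \<beta> \<kappa> t f x = (\<integral>\<^sup>+ y. indicator (- {0}) y * ennreal (p t x y) * f y \<partial>lborel)))"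

end

(* Killing at rate V(x) = kappa |x|^-(2+2 beta) is governed near the origin by the positive radial solution
phi of Delta phi = V phi vanishing at 0, an explicit Macdonald function. Discretising the Feynman-Kac
functional with a hard cut-off near the origin turns phi and its multiples into barriers, so a maximum principle
compares the semigroup with phi on balls. Since V beats the inverse square, mass decays instantly near the origin, whence
P_t 1(x) is at most of order phi(x) / phi(sqrt t) for |x| < sqrt t; the same bound holds with a small Gaussian
weight. Writing p(4s) as p(s) p(2s) p(s) and using p(2s) <= q(2s) in the middle gives the upper bound.
For the lower bound, P_s phi >= phi together with the upper bounds shows that a fixed proportion of phi(x) / phi(sqrt s)
reaches the annulus |z| ~ sqrt s, and there the middle factor is bounded below by comparison with
the Dirichlet heat kernel of half-spaces, on which V is at most of order 1/s. *)

theory Submission imports Defs "HOL-Real_Asymp.Real_Asymp"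
begin

section \<open>The Gaussian semigroup\<close>

text \<open>The kernel is accessible only through path integrals, and \<open>is_BM\<close> offers
  only increments and continuity. Sampling the path at multiples of \<open>t / n\<close> turns the
  weighted expectation into the iterate of a single operator, cut-off times Gaussian average.
  Fatou's lemma, with the mesh refined first and the cut-off radius shrunk afterwards, bounds the
  semigroup from above by such iterates; reverse Fatou at a fixed radius bounds it from below.
  Comparison principles thus become one-step inequalities with an error
  \<open>e * \<delta> + D * \<delta>\<^sup>2\<close>. The constant \<open>D\<close> blows up as the
  cut-off radius shrinks, because the derivatives of the barrier are controlled only on annuli; the
  order of the two limits makes this harmless. The three dimension-dependent forms of
  \<open>H\<close> are treated as one object, \<open>min 1 (phi r / phi (sqrt t))\<close>: a
  harmonic profile inside the parabolic ball and 1 outside it. In the upper bound the two outer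
  factors carry Gaussian weights centred at \<open>x\<close> and \<open>y\<close>; these absorb the
  displacement of the intermediate points, so that off-diagonal decay survives at the price of a
  larger time constant.\<close>

lemma heat_q_pos: "t > 0 \<Longrightarrow> heat_q t x y > 0"
  by (simp add: heat_q_def)

lemma heat_q_nonneg [simp]: "heat_q t x y \<ge> 0"
  by (simp add: heat_q_def)

lemma heat_q_commute: "heat_q t x y = heat_q t y x"
  by (simp add: heat_q_def norm_minus_commute)

lemma heat_q_shift: "heat_q t x (x + z) = heat_q t 0 z"
  by (simp add: heat_q_def)

lemma heat_q_continuous [continuous_intros]:
  "continuous_on A f \<Longrightarrow> continuous_on A g \<Longrightarrow> continuous_on A (\<lambda>x. heat_q t (f x) (g x))"
  unfolding heat_q_def divide_inverse by (intro continuous_intros)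

lemma heat_q_measurable [measurable]:
  "(\<lambda>(x, y). heat_q t x y) \<in> borel_measurable (borel \<Otimes>\<^sub>M borel)"
  unfolding heat_q_def by measurable

lemma heat_q_le: "t > 0 \<Longrightarrow> heat_q t x y \<le> (4 * pi * t) powr (- real DIM('a) / 2)" for x y :: "'a::euclidean_space"
  by (simp add: heat_q_def)

lemma nn_integral_lborel_shift:
  fixes f :: "'a::euclidean_space \<Rightarrow> ennreal"
  assumes [measurable]: "f \<in> borel_measurable borel"
  shows "(\<integral>\<^sup>+ y. f y \<partial>lborel) = (\<integral>\<^sup>+ z. f (c + z) \<partial>lborel)"
proof -
  have "(\<integral>\<^sup>+ y. f y \<partial>lborel) = (\<integral>\<^sup>+ y. f y \<partial>(distr lborel borel ((+) c)))"
    by (simp add: lborel_distr_plus)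
  also have "\<dots> = (\<integral>\<^sup>+ z. f (c + z) \<partial>lborel)"
    by (subst nn_integral_distr) auto
  finally show ?thesis .
qed

text \<open>Generator Laplacian means variance \<open>2 * t\<close> in every coordinate. The
  factorisation reduces the total mass of the kernel to that of the one-dimensional normal
  density.\<close>

lemma heat_q_prod_normal:
  fixes x z :: "'a::euclidean_space"
  assumes t: "t > 0"
  shows "heat_q t x z = (\<Prod>b\<in>Basis. normal_density (x \<bullet> b) (sqrt (2 * t)) (z \<bullet> b))"
proof -
  have "(\<Prod>b\<in>(Basis::'a set). normal_density (x \<bullet> b) (sqrt (2 * t)) (z \<bullet> b))
      = (\<Prod>b\<in>(Basis::'a set). 1 / sqrt (4 * pi * t)) * (\<Prod>b\<in>(Basis::'a set). exp (- (z \<bullet> b - x \<bullet> b)\<^sup>2 / (4 * t)))"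
    using t by (subst prod.distrib[symmetric], intro prod.cong refl) (simp add: normal_density_def algebra_simps)
  also have "(\<Prod>b\<in>(Basis::'a set). 1 / sqrt (4 * pi * t)) = (4 * pi * t) powr (- real DIM('a) / 2)"
  proof -
    have "1 / sqrt (4 * pi * t) = (4 * pi * t) powr (-1/2)"
      using t powr_minus_divide[of "4 * pi * t" "1/2"] powr_half_sqrt[of "4 * pi * t"] by simp
    hence "(\<Prod>b\<in>(Basis::'a set). 1 / sqrt (4 * pi * t)) = ((4 * pi * t) powr (-1/2)) powr real DIM('a)"
      using t powr_realpow[of "(4 * pi * t) powr (-1/2)" "DIM('a)"] by simp
    thus ?thesis by (simp only: powr_powr) simp
  qed
  also have "(\<Prod>b\<in>(Basis::'a set). exp (- (z \<bullet> b - x \<bullet> b)\<^sup>2 / (4 * t))) = exp (- (norm (x - z))\<^sup>2 / (4 * t))"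
  proof -
    have "(norm (x - z))\<^sup>2 = (\<Sum>b\<in>Basis. (z \<bullet> b - x \<bullet> b)\<^sup>2)"
      unfolding norm_minus_commute[of x z]
      unfolding power2_norm_eq_inner euclidean_inner[of "z - x" "z - x"] by (simp add: inner_diff_left power2_eq_square)
    thus ?thesis by (simp add: exp_sum[symmetric] sum_negf[symmetric] sum_divide_distrib)
  qed
  finally show ?thesis by (simp add: heat_q_def)
qed

lemma nn_integral_heat_q:
  fixes x :: "'a::euclidean_space"
  assumes t: "t > 0"
  shows "(\<integral>\<^sup>+ y. ennreal (heat_q t x y) \<partial>lborel) = 1"
proof -
  have "(\<integral>\<^sup>+ y. ennreal (heat_q t x y) \<partial>lborel)
     = (\<integral>\<^sup>+ y. (\<Prod>b\<in>Basis. ennreal (normal_density (x \<bullet> b) (sqrt (2 * t)) (y \<bullet> b))) \<partial>lborel)"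
    by (simp add: heat_q_prod_normal[OF t] prod_ennreal)
  also have "\<dots> = (\<Prod>b\<in>(Basis::'a set). \<integral>\<^sup>+ u. ennreal (normal_density (x \<bullet> b) (sqrt (2 * t)) u) \<partial>lborel)"
    by (rule nn_integral_lborel_prod) auto
  also have "\<dots> = 1"
    using t by (simp add: nn_integral_eq_integral integrable_normal_moment integral_normal_density)
  finally show ?thesis .
qed

text \<open>Completing the square; both the semigroup property and all Gaussian moments come from it.\<close>

lemma heat_q_mult:
  fixes x y z :: "'a::euclidean_space"
  assumes s: "s > 0" and t: "t > 0"
  shows "heat_q s x z * heat_q t z y
       = heat_q (s + t) x y * heat_q (s * t / (s + t)) ((t / (s + t)) *\<^sub>R x + (s / (s + t)) *\<^sub>R y) z"
proof -
  define m where "m = (t / (s + t)) *\<^sub>R x + (s / (s + t)) *\<^sub>R y"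
  have st: "s + t > 0" using s t by simp
  have coef: "(4 * pi * s) powr r * (4 * pi * t) powr r = (4 * pi * (s + t)) powr r * (4 * pi * (s * t / (s + t))) powr r" for r
  proof -
    have "4 * pi * s * (4 * pi * t) = 4 * pi * (s + t) * (4 * pi * (s * t / (s + t)))"
      using st by simp
    moreover have "4 * pi * (s + t) \<ge> 0" "4 * pi * (s * t / (s + t)) \<ge> 0" using s t by simp_all
    ultimately show ?thesis using powr_mult[of "4 * pi * s" "4 * pi * t" r] powr_mult[of "4 * pi * (s + t)" "4 * pi * (s * t / (s + t))" r] s t
      by (metis mult_nonneg_nonneg less_imp_le pi_ge_zero zero_le_numeral)
  qed
  define a b where "a = x - z" and "b = z - y"
  have xy: "x - y = a + b" by (simp add: a_def b_def)
  have mz: "m - z = (t / (s + t)) *\<^sub>R a - (s / (s + t)) *\<^sub>R b"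
  proof -
    have "z = (t / (s + t)) *\<^sub>R z + (s / (s + t)) *\<^sub>R z"
      using st by (simp add: scaleR_add_left[symmetric] add_divide_distrib[symmetric] add.commute)
    thus ?thesis unfolding m_def a_def b_def
      by (simp add: scaleR_diff_right algebra_simps)
  qed
  have n1: "(norm (a + b))\<^sup>2 = a \<bullet> a + 2 * (a \<bullet> b) + b \<bullet> b"
    unfolding power2_norm_eq_inner by (simp add: inner_simps inner_commute)
  have n2: "(norm (m - z))\<^sup>2 = (t / (s + t))\<^sup>2 * (a \<bullet> a) - 2 * (t / (s + t)) * (s / (s + t)) * (a \<bullet> b) + (s / (s + t))\<^sup>2 * (b \<bullet> b)"
    unfolding mz power2_norm_eq_inner by (simp add: inner_simps inner_commute power2_eq_square algebra_simps)
  have "(a \<bullet> a) / (4 * s) + (b \<bullet> b) / (4 * t)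
     = (a \<bullet> a + 2 * (a \<bullet> b) + b \<bullet> b) / (4 * (s + t)) + ((t / (s + t))\<^sup>2 * (a \<bullet> a) - 2 * (t / (s + t)) * (s / (s + t)) * (a \<bullet> b) + (s / (s + t))\<^sup>2 * (b \<bullet> b)) / (4 * (s * t / (s + t)))"
    (is "?l = ?r1 + ?r2")
  proof -
    have aux: "(X / N\<^sup>2) / (4 * (s * t / N)) = X / (4 * s * t * N)" if "N > 0" for X N :: real
      using that s t by (simp add: field_simps power2_eq_square)
    have "(t / (s + t))\<^sup>2 * (a \<bullet> a) - 2 * (t / (s + t)) * (s / (s + t)) * (a \<bullet> b) + (s / (s + t))\<^sup>2 * (b \<bullet> b)
       = (t\<^sup>2 * (a \<bullet> a) - 2 * t * s * (a \<bullet> b) + s\<^sup>2 * (b \<bullet> b)) / (s + t)\<^sup>2"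
      by (simp add: power_divide add_divide_distrib diff_divide_distrib power2_eq_square)
    hence r2: "?r2 = (t\<^sup>2 * (a \<bullet> a) - 2 * t * s * (a \<bullet> b) + s\<^sup>2 * (b \<bullet> b)) / (4 * s * t * (s + t))"
      using aux[OF st] by simp
    have "?r1 + ?r2 = ((a \<bullet> a + 2 * (a \<bullet> b) + b \<bullet> b) * (s * t) + (t\<^sup>2 * (a \<bullet> a) - 2 * t * s * (a \<bullet> b) + s\<^sup>2 * (b \<bullet> b))) / (4 * s * t * (s + t))"
    proof -
      have "X / (4 * N) + Y / (4 * s * t * N) = (X * (s * t) + Y) / (4 * s * t * N)" if "N > 0" for X Y N :: real
        using that s t by (simp add: field_simps)
      from this[OF st] show ?thesis unfolding r2 .
    qed
    also have "\<dots> = ((a \<bullet> a) * t + (b \<bullet> b) * s) * (s + t) / (4 * s * t * (s + t))"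
      by (rule arg_cong[where f = "\<lambda>u. u / _"]) (simp add: algebra_simps power2_eq_square)
    also have "\<dots> = ?l"
    proof -
      have "(A * t + B * s) * N / (4 * s * t * N) = A / (4 * s) + B / (4 * t)" if "N > 0" for A B N :: real
        using that s t by (simp add: field_simps)
      from this[OF st] show ?thesis .
    qed
    finally show ?thesis by simp
  qed
  hence "- (norm (x - z))\<^sup>2 / (4 * s) + - (norm (z - y))\<^sup>2 / (4 * t)
     = - (norm (x - y))\<^sup>2 / (4 * (s + t)) + - (norm (m - z))\<^sup>2 / (4 * (s * t / (s + t)))"
    unfolding xy n1 n2 a_def[symmetric] b_def[symmetric]
    unfolding power2_norm_eq_inner minus_divide_left[symmetric] by (simp only: minus_add_distrib[symmetric])
  hence "exp (- (norm (x - z))\<^sup>2 / (4 * s)) * exp (- (norm (z - y))\<^sup>2 / (4 * t))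
     = exp (- (norm (x - y))\<^sup>2 / (4 * (s + t))) * exp (- (norm (m - z))\<^sup>2 / (4 * (s * t / (s + t))))"
    by (simp only: exp_add[symmetric])
  moreover have "c1 * e1 * (c2 * e2) = c3 * e3 * (c4 * e4)" if "c1 * c2 = c3 * c4" "e1 * e2 = e3 * e4"
    for c1 c2 c3 c4 e1 e2 e3 e4 :: real
  proof -
    have "c1 * e1 * (c2 * e2) = (c1 * c2) * (e1 * e2)" by simp
    thus ?thesis unfolding that by simp
  qed
  ultimately show ?thesis using coef unfolding heat_q_def m_def[symmetric] by blast
qed

lemma heat_q_convolution:
  fixes x y :: "'a::euclidean_space"
  assumes s: "s > 0" and t: "t > 0"
  shows "(\<integral>\<^sup>+ z. ennreal (heat_q s x z) * ennreal (heat_q t z y) \<partial>lborel) = ennreal (heat_q (s + t) x y)"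
proof -
  have "(\<integral>\<^sup>+ z. ennreal (heat_q s x z) * ennreal (heat_q t z y) \<partial>lborel)
    = (\<integral>\<^sup>+ z. ennreal (heat_q (s + t) x y) * ennreal (heat_q (s * t / (s + t)) ((t / (s + t)) *\<^sub>R x + (s / (s + t)) *\<^sub>R y) z) \<partial>lborel)"
    by (simp add: ennreal_mult[symmetric] heat_q_mult[OF s t])
  also have "\<dots> = ennreal (heat_q (s + t) x y) * 1"
    using s t by (subst nn_integral_cmult) (auto simp: nn_integral_heat_q)
  finally show ?thesis by simp
qed

definition Gop :: "real \<Rightarrow> ('a::euclidean_space \<Rightarrow> ennreal) \<Rightarrow> 'a \<Rightarrow> ennreal" where
  "Gop t f x = (\<integral>\<^sup>+ y. ennreal (heat_q t x y) * f y \<partial>lborel)"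

lemma Gop_measurable [measurable]:
  assumes [measurable]: "f \<in> borel_measurable borel"
  shows "Gop t f \<in> borel_measurable borel"
  unfolding Gop_def[abs_def] by measurable

lemma Gop_shift:
  assumes [measurable]: "f \<in> borel_measurable borel"
  shows "Gop t f x = (\<integral>\<^sup>+ z. ennreal (heat_q t 0 z) * f (x + z) \<partial>lborel)"
  unfolding Gop_def by (subst nn_integral_lborel_shift[of _ x]) (auto simp: heat_q_shift)

lemma Gop_mono: "(\<And>y. f y \<le> g y) \<Longrightarrow> Gop t f x \<le> Gop t g x"
  unfolding Gop_def by (intro nn_integral_mono mult_left_mono) auto

lemma Gop_cmult:
  assumes [measurable]: "f \<in> borel_measurable borel"
  shows "Gop t (\<lambda>y. c * f y) x = c * Gop t f x"
proof -
  have "Gop t (\<lambda>y. c * f y) x = (\<integral>\<^sup>+ y. c * (ennreal (heat_q t x y) * f y) \<partial>lborel)"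
    unfolding Gop_def by (simp add: mult.left_commute)
  also have "\<dots> = c * Gop t f x"
    unfolding Gop_def by (rule nn_integral_cmult) measurable
  finally show ?thesis .
qed

lemma Gop_add:
  assumes [measurable]: "f \<in> borel_measurable borel" "g \<in> borel_measurable borel"
  shows "Gop t (\<lambda>y. f y + g y) x = Gop t f x + Gop t g x"
  unfolding Gop_def distrib_left by (rule nn_integral_add) measurable

lemma Gop_const: "t > 0 \<Longrightarrow> Gop t (\<lambda>y. c) x = c"
  unfolding Gop_def by (subst nn_integral_multc) (auto simp: nn_integral_heat_q)

text \<open>Self-adjointness of the Gaussian average, from the symmetry of \<open>heat_q\<close> and
  Tonelli. The symmetry of the killed kernel descends from it.\<close>

lemma nn_integral_Gop:
  fixes h g :: "'a::euclidean_space \<Rightarrow> ennreal"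
  assumes [measurable]: "g \<in> borel_measurable borel" "h \<in> borel_measurable borel"
  shows "(\<integral>\<^sup>+ x. g x * Gop t h x \<partial>lborel) = (\<integral>\<^sup>+ x. Gop t g x * h x \<partial>lborel)"
proof -
  have "(\<integral>\<^sup>+ x. g x * Gop t h x \<partial>lborel) = (\<integral>\<^sup>+ x. (\<integral>\<^sup>+ y. g x * (ennreal (heat_q t x y) * h y) \<partial>lborel) \<partial>lborel)"
    unfolding Gop_def by (intro nn_integral_cong nn_integral_cmult[symmetric]) measurable
  also have "\<dots> = (\<integral>\<^sup>+ y. (\<integral>\<^sup>+ x. g x * (ennreal (heat_q t x y) * h y) \<partial>lborel) \<partial>lborel)"
    by (rule lborel_pair.Fubini') measurable
  also have "\<dots> = (\<integral>\<^sup>+ y. (\<integral>\<^sup>+ x. (ennreal (heat_q t y x) * g x) * h y \<partial>lborel) \<partial>lborel)"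
    by (simp add: heat_q_commute mult_ac)
  also have "\<dots> = (\<integral>\<^sup>+ y. Gop t g y * h y \<partial>lborel)"
    unfolding Gop_def by (intro nn_integral_cong nn_integral_multc) measurable
  finally show ?thesis .
qed

lemma Gop_Gop:
  fixes f :: "'a::euclidean_space \<Rightarrow> ennreal"
  assumes s: "s > 0" and t: "t > 0" and [measurable]: "f \<in> borel_measurable borel"
  shows "Gop s (Gop t f) x = Gop (s + t) f x"
proof -
  have "Gop s (Gop t f) x = (\<integral>\<^sup>+ z. Gop t (\<lambda>z. ennreal (heat_q s x z)) z * f z \<partial>lborel)"
    unfolding Gop_def[of s] by (rule nn_integral_Gop) measurable
  also have "(\<lambda>z. Gop t (\<lambda>z. ennreal (heat_q s x z)) z) = (\<lambda>z. ennreal (heat_q (s + t) x z))"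
  proof
    fix z
    show "Gop t (\<lambda>z. ennreal (heat_q s x z)) z = ennreal (heat_q (s + t) x z)"
      using heat_q_convolution[OF s t, of x z] unfolding Gop_def
      by (simp add: mult.commute heat_q_commute[of t z])
  qed
  finally show ?thesis unfolding Gop_def[of "s + t"] .
qed

section \<open>Moments of the Gaussian increment\<close>

definition gauss :: "real \<Rightarrow> 'a::euclidean_space measure" where
  "gauss t = density lborel (\<lambda>z. ennreal (heat_q t 0 z))"

lemma sets_gauss [simp, measurable_cong]: "sets (gauss t) = sets borel"
  by (simp add: gauss_def)

lemma space_gauss [simp]: "space (gauss t) = UNIV"
  by (simp add: gauss_def)

lemma prob_space_gauss: "t > 0 \<Longrightarrow> prob_space (gauss t)"
  by (rule prob_spaceI) (simp add: gauss_def emeasure_density nn_integral_heat_q)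

lemma Gop_gauss:
  assumes [measurable]: "f \<in> borel_measurable borel"
  shows "Gop t f x = (\<integral>\<^sup>+ z. f (x + z) \<partial>gauss t)"
  unfolding gauss_def by (subst nn_integral_density) (auto simp: Gop_shift)

text \<open>The weight removes half of the Gaussian exponent \<open>1 / (4 * t)\<close>, which
  leaves the kernel at time \<open>2 * t\<close> up to the ratio of the normalising constants. All
  tail estimates below rest on this exponential moment.\<close>

lemma nn_integral_gauss_exp_sq:
  assumes t: "t > 0"
  shows "(\<integral>\<^sup>+ (z::'a::euclidean_space). ennreal (exp ((norm z)\<^sup>2 / (8 * t))) \<partial>gauss t) = ennreal (2 powr (real DIM('a) / 2))"
proof -
  have *: "heat_q t 0 z * exp ((norm z)\<^sup>2 / (8 * t)) = 2 powr (real DIM('a) / 2) * heat_q (2 * t) 0 z" for z :: 'a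
  proof -
    have "(4 * pi * (2 * t)) powr (- real DIM('a) / 2) = (4 * pi * t) powr (- real DIM('a) / 2) * 2 powr (- real DIM('a) / 2)"
      using t powr_mult[of "4 * pi * t" 2 "- real DIM('a) / 2"] by (simp add: mult_ac)
    hence "2 powr (real DIM('a) / 2) * (4 * pi * (2 * t)) powr (- real DIM('a) / 2) = (4 * pi * t) powr (- real DIM('a) / 2)"
      by (simp add: powr_minus field_simps)
    moreover have "exp (- (norm z)\<^sup>2 / (4 * t)) * exp ((norm z)\<^sup>2 / (8 * t)) = exp (- (norm z)\<^sup>2 / (4 * (2 * t)))"
      using t by (simp add: exp_add[symmetric] field_simps)
    ultimately show ?thesis unfolding heat_q_def by (simp add: mult.assoc[symmetric])
  qed
  have "(\<integral>\<^sup>+ (z::'a). ennreal (exp ((norm z)\<^sup>2 / (8 * t))) \<partial>gauss t)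
     = (\<integral>\<^sup>+ (z::'a). ennreal (2 powr (real DIM('a) / 2)) * ennreal (heat_q (2 * t) 0 z) \<partial>lborel)"
    unfolding gauss_def by (subst nn_integral_density) (auto simp: ennreal_mult[symmetric] *)
  also have "\<dots> = ennreal (2 powr (real DIM('a) / 2))"
    using t by (subst nn_integral_cmult) (auto simp: nn_integral_heat_q)
  finally show ?thesis .
qed

lemma nn_integral_gauss_exp:
  fixes a :: "'a::euclidean_space"
  assumes t: "t > 0"
  shows "(\<integral>\<^sup>+ z. ennreal (exp (a \<bullet> z)) \<partial>gauss t) = ennreal (exp (t * (norm a)\<^sup>2))"
proof -
  have *: "heat_q t 0 z * exp (a \<bullet> z) = exp (t * (norm a)\<^sup>2) * heat_q t ((2 * t) *\<^sub>R a) z" for z :: 'a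
  proof -
    have n: "(norm ((2 * t) *\<^sub>R a - z))\<^sup>2 = 4 * t\<^sup>2 * (norm a)\<^sup>2 - 4 * t * (a \<bullet> z) + (norm z)\<^sup>2"
      unfolding power2_norm_eq_inner by (simp add: inner_simps inner_commute power2_eq_square algebra_simps)
    have "- (norm z)\<^sup>2 / (4 * t) + a \<bullet> z = t * (norm a)\<^sup>2 - (norm ((2 * t) *\<^sub>R a - z))\<^sup>2 / (4 * t)"
      unfolding n using t by (simp add: field_simps power2_eq_square)
    hence "exp (- (norm z)\<^sup>2 / (4 * t)) * exp (a \<bullet> z) = exp (t * (norm a)\<^sup>2) * exp (- (norm ((2 * t) *\<^sub>R a - z))\<^sup>2 / (4 * t))"
      by (simp add: exp_add[symmetric])
    thus ?thesis unfolding heat_q_def by simp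
  qed
  have "(\<integral>\<^sup>+ z. ennreal (exp (a \<bullet> z)) \<partial>gauss t)
     = (\<integral>\<^sup>+ z. ennreal (exp (t * (norm a)\<^sup>2)) * ennreal (heat_q t ((2 * t) *\<^sub>R a) z) \<partial>lborel)"
    unfolding gauss_def by (subst nn_integral_density) (auto simp: ennreal_mult[symmetric] *)
  also have "\<dots> = ennreal (exp (t * (norm a)\<^sup>2))"
    using t by (subst nn_integral_cmult) (auto simp: nn_integral_heat_q)
  finally show ?thesis .
qed

lemma integrable_gauss_exp_sq:
  assumes t: "t > 0"
  shows "integrable (gauss t) (\<lambda>z::'a::euclidean_space. exp ((norm z)\<^sup>2 / (8 * t)))"
  using t by (intro integrableI_nonneg) (auto simp: nn_integral_gauss_exp_sq)

lemma integrable_gauss_exp_power: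
  assumes t: "t > 0"
  shows "integrable (gauss t) (\<lambda>z::'a::euclidean_space. exp (b * norm z) * norm z ^ k)"
proof (rule Bochner_Integration.integrable_bound)
  show "integrable (gauss t) (\<lambda>z::'a. (fact k * exp (2 * t * (b + 1)\<^sup>2)) * exp ((norm z)\<^sup>2 / (8 * t)))"
    using integrable_gauss_exp_sq[OF t] by (rule integrable_mult_right)
  show "AE z in (gauss t :: 'a measure). norm (exp (b * norm z) * norm z ^ k) \<le> norm (fact k * exp (2 * t * (b + 1)\<^sup>2) * exp ((norm z)\<^sup>2 / (8 * t)))"
  proof (rule AE_I2)
    fix z :: 'a
    define r where "r = norm z"
    have r: "r \<ge> 0" by (simp add: r_def)
    have "r ^ k / fact k \<le> exp r"
    proof -
      have "(\<Sum>n\<in>{k}. r ^ n / fact n) \<le> (\<Sum>n. r ^ n / fact n)"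
        using summable_exp[of r] r by (intro sum_le_suminf) (auto simp: divide_inverse mult.commute)
      thus ?thesis by (simp add: exp_def divide_inverse mult.commute)
    qed
    hence 1: "r ^ k \<le> fact k * exp r" by (simp add: field_simps)
    \<comment> \<open>Young's inequality: \<open>(b + 1) * r\<close> is at most
      \<open>r\<^sup>2 / (8 * t) + 2 * t * (b + 1)\<^sup>2\<close>. The 1 added to \<open>b\<close>
      pays for the power, through \<open>r ^ k \<le> fact k * exp r\<close>.\<close>
    have "0 \<le> (r - 4 * t * (b + 1))\<^sup>2 / (8 * t)" using t by simp
    also have "\<dots> = r\<^sup>2 / (8 * t) + 2 * t * (b + 1)\<^sup>2 - (b + 1) * r"
      using t by (simp add: field_simps power2_eq_square)
    finally have "exp ((b + 1) * r) \<le> exp (r\<^sup>2 / (8 * t) + 2 * t * (b + 1)\<^sup>2)" by simp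
    hence 2: "exp (b * r) * exp r \<le> exp (2 * t * (b + 1)\<^sup>2) * exp (r\<^sup>2 / (8 * t))"
      by (simp add: exp_add[symmetric] algebra_simps)
    have "exp (b * r) * r ^ k \<le> exp (b * r) * (fact k * exp r)" using 1 by simp
    also have "\<dots> = fact k * (exp (b * r) * exp r)" by simp
    also have "\<dots> \<le> fact k * (exp (2 * t * (b + 1)\<^sup>2) * exp (r\<^sup>2 / (8 * t)))"
      using 2 by (intro mult_left_mono) auto
    finally show "norm (exp (b * norm z) * norm z ^ k) \<le> norm (fact k * exp (2 * t * (b + 1)\<^sup>2) * exp ((norm z)\<^sup>2 / (8 * t)))"
      using r by (simp add: r_def[symmetric] mult.assoc)
  qed
qed measurable

lemma integrable_gauss_norm_power:
  "t > 0 \<Longrightarrow> integrable (gauss t) (\<lambda>z::'a::euclidean_space. norm z ^ k)"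
  using integrable_gauss_exp_power[of t 0 k] by simp

lemma integrable_gauss_inner_power:
  fixes x :: "'a::euclidean_space"
  assumes t: "t > 0"
  shows "integrable (gauss t) (\<lambda>z. (x \<bullet> z) ^ k)"
proof (rule Bochner_Integration.integrable_bound)
  show "integrable (gauss t) (\<lambda>z::'a. norm x ^ k * norm z ^ k)"
    using integrable_gauss_norm_power[OF t] by (rule integrable_mult_right)
  show "AE z in gauss t. norm ((x \<bullet> z) ^ k) \<le> norm (norm x ^ k * norm z ^ k)"
    by (intro AE_I2) (simp add: power_abs power_mult_distrib[symmetric] power_mono Cauchy_Schwarz_ineq2)
qed measurable

text \<open>The moments are read off the moment generating function:
  \<open>exp (a\<^sup>2 * c)\<close> is compared with the integrated Taylor polynomial in
  \<open>a\<close>, the difference is divided by \<open>a\<close> or \<open>a\<^sup>2\<close>, and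
  \<open>a\<close> tends to 0 from the right.\<close>

lemma gauss_inner_moments:
  fixes x :: "'a::euclidean_space"
  assumes t: "t > 0"
  shows "(\<integral>z. x \<bullet> z \<partial>gauss t) = 0" "(\<integral>z. (x \<bullet> z)\<^sup>2 \<partial>gauss t) = 2 * t * (norm x)\<^sup>2"
proof -
  interpret prob_space "gauss t :: 'a measure" by (rule prob_space_gauss[OF t])
  define c where "c = t * (norm x)\<^sup>2"
  define K where "K k = (\<integral>z. norm x ^ k * (exp (norm x * norm z) * norm z ^ k) \<partial>(gauss t :: 'a measure))" for k
  have iexp: "integrable (gauss t) (\<lambda>z. exp (a \<bullet> z))" for a :: 'a
    using t by (intro integrableI_nonneg) (auto simp: nn_integral_gauss_exp)
  have vexp: "(\<integral>z. exp (a \<bullet> z) \<partial>gauss t) = exp (t * (norm a)\<^sup>2)" for a :: 'a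
    using t by (subst integral_eq_nn_integral) (auto simp: nn_integral_gauss_exp)
  \<comment> \<open>For \<open>a \<le> 1\<close> the Taylor remainder is \<open>a ^ Suc n\<close>
    times an integrable function of \<open>z\<close> that no longer involves \<open>a\<close>, so
    integration yields an error of order \<open>a ^ Suc n\<close>.\<close>
  have bound: "\<bar>exp (a * (x \<bullet> z)) - (\<Sum>i\<le>n. (a * (x \<bullet> z)) ^ i / fact i)\<bar> \<le> a ^ Suc n * (norm x ^ Suc n * (exp (norm x * norm z) * norm z ^ Suc n))"
    if a: "0 < a" "a \<le> 1" for a n and z :: 'a
  proof -
    have l: "\<bar>a * (x \<bullet> z)\<bar> \<le> a * (norm x * norm z)"
      using a Cauchy_Schwarz_ineq2[of x z] by (simp add: abs_mult)
    have l2: "a * (norm x * norm z) \<le> norm x * norm z" using a by (simp add: mult_left_le_one_le)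
    have "\<bar>exp (a * (x \<bullet> z)) - (\<Sum>i\<le>n. (a * (x \<bullet> z)) ^ i / fact i)\<bar> \<le> exp \<bar>a * (x \<bullet> z)\<bar> * \<bar>a * (x \<bullet> z)\<bar> ^ Suc n / fact n"
      using Taylor_exp_field[of "a * (x \<bullet> z)" n] by simp
    also have "\<dots> \<le> exp \<bar>a * (x \<bullet> z)\<bar> * \<bar>a * (x \<bullet> z)\<bar> ^ Suc n / 1"
      by (intro divide_left_mono) auto
    also have "\<dots> \<le> exp (norm x * norm z) * (a * (norm x * norm z)) ^ Suc n"
      unfolding div_by_1 using l l2 by (intro mult_mono power_mono) auto
    finally show ?thesis by (simp add: power_mult_distrib mult_ac)
  qed
  have intK: "integrable (gauss t) (\<lambda>z::'a. norm x ^ k * (exp (norm x * norm z) * norm z ^ k))" for k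
    using integrable_gauss_exp_power[OF t] by (rule integrable_mult_right)
  have main: "\<bar>exp (a\<^sup>2 * c) - (\<integral>z. (\<Sum>i\<le>n. (a * (x \<bullet> z)) ^ i / fact i) \<partial>gauss t)\<bar> \<le> a ^ Suc n * K (Suc n)"
    if a: "0 < a" "a \<le> 1" for a n
  proof -
    have isu: "integrable (gauss t) (\<lambda>z. (\<Sum>i\<le>n. (a * (x \<bullet> z)) ^ i / fact i))"
      by (intro Bochner_Integration.integrable_sum integrable_divide)
         (simp add: power_mult_distrib integrable_gauss_inner_power[OF t])
    have ie: "integrable (gauss t) (\<lambda>z. exp (a * (x \<bullet> z)))" using iexp[of "a *\<^sub>R x"] by simp
    have "exp (a\<^sup>2 * c) = (\<integral>z. exp (a * (x \<bullet> z)) \<partial>gauss t)"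
      using vexp[of "a *\<^sub>R x"] by (simp add: c_def power_mult_distrib mult_ac)
    hence "\<bar>exp (a\<^sup>2 * c) - (\<integral>z. (\<Sum>i\<le>n. (a * (x \<bullet> z)) ^ i / fact i) \<partial>gauss t)\<bar>
       = \<bar>\<integral>z. exp (a * (x \<bullet> z)) - (\<Sum>i\<le>n. (a * (x \<bullet> z)) ^ i / fact i) \<partial>gauss t\<bar>"
      using isu ie by (subst Bochner_Integration.integral_diff) auto
    also have "\<dots> \<le> (\<integral>z. \<bar>exp (a * (x \<bullet> z)) - (\<Sum>i\<le>n. (a * (x \<bullet> z)) ^ i / fact i)\<bar> \<partial>gauss t)"
      by (rule integral_abs_bound)
    also have "\<dots> \<le> (\<integral>(z::'a). a ^ Suc n * (norm x ^ Suc n * (exp (norm x * norm z) * norm z ^ Suc n)) \<partial>gauss t)"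
      by (rule Bochner_Integration.integral_mono) (use isu ie intK[of "Suc n"] bound[OF a, of _ n] in \<open>auto intro!: integrable_abs integrable_mult_right simp del: power_Suc sum.atMost_Suc\<close>)
    also have "\<dots> = a ^ Suc n * K (Suc n)" unfolding K_def by simp
    finally show ?thesis .
  qed
  have ev: "eventually (\<lambda>a::real. 0 < a \<and> a \<le> 1) (at_right 0)"
    by (auto simp: eventually_at_right_field intro!: exI[of _ 1])
  have i1: "integrable (gauss t) (\<lambda>z. x \<bullet> z)" using integrable_gauss_inner_power[OF t, of x 1] by simp
  have i2: "integrable (gauss t) (\<lambda>z. (x \<bullet> z)\<^sup>2)" using integrable_gauss_inner_power[OF t, of x 2] by simp
  define m1 where "m1 = (\<integral>z. x \<bullet> z \<partial>gauss t)"
  define m2 where "m2 = (\<integral>z. (x \<bullet> z)\<^sup>2 \<partial>gauss t)"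
  have "((\<lambda>a. (exp (a\<^sup>2 * c) - 1) / a - m1) \<longlongrightarrow> 0) (at_right 0)"
  proof (rule Lim_null_comparison)
    show "\<forall>\<^sub>F a in at_right 0. norm ((exp (a\<^sup>2 * c) - 1) / a - m1) \<le> a * K 2"
      using ev
    proof eventually_elim
      case (elim a)
      have "(\<integral>z. (\<Sum>i\<le>Suc 0. (a * (x \<bullet> z)) ^ i / fact i) \<partial>gauss t) = 1 + a * m1"
        using i1 prob_space by (simp add: m1_def)
      with main[of a "Suc 0"] elim have "\<bar>exp (a\<^sup>2 * c) - (1 + a * m1)\<bar> \<le> a\<^sup>2 * K 2"
        by (simp add: numeral_2_eq_2 del: power_Suc sum.atMost_Suc)
      moreover have "(exp (a\<^sup>2 * c) - 1) / a - m1 = (exp (a\<^sup>2 * c) - (1 + a * m1)) / a"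
        using elim by (simp add: field_simps)
      ultimately show ?case using elim by (simp add: field_simps power2_eq_square)
    qed
    show "((\<lambda>a. a * K 2) \<longlongrightarrow> 0) (at_right 0)" by real_asymp
  qed
  moreover have "((\<lambda>a. (exp (a\<^sup>2 * c) - 1) / a - m1) \<longlongrightarrow> 0 - m1) (at_right 0)" by (intro tendsto_diff tendsto_const) real_asymp
  ultimately have "0 - m1 = 0" using tendsto_unique trivial_limit_at_right_real by blast
  hence m1: "m1 = 0" by simp
  thus "(\<integral>z. x \<bullet> z \<partial>gauss t) = 0" by (simp add: m1_def)
  have "((\<lambda>a. (exp (a\<^sup>2 * c) - 1) / a\<^sup>2 - m2 / 2) \<longlongrightarrow> 0) (at_right 0)"
  proof (rule Lim_null_comparison)
    show "\<forall>\<^sub>F a in at_right 0. norm ((exp (a\<^sup>2 * c) - 1) / a\<^sup>2 - m2 / 2) \<le> a * K 3"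
      using ev
    proof eventually_elim
      case (elim a)
      have "(\<integral>z. (\<Sum>i\<le>Suc (Suc 0). (a * (x \<bullet> z)) ^ i / fact i) \<partial>gauss t) = 1 + a * m1 + a\<^sup>2 * m2 / 2"
        using i1 i2 prob_space by (simp add: m1_def m2_def power_mult_distrib power2_eq_square[symmetric])
      with main[of a "Suc (Suc 0)"] elim have "\<bar>exp (a\<^sup>2 * c) - (1 + a\<^sup>2 * m2 / 2)\<bar> \<le> a ^ 3 * K 3"
        by (simp add: numeral_3_eq_3 m1 del: power_Suc sum.atMost_Suc)
      moreover have "(exp (a\<^sup>2 * c) - 1) / a\<^sup>2 - m2 / 2 = (exp (a\<^sup>2 * c) - (1 + a\<^sup>2 * m2 / 2)) / a\<^sup>2"
        using elim by (simp add: field_simps)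
      ultimately show ?case using elim by (simp add: field_simps power2_eq_square power3_eq_cube)
    qed
    show "((\<lambda>a. a * K 3) \<longlongrightarrow> 0) (at_right 0)" by real_asymp
  qed
  moreover have "((\<lambda>a. (exp (a\<^sup>2 * c) - 1) / a\<^sup>2 - m2 / 2) \<longlongrightarrow> c - m2 / 2) (at_right 0)" by (intro tendsto_diff tendsto_const) real_asymp
  ultimately have "c - m2 / 2 = 0" using tendsto_unique trivial_limit_at_right_real by blast
  thus "(\<integral>z. (x \<bullet> z)\<^sup>2 \<partial>gauss t) = 2 * t * (norm x)\<^sup>2" by (simp add: m2_def c_def)
qed

lemma gauss_norm_sq:
  assumes t: "t > 0"
  shows "(\<integral>(z::'a::euclidean_space). (norm z)\<^sup>2 \<partial>gauss t) = 2 * real DIM('a) * t"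
proof -
  have "(norm z)\<^sup>2 = (\<Sum>b\<in>Basis. (b \<bullet> z)\<^sup>2)" for z :: 'a
    unfolding power2_norm_eq_inner euclidean_inner[of z z] by (simp add: power2_eq_square inner_commute)
  hence "(\<integral>(z::'a). (norm z)\<^sup>2 \<partial>gauss t) = (\<Sum>b\<in>(Basis::'a set). \<integral>z. (b \<bullet> z)\<^sup>2 \<partial>gauss t)"
    using integrable_gauss_inner_power[OF t, where k = 2] by (simp only:) (rule Bochner_Integration.integral_sum)
  also have "\<dots> = 2 * real DIM('a) * t" by (simp add: gauss_inner_moments[OF t])
  finally show ?thesis .
qed

text \<open>With \<open>u = (norm z)\<^sup>2 / (8 * t)\<close>, the bound
  \<open>u\<^sup>2 / 2 \<le> exp u\<close> gives the factor 128. What matters is the order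
  \<open>t\<^sup>2\<close>: a quartic error in each of \<open>n\<close> steps of length
  \<open>t / n\<close> sums to something that vanishes as \<open>n\<close> grows.\<close>

lemma gauss_norm_4:
  assumes t: "t > 0"
  shows "(\<integral>(z::'a::euclidean_space). norm z ^ 4 \<partial>gauss t) \<le> 128 * 2 powr (real DIM('a) / 2) * t\<^sup>2"
proof -
  have "(\<integral>(z::'a). norm z ^ 4 \<partial>gauss t) \<le> (\<integral>(z::'a). 128 * t\<^sup>2 * exp ((norm z)\<^sup>2 / (8 * t)) \<partial>gauss t)"
  proof (rule integral_mono)
    show "integrable (gauss t) (\<lambda>z::'a. norm z ^ 4)" by (rule integrable_gauss_norm_power[OF t])
    show "integrable (gauss t) (\<lambda>z::'a. 128 * t\<^sup>2 * exp ((norm z)\<^sup>2 / (8 * t)))"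
      using integrable_gauss_exp_sq[OF t] by (rule integrable_mult_right)
    fix z :: 'a
    define u where "u = (norm z)\<^sup>2 / (8 * t)"
    have "u \<ge> 0" using t by (simp add: u_def)
    hence "u\<^sup>2 / 2 \<le> exp u" using exp_lower_Taylor_quadratic[of u] by linarith
    hence "128 * t\<^sup>2 * (u\<^sup>2 / 2) \<le> 128 * t\<^sup>2 * exp u" by (intro mult_left_mono) auto
    moreover have "128 * t\<^sup>2 * (u\<^sup>2 / 2) = norm z ^ 4" using t by (simp add: u_def power_divide power_mult_distrib)
    ultimately show "norm z ^ 4 \<le> 128 * t\<^sup>2 * exp ((norm z)\<^sup>2 / (8 * t))" by (simp add: u_def)
  qed
  also have "\<dots> = 128 * t\<^sup>2 * 2 powr (real DIM('a) / 2)"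
  proof -
    have "(\<integral>(z::'a). exp ((norm z)\<^sup>2 / (8 * t)) \<partial>gauss t) = 2 powr (real DIM('a) / 2)"
      using t by (subst integral_eq_nn_integral) (auto simp: nn_integral_gauss_exp_sq)
    thus ?thesis by simp
  qed
  finally show ?thesis by (simp add: mult_ac)
qed

text \<open>\<open>Q\<close> has the shape of the second-order Taylor polynomial at \<open>x\<close>
  of a radial function, plus a quartic correction. When \<open>u\<close> and \<open>r\<close> are
  the first and second derivative in the variable \<open>\<rho> = (norm x)\<^sup>2\<close>, the
  factor of \<open>t\<close> in the mean is the Laplacian of that function.\<close>

lemma gauss_quartic:
  fixes x :: "'a::euclidean_space" and \<alpha> p u r C :: real
  assumes t: "t > 0"
  defines "Q \<equiv> \<lambda>z. \<alpha> + 2 * p * (x \<bullet> z) + u * (norm z)\<^sup>2 + 2 * r * (x \<bullet> z)\<^sup>2 + C * norm z ^ 4"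
  shows "integrable (gauss t) Q"
    and "(\<integral>z. Q z \<partial>gauss t) = \<alpha> + t * (2 * real DIM('a) * u + 4 * r * (norm x)\<^sup>2) + C * (\<integral>(z::'a). norm z ^ 4 \<partial>gauss t)"
proof -
  interpret prob_space "gauss t :: 'a measure" by (rule prob_space_gauss[OF t])
  have i: "integrable (gauss t) (\<lambda>z. x \<bullet> z)" "integrable (gauss t) (\<lambda>z. (x \<bullet> z)\<^sup>2)"
    "integrable (gauss t) (\<lambda>z::'a. (norm z)\<^sup>2)" "integrable (gauss t) (\<lambda>z::'a. norm z ^ 4)"
    using integrable_gauss_inner_power[OF t, of x 1] integrable_gauss_inner_power[OF t, of x 2]
      integrable_gauss_norm_power[OF t] by auto
  show "integrable (gauss t) Q" unfolding Q_def using i by auto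
  show "(\<integral>z. Q z \<partial>gauss t) = \<alpha> + t * (2 * real DIM('a) * u + 4 * r * (norm x)\<^sup>2) + C * (\<integral>(z::'a). norm z ^ 4 \<partial>gauss t)"
    unfolding Q_def using i by (simp add: gauss_inner_moments[OF t] gauss_norm_sq[OF t] prob_space[unfolded space_gauss] algebra_simps)
qed

section \<open>Discretised Feynman-Kac functionals\<close>

text \<open>The tail infima of both sequences increase, so their products converge to the product of
  the limits; \<open>0 < l < \<top>\<close> excludes the indeterminate product of zero and
  infinity.\<close>

lemma Liminf_mult_ennreal:
  fixes a b :: "nat \<Rightarrow> ennreal"
  assumes a: "a \<longlonglongrightarrow> l" and l: "0 < l" "l < \<top>"
  shows "l * liminf b \<le> liminf (\<lambda>n. a n * b n)"
proof -
  define A where "A n = (INF m\<in>{n..}. a m)" for n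
  define B where "B n = (INF m\<in>{n..}. b m)" for n
  have "incseq A" "incseq B" unfolding A_def B_def by (auto simp: incseq_def intro!: INF_superset_mono)
  hence "A \<longlonglongrightarrow> (SUP n. A n)" "B \<longlonglongrightarrow> (SUP n. B n)" by (auto intro: LIMSEQ_SUP)
  moreover have "(SUP n. A n) = l" unfolding A_def liminf_SUP_INF[symmetric] using a by (intro lim_imp_Liminf) auto
  moreover have "(SUP n. B n) = liminf b" unfolding B_def liminf_SUP_INF ..
  ultimately have "(\<lambda>n. A n * B n) \<longlonglongrightarrow> l * liminf b"
    using l by (intro tendsto_mult_ennreal) auto
  moreover have "A n * B n \<le> liminf (\<lambda>n. a n * b n)" for n
  proof -
    have "A n * B n \<le> (INF m\<in>{n..}. a m * b m)"
      by (intro INF_greatest mult_mono) (auto simp: A_def B_def intro: INF_lower)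
    also have "\<dots> \<le> liminf (\<lambda>n. a n * b n)" unfolding liminf_SUP_INF by (rule SUP_upper) simp
    finally show ?thesis .
  qed
  ultimately show ?thesis by (intro LIMSEQ_le_const2) auto
qed

lemma Limsup_mult_ennreal:
  fixes a b :: "nat \<Rightarrow> ennreal"
  assumes a: "a \<longlonglongrightarrow> l" and l: "l < \<top>" and b: "\<And>n. b n \<le> K" and K: "K < \<top>"
  shows "limsup (\<lambda>n. a n * b n) \<le> l * limsup b"
proof -
  define A where "A n = (SUP m\<in>{n..}. a m)" for n
  define B where "B n = (SUP m\<in>{n..}. b m)" for n
  have "decseq A" "decseq B" unfolding A_def B_def by (auto simp: decseq_def intro!: SUP_subset_mono)
  hence "A \<longlonglongrightarrow> (INF n. A n)" "B \<longlonglongrightarrow> (INF n. B n)" by (auto intro: LIMSEQ_INF)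
  moreover have "(INF n. A n) = l" unfolding A_def limsup_INF_SUP[symmetric] using a by (intro lim_imp_Limsup) auto
  moreover have "(INF n. B n) = limsup b" unfolding B_def limsup_INF_SUP ..
  moreover have "limsup b \<le> K" using b by (intro Limsup_bounded) auto
  ultimately have "(\<lambda>n. A n * B n) \<longlonglongrightarrow> l * limsup b"
    using l K by (intro tendsto_mult_ennreal) auto
  moreover have "limsup (\<lambda>n. a n * b n) \<le> A n * B n" for n
  proof -
    have "limsup (\<lambda>n. a n * b n) \<le> (SUP m\<in>{n..}. a m * b m)"
      unfolding limsup_INF_SUP by (rule INF_lower) simp
    also have "\<dots> \<le> A n * B n"
      by (intro SUP_least mult_mono) (auto simp: A_def B_def intro: SUP_upper)
    finally show ?thesis .
  qed
  ultimately show ?thesis by (intro LIMSEQ_le_const) auto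
qed

text \<open>On each cell the mean value theorem for the antiderivative \<open>F\<close> replaces the
  integral by a value of \<open>g\<close> inside the cell, and uniform continuity compares it with
  the value at the left end.\<close>

lemma left_Riemann_sum_tendsto:
  fixes g :: "real \<Rightarrow> real"
  assumes g: "continuous_on {0..t} g" and t: "t > 0"
  shows "(\<lambda>n. (t / real n) * (\<Sum>k<n. g (real k * (t / real n)))) \<longlonglongrightarrow> integral {0..t} g"
proof (rule LIMSEQ_I)
  fix r :: real assume r: "r > 0"
  define e where "e = r / (2 * t)"
  have e: "e > 0" using r t by (simp add: e_def)
  have "uniformly_continuous_on {0..t} g" using g by (intro compact_uniformly_continuous) auto
  then obtain d where d: "d > 0" "\<And>x y. x \<in> {0..t} \<Longrightarrow> y \<in> {0..t} \<Longrightarrow> dist x y < d \<Longrightarrow> dist (g x) (g y) < e"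
    unfolding uniformly_continuous_on_def using e by metis
  obtain N where N: "real N > t / d" using reals_Archimedean2 by blast
  define F where "F s = integral {0..s} g" for s
  have F: "(F has_real_derivative g s) (at s within {0..t})" if "s \<in> {0..t}" for s
    unfolding F_def using integral_has_real_derivative[OF g that] .
  show "\<exists>no. \<forall>n\<ge>no. norm ((t / real n) * (\<Sum>k<n. g (real k * (t / real n))) - integral {0..t} g) < r"
  proof (intro exI[of _ "Suc N"] allI impI)
    fix n assume n: "n \<ge> Suc N"
    define h where "h = t / real n"
    have n0: "real n > 0" using n by simp
    have h: "h > 0" "real n * h = t" using t n0 by (auto simp: h_def)
    have "t / d < real n" using N n by linarith
    hence hd: "h < d" using d(1) n0 by (simp add: h_def field_simps)
    have step: "\<bar>F (real (Suc k) * h) - F (real k * h) - h * g (real k * h)\<bar> \<le> h * e" if k: "k < n" for k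
    proof -
      have kh: "real (Suc k) * h \<le> t" using k h by (metis Suc_leI less_imp_le mult_right_mono of_nat_le_iff)
      have lt: "real k * h < real (Suc k) * h" using h by simp
      have "0 \<le> real k * h" using h by simp
      have "\<exists>\<xi>\<in>{real k * h<..<real (Suc k) * h}. F (real (Suc k) * h) - F (real k * h) = g \<xi> * (real (Suc k) * h - real k * h)"
      proof (rule mvt_simple[OF lt])
        fix s assume s: "real k * h \<le> s" "s \<le> real (Suc k) * h"
        have "(F has_real_derivative g s) (at s within {real k * h..real (Suc k) * h})"
          using s kh \<open>0 \<le> real k * h\<close> by (intro DERIV_subset[OF F]) auto
        thus "(F has_derivative (*) (g s)) (at s within {real k * h..real (Suc k) * h})"
          by (simp add: has_field_derivative_def)
      qed
      then obtain \<xi> where xi: "real k * h < \<xi>" "\<xi> < real (Suc k) * h" "F (real (Suc k) * h) - F (real k * h) = h * g \<xi>"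
        by (auto simp: algebra_simps)
      have "0 \<le> \<xi>" using xi \<open>0 \<le> real k * h\<close> by linarith
      have "dist (g \<xi>) (g (real k * h)) < e"
        using xi kh \<open>0 \<le> real k * h\<close> \<open>0 \<le> \<xi>\<close> hd h by (intro d(2)) (auto simp: dist_real_def algebra_simps)
      hence "\<bar>h * (g \<xi> - g (real k * h))\<bar> \<le> h * e" using h by (simp add: abs_mult dist_real_def)
      thus ?thesis unfolding xi(3) by (simp add: algebra_simps)
    qed
    have "F (real n * h) - F 0 = (\<Sum>k<n. F (real (Suc k) * h) - F (real k * h))"
      using sum_lessThan_telescope[of "\<lambda>k. F (real k * h)" n] by simp
    moreover have "F 0 = 0" by (simp add: F_def)
    ultimately have "\<bar>F t - h * (\<Sum>k<n. g (real k * h))\<bar> = \<bar>\<Sum>k<n. F (real (Suc k) * h) - F (real k * h) - h * g (real k * h)\<bar>"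
      using h by (simp add: sum_subtractf sum_distrib_left)
    also have "\<dots> \<le> (\<Sum>k<n. h * e)" using step by (intro order_trans[OF sum_abs] sum_mono) auto
    also have "\<dots> = t * e" using h by simp
    also have "\<dots> < r" using r t by (simp add: e_def)
    finally show "norm ((t / real n) * (\<Sum>k<n. g (real k * (t / real n))) - integral {0..t} g) < r"
      by (simp add: F_def h_def abs_minus_commute)
  qed
qed

locale inv_pot =
  fixes \<beta> \<kappa> :: real
  assumes beta: "\<beta> > 0" and kappa: "\<kappa> > 0"
begin

definition pot :: "'a::euclidean_space \<Rightarrow> real" where
  "pot x = \<kappa> * norm x powr (- (2 + 2 * \<beta>))"

text \<open>In HOL \<open>0 powr a = 0\<close>, so \<open>pot\<close> vanishes at the origin instead
  of being infinite. The strict inequality makes the cut-off kill there even for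
  \<open>\<epsilon> = 0\<close>.\<close>

definition cut :: "real \<Rightarrow> real \<Rightarrow> 'a::euclidean_space \<Rightarrow> ennreal" where
  "cut \<epsilon> \<delta> x = (if norm x > \<epsilon> then ennreal (exp (- \<delta> * pot x)) else 0)"

text \<open>The weight acts before the Gaussian step, which corresponds to left Riemann sums:
  \<open>n\<close> iterations weight the path at the times of index 0 to \<open>n - 1\<close> and
  leave the final position unweighted.\<close>

definition Top :: "real \<Rightarrow> real \<Rightarrow> ('a::euclidean_space \<Rightarrow> ennreal) \<Rightarrow> 'a \<Rightarrow> ennreal" where
  "Top \<epsilon> \<delta> f x = cut \<epsilon> \<delta> x * Gop \<delta> f x"

lemma pot_nonneg [simp]: "pot x \<ge> 0"
  using kappa by (simp add: pot_def)

lemma pot_measurable [measurable]: "pot \<in> borel_measurable borel"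
  unfolding pot_def[abs_def] by measurable

lemma cut_measurable [measurable]: "cut \<epsilon> \<delta> \<in> borel_measurable borel"
  unfolding cut_def[abs_def] by measurable

lemma Top_measurable [measurable]: "f \<in> borel_measurable borel \<Longrightarrow> Top \<epsilon> \<delta> f \<in> borel_measurable borel"
  unfolding Top_def[abs_def] by measurable

lemma Top_funpow_measurable [measurable]:
  "f \<in> borel_measurable borel \<Longrightarrow> (Top \<epsilon> \<delta> ^^ n) f \<in> borel_measurable borel"
  by (induction n) auto

lemma cut_le_1: "\<delta> \<ge> 0 \<Longrightarrow> cut \<epsilon> \<delta> x \<le> 1"
  unfolding cut_def by (auto simp: ennreal_le_1)

lemma Top_mono: "(\<And>y. f y \<le> g y) \<Longrightarrow> Top \<epsilon> \<delta> f x \<le> Top \<epsilon> \<delta> g x"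
  unfolding Top_def by (intro mult_left_mono Gop_mono) auto

lemma Top_funpow_mono: "(\<And>y. f y \<le> g y) \<Longrightarrow> (Top \<epsilon> \<delta> ^^ n) f x \<le> (Top \<epsilon> \<delta> ^^ n) g x"
  by (induction n arbitrary: x) (auto intro: Top_mono)

lemma Top_funpow_le_const:
  assumes d: "\<delta> > 0" and f: "\<And>y. f y \<le> C"
  shows "(Top \<epsilon> \<delta> ^^ n) f x \<le> C"
  using f
proof (induction n arbitrary: x)
  case (Suc n)
  have "Top \<epsilon> \<delta> ((Top \<epsilon> \<delta> ^^ n) f) x \<le> 1 * Gop \<delta> (\<lambda>_. C) x"
    by (subst Top_def, intro mult_mono cut_le_1 Gop_mono Suc) (use d in auto)
  thus ?case using d by (simp add: Gop_const)
qed simp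

lemma continuous_on_pot:
  assumes "continuous_on A w" "\<And>s. s \<in> A \<Longrightarrow> w s \<noteq> 0"
  shows "continuous_on A (\<lambda>s. pot (w s))"
  unfolding pot_def using assms by (intro continuous_intros) auto

lemma prod_cut_eq:
  fixes n :: nat
  assumes "\<And>k. k < n \<Longrightarrow> norm (w k) > \<epsilon>"
  shows "(\<Prod>k<n. cut \<epsilon> \<delta> (w k)) = ennreal (exp (- (\<delta> * (\<Sum>k<n. pot (w k)))))"
proof -
  have "(\<Prod>k<n. cut \<epsilon> \<delta> (w k)) = (\<Prod>k<n. ennreal (exp (- \<delta> * pot (w k))))"
    using assms by (intro prod.cong) (auto simp: cut_def)
  also have "\<dots> = ennreal (exp (\<Sum>k<n. - \<delta> * pot (w k)))"
    by (subst exp_sum) (simp_all add: prod_ennreal)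
  finally show ?thesis by (simp add: sum_distrib_left sum_negf)
qed

lemma prod_cut_le:
  fixes n :: nat
  shows "(\<Prod>k<n. cut \<epsilon> \<delta> (w k)) \<le> ennreal (exp (- (\<delta> * (\<Sum>k<n. pot (w k)))))"
proof (cases "\<forall>k<n. norm (w k) > \<epsilon>")
  case False
  then obtain k where "k < n" "\<not> norm (w k) > \<epsilon>" by blast
  hence z: "(\<Prod>k<n. cut \<epsilon> \<delta> (w k)) = 0" by (intro prod_zero bexI[of _ k]) (auto simp: cut_def)
  show ?thesis unfolding z by simp
qed (simp add: prod_cut_eq)

text \<open>An iterate alone is not symmetric, since only its starting end carries a weight. With
  one more \<open>cut\<close> at the final position the word of cuts and Gaussian averages is a
  palindrome. The induction moves one outer step across the integral by self-adjointness of
  \<open>Gop\<close>.\<close>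

lemma nn_integral_Top_adjoint:
  fixes f g :: "'a::euclidean_space \<Rightarrow> ennreal"
  assumes [measurable]: "f \<in> borel_measurable borel" "g \<in> borel_measurable borel"
  shows "(\<integral>\<^sup>+ x. g x * (Top \<epsilon> \<delta> ^^ n) (\<lambda>y. cut \<epsilon> \<delta> y * f y) x \<partial>lborel)
       = (\<integral>\<^sup>+ x. (Top \<epsilon> \<delta> ^^ n) (\<lambda>y. cut \<epsilon> \<delta> y * g y) x * f x \<partial>lborel)"
  using assms(2)
proof (induction n arbitrary: g)
  case 0
  show ?case by (simp add: mult_ac)
next
  case (Suc n)
  note [measurable] = Suc.prems
  define h where "h = (Top \<epsilon> \<delta> ^^ n) (\<lambda>y. cut \<epsilon> \<delta> y * f y)"
  have [measurable]: "h \<in> borel_measurable borel" unfolding h_def by measurable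
  have "(\<integral>\<^sup>+ x. g x * (Top \<epsilon> \<delta> ^^ Suc n) (\<lambda>y. cut \<epsilon> \<delta> y * f y) x \<partial>lborel)
      = (\<integral>\<^sup>+ x. (cut \<epsilon> \<delta> x * g x) * Gop \<delta> h x \<partial>lborel)"
    unfolding funpow.simps comp_def h_def[symmetric] Top_def by (simp add: mult_ac)
  also have "\<dots> = (\<integral>\<^sup>+ x. Gop \<delta> (\<lambda>x. cut \<epsilon> \<delta> x * g x) x * h x \<partial>lborel)"
    by (rule nn_integral_Gop) measurable
  also have "\<dots> = (\<integral>\<^sup>+ x. (Top \<epsilon> \<delta> ^^ n) (\<lambda>y. cut \<epsilon> \<delta> y * Gop \<delta> (\<lambda>x. cut \<epsilon> \<delta> x * g x) y) x * f x \<partial>lborel)"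
    unfolding h_def by (rule Suc.IH) measurable
  also have "(\<lambda>y. cut \<epsilon> \<delta> y * Gop \<delta> (\<lambda>x. cut \<epsilon> \<delta> x * g x) y) = Top \<epsilon> \<delta> (\<lambda>x. cut \<epsilon> \<delta> x * g x)"
    by (auto simp: Top_def fun_eq_iff)
  finally show ?case by (simp add: funpow_swap1)
qed

text \<open>Integrating out the last increment replaces the test function \<open>g\<close> by
  \<open>Top \<epsilon> \<delta> g\<close> and leaves a product of one factor fewer; hence the
  induction runs over all \<open>g\<close>.\<close>

lemma PiM_gauss_Top:
  fixes x :: "'a::euclidean_space"
  assumes d: "\<delta> > 0" and "g \<in> borel_measurable borel"
  shows "(\<integral>\<^sup>+ v. (\<Prod>k<n. cut \<epsilon> \<delta> (x + (\<Sum>i<k. v i))) * g (x + (\<Sum>i<n. v i)) \<partial>(\<Pi>\<^sub>M i\<in>{..<n}. gauss \<delta>))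
       = (Top \<epsilon> \<delta> ^^ n) g x"
  using assms(2)
proof (induction n arbitrary: g)
  case 0
  interpret product_sigma_finite "\<lambda>_::nat. gauss \<delta> :: 'a measure"
    using prob_space_gauss[OF d] by (intro product_sigma_finite.intro prob_space_imp_sigma_finite)
  show ?case by (simp add: PiM_empty nn_integral_count_space_finite)
next
  case (Suc n)
  note [measurable] = Suc.prems
  interpret product_sigma_finite "\<lambda>_::nat. gauss \<delta> :: 'a measure"
    using prob_space_gauss[OF d] by (intro product_sigma_finite.intro prob_space_imp_sigma_finite)
  let ?F = "\<lambda>v. (\<Prod>k<n. cut \<epsilon> \<delta> (x + (\<Sum>i<k. v i)))"
  have "(\<integral>\<^sup>+ v. (\<Prod>k<Suc n. cut \<epsilon> \<delta> (x + (\<Sum>i<k. v i))) * g (x + (\<Sum>i<Suc n. v i)) \<partial>(\<Pi>\<^sub>M i\<in>{..<Suc n}. gauss \<delta>))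
    = (\<integral>\<^sup>+ v. (\<integral>\<^sup>+ y. (\<Prod>k<Suc n. cut \<epsilon> \<delta> (x + (\<Sum>i<k. (v(n := y)) i))) * g (x + (\<Sum>i<Suc n. (v(n := y)) i)) \<partial>gauss \<delta>) \<partial>(\<Pi>\<^sub>M i\<in>{..<n}. gauss \<delta>))"
    unfolding lessThan_Suc by (rule product_nn_integral_insert) (auto simp: lessThan_Suc[symmetric])
  also have "\<dots> = (\<integral>\<^sup>+ v. ?F v * Top \<epsilon> \<delta> g (x + (\<Sum>i<n. v i)) \<partial>(\<Pi>\<^sub>M i\<in>{..<n}. gauss \<delta>))"
  proof (rule nn_integral_cong)
    fix v :: "nat \<Rightarrow> 'a"
    have s: "(\<Sum>i<k. (v(n := y)) i) = (\<Sum>i<k. v i)" if "k \<le> n" for k y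
      using that by (intro sum.cong) auto
    have p: "(\<Prod>k<Suc n. cut \<epsilon> \<delta> (x + (\<Sum>i<k. (v(n := y)) i))) = ?F v * cut \<epsilon> \<delta> (x + (\<Sum>i<n. v i))" for y
    proof -
      have "(\<Prod>k<n. cut \<epsilon> \<delta> (x + (\<Sum>i<k. (v(n := y)) i))) = ?F v" by (intro prod.cong refl) (simp add: s)
      thus ?thesis by (simp only: prod.lessThan_Suc s[OF order_refl])
    qed
    have q: "x + (\<Sum>i<Suc n. (v(n := y)) i) = x + (\<Sum>i<n. v i) + y" for y
      by (simp only: sum.lessThan_Suc s[OF order_refl]) (simp add: add_ac)
    show "(\<integral>\<^sup>+ y. (\<Prod>k<Suc n. cut \<epsilon> \<delta> (x + (\<Sum>i<k. (v(n := y)) i))) * g (x + (\<Sum>i<Suc n. (v(n := y)) i)) \<partial>gauss \<delta>)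
       = ?F v * Top \<epsilon> \<delta> g (x + (\<Sum>i<n. v i))"
      unfolding p q Top_def Gop_gauss[OF Suc.prems] mult.assoc by (subst nn_integral_cmult[symmetric]; measurable?) (simp add: nn_integral_cmult)
  qed
  also have "\<dots> = (Top \<epsilon> \<delta> ^^ n) (Top \<epsilon> \<delta> g) x" by (rule Suc.IH) measurable
  finally show ?case by (simp add: funpow_swap1)
qed

lemma fk_weight_eq:
  assumes c: "continuous_on {0..} (\<lambda>s. W s \<omega>)" and t: "t > 0" and nz: "\<And>s. s \<in> {0..t} \<Longrightarrow> W s \<omega> \<noteq> 0"
  shows "fk_weight W \<beta> \<kappa> t \<omega> = ennreal (exp (- integral {0..t} (\<lambda>s. pot (W s \<omega>))))"
    and "continuous_on {0..t} (\<lambda>s. pot (W s \<omega>))"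
proof -
  have c': "continuous_on {0..t} (\<lambda>s. W s \<omega>)" using c by (rule continuous_on_subset) auto
  show cp: "continuous_on {0..t} (\<lambda>s. pot (W s \<omega>))" using c' nz by (rule continuous_on_pot)
  have hi: "((\<lambda>s. pot (W s \<omega>)) has_integral integral {0..t} (\<lambda>s. pot (W s \<omega>))) {0..t}"
    using integrable_continuous_interval[OF cp] by (rule integrable_integral)
  have I: "(\<integral>\<^sup>+ s. indicator {0..t} s * ennreal (\<kappa> * norm (W s \<omega>) powr (- (2 + 2 * \<beta>))) \<partial>lborel)
      = ennreal (integral {0..t} (\<lambda>s. pot (W s \<omega>)))"
    using nn_integral_has_integral_lebesgue[OF _ hi] unfolding pot_def[symmetric]
    by (simp add: ennreal_mult'' ennreal_indicator)
  have "integral {0..t} (\<lambda>s. pot (W s \<omega>)) \<ge> 0" by (rule integral_nonneg) (auto intro: integrable_continuous_interval cp)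
  thus "fk_weight W \<beta> \<kappa> t \<omega> = ennreal (exp (- integral {0..t} (\<lambda>s. pot (W s \<omega>))))"
    unfolding fk_weight_def I by (simp add: Let_def)
qed

lemma less_exit_timeD:
  assumes "ereal t < exit_time W \<omega>" "0 \<le> s" "s \<le> t"
  shows "W s \<omega> \<noteq> 0"
proof
  assume "W s \<omega> = 0"
  hence "exit_time W \<omega> \<le> ereal s" unfolding exit_time_def using assms by (intro INF_lower) auto
  thus False using assms by (metis ereal_less_eq(3) leD order_trans)
qed

text \<open>Avoiding the origin on the closed interval only gives \<open>exit_time \<ge> t\<close>.
  Strictness comes from continuity at \<open>t\<close>, which keeps the path away from the origin
  for a further time \<open>d\<close>.\<close>

lemma less_exit_timeI:
  assumes c: "continuous_on {0..} (\<lambda>s. W s \<omega>)" and t: "t \<ge> 0" and nz: "\<And>s. s \<in> {0..t} \<Longrightarrow> W s \<omega> \<noteq> 0"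
  shows "ereal t < exit_time W \<omega>"
proof -
  have "W t \<omega> \<noteq> 0" using nz t by auto
  moreover have "((\<lambda>s. W s \<omega>) \<longlongrightarrow> W t \<omega>) (at t within {0..})"
    using c t by (auto simp: continuous_on_def)
  ultimately have "\<forall>\<^sub>F s in at t within {0..}. W s \<omega> \<noteq> 0"
    by (intro tendsto_imp_eventually_ne)
  then obtain d where d: "d > 0" "\<And>s. s \<in> {0..} \<Longrightarrow> s \<noteq> t \<Longrightarrow> dist s t < d \<Longrightarrow> W s \<omega> \<noteq> 0"
    unfolding eventually_at by blast
  have "ereal (t + d) \<le> exit_time W \<omega>"
    unfolding exit_time_def
  proof (rule INF_greatest)
    fix s assume s: "s \<in> {s. 0 \<le> s \<and> W s \<omega> = 0}"
    hence "\<not> s \<le> t" using nz by auto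
    hence "\<not> s < t + d" using d(2)[of s] s by (auto simp: dist_real_def)
    thus "ereal (t + d) \<le> ereal s" by simp
  qed
  thus ?thesis using d(1) by (metis ereal_less(2) ereal_less_eq(3) less_add_same_cancel1 less_ereal.simps(1) order_less_le_trans)
qed

lemma exp_Riemann_tendsto:
  assumes "continuous_on {0..t} (\<lambda>s. pot (w s))" "t > 0"
  shows "(\<lambda>n. ennreal (exp (- ((t / real n) * (\<Sum>k<n. pot (w (real k * (t / real n))))))))
     \<longlonglongrightarrow> ennreal (exp (- integral {0..t} (\<lambda>s. pot (w s))))"
  by (intro tendsto_ennrealI tendsto_exp tendsto_minus left_Riemann_sum_tendsto assms)

text \<open>The hard cut-off at radius \<open>\<epsilon>\<close> only sees whether the path stays outside the ball, so that
  neither polarity of the origin nor Hoelder regularity of the path is required.\<close>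

lemma prod_cut_tendsto:
  assumes c: "continuous_on {0..} (\<lambda>s. W s \<omega>)" and t: "t > 0" and e: "\<epsilon> \<ge> 0" and nz: "\<And>s. s \<in> {0..t} \<Longrightarrow> norm (W s \<omega>) > \<epsilon>"
  shows "(\<lambda>n. \<Prod>k<n. cut \<epsilon> (t / real n) (W (real k * (t / real n)) \<omega>)) \<longlonglongrightarrow> fk_weight W \<beta> \<kappa> t \<omega>"
proof -
  have nz': "s \<in> {0..t} \<Longrightarrow> W s \<omega> \<noteq> 0" for s using nz[of s] e by auto
  have in01: "k < n \<Longrightarrow> real k * (t / real n) \<in> {0..t}" for k n :: nat
    using t by (auto simp: field_simps)
  have "(\<Prod>k<n. cut \<epsilon> (t / real n) (W (real k * (t / real n)) \<omega>))
     = ennreal (exp (- ((t / real n) * (\<Sum>k<n. pot (W (real k * (t / real n)) \<omega>)))))" for n :: nat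
    by (intro prod_cut_eq nz in01)
  thus ?thesis
    using exp_Riemann_tendsto[OF fk_weight_eq(2)[of W \<omega> t, OF c t nz'] t] fk_weight_eq(1)[of W \<omega> t, OF c t nz'] by simp
qed

text \<open>A path that enters the open ball of radius \<open>\<epsilon>\<close> stays in it for a
  whole time interval, which a fine mesh must sample, so the products are eventually 0. All other
  paths survive and the product is at most the exponential of a Riemann sum. Paths that merely touch
  the sphere may or may not be killed by the product, which is why only an upper bound is
  claimed.\<close>

lemma prod_cut_limsup:
  assumes c: "continuous_on {0..} (\<lambda>s. W s \<omega>)" and t: "t > 0" and e: "\<epsilon> > 0"
    and b: "\<And>n. b n \<le> K" "K < \<top>"
    and f: "norm (W t \<omega>) \<ge> \<epsilon> \<Longrightarrow> limsup b \<le> f"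
  shows "limsup (\<lambda>n. (\<Prod>k<n. cut \<epsilon> (t / real n) (W (real k * (t / real n)) \<omega>)) * b n)
     \<le> fk_weight W \<beta> \<kappa> t \<omega> * indicator {\<omega>. ereal t < exit_time W \<omega>} \<omega> * f"
proof (cases "\<forall>s\<in>{0..t}. norm (W s \<omega>) \<ge> \<epsilon>")
  case True
  hence nz: "s \<in> {0..t} \<Longrightarrow> W s \<omega> \<noteq> 0" for s using e by fastforce
  have "limsup (\<lambda>n. (\<Prod>k<n. cut \<epsilon> (t / real n) (W (real k * (t / real n)) \<omega>)) * b n)
     \<le> limsup (\<lambda>n. ennreal (exp (- ((t / real n) * (\<Sum>k<n. pot (W (real k * (t / real n)) \<omega>))))) * b n)"
    by (intro Limsup_mono always_eventually allI mult_right_mono prod_cut_le) auto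
  also have "\<dots> \<le> fk_weight W \<beta> \<kappa> t \<omega> * limsup b"
    using exp_Riemann_tendsto[OF fk_weight_eq(2)[of W \<omega> t, OF c t nz] t] fk_weight_eq(1)[of W \<omega> t, OF c t nz]
    by (intro Limsup_mult_ennreal[OF _ _ b]) auto
  also have "\<dots> \<le> fk_weight W \<beta> \<kappa> t \<omega> * f" using f True t by (intro mult_left_mono) auto
  finally show ?thesis using less_exit_timeI[of W \<omega> t, OF c less_imp_le[OF t] nz] by simp
next
  case False
  then obtain s where s: "s \<in> {0..t}" "norm (W s \<omega>) < \<epsilon>" by fastforce
  have "continuous_on {0..t} (\<lambda>s. norm (W s \<omega>))" using c by (intro continuous_intros) (auto intro: continuous_on_subset)
  hence "((\<lambda>s. norm (W s \<omega>)) \<longlongrightarrow> norm (W s \<omega>)) (at s within {0..t})" using s by (auto simp: continuous_on_def)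
  hence "\<forall>\<^sub>F u in at s within {0..t}. norm (W u \<omega>) < \<epsilon>" using s(2) by (rule order_tendstoD)
  then obtain d where d: "d > 0" "\<And>u. u \<in> {0..t} \<Longrightarrow> u \<noteq> s \<Longrightarrow> dist u s < d \<Longrightarrow> norm (W u \<omega>) < \<epsilon>"
    unfolding eventually_at by blast
  hence d': "u \<in> {0..t} \<Longrightarrow> dist u s < d \<Longrightarrow> norm (W u \<omega>) < \<epsilon>" for u using s(2) by (cases "u = s") auto
  obtain N where N: "real N > t / d" using reals_Archimedean2 by blast
  have "(\<Prod>k<n. cut \<epsilon> (t / real n) (W (real k * (t / real n)) \<omega>)) = 0" if n: "n \<ge> Suc N" for n
  proof -
    define h where "h = t / real n"
    have n0: "real n > 0" using n by simp
    have h: "h > 0" "real n * h = t" using t n0 by (auto simp: h_def)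
    have "t / d < real n" using N n by linarith
    hence hd: "h < d" using d(1) n0 by (simp add: h_def field_simps)
    \<comment> \<open>The terminal time is not sampled, so for \<open>s = t\<close> the last index
      \<open>n - 1\<close> is taken; otherwise the sampling time just before
      \<open>s\<close>.\<close>
    define k where "k = (if s = t then n - 1 else nat \<lfloor>s / h\<rfloor>)"
    have "k < n \<and> \<bar>real k * h - s\<bar> \<le> h"
    proof (cases "s = t")
      case True
      have "real (n - 1) * h = t - h" using n h(2) by (simp add: of_nat_diff algebra_simps)
      thus ?thesis using True n h by (simp add: k_def)
    next
      case False
      have sh: "0 \<le> s / h" "s / h < real n" using s h False by (auto simp: field_simps)
      have "real (nat \<lfloor>s / h\<rfloor>) \<le> s / h" "s / h < real (nat \<lfloor>s / h\<rfloor>) + 1" using sh by linarith+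
      hence "real (nat \<lfloor>s / h\<rfloor>) * h \<le> s" "s < real (nat \<lfloor>s / h\<rfloor>) * h + h" using h by (auto simp: field_simps)
      moreover have "nat \<lfloor>s / h\<rfloor> < n" using sh by linarith
      ultimately show ?thesis using False by (simp add: k_def)
    qed
    hence k: "k < n" "dist (real k * h) s < d" using hd by (auto simp: dist_real_def)
    have "real k * h \<in> {0..t}" using k(1) h by (metis atLeastAtMost_iff less_imp_le mult_nonneg_nonneg mult_right_mono of_nat_0_le_iff of_nat_mono)
    hence "norm (W (real k * h) \<omega>) < \<epsilon>" using k by (intro d')
    thus ?thesis using k(1) unfolding h_def[symmetric] by (intro prod_zero bexI[of _ k]) (auto simp: cut_def)
  qed
  hence "\<forall>\<^sub>F n in sequentially. (\<Prod>k<n. cut \<epsilon> (t / real n) (W (real k * (t / real n)) \<omega>)) * b n = 0"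
    by (auto simp: eventually_sequentially intro!: exI[of _ "Suc N"])
  hence "(\<lambda>n. (\<Prod>k<n. cut \<epsilon> (t / real n) (W (real k * (t / real n)) \<omega>)) * b n) \<longlonglongrightarrow> 0"
    by (rule tendsto_eventually)
  hence "limsup (\<lambda>n. (\<Prod>k<n. cut \<epsilon> (t / real n) (W (real k * (t / real n)) \<omega>)) * b n) = 0"
    by (intro lim_imp_Limsup) auto
  thus ?thesis by simp
qed

end

section \<open>The killed semigroup\<close>

locale fk_setup = inv_pot +
  fixes M :: "'a::euclidean_space \<Rightarrow> 'b measure" and W :: "real \<Rightarrow> 'b \<Rightarrow> 'a"
  assumes bm: "is_BM (M x) W x"
begin

lemma BM_measurable [measurable]: "t \<ge> 0 \<Longrightarrow> W t \<in> borel_measurable (M x)"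
  using bm[of x] unfolding is_BM_def by blast

lemma BM_prob_space: "prob_space (M x)"
  using bm[of x] unfolding is_BM_def by blast

lemma BM_start: "\<omega> \<in> space (M x) \<Longrightarrow> W 0 \<omega> = x"
  using bm[of x] unfolding is_BM_def by blast

lemma BM_continuous: "\<omega> \<in> space (M x) \<Longrightarrow> continuous_on {0..} (\<lambda>s. W s \<omega>)"
  using bm[of x] unfolding is_BM_def by blast

lemma distr_BM_increment:
  assumes "0 \<le> s" "s < t"
  shows "distr (M x) borel (\<lambda>\<omega>. W t \<omega> - W s \<omega>) = gauss (t - s)"
proof -
  have "distributed (M x) lborel (\<lambda>\<omega>. W t \<omega> - W s \<omega>) (\<lambda>z. ennreal (heat_q (t - s) 0 z))"
    using bm[of x] assms unfolding is_BM_def by blast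
  hence "distr (M x) lborel (\<lambda>\<omega>. W t \<omega> - W s \<omega>) = gauss (t - s)"
    by (simp add: distributed_def gauss_def)
  moreover have "distr (M x) lborel (\<lambda>\<omega>. W t \<omega> - W s \<omega>) = distr (M x) borel (\<lambda>\<omega>. W t \<omega> - W s \<omega>)"
    by (rule distr_cong) auto
  ultimately show ?thesis by simp
qed

lemma nn_integral_BM:
  assumes t: "t > 0" and [measurable]: "f \<in> borel_measurable borel"
  shows "(\<integral>\<^sup>+ \<omega>. f (W t \<omega>) \<partial>M x) = Gop t f x"
proof -
  have [measurable]: "W t \<in> borel_measurable (M x)" "W 0 \<in> borel_measurable (M x)"
    using t by (auto intro: BM_measurable)
  have "(\<integral>\<^sup>+ \<omega>. f (W t \<omega>) \<partial>M x) = (\<integral>\<^sup>+ \<omega>. f (x + (W t \<omega> - W 0 \<omega>)) \<partial>M x)"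
    by (intro nn_integral_cong) (simp add: BM_start)
  also have "\<dots> = (\<integral>\<^sup>+ z. f (x + z) \<partial>distr (M x) borel (\<lambda>\<omega>. W t \<omega> - W 0 \<omega>))"
    by (subst nn_integral_distr) auto
  also have "\<dots> = Gop t f x" using t by (simp add: distr_BM_increment Gop_gauss)
  finally show ?thesis .
qed

lemma Top_BM:
  assumes d: "\<delta> > 0" and g [measurable]: "g \<in> borel_measurable borel"
  shows "(\<integral>\<^sup>+ \<omega>. (\<Prod>k<n. cut \<epsilon> \<delta> (W (real k * \<delta>) \<omega>)) * g (W (real n * \<delta>) \<omega>) \<partial>M x) = (Top \<epsilon> \<delta> ^^ n) g x"
\<comment> \<open>The case without increments is separate: the description of independence by the
  joint law is for nonempty index sets.\<close>
proof (cases "n = 0")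
  case True
  have "(\<integral>\<^sup>+ \<omega>. g (W 0 \<omega>) \<partial>M x) = (\<integral>\<^sup>+ \<omega>. g x \<partial>M x)" by (intro nn_integral_cong) (simp add: BM_start)
  also have "\<dots> = g x" using prob_space.emeasure_space_1[OF BM_prob_space] by simp
  finally show ?thesis using True by simp
next
  case False
  interpret prob_space "M x" by (rule BM_prob_space)
  define X where "X i \<omega> = W (real (Suc i) * \<delta>) \<omega> - W (real i * \<delta>) \<omega>" for i \<omega>
  have Wm [measurable]: "W (real k * \<delta>) \<in> borel_measurable (M x)" for k using d by (intro BM_measurable) auto
  have Xm [measurable]: "X i \<in> borel_measurable (M x)" for i unfolding X_def[abs_def] by measurable
  have dX: "distr (M x) borel (X i) = gauss \<delta>" for i
    using distr_BM_increment[of "real i * \<delta>" "real (Suc i) * \<delta>" x] d by (simp add: X_def[abs_def] algebra_simps)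
  have "indep_vars (\<lambda>_. borel) X {..<n}"
  proof -
    have "\<forall>(ts :: nat \<Rightarrow> real) n. 0 \<le> ts 0 \<and> (\<forall>i<n. ts i < ts (Suc i)) \<longrightarrow>
        indep_vars (\<lambda>_. borel) (\<lambda>i \<omega>. W (ts (Suc i)) \<omega> - W (ts i) \<omega>) {..<n}"
      using bm[of x] unfolding is_BM_def by blast
    from this[rule_format, of "\<lambda>i. real i * \<delta>" n] show ?thesis
      unfolding X_def[abs_def] using d by auto
  qed
  hence dd: "distr (M x) (\<Pi>\<^sub>M i\<in>{..<n}. borel) (\<lambda>\<omega>. \<lambda>i\<in>{..<n}. X i \<omega>) = (\<Pi>\<^sub>M i\<in>{..<n}. gauss \<delta>)"
    using False by (subst (asm) indep_vars_iff_distr_eq_PiM) (auto simp: dX lessThan_empty_iff)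
  have W: "W (real k * \<delta>) \<omega> = x + (\<Sum>i<k. X i \<omega>)" if "\<omega> \<in> space (M x)" for k \<omega>
    using that sum_lessThan_telescope[of "\<lambda>i. W (real i * \<delta>) \<omega>" k] by (simp add: X_def BM_start)
  define F where "F v = (\<Prod>k<n. cut \<epsilon> \<delta> (x + (\<Sum>i<k. v i))) * g (x + (\<Sum>i<n. v i))" for v
  have Fm: "F \<in> borel_measurable (\<Pi>\<^sub>M i\<in>{..<n}. borel)"
  proof -
    have [measurable]: "(\<lambda>v. \<Sum>i<k. v i) \<in> borel_measurable (\<Pi>\<^sub>M i\<in>{..<n}. borel :: 'a measure)" if "k \<le> n" for k
      using that by (intro borel_measurable_sum) (auto intro!: measurable_component_singleton)
    have "(\<lambda>v. \<Prod>k<n. cut \<epsilon> \<delta> (x + (\<Sum>i<k. v i))) \<in> borel_measurable (\<Pi>\<^sub>M i\<in>{..<n}. borel)"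
      by (intro borel_measurable_prod_ennreal measurable_compose[OF _ cut_measurable]) auto
    thus ?thesis unfolding F_def by measurable
  qed
  have "(\<integral>\<^sup>+ \<omega>. (\<Prod>k<n. cut \<epsilon> \<delta> (W (real k * \<delta>) \<omega>)) * g (W (real n * \<delta>) \<omega>) \<partial>M x)
     = (\<integral>\<^sup>+ \<omega>. F (\<lambda>i\<in>{..<n}. X i \<omega>) \<partial>M x)"
  proof (intro nn_integral_cong)
    fix \<omega> assume w: "\<omega> \<in> space (M x)"
    have "(\<Sum>i<k. (\<lambda>i\<in>{..<n}. X i \<omega>) i) = (\<Sum>i<k. X i \<omega>)" if "k \<le> n" for k
      using that by (intro sum.cong) auto
    thus "(\<Prod>k<n. cut \<epsilon> \<delta> (W (real k * \<delta>) \<omega>)) * g (W (real n * \<delta>) \<omega>) = F (\<lambda>i\<in>{..<n}. X i \<omega>)"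
      unfolding F_def W[OF w] by simp
  qed
  also have "\<dots> = (\<integral>\<^sup>+ v. F v \<partial>distr (M x) (\<Pi>\<^sub>M i\<in>{..<n}. borel) (\<lambda>\<omega>. \<lambda>i\<in>{..<n}. X i \<omega>))"
    using Fm by (subst nn_integral_distr) auto
  also have "\<dots> = (Top \<epsilon> \<delta> ^^ n) g x"
    unfolding dd F_def by (rule PiM_gauss_Top[OF d g])
  finally show ?thesis .
qed

abbreviation P :: "real \<Rightarrow> ('a \<Rightarrow> ennreal) \<Rightarrow> 'a \<Rightarrow> ennreal" where
  "P \<equiv> fk_semigroup M W \<beta> \<kappa>"

lemma P_le_Gop:
  assumes t: "t > 0" and f: "f \<in> borel_measurable borel"
  shows "P t f x \<le> Gop t f x"
proof -
  have "fk_weight W \<beta> \<kappa> t \<omega> \<le> 1" for \<omega>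
    by (auto simp: fk_weight_def Let_def ennreal_le_1)
  hence "fk_weight W \<beta> \<kappa> t \<omega> * indicator {\<omega>. ereal t < exit_time W \<omega>} \<omega> * f (W t \<omega>) \<le> 1 * 1 * f (W t \<omega>)" for \<omega>
    by (intro mult_right_mono mult_mono) (auto simp: indicator_def)
  hence "P t f x \<le> (\<integral>\<^sup>+ \<omega>. f (W t \<omega>) \<partial>M x)"
    unfolding fk_semigroup_def by (intro nn_integral_mono) auto
  thus ?thesis using nn_integral_BM[OF t f] by simp
qed

text \<open>Fatou's lemma twice, first in the mesh and then in the cut-off radius. A surviving path
  has a positive minimal distance from the origin on \<open>[0, t]\<close>, so for all large
  \<open>j\<close> the cut-off does not see it and the products converge to the exact weight. The
  test function may depend on \<open>j\<close> and \<open>n\<close> so that end-point weights and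
  nested iterates can be inserted.\<close>

lemma P_le_liminf:
  assumes t: "t > 0" and gm: "\<And>j n. g j n \<in> borel_measurable borel"
    and g: "\<And>j z. norm z > 1 / real (Suc j) \<Longrightarrow> f z \<le> liminf (\<lambda>n. g j n z)"
  shows "P t f x \<le> liminf (\<lambda>j. liminf (\<lambda>n. (Top (1 / real (Suc j)) (t / real n) ^^ n) (g j n) x))"
proof -
  define u where "u j n \<omega> = (\<Prod>k<n. cut (1 / real (Suc j)) (t / real n) (W (real k * (t / real n)) \<omega>)) * g j n (W t \<omega>)" for j n \<omega>
  have [measurable]: "W (real k * (t / real n)) \<in> borel_measurable (M x)" "W t \<in> borel_measurable (M x)" for k n :: nat
    using t by (auto intro!: BM_measurable)
  note gm [measurable]
  have um [measurable]: "u j n \<in> borel_measurable (M x)" for j n unfolding u_def[abs_def] by measurable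
  have iu: "(\<integral>\<^sup>+ \<omega>. u j n \<omega> \<partial>M x) = (Top (1 / real (Suc j)) (t / real n) ^^ n) (g j n) x" if "n > 0" for j n
  proof -
    have "t / real n > 0" "real n * (t / real n) = t" using t that by auto
    from Top_BM[OF this(1) gm[of j n], where n = n and \<epsilon> = "1 / real (Suc j)" and x = x] this(2) show ?thesis by (simp add: u_def)
  qed
  have "P t f x \<le> (\<integral>\<^sup>+ \<omega>. liminf (\<lambda>j. liminf (\<lambda>n. u j n \<omega>)) \<partial>M x)"
    unfolding fk_semigroup_def
  proof (rule nn_integral_mono)
    fix \<omega> assume w: "\<omega> \<in> space (M x)"
    note c = BM_continuous[OF w]
    show "fk_weight W \<beta> \<kappa> t \<omega> * indicator {\<omega>. ereal t < exit_time W \<omega>} \<omega> * f (W t \<omega>) \<le> liminf (\<lambda>j. liminf (\<lambda>n. u j n \<omega>))"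
    proof (cases "ereal t < exit_time W \<omega>")
      case True
      have nz: "s \<in> {0..t} \<Longrightarrow> W s \<omega> \<noteq> 0" for s using less_exit_timeD[OF True] by auto
      have "continuous_on {0..t} (\<lambda>s. norm (W s \<omega>))" using c by (intro continuous_intros) (auto intro: continuous_on_subset)
      then obtain s0 where s0: "s0 \<in> {0..t}" "\<And>s. s \<in> {0..t} \<Longrightarrow> norm (W s0 \<omega>) \<le> norm (W s \<omega>)"
        using continuous_attains_inf[of "{0..t}" "\<lambda>s. norm (W s \<omega>)"] t by auto
      have "norm (W s0 \<omega>) > 0" using nz s0(1) by simp
      then obtain J where J: "1 / real (Suc J) < norm (W s0 \<omega>)" using nat_approx_posE by metis
      have "fk_weight W \<beta> \<kappa> t \<omega> * f (W t \<omega>) \<le> liminf (\<lambda>n. u j n \<omega>)" if j: "j \<ge> J" for j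
      proof -
        have "1 / real (Suc j) \<le> 1 / real (Suc J)" using j by (simp add: frac_le)
        hence e: "s \<in> {0..t} \<Longrightarrow> norm (W s \<omega>) > 1 / real (Suc j)" for s using J s0(2)[of s] by linarith
        have lim: "(\<lambda>n. \<Prod>k<n. cut (1 / real (Suc j)) (t / real n) (W (real k * (t / real n)) \<omega>)) \<longlonglongrightarrow> fk_weight W \<beta> \<kappa> t \<omega>"
          by (rule prod_cut_tendsto[where W = W and \<omega> = \<omega>, OF c t _ e]) auto
        have "fk_weight W \<beta> \<kappa> t \<omega> * f (W t \<omega>) \<le> fk_weight W \<beta> \<kappa> t \<omega> * liminf (\<lambda>n. g j n (W t \<omega>))"
          using e[of t] t by (intro mult_left_mono g) auto
        also have "\<dots> \<le> liminf (\<lambda>n. u j n \<omega>)"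
          unfolding u_def by (rule Liminf_mult_ennreal[OF lim]) (use fk_weight_eq(1)[of W \<omega> t, OF c t nz] in simp_all)
        finally show ?thesis .
      qed
      hence "fk_weight W \<beta> \<kappa> t \<omega> * f (W t \<omega>) \<le> liminf (\<lambda>j. liminf (\<lambda>n. u j n \<omega>))"
        by (intro Liminf_bounded) (auto simp: eventually_sequentially)
      thus ?thesis using True by simp
    qed simp
  qed
  also have "\<dots> \<le> liminf (\<lambda>j. (\<integral>\<^sup>+ \<omega>. liminf (\<lambda>n. u j n \<omega>) \<partial>M x))"
    by (rule nn_integral_liminf) measurable
  also have "\<dots> \<le> liminf (\<lambda>j. liminf (\<lambda>n. (\<integral>\<^sup>+ \<omega>. u j n \<omega> \<partial>M x)))"
    by (intro Liminf_mono always_eventually allI nn_integral_liminf) measurable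
  also have "\<dots> = liminf (\<lambda>j. liminf (\<lambda>n. (Top (1 / real (Suc j)) (t / real n) ^^ n) (g j n) x))"
    by (intro arg_cong[where f = liminf] ext Liminf_eq) (auto simp: iu eventually_sequentially intro!: exI[of _ 1])
  finally show ?thesis .
qed

text \<open>Reverse Fatou at a fixed cut-off radius. The uniform bound \<open>K\<close> is the
  dominating function, integrable because the law of the path is a probability measure.\<close>

lemma limsup_le_P:
  assumes t: "t > 0" and e: "\<epsilon> > 0" and gm: "\<And>n. g n \<in> borel_measurable borel"
    and b: "\<And>n z. g n z \<le> K" "K < \<top>"
    and g: "\<And>z. norm z \<ge> \<epsilon> \<Longrightarrow> limsup (\<lambda>n. g n z) \<le> f z"
  shows "limsup (\<lambda>n. (Top \<epsilon> (t / real n) ^^ n) (g n) x) \<le> P t f x"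
proof -
  define u where "u n \<omega> = (\<Prod>k<n. cut \<epsilon> (t / real n) (W (real k * (t / real n)) \<omega>)) * g n (W t \<omega>)" for n \<omega>
  have [measurable]: "W (real k * (t / real n)) \<in> borel_measurable (M x)" "W t \<in> borel_measurable (M x)" for k n :: nat
    using t by (auto intro!: BM_measurable)
  note gm [measurable]
  have um [measurable]: "u n \<in> borel_measurable (M x)" for n unfolding u_def[abs_def] by measurable
  have iu: "(\<integral>\<^sup>+ \<omega>. u n \<omega> \<partial>M x) = (Top \<epsilon> (t / real n) ^^ n) (g n) x" if "n > 0" for n
  proof -
    have "t / real n > 0" "real n * (t / real n) = t" using t that by auto
    from Top_BM[OF this(1) gm[of n], where n = n and \<epsilon> = \<epsilon> and x = x] this(2) show ?thesis by (simp add: u_def)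
  qed
  have ub: "u n \<omega> \<le> K" for n \<omega>
  proof -
    have "(\<Prod>k<n. cut \<epsilon> (t / real n) (W (real k * (t / real n)) \<omega>)) \<le> 1"
      using t by (intro prod_le_1) (auto intro: cut_le_1)
    hence "u n \<omega> \<le> 1 * K" unfolding u_def by (intro mult_mono b) auto
    thus ?thesis by simp
  qed
  have "limsup (\<lambda>n. (Top \<epsilon> (t / real n) ^^ n) (g n) x) = limsup (\<lambda>n. \<integral>\<^sup>+ \<omega>. u n \<omega> \<partial>M x)"
    by (intro Limsup_eq) (auto simp: iu eventually_sequentially intro!: exI[of _ 1])
  also have "\<dots> \<le> (\<integral>\<^sup>+ \<omega>. limsup (\<lambda>n. u n \<omega>) \<partial>M x)"
  proof (rule nn_integral_limsup[of _ _ "\<lambda>_. K"])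
    show "(\<integral>\<^sup>+ \<omega>. K \<partial>M x) < \<infinity>"
      using prob_space.emeasure_space_1[OF BM_prob_space] b(2) by (simp add: infinity_ennreal_def)
  qed (use ub in auto)
  also have "\<dots> \<le> P t f x"
    unfolding fk_semigroup_def u_def
    by (intro nn_integral_mono prod_cut_limsup[OF BM_continuous t e b] g) auto
  finally show ?thesis .
qed

end

section \<open>Symmetry and semigroup property of the kernel\<close>

lemma indicator_cball_measurable [measurable, simp]:
  "(indicator (cball z r) :: 'a::euclidean_space \<Rightarrow> ennreal) \<in> borel_measurable borel"
  by (rule borel_measurable_indicator) simp

lemma indicator_le_1_ennreal: "(indicator A y :: ennreal) \<le> 1"
  by (simp add: indicator_def)

lemma nn_integral_indicator_cball: "(\<integral>\<^sup>+ v. indicator (cball z r) v \<partial>lborel) = emeasure lborel (cball z (r::real))"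
  for z :: "'a::euclidean_space"
  by (rule nn_integral_indicator) simp

text \<open>A violation at \<open>y\<close> persists with margin \<open>e\<close> on a small ball,
  where the integrals then differ by at least \<open>e\<close> times its volume. Finiteness of the
  integral of \<open>h\<close> permits the cancellation in \<open>ennreal\<close>. On that ball
  \<open>g\<close> exceeds \<open>h + e\<close> and hence is positive, so the truncation of
  \<open>g\<close> by \<open>ennreal\<close> has no effect.\<close>

lemma continuous_le_if_nn_integral_le:
  fixes g h :: "'a::euclidean_space \<Rightarrow> real"
  assumes S: "open S" and g: "continuous_on S g" and h: "continuous_on S h" and hn: "\<And>y. y \<in> S \<Longrightarrow> h y \<ge> 0"
    and le: "\<And>y r. cball y r \<subseteq> S \<Longrightarrow> (\<integral>\<^sup>+ z. ennreal (g z) * indicator (cball y r) z \<partial>lborel) \<le> (\<integral>\<^sup>+ z. ennreal (h z) * indicator (cball y r) z \<partial>lborel)"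
    and y: "y \<in> S"
  shows "g y \<le> h y"
proof (rule ccontr)
  assume "\<not> g y \<le> h y"
  define e where "e = (g y - h y) / 2"
  have e: "e > 0" using \<open>\<not> g y \<le> h y\<close> by (simp add: e_def)
  have "continuous_on S (\<lambda>z. g z - h z)" using g h by (intro continuous_intros)
  hence "((\<lambda>z. g z - h z) \<longlongrightarrow> g y - h y) (at y)"
    using S y continuous_on_eq_continuous_at[OF S, of "\<lambda>z. g z - h z"] by (auto simp: isCont_def)
  hence "\<forall>\<^sub>F z in at y. g z - h z > e" using e by (intro order_tendstoD) (auto simp: e_def)
  moreover have "\<forall>\<^sub>F z in at y. z \<in> S" using S y by (rule eventually_at_in_open')
  ultimately have "\<forall>\<^sub>F z in at y. g z - h z > e \<and> z \<in> S" by eventually_elim auto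
  then obtain d where d: "d > 0" "\<And>z. z \<noteq> y \<Longrightarrow> dist z y < d \<Longrightarrow> g z - h z > e \<and> z \<in> S"
    unfolding eventually_at by auto
  have "g y - h y > e" using e by (simp add: e_def)
  hence d': "g z - h z > e \<and> z \<in> S" if "z \<in> cball y (d / 2)" for z
    using d y that by (cases "z = y") (auto simp: dist_commute)
  define B where "B = cball y (d / 2)"
  have BS: "B \<subseteq> S" using d' by (auto simp: B_def)
  have B [measurable]: "B \<in> sets borel" by (simp add: B_def)
  have vol: "0 < emeasure lborel B" "emeasure lborel B < \<infinity>"
  proof -
    have "0 < unit_ball_vol (real DIM('a)) * (d / 2) ^ DIM('a)" using d(1) by (intro mult_pos_pos unit_ball_vol_pos) auto
    thus "0 < emeasure lborel B" using d(1) by (simp add: B_def emeasure_cball)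
    show "emeasure lborel B < \<infinity>" unfolding B_def by (rule emeasure_lborel_cball_finite)
  qed
  have ch: "continuous_on B h" using h BS by (rule continuous_on_subset)
  have "compact (h ` B)" using ch by (intro compact_continuous_image) (auto simp: B_def)
  then obtain K where K: "\<And>z. z \<in> B \<Longrightarrow> h z \<le> K" by (meson bounded_imp_bdd_above compact_imp_bounded bdd_above_def imageI)
  have hm [measurable]: "(\<lambda>z. h z * indicator B z) \<in> borel_measurable borel"
    using borel_measurable_continuous_on_indicator[OF B ch] by (simp add: mult.commute)
  have "(\<integral>\<^sup>+ z. ennreal (h z * indicator B z) \<partial>lborel) \<le> (\<integral>\<^sup>+ z. ennreal K * indicator B z \<partial>lborel)"
    using K by (intro nn_integral_mono) (auto simp: indicator_def intro!: ennreal_leI)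
  also have "\<dots> < \<infinity>" using vol by (simp add: nn_integral_cmult_indicator ennreal_mult_less_top)
  finally have fin: "(\<integral>\<^sup>+ z. ennreal (h z * indicator B z) \<partial>lborel) < \<infinity>" .
  have "(\<integral>\<^sup>+ z. ennreal (h z * indicator B z) \<partial>lborel) + ennreal e * emeasure lborel B
      = (\<integral>\<^sup>+ z. ennreal (h z * indicator B z) + ennreal e * indicator B z \<partial>lborel)"
    by (subst nn_integral_add) (auto simp: nn_integral_cmult_indicator)
  also have "\<dots> \<le> (\<integral>\<^sup>+ z. ennreal (g z) * indicator B z \<partial>lborel)"
  proof (rule nn_integral_mono)
    fix z show "ennreal (h z * indicator B z) + ennreal e * indicator B z \<le> ennreal (g z) * indicator B z"
      using d'[of z] hn[of z] e by (auto simp: B_def indicator_def ennreal_plus[symmetric] simp del: ennreal_plus intro!: ennreal_leI)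
  qed
  also have "\<dots> \<le> (\<integral>\<^sup>+ z. ennreal (h z) * indicator B z \<partial>lborel)" using le BS unfolding B_def by blast
  also have "\<dots> = (\<integral>\<^sup>+ z. ennreal (h z * indicator B z) \<partial>lborel)"
    by (intro nn_integral_cong) (auto simp: indicator_def)
  finally have "(\<integral>\<^sup>+ z. ennreal (h z * indicator B z) \<partial>lborel) + ennreal e * emeasure lborel B \<le> (\<integral>\<^sup>+ z. ennreal (h z * indicator B z) \<partial>lborel) + 0" by simp
  hence "ennreal e * emeasure lborel B \<le> 0"
    using fin by (subst (asm) ennreal_add_left_cancel_le) auto
  thus False using e vol(1) by auto
qed

locale fk_kernel = fk_setup +
  fixes p :: "real \<Rightarrow> 'a \<Rightarrow> 'a \<Rightarrow> real"
  assumes dens: "is_fk_density M W \<beta> \<kappa> p"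
    and cont: "continuous_on ({0<..} \<times> ((- {0}) \<times> (- {0}))) (\<lambda>(t, x, y). p t x y)"
begin

text \<open>The density determines \<open>p\<close> only through its positive part; in dimension one the kernel
  vanishes across the origin, where a continuous \<open>p\<close> may be negative.\<close>

definition pp :: "real \<Rightarrow> 'a \<Rightarrow> 'a \<Rightarrow> real" where
  "pp t x y = (if (x, y) \<in> (- {0}) \<times> (- {0}) then max 0 (p t x y) else 0)"

definition K :: "real \<Rightarrow> ('a \<Rightarrow> ennreal) \<Rightarrow> 'a \<Rightarrow> ennreal" where
  "K t f x = (\<integral>\<^sup>+ y. ennreal (pp t x y) * f y \<partial>lborel)"

lemma pp_nonneg [simp]: "pp t x y \<ge> 0"
  by (simp add: pp_def)

lemma pp_zero [simp]: "pp t 0 y = 0" "pp t x 0 = 0"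
  by (simp_all add: pp_def)

lemma continuous_on_p: "t > 0 \<Longrightarrow> continuous_on ((- {0}) \<times> (- {0})) (\<lambda>(x, y). p t x y)"
proof -
  assume t: "t > 0"
  have "continuous_on ((- {0}) \<times> (- {0})) ((\<lambda>(t, x, y). p t x y) \<circ> (\<lambda>z. (t, z)))"
    using t by (intro continuous_on_compose continuous_intros continuous_on_subset[OF cont]) auto
  thus ?thesis by (simp add: comp_def case_prod_unfold)
qed

lemma pp_measurable [measurable]:
  assumes t: "t > 0" shows "(\<lambda>(x, y). pp t x y) \<in> borel_measurable (borel \<Otimes>\<^sub>M borel)"
proof -
  have c: "continuous_on ((- {0}) \<times> (- {0})) (\<lambda>z. max 0 (case z of (x, y) \<Rightarrow> p t x y))"
    by (intro continuous_intros continuous_on_p t)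
  have "open ((- {0 :: 'a}) \<times> (- {0 :: 'a}))" by (intro open_Times) auto
  hence m: "(\<lambda>z. if z \<in> (- {0}) \<times> (- {0}) then max 0 (case z of (x, y) \<Rightarrow> p t x y) else 0) \<in> borel_measurable borel"
    using c by (intro borel_measurable_continuous_on_if) auto
  have "(\<lambda>z. if z \<in> (- {0}) \<times> (- {0}) then max 0 (case z of (x, y) \<Rightarrow> p t x y) else 0) = (\<lambda>(x, y). pp t x y)"
    by (auto simp: fun_eq_iff pp_def)
  with m show ?thesis by (simp add: borel_prod)
qed

lemma pp_measurable_snd: "t > 0 \<Longrightarrow> (\<lambda>y. pp t x y) \<in> borel_measurable borel"
  using measurable_Pair2[OF pp_measurable, of t x] by simp

lemma continuous_on_pp:
  assumes t: "t > 0" and x: "x \<noteq> 0"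
  shows "continuous_on (- {0}) (\<lambda>y. pp t x y)" "continuous_on (- {0}) (\<lambda>y. pp t y x)"
proof -
  have "continuous_on (- {0}) ((\<lambda>(x, y). p t x y) \<circ> (\<lambda>y. (x, y)))"
    using x by (intro continuous_on_compose continuous_intros continuous_on_subset[OF continuous_on_p[OF t]]) auto
  hence "continuous_on (- {0}) (\<lambda>y. max 0 (p t x y))" by (intro continuous_intros) (simp add: comp_def)
  thus "continuous_on (- {0}) (\<lambda>y. pp t x y)" by (rule continuous_on_eq) (use x in \<open>auto simp: pp_def\<close>)
  have "continuous_on (- {0}) ((\<lambda>(x, y). p t x y) \<circ> (\<lambda>y. (y, x)))"
    using x by (intro continuous_on_compose continuous_intros continuous_on_subset[OF continuous_on_p[OF t]]) auto
  hence "continuous_on (- {0}) (\<lambda>y. max 0 (p t y x))" by (intro continuous_intros) (simp add: comp_def)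
  thus "continuous_on (- {0}) (\<lambda>y. pp t y x)" by (rule continuous_on_eq) (use x in \<open>auto simp: pp_def\<close>)
qed

lemma K_measurable [measurable]:
  assumes t: "t > 0" and [measurable]: "f \<in> borel_measurable borel"
  shows "K t f \<in> borel_measurable borel"
proof -
  note pp_measurable[OF t, measurable]
  show ?thesis unfolding K_def[abs_def] by measurable
qed

lemma P_eq_K:
  assumes "t > 0" "x \<noteq> 0" "f \<in> borel_measurable borel"
  shows "P t f x = K t f x"
proof -
  have "P t f x = (\<integral>\<^sup>+ y. indicator (- {0}) y * ennreal (p t x y) * f y \<partial>lborel)"
    using dens assms unfolding is_fk_density_def by blast
  also have "\<dots> = K t f x"
    unfolding K_def by (intro nn_integral_cong) (use assms(2) in \<open>auto simp: pp_def indicator_def max_def ennreal_neg\<close>)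
  finally show ?thesis .
qed

lemma K_mono: "(\<And>y. y \<noteq> 0 \<Longrightarrow> f y \<le> g y) \<Longrightarrow> K t f x \<le> K t g x"
proof -
  assume a: "\<And>y. y \<noteq> 0 \<Longrightarrow> f y \<le> g y"
  have "ennreal (pp t x y) * f y \<le> ennreal (pp t x y) * g y" for y
    using a[of y] by (cases "y = 0") (auto intro: mult_left_mono)
  thus ?thesis unfolding K_def by (intro nn_integral_mono)
qed

lemma K_cmult:
  assumes t: "t > 0" and [measurable]: "f \<in> borel_measurable borel"
  shows "K t (\<lambda>y. c * f y) x = c * K t f x"
proof -
  note pp_measurable_snd[OF t, measurable]
  have "K t (\<lambda>y. c * f y) x = (\<integral>\<^sup>+ y. c * (ennreal (pp t x y) * f y) \<partial>lborel)"
    unfolding K_def by (simp add: mult.left_commute)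
  also have "\<dots> = c * K t f x"
    unfolding K_def by (rule nn_integral_cmult) measurable
  finally show ?thesis .
qed

lemma K_add:
  assumes t: "t > 0" and [measurable]: "f \<in> borel_measurable borel" "g \<in> borel_measurable borel"
  shows "K t (\<lambda>y. f y + g y) x = K t f x + K t g x"
proof -
  note pp_measurable_snd[OF t, measurable]
  show ?thesis unfolding K_def distrib_left by (rule nn_integral_add) measurable
qed

lemma pp_le_heat_q:
  assumes t: "t > 0" shows "pp t x y \<le> heat_q t x y"
proof (cases "x = 0 \<or> y = 0")
  case False
  show ?thesis
  proof (rule continuous_le_if_nn_integral_le[of "- {0}" "\<lambda>y. pp t x y" "\<lambda>y. heat_q t x y"])
    fix z :: 'a and r
    have "(\<integral>\<^sup>+ y. ennreal (pp t x y) * indicator (cball z r) y \<partial>lborel) = P t (indicator (cball z r)) x"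
      using False t by (subst P_eq_K) (auto simp: K_def)
    also have "\<dots> \<le> Gop t (indicator (cball z r)) x" using t by (intro P_le_Gop) auto
    finally show "(\<integral>\<^sup>+ y. ennreal (pp t x y) * indicator (cball z r) y \<partial>lborel) \<le> (\<integral>\<^sup>+ y. ennreal (heat_q t x y) * indicator (cball z r) y \<partial>lborel)"
      by (simp add: Gop_def)
  qed (use False t in \<open>auto intro!: continuous_on_pp continuous_intros\<close>)
qed auto

lemma K_le_Gop: "t > 0 \<Longrightarrow> K t f x \<le> Gop t f x"
  unfolding K_def Gop_def by (intro nn_integral_mono mult_right_mono ennreal_leI pp_le_heat_q) auto

lemma P_zero: "t > 0 \<Longrightarrow> P t f 0 = 0"
proof -
  assume t: "t > 0"
  have *: "exit_time W \<omega> \<le> ereal 0" if "\<omega> \<in> space (M 0)" for \<omega>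
    unfolding exit_time_def using BM_start[OF that] by (intro INF_lower) auto
  have "\<not> ereal t < exit_time W \<omega>" if "\<omega> \<in> space (M 0)" for \<omega>
  proof
    assume "ereal t < exit_time W \<omega>"
    also have "\<dots> \<le> ereal 0" using that by (rule *)
    finally show False using t by simp
  qed
  hence "P t f 0 = (\<integral>\<^sup>+ \<omega>. 0 \<partial>M 0)"
    unfolding fk_semigroup_def by (intro nn_integral_cong) (auto simp: indicator_def)
  thus ?thesis by simp
qed

text \<open>At the origin both sides vanish: the process is already killed, and \<open>pp\<close>
  was set to 0 there. The identity therefore holds everywhere, which lets operators be composed
  without exceptional points.\<close>

lemma P_eq_K': "t > 0 \<Longrightarrow> f \<in> borel_measurable borel \<Longrightarrow> P t f x = K t f x"
  by (cases "x = 0") (simp_all add: P_eq_K P_zero, simp add: K_def)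

lemma cut_tendsto_1:
  assumes "norm z > \<epsilon>" shows "(\<lambda>n. cut \<epsilon> (t / real n) z) \<longlonglongrightarrow> 1"
proof -
  have "(\<lambda>n. ennreal (exp (- (t / real n) * pot z))) \<longlonglongrightarrow> ennreal (exp (- 0 * pot z))"
    by (intro tendsto_ennrealI tendsto_exp tendsto_mult tendsto_minus tendsto_const lim_const_over_n)
  thus ?thesis using assms by (simp add: cut_def)
qed

text \<open>Fatou leads from \<open>K\<close> to the discrete iterates, adjointness swaps
  \<open>f\<close> and \<open>g\<close>, and reverse Fatou leads back; the integrable
  \<open>f\<close> is the dominating function. The passage works in one direction only, and the
  opposite inequality arises later by exchanging the two variables of the kernel.\<close>

lemma nn_integral_K_le:
  fixes f g :: "'a \<Rightarrow> ennreal"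
  assumes t: "t > 0" and [measurable]: "f \<in> borel_measurable borel" "g \<in> borel_measurable borel"
    and f1: "\<And>y. f y \<le> 1" and g1: "\<And>y. g y \<le> 1" and fi: "(\<integral>\<^sup>+ y. f y \<partial>lborel) < \<infinity>"
  shows "(\<integral>\<^sup>+ x. g x * K t f x \<partial>lborel) \<le> (\<integral>\<^sup>+ x. K t g x * f x \<partial>lborel)"
proof -
  \<comment> \<open>The end-point weight that makes the iterate symmetric. It tends to 1 outside the
    cut-off ball as the mesh is refined, so inserting it does not change the limit.\<close>
  define m :: "nat \<Rightarrow> nat \<Rightarrow> 'a \<Rightarrow> ennreal" where "m j n = cut (1 / real (Suc j)) (t / real n)" for j n
  have [measurable]: "m j n \<in> borel_measurable borel" for j n :: nat unfolding m_def by measurable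
  let ?T = "\<lambda>j n. Top (1 / real (Suc j)) (t / real n) ^^ n"
  have lm: "\<And>z j f. norm z > 1 / real (Suc j) \<Longrightarrow> (\<lambda>n. m j n z * (f::ennreal)) \<longlonglongrightarrow> f"
  proof -
    fix z j and f :: ennreal assume "norm (z::'a) > 1 / real (Suc j)"
    from cut_tendsto_1[OF this, of t] have "(\<lambda>n. m j n z * f) \<longlonglongrightarrow> 1 * f"
      unfolding m_def by (intro tendsto_mult_ennreal) auto
    thus "(\<lambda>n. m j n z * f) \<longlonglongrightarrow> f" by simp
  qed
  have "K t f x \<le> liminf (\<lambda>j. liminf (\<lambda>n. ?T j n (\<lambda>y. m j n y * f y) x))" for x
  proof -
    have "P t f x \<le> liminf (\<lambda>j. liminf (\<lambda>n. ?T j n (\<lambda>y. m j n y * f y) x))"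
    proof (rule P_le_liminf[OF t])
      fix j and z :: 'a assume "norm z > 1 / real (Suc j)"
      from lim_imp_Liminf[OF _ lm[OF this, of "f z"]] show "f z \<le> liminf (\<lambda>n. m j n z * f z)" by simp
    qed measurable
    thus ?thesis using t by (simp add: P_eq_K')
  qed
  hence "(\<integral>\<^sup>+ x. g x * K t f x \<partial>lborel) \<le> (\<integral>\<^sup>+ x. liminf (\<lambda>j. liminf (\<lambda>n. g x * ?T j n (\<lambda>y. m j n y * f y) x)) \<partial>lborel)"
  proof (intro nn_integral_mono)
    fix x assume *: "\<And>x. K t f x \<le> liminf (\<lambda>j. liminf (\<lambda>n. ?T j n (\<lambda>y. m j n y * f y) x))"
    show "g x * K t f x \<le> liminf (\<lambda>j. liminf (\<lambda>n. g x * ?T j n (\<lambda>y. m j n y * f y) x))"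
    proof (cases "g x = 0")
      case False
      have gx: "0 < g x" "g x < \<top>" using False g1[of x] by (auto simp: zero_less_iff_neq_zero less_top[symmetric] top_unique)
      have "g x * K t f x \<le> g x * liminf (\<lambda>j. liminf (\<lambda>n. ?T j n (\<lambda>y. m j n y * f y) x))"
        by (intro mult_left_mono *) auto
      also have "\<dots> \<le> liminf (\<lambda>j. g x * liminf (\<lambda>n. ?T j n (\<lambda>y. m j n y * f y) x))"
        by (rule Liminf_mult_ennreal[OF tendsto_const gx])
      also have "\<dots> \<le> liminf (\<lambda>j. liminf (\<lambda>n. g x * ?T j n (\<lambda>y. m j n y * f y) x))"
        by (intro Liminf_mono always_eventually allI Liminf_mult_ennreal[OF tendsto_const gx])
      finally show ?thesis .
    qed simp
  qed
  also have "\<dots> \<le> liminf (\<lambda>j. (\<integral>\<^sup>+ x. liminf (\<lambda>n. g x * ?T j n (\<lambda>y. m j n y * f y) x) \<partial>lborel))"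
    by (rule nn_integral_liminf) measurable
  also have "\<dots> \<le> liminf (\<lambda>j. liminf (\<lambda>n. (\<integral>\<^sup>+ x. g x * ?T j n (\<lambda>y. m j n y * f y) x \<partial>lborel)))"
    by (intro Liminf_mono always_eventually allI nn_integral_liminf) measurable
  also have "\<dots> = liminf (\<lambda>j. liminf (\<lambda>n. (\<integral>\<^sup>+ x. ?T j n (\<lambda>y. m j n y * g y) x * f x \<partial>lborel)))"
    unfolding m_def by (simp add: nn_integral_Top_adjoint)
  also have "\<dots> \<le> liminf (\<lambda>j. (\<integral>\<^sup>+ x. K t g x * f x \<partial>lborel))"
  proof (intro Liminf_mono always_eventually allI)
    fix j
    have mg: "m j n y * g y \<le> 1" for n :: nat and y
      using mult_mono[of "m j n y" 1 "g y" 1] g1[of y] t unfolding m_def by (simp add: cut_le_1)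
    have Tb: "?T j n (\<lambda>y. m j n y * g y) x \<le> 1" for n x
      using mg t by (cases "n = 0") (auto intro!: Top_funpow_le_const)
    have "liminf (\<lambda>n. (\<integral>\<^sup>+ x. ?T j n (\<lambda>y. m j n y * g y) x * f x \<partial>lborel)) \<le> limsup (\<lambda>n. (\<integral>\<^sup>+ x. ?T j n (\<lambda>y. m j n y * g y) x * f x \<partial>lborel))"
      by (intro Liminf_le_Limsup) auto
    also have "\<dots> \<le> (\<integral>\<^sup>+ x. limsup (\<lambda>n. ?T j n (\<lambda>y. m j n y * g y) x * f x) \<partial>lborel)"
    proof (rule nn_integral_limsup[of _ _ f])
      show "AE x in lborel. ?T j n (\<lambda>y. m j n y * g y) x * f x \<le> f x" for n
        using mult_right_mono[OF Tb] by simp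
    qed (use fi in auto)
    also have "\<dots> \<le> (\<integral>\<^sup>+ x. K t g x * f x \<partial>lborel)"
    proof (intro nn_integral_mono)
      fix x
      have "limsup (\<lambda>n. ?T j n (\<lambda>y. m j n y * g y) x) \<le> P t (\<lambda>y. g y) x"
      proof (rule limsup_le_P[OF t _ _ mg])
        fix z :: 'a
        have "m j n z * g z \<le> 1 * g z" for n :: nat using t unfolding m_def by (intro mult_right_mono cut_le_1) auto
        thus "limsup (\<lambda>n. m j n z * g z) \<le> g z" by (intro Limsup_bounded) auto
      qed auto
      hence "limsup (\<lambda>n. ?T j n (\<lambda>y. m j n y * g y) x) \<le> K t g x" using t by (simp add: P_eq_K')
      moreover have "limsup (\<lambda>n. f x * ?T j n (\<lambda>y. m j n y * g y) x) \<le> f x * limsup (\<lambda>n. ?T j n (\<lambda>y. m j n y * g y) x)"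
        using f1[of x] by (intro Limsup_mult_ennreal[OF tendsto_const _ Tb]) (auto simp: less_top[symmetric] top_unique)
      ultimately show "limsup (\<lambda>n. ?T j n (\<lambda>y. m j n y * g y) x * f x) \<le> K t g x * f x"
        by (simp add: mult.commute) (meson mult_left_mono order_trans zero_le)
    qed
    finally show "liminf (\<lambda>n. (\<integral>\<^sup>+ x. ?T j n (\<lambda>y. m j n y * g y) x * f x \<partial>lborel)) \<le> (\<integral>\<^sup>+ x. K t g x * f x \<partial>lborel)" .
  qed
  also have "\<dots> = (\<integral>\<^sup>+ x. K t g x * f x \<partial>lborel)" by (simp add: Liminf_const)
  finally show ?thesis .
qed

text \<open>The integrated inequality concerns averages in both variables, and they are removed one
  at a time. Averages over a ball in one variable are continuous in the other by dominated
  convergence, with the constant bound of the Gaussian kernel as majorant. If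
  \<open>pp t y x < pp t x y\<close>, the same strict inequality holds with \<open>y\<close>
  replaced by any point of a small ball, and integrating over that ball gives a
  contradiction.\<close>

lemma pp_commute_le:
  assumes t: "t > 0" and x: "x \<noteq> 0" and y: "y \<noteq> 0"
  shows "pp t x y \<le> pp t y x"
proof -
  note pp_measurable[OF t, measurable]
  let ?q = "(4 * pi * t) powr (- real DIM('a) / 2)"
  have q: "pp t u v \<le> ?q" for u v using pp_le_heat_q[OF t, of u v] heat_q_le[OF t, of u v] by linarith
  \<comment> \<open>averages over a ball in the second variable are continuous in the first one\<close>
  have c1: "continuous_on (- {0}) (\<lambda>u. \<integral>v. indicator (cball y r) v * pp t u v \<partial>lborel)"
    and c2: "continuous_on (- {0}) (\<lambda>u. \<integral>v. indicator (cball y r) v * pp t v u \<partial>lborel)"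
    if r: "cball y r \<subseteq> - {0}" for r
  proof -
    have dom: "integrable lborel (\<lambda>v. ?q * indicator (cball y r) v)"
      using emeasure_lborel_cball_finite[of y r] by (intro integrable_mult_right) auto
    have conv: "(\<lambda>n. pp t (s n) v) \<longlonglongrightarrow> pp t u v" "(\<lambda>n. pp t v (s n)) \<longlonglongrightarrow> pp t v u"
      if "\<And>n. s n \<in> - {0}" "u \<in> - {0}" "s \<longlonglongrightarrow> u" for s :: "nat \<Rightarrow> 'a" and u v
      using continuous_on_pp[OF t, of v] that unfolding continuous_on_sequentially comp_def by (cases "v = 0"; simp)+
    show "continuous_on (- {0}) (\<lambda>u. \<integral>v. indicator (cball y r) v * pp t u v \<partial>lborel)"
      unfolding continuous_on_sequentially comp_def
    proof (intro allI ballI impI)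
      fix s :: "nat \<Rightarrow> 'a" and u assume u: "u \<in> - {0}" and "(\<forall>n. s n \<in> - {0}) \<and> s \<longlonglongrightarrow> u"
      hence s: "\<And>n. s n \<in> - {0}" "s \<longlonglongrightarrow> u" by auto
      show "(\<lambda>n. \<integral>v. indicator (cball y r) v * pp t (s n) v \<partial>lborel) \<longlonglongrightarrow> (\<integral>v. indicator (cball y r) v * pp t u v \<partial>lborel)"
      proof (rule integral_dominated_convergence[OF _ _ dom])
        show "AE v in lborel. (\<lambda>n. indicator (cball y r) v * pp t (s n) v) \<longlonglongrightarrow> indicator (cball y r) v * pp t u v"
          by (intro AE_I2 tendsto_mult tendsto_const conv s u)
      qed (use q in \<open>auto simp: indicator_def pp_measurable_snd[OF t]\<close>)
    qed
    show "continuous_on (- {0}) (\<lambda>u. \<integral>v. indicator (cball y r) v * pp t v u \<partial>lborel)"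
      unfolding continuous_on_sequentially comp_def
    proof (intro allI ballI impI)
      fix s :: "nat \<Rightarrow> 'a" and u assume u: "u \<in> - {0}" and "(\<forall>n. s n \<in> - {0}) \<and> s \<longlonglongrightarrow> u"
      hence s: "\<And>n. s n \<in> - {0}" "s \<longlonglongrightarrow> u" by auto
      show "(\<lambda>n. \<integral>v. indicator (cball y r) v * pp t v (s n) \<partial>lborel) \<longlonglongrightarrow> (\<integral>v. indicator (cball y r) v * pp t v u \<partial>lborel)"
      proof (rule integral_dominated_convergence[OF _ _ dom])
        show "AE v in lborel. (\<lambda>n. indicator (cball y r) v * pp t v (s n)) \<longlonglongrightarrow> indicator (cball y r) v * pp t v u"
          by (intro AE_I2 tendsto_mult tendsto_const conv s u)
      qed (use q in \<open>auto simp: indicator_def\<close>)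
    qed
  qed
  have nn1: "ennreal (\<integral>v. indicator (cball y r) v * pp t u v \<partial>lborel) = (\<integral>\<^sup>+ v. ennreal (pp t u v) * indicator (cball y r) v \<partial>lborel)"
    and nn2: "ennreal (\<integral>v. indicator (cball y r) v * pp t v u \<partial>lborel) = (\<integral>\<^sup>+ v. ennreal (pp t v u) * indicator (cball y r) v \<partial>lborel)" for r u
  proof -
    have dom: "integrable lborel (\<lambda>v. ?q * indicator (cball y r) v)"
      using emeasure_lborel_cball_finite[of y r] by (intro integrable_mult_right) auto
    have "integrable lborel (\<lambda>v. indicator (cball y r) v * pp t u v)"
      by (rule Bochner_Integration.integrable_bound[OF dom]) (use q in \<open>auto simp: indicator_def pp_measurable_snd[OF t]\<close>)
    thus "ennreal (\<integral>v. indicator (cball y r) v * pp t u v \<partial>lborel) = (\<integral>\<^sup>+ v. ennreal (pp t u v) * indicator (cball y r) v \<partial>lborel)"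
      by (subst nn_integral_eq_integral[symmetric]) (auto intro!: nn_integral_cong simp: indicator_def)
    have "integrable lborel (\<lambda>v. indicator (cball y r) v * pp t v u)"
      by (rule Bochner_Integration.integrable_bound[OF dom]) (use q in \<open>auto simp: indicator_def\<close>)
    thus "ennreal (\<integral>v. indicator (cball y r) v * pp t v u \<partial>lborel) = (\<integral>\<^sup>+ v. ennreal (pp t v u) * indicator (cball y r) v \<partial>lborel)"
      by (subst nn_integral_eq_integral[symmetric]) (auto intro!: nn_integral_cong simp: indicator_def)
  qed
  \<comment> \<open>Removes the average in the first variable; the average over
    \<open>cball y r\<close> is still present.\<close>
  have step: "(\<integral>v. indicator (cball y r) v * pp t u v \<partial>lborel) \<le> (\<integral>v. indicator (cball y r) v * pp t v u \<partial>lborel)"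
    if r: "cball y r \<subseteq> - {0}" and u: "u \<in> - {0}" for r u
  proof (rule continuous_le_if_nn_integral_le[OF _ c1[OF r] c2[OF r] _ _ u])
    fix z :: 'a and s
    have "(\<integral>\<^sup>+ u. ennreal (\<integral>v. indicator (cball y r) v * pp t u v \<partial>lborel) * indicator (cball z s) u \<partial>lborel)
        = (\<integral>\<^sup>+ u. indicator (cball z s) u * K t (indicator (cball y r)) u \<partial>lborel)"
      unfolding nn1 K_def by (simp add: mult.commute)
    also have "\<dots> \<le> (\<integral>\<^sup>+ v. K t (indicator (cball z s)) v * indicator (cball y r) v \<partial>lborel)"
      using emeasure_lborel_cball_finite[of y r]
      by (intro nn_integral_K_le t indicator_cball_measurable) (simp_all add: indicator_le_1_ennreal nn_integral_indicator_cball)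
    also have "\<dots> = (\<integral>\<^sup>+ v. (\<integral>\<^sup>+ u. ennreal (pp t v u) * indicator (cball z s) u * indicator (cball y r) v \<partial>lborel) \<partial>lborel)"
      unfolding K_def using pp_measurable_snd[OF t] by (intro nn_integral_cong nn_integral_multc[symmetric]) auto
    also have "\<dots> = (\<integral>\<^sup>+ u. (\<integral>\<^sup>+ v. ennreal (pp t v u) * indicator (cball z s) u * indicator (cball y r) v \<partial>lborel) \<partial>lborel)"
      by (rule lborel_pair.Fubini') measurable
    also have "\<dots> = (\<integral>\<^sup>+ u. (\<integral>\<^sup>+ v. ennreal (pp t v u) * indicator (cball y r) v * indicator (cball z s) u \<partial>lborel) \<partial>lborel)"
      by (simp add: mult_ac)
    also have "\<dots> = (\<integral>\<^sup>+ u. (\<integral>\<^sup>+ v. ennreal (pp t v u) * indicator (cball y r) v \<partial>lborel) * indicator (cball z s) u \<partial>lborel)"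
      by (intro nn_integral_cong nn_integral_multc) measurable
    finally show "(\<integral>\<^sup>+ u. ennreal (\<integral>v. indicator (cball y r) v * pp t u v \<partial>lborel) * indicator (cball z s) u \<partial>lborel)
       \<le> (\<integral>\<^sup>+ u. ennreal (\<integral>v. indicator (cball y r) v * pp t v u \<partial>lborel) * indicator (cball z s) u \<partial>lborel)"
      unfolding nn2 .
  qed (auto intro!: integral_nonneg_AE)
  show ?thesis
  proof (rule ccontr)
    assume "\<not> ?thesis"
    hence gap: "pp t y x < pp t x y" by simp
    have c: "continuous_on (- {0}) (\<lambda>v. pp t x v - pp t v x)" using continuous_on_pp[OF t x] by (intro continuous_intros)
    hence "((\<lambda>v. pp t x v - pp t v x) \<longlongrightarrow> pp t x y - pp t y x) (at y)"
      using y continuous_on_eq_continuous_at[of "- {0}" "\<lambda>v. pp t x v - pp t v x"] by (auto simp: isCont_def)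
    hence "\<forall>\<^sub>F v in at y. pp t x v - pp t v x > 0" using gap by (intro order_tendstoD) auto
    then obtain d where d: "d > 0" "\<And>v. v \<noteq> y \<Longrightarrow> dist v y < d \<Longrightarrow> pp t x v - pp t v x > 0"
      unfolding eventually_at by auto
    define r where "r = min (d / 2) (norm y / 2)"
    have r: "r > 0" "r < d" "cball y r \<subseteq> - {0}" using d(1) y by (auto simp: r_def dist_norm min_def)
    have pos: "pp t v x < pp t x v" if "v \<in> cball y r" for v
      using d(2)[of v] that gap r by (cases "v = y") (auto simp: dist_commute)
    have dom: "integrable lborel (\<lambda>v. ?q * indicator (cball y r) v)"
      using emeasure_lborel_cball_finite[of y r] by (intro integrable_mult_right) auto
    have i1: "integrable lborel (\<lambda>v. indicator (cball y r) v * pp t x v)"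
      by (rule Bochner_Integration.integrable_bound[OF dom]) (use q in \<open>auto simp: indicator_def pp_measurable_snd[OF t]\<close>)
    have i2: "integrable lborel (\<lambda>v. indicator (cball y r) v * pp t v x)"
      by (rule Bochner_Integration.integrable_bound[OF dom]) (use q in \<open>auto simp: indicator_def\<close>)
    let ?D = "\<lambda>v. indicator (cball y r) v * pp t x v - indicator (cball y r) v * pp t v x"
    have D0: "?D v \<ge> 0" for v using pos[of v] by (auto simp: indicator_def)
    have "integral\<^sup>L lborel ?D \<le> 0" using step[OF r(3), of x] x i1 i2 by (simp add: Bochner_Integration.integral_diff)
    moreover have "integral\<^sup>L lborel ?D \<ge> 0" using D0 by (intro integral_nonneg_AE) auto
    ultimately have "integral\<^sup>L lborel ?D = 0" by simp
    hence "AE v in lborel. ?D v = 0" using i1 i2 D0 by (subst (asm) integral_nonneg_eq_0_iff_AE) auto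
    moreover have "?D v \<noteq> 0" if "v \<in> cball y r" for v using pos[OF that] that by (simp add: indicator_def)
    ultimately have "AE v in lborel. v \<notin> cball y r" by (auto elim!: eventually_mono)
    hence "emeasure lborel (cball y r) = 0" by (subst (asm) AE_iff_null_sets[symmetric]) (auto simp: null_sets_def)
    moreover have "0 < unit_ball_vol (real DIM('a)) * r ^ DIM('a)" using r(1) by (intro mult_pos_pos unit_ball_vol_pos) auto
    ultimately show False using r(1) by (simp add: emeasure_cball)
  qed
qed

lemma pp_commute: "t > 0 \<Longrightarrow> pp t x y = pp t y x"
  by (cases "x = 0 \<or> y = 0") (auto intro: antisym pp_commute_le)

end

section \<open>The Chapman-Kolmogorov identity for doubled times\<close>

context inv_pot begin

lemma cut_antimono: "\<epsilon> \<le> \<epsilon>' \<Longrightarrow> cut \<epsilon>' \<delta> x \<le> cut \<epsilon> \<delta> x"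
  by (auto simp: cut_def)

lemma Top_funpow_antimono: "\<epsilon> \<le> \<epsilon>' \<Longrightarrow> (Top \<epsilon>' \<delta> ^^ n) f x \<le> (Top \<epsilon> \<delta> ^^ n) f x"
proof (induction n arbitrary: x)
  case (Suc n)
  have "Top \<epsilon>' \<delta> ((Top \<epsilon>' \<delta> ^^ n) f) x \<le> Top \<epsilon> \<delta> ((Top \<epsilon> \<delta> ^^ n) f) x"
    by (subst (1 2) Top_def, intro mult_mono cut_antimono Gop_mono Suc) auto
  thus ?case by simp
qed simp

end

context fk_kernel begin

text \<open>Time \<open>2 * t\<close> in \<open>2 * m\<close> steps and time \<open>t\<close> in
  \<open>m\<close> steps have the same step length, so the iterates compose exactly. This is why
  only doubled times are considered.\<close>

lemma Top_funpow_double: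
  "(Top \<epsilon> (2 * t / real (2 * m)) ^^ (2 * m)) f = (Top \<epsilon> (t / real m) ^^ m) ((Top \<epsilon> (t / real m) ^^ m) f)"
proof -
  have "2 * t / real (2 * m) = t / real m" by simp
  thus ?thesis by (simp only: mult_2[of m] funpow_add comp_def)
qed

text \<open>Along even step numbers the iterate for \<open>2 * t\<close> is a nested one, and
  \<open>limsup_le_P\<close> applies twice: to the outer iterate, and pointwise to the inner iterate
  that serves as its test function.\<close>

lemma K_double_le:
  assumes t: "t > 0" and [measurable]: "f \<in> borel_measurable borel" and f1: "\<And>y. f y \<le> 1"
  shows "K (2 * t) f x \<le> K t (K t f) x"
proof -
  let ?T = "\<lambda>j n. Top (1 / real (Suc j)) (2 * t / real n) ^^ n"
  let ?S = "\<lambda>j m. Top (1 / real (Suc j)) (t / real m) ^^ m"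
  have S1: "?S j m f y \<le> 1" for j m y
  proof (cases "m = 0")
    case False
    hence "t / real m > 0" using t by simp
    thus ?thesis by (rule Top_funpow_le_const[OF _ f1])
  qed (simp add: f1)
  have "liminf (\<lambda>n. ?T j n f x) \<le> K t (K t f) x" for j
  proof -
    have eq: "?T j (2 * m) f = ?S j m (?S j m f)" for m
      by (rule Top_funpow_double)
    have "liminf (\<lambda>n. ?T j n f x) \<le> liminf ((\<lambda>n. ?T j n f x) \<circ> (\<lambda>m. 2 * m))"
      by (intro liminf_subseq_mono) (simp add: strict_mono_def)
    also have "\<dots> = liminf (\<lambda>m. ?S j m (?S j m f) x)" using eq by (simp add: comp_def)
    also have "\<dots> \<le> limsup (\<lambda>m. ?S j m (?S j m f) x)" by (intro Liminf_le_Limsup) auto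
    also have "\<dots> \<le> P t (K t f) x"
    proof (rule limsup_le_P[OF t _ _ S1])
      fix z :: 'a
      have "limsup (\<lambda>m. ?S j m f z) \<le> P t f z"
        by (rule limsup_le_P[OF t, where g = "\<lambda>_. f" and K = 1])
           (use f1 in \<open>auto intro!: Limsup_bounded\<close>)
      thus "limsup (\<lambda>m. ?S j m f z) \<le> K t f z" using t by (simp add: P_eq_K')
    qed auto
    finally show ?thesis using t by (simp add: P_eq_K')
  qed
  hence "liminf (\<lambda>j. liminf (\<lambda>n. ?T j n f x)) \<le> liminf (\<lambda>j::nat. K t (K t f) x)"
    by (intro Liminf_mono) auto
  moreover have "P (2 * t) f x \<le> liminf (\<lambda>j. liminf (\<lambda>n. ?T j n f x))"
    using t by (intro P_le_liminf) (auto simp: Liminf_const)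
  ultimately show ?thesis using t by (simp add: P_eq_K' Liminf_const)
qed

text \<open>Fatou produces a cut-off radius for each of the two factors, but composition requires
  them to be equal. Iterates increase as the radius shrinks, so the inner index is frozen at
  \<open>i\<close> and then raised to \<open>max j i\<close>, which equals the outer index
  \<open>j\<close> for large \<open>j\<close>. Monotone convergence in \<open>i\<close> finally
  recovers \<open>K t f\<close>.\<close>

lemma K_double_ge:
  assumes t: "t > 0" and [measurable]: "f \<in> borel_measurable borel" and f1: "\<And>y. f y \<le> 1"
  shows "K t (K t f) x \<le> K (2 * t) f x"
proof -
  note pp_measurable_snd[OF t, measurable]
  let ?S = "\<lambda>j m. Top (1 / real (Suc j)) (t / real m) ^^ m"
  define h where "h j z = liminf (\<lambda>m. ?S j m f z)" for j z
  have [measurable]: "h j \<in> borel_measurable borel" for j unfolding h_def[abs_def] by measurable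
  have mono: "h i z \<le> h j z" if "i \<le> j" for i j z
    unfolding h_def using that by (intro Liminf_mono always_eventually allI Top_funpow_antimono) (auto simp: frac_le)
  have Kh: "K t f z \<le> (SUP j. h j z)" for z
  proof -
    have "P t f z \<le> liminf (\<lambda>j. h j z)" unfolding h_def
      using t by (intro P_le_liminf) (auto simp: Liminf_const)
    also have "\<dots> \<le> (SUP j. h j z)"
    proof -
      have "liminf (\<lambda>j. h j z) \<le> limsup (\<lambda>j. h j z)" by (intro Liminf_le_Limsup) auto
      also have "\<dots> \<le> (SUP j. h j z)" by (intro Limsup_bounded always_eventually allI SUP_upper) auto
      finally show ?thesis .
    qed
    finally show ?thesis using t by (simp add: P_eq_K')
  qed
  have hj: "K t (h i) x \<le> K (2 * t) f x" for i
  proof -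
    have "P t (h i) x \<le> liminf (\<lambda>j. liminf (\<lambda>n. ?S j n (?S (max j i) n f) x))"
    proof (rule P_le_liminf[OF t])
      show "h i z \<le> liminf (\<lambda>n. (?S (max j i) n f) z)" for j z
        using mono[of i "max j i" z] by (simp add: h_def)
    qed measurable
    also have "\<dots> \<le> liminf (\<lambda>j::nat. K (2 * t) f x)"
    proof (intro Liminf_mono eventually_mono[OF eventually_ge_at_top[of i]])
      fix j assume "i \<le> j"
      let ?T = "\<lambda>n. Top (1 / real (Suc j)) (2 * t / real n) ^^ n"
      have eq: "?T (2 * m) f = ?S j m (?S j m f)" for m by (rule Top_funpow_double)
      have "liminf (\<lambda>n. ?S j n (?S (max j i) n f) x) = liminf (\<lambda>n. ?S j n (?S j n f) x)" using \<open>i \<le> j\<close> by (simp add: max_def)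
      also have "\<dots> \<le> limsup (\<lambda>n. ?S j n (?S j n f) x)" by (intro Liminf_le_Limsup) auto
      also have "\<dots> = limsup ((\<lambda>n. ?T n f x) \<circ> (\<lambda>m. 2 * m))" using eq by (simp add: comp_def)
      also have "\<dots> \<le> limsup (\<lambda>n. ?T n f x)" by (intro limsup_subseq_mono) (simp add: strict_mono_def)
      also have "\<dots> \<le> P (2 * t) f x"
        by (rule limsup_le_P[where g = "\<lambda>_. f" and K = 1]) (use t f1 in \<open>auto intro!: Limsup_bounded\<close>)
      finally show "liminf (\<lambda>n. ?S j n (?S (max j i) n f) x) \<le> K (2 * t) f x" using t by (simp add: P_eq_K')
    qed
    finally show ?thesis using t by (simp add: P_eq_K' Liminf_const)
  qed
  have "K t (K t f) x \<le> K t (\<lambda>z. SUP j. h j z) x" by (intro K_mono Kh)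
  also have "\<dots> = (\<integral>\<^sup>+ y. (SUP j. ennreal (pp t x y) * h j y) \<partial>lborel)"
    unfolding K_def by (simp add: SUP_mult_left_ennreal)
  also have "\<dots> = (SUP j. \<integral>\<^sup>+ y. ennreal (pp t x y) * h j y \<partial>lborel)"
    by (intro nn_integral_monotone_convergence_SUP) (auto simp: incseq_def le_fun_def intro!: mult_left_mono mono)
  also have "\<dots> \<le> K (2 * t) f x" using hj by (intro SUP_least) (auto simp: K_def)
  finally show ?thesis .
qed

lemma pp_le_const: "t > 0 \<Longrightarrow> pp t x y \<le> (4 * pi * t) powr (- real DIM('a) / 2)"
  using pp_le_heat_q[of t x y] heat_q_le[of t x y] by linarith

text \<open>The convolution \<open>C\<close> is continuous in \<open>y\<close> by dominated
  convergence, with \<open>heat_q t x z\<close> times a constant as majorant. The two operator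
  inequalities tested on balls therefore become pointwise.\<close>

lemma pp_double:
  assumes t: "t > 0" and x: "x \<noteq> 0" and y: "y \<noteq> 0"
  shows "ennreal (pp (2 * t) x y) = (\<integral>\<^sup>+ z. ennreal (pp t x z) * ennreal (pp t z y) \<partial>lborel)"
proof -
  note pp_measurable[OF t, measurable] pp_measurable_snd[OF t, measurable]
  let ?q = "(4 * pi * t) powr (- real DIM('a) / 2)"
  define C where "C y = (\<integral>z. pp t x z * pp t z y \<partial>lborel)" for y
  have dom: "integrable lborel (\<lambda>z. heat_q t x z * ?q)"
    using t by (intro integrable_mult_left integrableI_nonneg) (auto simp: nn_integral_heat_q)
  have le: "\<bar>pp t x z * pp t z y\<bar> \<le> heat_q t x z * ?q" for z y
    using pp_le_heat_q[OF t, of x z] pp_le_const[OF t, of z y] by (simp add: abs_mult mult_mono)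
  have int: "integrable lborel (\<lambda>z. pp t x z * pp t z y)" for y
    by (rule Bochner_Integration.integrable_bound[OF dom]) (use le in auto)
  have C0: "C y \<ge> 0" for y unfolding C_def by (intro integral_nonneg_AE) auto
  have C: "ennreal (C y) = (\<integral>\<^sup>+ z. ennreal (pp t x z) * ennreal (pp t z y) \<partial>lborel)" for y
    unfolding C_def using int[of y] by (subst nn_integral_eq_integral[symmetric]) (auto simp: ennreal_mult)
  have cC: "continuous_on (- {0}) C"
    unfolding continuous_on_sequentially comp_def
  proof (intro allI ballI impI)
    fix s :: "nat \<Rightarrow> 'a" and u assume u: "u \<in> - {0}" and "(\<forall>n. s n \<in> - {0}) \<and> s \<longlonglongrightarrow> u"
    hence s: "\<And>n. s n \<in> - {0}" "s \<longlonglongrightarrow> u" by auto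
    have conv: "(\<lambda>n. pp t v (s n)) \<longlonglongrightarrow> pp t v u" for v
      using continuous_on_pp[OF t, of v] s u unfolding continuous_on_sequentially comp_def by (cases "v = 0"; simp)
    show "(\<lambda>n. C (s n)) \<longlonglongrightarrow> C u"
      unfolding C_def
    proof (rule integral_dominated_convergence[OF _ _ dom])
      show "AE z in lborel. (\<lambda>n. pp t x z * pp t z (s n)) \<longlonglongrightarrow> pp t x z * pp t z u"
        by (intro AE_I2 tendsto_mult tendsto_const conv)
    qed (use le in auto)
  qed
  have CK: "(\<integral>\<^sup>+ y. ennreal (C y) * f y \<partial>lborel) = K t (K t f) x" if [measurable]: "f \<in> borel_measurable borel" for f
  proof -
    have "K t (K t f) x = (\<integral>\<^sup>+ z. (\<integral>\<^sup>+ y. ennreal (pp t x z) * (ennreal (pp t z y) * f y) \<partial>lborel) \<partial>lborel)"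
      unfolding K_def by (intro nn_integral_cong nn_integral_cmult[symmetric]) measurable
    also have "\<dots> = (\<integral>\<^sup>+ y. (\<integral>\<^sup>+ z. ennreal (pp t x z) * (ennreal (pp t z y) * f y) \<partial>lborel) \<partial>lborel)"
      by (rule lborel_pair.Fubini') measurable
    also have "\<dots> = (\<integral>\<^sup>+ y. (\<integral>\<^sup>+ z. ennreal (pp t x z) * ennreal (pp t z y) * f y \<partial>lborel) \<partial>lborel)"
      by (simp add: mult_ac)
    also have "\<dots> = (\<integral>\<^sup>+ y. ennreal (C y) * f y \<partial>lborel)"
      unfolding C by (intro nn_integral_cong nn_integral_multc) measurable
    finally show ?thesis ..
  qed
  have t2: "2 * t > 0" using t by simp
  have "pp (2 * t) x y \<le> C y"
  proof (rule continuous_le_if_nn_integral_le[of "- {0}" "\<lambda>y. pp (2 * t) x y" C])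
    fix z r
    have "K (2 * t) (indicator (cball z r)) x \<le> K t (K t (indicator (cball z r))) x"
      using t by (intro K_double_le) (auto simp: indicator_le_1_ennreal)
    thus "(\<integral>\<^sup>+ v. ennreal (pp (2 * t) x v) * indicator (cball z r) v \<partial>lborel) \<le> (\<integral>\<^sup>+ v. ennreal (C v) * indicator (cball z r) v \<partial>lborel)"
      by (simp add: CK) (simp add: K_def)
  qed (use x y C0 cC in \<open>auto intro!: continuous_on_pp t2\<close>)
  moreover have "C y \<le> pp (2 * t) x y"
  proof (rule continuous_le_if_nn_integral_le[of "- {0}" C "\<lambda>y. pp (2 * t) x y"])
    fix z r
    have "K t (K t (indicator (cball z r))) x \<le> K (2 * t) (indicator (cball z r)) x"
      using t by (intro K_double_ge) (auto simp: indicator_le_1_ennreal)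
    thus "(\<integral>\<^sup>+ v. ennreal (C v) * indicator (cball z r) v \<partial>lborel) \<le> (\<integral>\<^sup>+ v. ennreal (pp (2 * t) x v) * indicator (cball z r) v \<partial>lborel)"
      by (simp add: CK) (simp add: K_def)
  qed (use x y C0 cC in \<open>auto intro!: continuous_on_pp t2\<close>)
  ultimately show ?thesis using C[of y] by simp
qed

lemma K_double:
  assumes t: "t > 0" and [measurable]: "f \<in> borel_measurable borel"
  shows "K (2 * t) f x = K t (K t f) x"
proof (cases "x = 0")
  case False
  note pp_measurable[OF t, measurable] pp_measurable_snd[OF t, measurable]
  have "K t (K t f) x = (\<integral>\<^sup>+ z. (\<integral>\<^sup>+ y. ennreal (pp t x z) * (ennreal (pp t z y) * f y) \<partial>lborel) \<partial>lborel)"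
    unfolding K_def by (intro nn_integral_cong nn_integral_cmult[symmetric]) measurable
  also have "\<dots> = (\<integral>\<^sup>+ y. (\<integral>\<^sup>+ z. ennreal (pp t x z) * (ennreal (pp t z y) * f y) \<partial>lborel) \<partial>lborel)"
    by (rule lborel_pair.Fubini') measurable
  also have "\<dots> = (\<integral>\<^sup>+ y. (\<integral>\<^sup>+ z. ennreal (pp t x z) * ennreal (pp t z y) * f y \<partial>lborel) \<partial>lborel)"
    by (simp add: mult_ac)
  also have "\<dots> = (\<integral>\<^sup>+ y. (\<integral>\<^sup>+ z. ennreal (pp t x z) * ennreal (pp t z y) \<partial>lborel) * f y \<partial>lborel)"
    by (intro nn_integral_cong nn_integral_multc) measurable
  also have "\<dots> = K (2 * t) f x" unfolding K_def
  proof (rule nn_integral_cong)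
    fix y show "(\<integral>\<^sup>+ z. ennreal (pp t x z) * ennreal (pp t z y) \<partial>lborel) * f y = ennreal (pp (2 * t) x y) * f y"
      using pp_double[OF t False, of y] by (cases "y = 0") auto
  qed
  finally show ?thesis ..
qed (simp add: K_def)

end

section \<open>Comparison with half-spaces by the method of images\<close>

lemma Gop_heat_kernel:
  fixes f :: "'a::euclidean_space \<Rightarrow> ennreal"
  assumes s: "s > 0" and t: "t > 0" and [measurable]: "f \<in> borel_measurable borel" "\<rho> \<in> borel_measurable borel"
  shows "Gop s (\<lambda>z. \<integral>\<^sup>+ y. ennreal (heat_q t z (\<rho> y)) * f y \<partial>lborel) x = (\<integral>\<^sup>+ y. ennreal (heat_q (s + t) x (\<rho> y)) * f y \<partial>lborel)"
proof -
  have "Gop s (\<lambda>z. \<integral>\<^sup>+ y. ennreal (heat_q t z (\<rho> y)) * f y \<partial>lborel) x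
      = (\<integral>\<^sup>+ z. (\<integral>\<^sup>+ y. ennreal (heat_q s x z) * (ennreal (heat_q t z (\<rho> y)) * f y) \<partial>lborel) \<partial>lborel)"
    unfolding Gop_def by (intro nn_integral_cong nn_integral_cmult[symmetric]) measurable
  also have "\<dots> = (\<integral>\<^sup>+ y. (\<integral>\<^sup>+ z. ennreal (heat_q s x z) * (ennreal (heat_q t z (\<rho> y)) * f y) \<partial>lborel) \<partial>lborel)"
    by (rule lborel_pair.Fubini') measurable
  also have "\<dots> = (\<integral>\<^sup>+ y. (\<integral>\<^sup>+ z. ennreal (heat_q s x z) * ennreal (heat_q t z (\<rho> y)) * f y \<partial>lborel) \<partial>lborel)"
    by (simp add: mult_ac)
  also have "\<dots> = (\<integral>\<^sup>+ y. (\<integral>\<^sup>+ z. ennreal (heat_q s x z) * ennreal (heat_q t z (\<rho> y)) \<partial>lborel) * f y \<partial>lborel)"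
    by (intro nn_integral_cong nn_integral_multc) measurable
  also have "\<dots> = (\<integral>\<^sup>+ y. ennreal (heat_q (s + t) x (\<rho> y)) * f y \<partial>lborel)"
    by (simp add: heat_q_convolution[OF s t])
  finally show ?thesis .
qed

text \<open>For a unit vector \<open>v\<close> this is the reflection in the hyperplane
  \<open>y \<bullet> v = l\<close>.\<close>

definition mirror :: "'a::euclidean_space \<Rightarrow> real \<Rightarrow> 'a \<Rightarrow> 'a" where
  "mirror v l y = y - (2 * (y \<bullet> v - l)) *\<^sub>R v"

lemma mirror_measurable [measurable]: "mirror v l \<in> borel_measurable borel"
  unfolding mirror_def[abs_def] by measurable

text \<open>The product on the right is positive exactly when \<open>y\<close> and \<open>z\<close>
  lie on the same side of the hyperplane. Its sign drives the discrete comparison, its size the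
  factor \<open>1 - exp\<close> of the final bound.\<close>

lemma norm_mirror:
  fixes z :: "'a::euclidean_space"
  assumes "norm v = 1"
  shows "(norm (z - mirror v l y))\<^sup>2 = (norm (z - y))\<^sup>2 + 4 * (y \<bullet> v - l) * (z \<bullet> v - l)"
proof -
  have vv: "v \<bullet> v = 1" using assms by (simp add: power2_norm_eq_inner[symmetric])
  define a where "a = 2 * (y \<bullet> v - l)"
  have "z - mirror v l y = (z - y) + a *\<^sub>R v" by (simp add: mirror_def a_def)
  moreover have "(norm ((z - y) + a *\<^sub>R v))\<^sup>2 = (norm (z - y))\<^sup>2 + 2 * a * ((z - y) \<bullet> v) + a\<^sup>2"
    unfolding power2_norm_eq_inner by (simp add: inner_simps inner_commute vv power2_eq_square algebra_simps)
  ultimately have "(norm (z - mirror v l y))\<^sup>2 = (norm (z - y))\<^sup>2 + 2 * a * ((z - y) \<bullet> v) + a\<^sup>2" by (simp only:)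
  thus ?thesis by (simp add: a_def inner_diff_left power2_eq_square algebra_simps)
qed

context fk_kernel begin

text \<open>The image kernel solves the heat equation and is nonpositive beyond the mirror, which is all the
  discrete comparison needs.\<close>

lemma Top_half_space:
  fixes v :: 'a
  assumes v: "norm v = 1" and l: "l > 0" and e: "\<epsilon> < l" and d: "\<delta> > 0" and k: "k > 0"
    and [measurable]: "f \<in> borel_measurable borel" and supp: "\<And>y. f y \<noteq> 0 \<Longrightarrow> y \<bullet> v > l"
    and z: "z \<bullet> v > l"
  defines "L \<equiv> \<kappa> * l powr (- (2 + 2 * \<beta>))"
  shows "ennreal (exp (- L * (real k * \<delta>))) * Gop (real k * \<delta>) f z
     \<le> (Top \<epsilon> \<delta> ^^ k) f z + ennreal (exp (- L * (real k * \<delta>))) * (\<integral>\<^sup>+ y. ennreal (heat_q (real k * \<delta>) z (mirror v l y)) * f y \<partial>lborel)"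
  using k z
proof (induction k arbitrary: z rule: nat_induct_non_zero)
  have L0: "L \<ge> 0" using kappa by (simp add: L_def)
  \<comment> \<open>Beyond the hyperplane \<open>norm z\<close> exceeds \<open>l\<close>, so the
    potential is at most \<open>L\<close> there and the cut-off at radius
    \<open>\<epsilon> < l\<close> does not act.\<close>
  have cut: "ennreal (exp (- L * \<delta>)) \<le> cut \<epsilon> \<delta> z" if "z \<bullet> v > l" for z
  proof -
    have "l < norm z" using that Cauchy_Schwarz_ineq2[of z v] v by simp
    hence "pot z \<le> L" unfolding pot_def L_def using l kappa beta by (intro mult_left_mono powr_mono2') auto
    hence "L * \<delta> \<ge> \<delta> * pot z" using d by simp
    thus ?thesis using \<open>l < norm z\<close> e by (simp add: cut_def)
  qed
  {
    case 1
    have "ennreal (exp (- L * \<delta>)) * Gop \<delta> f z \<le> Top \<epsilon> \<delta> f z"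
      unfolding Top_def using 1 by (intro mult_right_mono cut) auto
    thus ?case by (simp add: add_increasing2)
  next
    case (Suc k)
    define c where "c = ennreal (exp (- L * (real k * \<delta>)))"
    define m where "m z = (\<integral>\<^sup>+ y. ennreal (heat_q (real k * \<delta>) z (mirror v l y)) * f y \<partial>lborel)" for z
    have [measurable]: "m \<in> borel_measurable borel" unfolding m_def[abs_def] by measurable
    define u where "u = (Top \<epsilon> \<delta> ^^ k) f"
    have [measurable]: "u \<in> borel_measurable borel" unfolding u_def by measurable
    have kd: "real k * \<delta> > 0" using Suc d by simp
    have pw: "c * Gop (real k * \<delta>) f w \<le> u w + c * m w" for w
    proof (cases "w \<bullet> v > l")
      case True
      thus ?thesis using Suc unfolding c_def u_def m_def by blast
    next
      case False
      have "Gop (real k * \<delta>) f w \<le> m w" unfolding Gop_def m_def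
      proof (rule nn_integral_mono)
        fix y
        show "ennreal (heat_q (real k * \<delta>) w y) * f y \<le> ennreal (heat_q (real k * \<delta>) w (mirror v l y)) * f y"
        proof (cases "f y = 0")
          case nz: False
          have "4 * (y \<bullet> v - l) * (w \<bullet> v - l) \<le> 0" using supp[OF nz] False by (intro mult_nonneg_nonpos) auto
          hence "(norm (w - mirror v l y))\<^sup>2 \<le> (norm (w - y))\<^sup>2" by (simp add: norm_mirror[OF v])
          hence "heat_q (real k * \<delta>) w y \<le> heat_q (real k * \<delta>) w (mirror v l y)"
            unfolding heat_q_def using kd by (intro mult_left_mono) (auto intro!: divide_right_mono)
          thus ?thesis by (intro mult_right_mono ennreal_leI) auto
        qed simp
      qed
      hence "c * Gop (real k * \<delta>) f w \<le> c * m w" by (intro mult_left_mono) auto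
      thus ?thesis by (simp add: add_increasing)
    qed
    have split: "real (Suc k) * \<delta> = \<delta> + real k * \<delta>" by (simp add: algebra_simps)
    have "c * Gop (real (Suc k) * \<delta>) f z = Gop \<delta> (\<lambda>w. c * Gop (real k * \<delta>) f w) z"
      unfolding split by (simp add: Gop_cmult Gop_Gop[OF d kd])
    also have "\<dots> \<le> Gop \<delta> (\<lambda>w. u w + c * m w) z" by (intro Gop_mono pw)
    also have "\<dots> = Gop \<delta> u z + c * (\<integral>\<^sup>+ y. ennreal (heat_q (real (Suc k) * \<delta>) z (mirror v l y)) * f y \<partial>lborel)"
      unfolding split m_def by (simp add: Gop_add Gop_cmult Gop_heat_kernel[OF d kd])
    finally have "ennreal (exp (- L * \<delta>)) * (c * Gop (real (Suc k) * \<delta>) f z)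
       \<le> ennreal (exp (- L * \<delta>)) * (Gop \<delta> u z + c * (\<integral>\<^sup>+ y. ennreal (heat_q (real (Suc k) * \<delta>) z (mirror v l y)) * f y \<partial>lborel))"
      by (intro mult_left_mono) auto
    also have "\<dots> \<le> Top \<epsilon> \<delta> u z + ennreal (exp (- L * \<delta>)) * c * (\<integral>\<^sup>+ y. ennreal (heat_q (real (Suc k) * \<delta>) z (mirror v l y)) * f y \<partial>lborel)"
      unfolding distrib_left Top_def mult.assoc using Suc by (intro add_mono mult_right_mono cut) auto
    finally have *: "ennreal (exp (- L * \<delta>)) * c * Gop (real (Suc k) * \<delta>) f z \<le> Top \<epsilon> \<delta> u z + ennreal (exp (- L * \<delta>)) * c * (\<integral>\<^sup>+ y. ennreal (heat_q (real (Suc k) * \<delta>) z (mirror v l y)) * f y \<partial>lborel)"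
      by (simp add: mult.assoc)
    have "ennreal (exp (- L * \<delta>)) * c = ennreal (exp (- L * (real (Suc k) * \<delta>)))"
      unfolding c_def split by (simp add: ennreal_mult[symmetric] exp_add[symmetric] algebra_simps)
    with * show ?case by (simp add: u_def)
  }
qed

text \<open>The first factor is the largest possible loss by killing inside the half-space. The
  other two form its Dirichlet heat kernel, since the image kernel equals
  \<open>heat_q t x y\<close> times the exponential shown. Ball averages are turned into point
  values by continuity.\<close>

lemma pp_half_space:
  fixes v :: 'a
  assumes v: "norm v = 1" and l: "l > 0" and t: "t > 0" and x: "x \<bullet> v > l" and y: "y \<bullet> v > l"
  shows "exp (- \<kappa> * l powr (- (2 + 2 * \<beta>)) * t) * (1 - exp (- (y \<bullet> v - l) * (x \<bullet> v - l) / t)) * heat_q t x y \<le> pp t x y"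
proof -
  define E where "E = exp (- (\<kappa> * l powr (- (2 + 2 * \<beta>))) * t)"
  let ?S = "{y. y \<bullet> v > l}"
  have S: "open ?S" using open_halfspace_gt[of l v] by (simp add: inner_commute)
  have S0: "?S \<subseteq> - {0}" using l by auto
  have x0: "x \<noteq> 0" using x l by auto
  have E: "E > 0" by (simp add: E_def)
  have "E * heat_q t x y \<le> pp t x y + E * heat_q t x (mirror v l y)"
  proof (rule continuous_le_if_nn_integral_le[OF S, where g = "\<lambda>y. E * heat_q t x y" and h = "\<lambda>y. pp t x y + E * heat_q t x (mirror v l y)"])
    show "continuous_on ?S (\<lambda>y. E * heat_q t x y)" by (intro continuous_intros)
    show "continuous_on ?S (\<lambda>y. pp t x y + E * heat_q t x (mirror v l y))"
      unfolding mirror_def by (intro continuous_intros continuous_on_subset[OF continuous_on_pp(1)[OF t x0] S0])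
    show "y \<in> ?S" using y by simp
  next
    fix z :: 'a and r assume B: "cball z r \<subseteq> ?S"
    define f :: "'a \<Rightarrow> ennreal" where "f = indicator (cball z r)"
    have fm [measurable]: "f \<in> borel_measurable borel" by (simp add: f_def)
    have supp: "u \<bullet> v > l" if "f u \<noteq> 0" for u
      using that B by (auto simp: f_def indicator_def split: if_splits)
    define c where "c = ennreal E * (\<integral>\<^sup>+ y. ennreal (heat_q t x (mirror v l y)) * f y \<partial>lborel)"
    have "(\<integral>\<^sup>+ y. ennreal (heat_q t x (mirror v l y)) * f y \<partial>lborel) \<le> (\<integral>\<^sup>+ y. ennreal ((4 * pi * t) powr (- real DIM('a) / 2)) * f y \<partial>lborel)"
      using t by (intro nn_integral_mono mult_right_mono ennreal_leI heat_q_le) auto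
    also have "\<dots> < \<top>" unfolding f_def
      using emeasure_lborel_cball_finite[of z r] by (subst nn_integral_cmult) (auto simp: nn_integral_indicator_cball ennreal_mult_less_top)
    finally have c: "c < \<top>" unfolding c_def by (auto simp: ennreal_mult_less_top)
    \<comment> \<open>The finite image term \<open>c\<close> does not depend on \<open>n\<close>;
      moved to the left, it lets the limit concern the iterate alone.\<close>
    have "ennreal E * Gop t f x - c \<le> limsup (\<lambda>n. (Top (l / 2) (t / real n) ^^ n) f x)"
    proof (rule order_trans)
      show "liminf (\<lambda>n. (Top (l / 2) (t / real n) ^^ n) f x) \<le> limsup (\<lambda>n. (Top (l / 2) (t / real n) ^^ n) f x)"
        by (intro Liminf_le_Limsup) auto
      show "ennreal E * Gop t f x - c \<le> liminf (\<lambda>n. (Top (l / 2) (t / real n) ^^ n) f x)"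
      proof (rule Liminf_bounded)
        show "\<forall>\<^sub>F n in sequentially. ennreal E * Gop t f x - c \<le> (Top (l / 2) (t / real n) ^^ n) f x"
          using eventually_gt_at_top[of 0]
        proof eventually_elim
          case (elim n)
          have tn: "t / real n > 0" "real n * (t / real n) = t" using elim t by auto
          have "ennreal E * Gop t f x \<le> (Top (l / 2) (t / real n) ^^ n) f x + c"
            using Top_half_space[OF v l _ tn(1) elim fm supp x, of "l / 2"] l
            unfolding tn(2) E_def c_def by simp
          thus ?case using c by (subst ennreal_minus_le_iff) (auto simp: add.commute)
        qed
      qed
    qed
    also have "\<dots> \<le> P t f x"
      by (rule limsup_le_P[where g = "\<lambda>_. f" and K = 1]) (use t l in \<open>auto simp: Limsup_const f_def indicator_le_1_ennreal\<close>)
    also have "\<dots> = K t f x" using t by (simp add: P_eq_K')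
    finally have *: "ennreal E * Gop t f x \<le> K t f x + c" using c by (subst (asm) ennreal_minus_le_iff) (auto simp: add.commute)
    note pp_measurable_snd[OF t, measurable]
    have "(\<integral>\<^sup>+ y. ennreal (E * heat_q t x y) * f y \<partial>lborel) = ennreal E * Gop t f x"
      unfolding Gop_def using E by (subst nn_integral_cmult[symmetric]) (auto simp: ennreal_mult mult.assoc)
    also have "\<dots> \<le> K t f x + c" by (rule *)
    also have "\<dots> = (\<integral>\<^sup>+ y. ennreal (pp t x y + E * heat_q t x (mirror v l y)) * f y \<partial>lborel)"
      unfolding K_def c_def using E
      by (subst nn_integral_cmult[symmetric]; (subst nn_integral_add[symmetric])?) (auto simp: ennreal_mult mult.assoc distrib_right)
    finally show "(\<integral>\<^sup>+ y. ennreal (E * heat_q t x y) * indicator (cball z r) y \<partial>lborel)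
      \<le> (\<integral>\<^sup>+ y. ennreal (pp t x y + E * heat_q t x (mirror v l y)) * indicator (cball z r) y \<partial>lborel)"
      unfolding f_def .
  qed (use E in auto)
  moreover have "heat_q t x (mirror v l y) = exp (- (y \<bullet> v - l) * (x \<bullet> v - l) / t) * heat_q t x y"
  proof -
    have eq: "- (norm (x - mirror v l y))\<^sup>2 / (4 * t) = - (y \<bullet> v - l) * (x \<bullet> v - l) / t + - (norm (x - y))\<^sup>2 / (4 * t)"
      unfolding norm_mirror[OF v] using t by (simp add: field_simps)
    show ?thesis unfolding heat_q_def eq exp_add by simp
  qed
  ultimately show ?thesis by (simp add: E_def algebra_simps)
qed

text \<open>On a line a continuous path from \<open>x\<close> to the side where
  \<open>x \<bullet> y < 0\<close> has a zero of \<open>x \<bullet> W s\<close> by the intermediate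
  value theorem, and in dimension one this is a visit to the origin, hence killing.\<close>

lemma pp_opposite:
  assumes D: "DIM('a) = 1" and t: "t > 0" and xy: "x \<bullet> y < 0"
  shows "pp t x y = 0"
proof -
  have x0: "x \<noteq> 0" using xy by auto
  have zero: "v = 0" if "x \<bullet> v = 0" for v
  proof -
    obtain b where b: "(Basis :: 'a set) = {b}" using D by (metis card_1_singletonE)
    have "x \<bullet> v = (x \<bullet> b) * (v \<bullet> b)" "x = (x \<bullet> b) *\<^sub>R b" "v = (v \<bullet> b) *\<^sub>R b"
      using euclidean_inner[of x v] euclidean_representation[of x] euclidean_representation[of v] unfolding b by simp_all
    with that x0 show ?thesis by (metis mult_eq_0_iff scaleR_zero_left)
  qed
  let ?S = "{y. x \<bullet> y < 0}"
  have "pp t x y \<le> 0"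
  proof (rule continuous_le_if_nn_integral_le[of ?S "\<lambda>y. pp t x y" "\<lambda>_. 0"])
    show "open ?S" by (rule open_halfspace_lt)
    show "continuous_on ?S (\<lambda>y. pp t x y)" by (rule continuous_on_subset[OF continuous_on_pp(1)[OF t x0]]) auto
    show "y \<in> ?S" using xy by simp
  next
    fix z :: 'a and r assume B: "cball z r \<subseteq> ?S"
    have "K t (indicator (cball z r)) x = P t (indicator (cball z r)) x" using t by (simp add: P_eq_K')
    also have "\<dots> = (\<integral>\<^sup>+ \<omega>. 0 \<partial>M x)"
      unfolding fk_semigroup_def
    proof (rule nn_integral_cong)
      fix \<omega> assume w: "\<omega> \<in> space (M x)"
      have "\<not> ereal t < exit_time W \<omega>" if "W t \<omega> \<in> cball z r"
      proof
        assume ex: "ereal t < exit_time W \<omega>"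
        have "continuous_on {0..t} (\<lambda>s. x \<bullet> W s \<omega>)"
          using BM_continuous[OF w] by (intro continuous_intros) (auto intro: continuous_on_subset)
        moreover have "x \<bullet> W 0 \<omega> \<ge> 0" by (simp add: BM_start[OF w])
        moreover have "x \<bullet> W t \<omega> \<le> 0" using that B by auto
        ultimately obtain s where "0 \<le> s" "s \<le> t" "x \<bullet> W s \<omega> = 0"
          using IVT2'[of "\<lambda>s. x \<bullet> W s \<omega>" t 0 0] t by auto
        thus False using less_exit_timeD[OF ex] zero by blast
      qed
      thus "fk_weight W \<beta> \<kappa> t \<omega> * indicator {\<omega>. ereal t < exit_time W \<omega>} \<omega> * indicator (cball z r) (W t \<omega>) = 0"
        by (auto simp: indicator_def)
    qed
    finally show "(\<integral>\<^sup>+ v. ennreal (pp t x v) * indicator (cball z r) v \<partial>lborel) \<le> (\<integral>\<^sup>+ v. ennreal 0 * indicator (cball z r) v \<partial>lborel)"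
      by (simp add: K_def)
  qed auto
  thus ?thesis using pp_nonneg[of t x y] by linarith
qed

end

section \<open>Macdonald functions\<close>

lemma powr_le_exp:
  fixes s b :: real assumes s: "s > 0" and b: "b \<ge> 0"
  obtains C where "C > 0" "\<And>x. x > 0 \<Longrightarrow> x powr b \<le> C * exp (s * x)"
proof
  define n where "n = nat \<lceil>b\<rceil>"
  have n: "real n \<ge> b" unfolding n_def by linarith
  show "1 + fact n / s ^ n > (0::real)" using s by (intro add_pos_nonneg) auto
  fix x :: real assume x: "x > 0"
  have "x powr b \<le> 1 + x ^ n"
  proof (cases "x \<ge> 1")
    case True
    hence "x powr b \<le> x powr real n" using n by (intro powr_mono) auto
    thus ?thesis using x by (simp add: powr_realpow)
  next
    case False
    hence "x powr b \<le> 1" using b x by (intro powr_le1) auto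
    thus ?thesis using x by (smt (verit) zero_le_power)
  qed
  also have "x ^ n \<le> fact n / s ^ n * exp (s * x)"
  proof -
    have "(\<Sum>k\<in>{n}. (s * x) ^ k / fact k) \<le> (\<Sum>k. (s * x) ^ k / fact k)"
      using summable_exp[of "s * x"] x s by (intro sum_le_suminf) (auto simp: divide_inverse mult.commute)
    hence "(s * x) ^ n / fact n \<le> exp (s * x)" by (simp add: exp_def divide_inverse mult.commute)
    thus ?thesis using s by (simp add: field_simps)
  qed
  also have "1 \<le> exp (s * x)" using s x by simp
  finally show "x powr b \<le> (1 + fact n / s ^ n) * exp (s * x)" by (simp add: distrib_right)
qed

definition bessel_kernel :: "real \<Rightarrow> real \<Rightarrow> real \<Rightarrow> real" where
  "bessel_kernel a w \<tau> = (if \<tau> > 0 then exp (- \<tau> - w / \<tau>) * \<tau> powr (a - 1) else 0)"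

text \<open>\<open>bessel_I a w\<close> is \<open>2 w\<^bsup>a/2\<^esup> K\<^sub>a(2 \<surd>w)\<close> in terms of the Macdonald function.\<close>

definition bessel_I :: "real \<Rightarrow> real \<Rightarrow> real" where
  "bessel_I a w = (\<integral>\<tau>. bessel_kernel a w \<tau> \<partial>lborel)"

lemma bessel_kernel_nonneg [simp]: "bessel_kernel a w \<tau> \<ge> 0"
  by (simp add: bessel_kernel_def)

lemma bessel_kernel_measurable [measurable]: "bessel_kernel a w \<in> borel_measurable borel"
  unfolding bessel_kernel_def[abs_def] by measurable

lemma integrable_exp_decay:
  assumes c: "c > 0" shows "integrable lborel (\<lambda>\<tau>::real. if \<tau> > 0 then exp (- c * \<tau>) else 0)"
proof -
  have "(\<integral>\<^sup>+ \<tau>. ennreal (exp (- c * \<tau>)) * indicator {0..} \<tau> \<partial>lborel) = ennreal (0 - (- exp (- c * 0) / c))"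
  proof (rule nn_integral_FTC_atLeast)
    fix \<tau> :: real
    show "((\<lambda>\<tau>. - exp (- c * \<tau>) / c) has_real_derivative exp (- c * \<tau>)) (at \<tau>)"
      using c by (auto intro!: derivative_eq_intros)
    show "((\<lambda>\<tau>. - exp (- c * \<tau>) / c) \<longlongrightarrow> 0) at_top" using c by real_asymp
  qed auto
  hence fin: "(\<integral>\<^sup>+ \<tau>. ennreal (exp (- c * \<tau>)) * indicator {0..} \<tau> \<partial>lborel) < \<infinity>" by simp
  show ?thesis
  proof (rule integrableI_nonneg)
    have "(\<integral>\<^sup>+ \<tau>. ennreal (if \<tau> > 0 then exp (- c * \<tau>) else 0) \<partial>lborel) \<le> (\<integral>\<^sup>+ \<tau>. ennreal (exp (- c * \<tau>)) * indicator {0..} \<tau> \<partial>lborel)"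
      by (intro nn_integral_mono) (auto simp: indicator_def)
    thus "(\<integral>\<^sup>+ \<tau>. ennreal (if \<tau> > 0 then exp (- c * \<tau>) else 0) \<partial>lborel) < \<infinity>" using fin by (rule order.strict_trans1)
  qed auto
qed

text \<open>For \<open>a \<ge> 1\<close> half of \<open>exp (- \<tau>)\<close> absorbs the power at
  infinity; for \<open>a < 1\<close> the factor \<open>exp (- w / \<tau>)\<close> absorbs the
  singularity at 0.\<close>

lemma bessel_kernel_bound:
  fixes a w :: real
  assumes w: "w > 0"
  obtains C where "C > 0" "\<And>\<tau>. \<tau> > 0 \<Longrightarrow> exp (- \<tau> - w / \<tau>) * \<tau> powr (a - 1) \<le> C * exp (- \<tau> / 2)"
proof -
  obtain C1 where C1: "C1 > 0" "\<And>x. x > 0 \<Longrightarrow> x powr \<bar>a - 1\<bar> \<le> C1 * exp (1 / 2 * x)" by (rule powr_le_exp[of "1 / 2" "\<bar>a - 1\<bar>"]) auto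
  obtain C2 where C2: "C2 > 0" "\<And>x. x > 0 \<Longrightarrow> x powr \<bar>a - 1\<bar> \<le> C2 * exp (w * x)" by (rule powr_le_exp[of w "\<bar>a - 1\<bar>"]) (use w in auto)
  show thesis
  proof (rule that[of "C1 + C2"])
    fix \<tau> :: real assume t: "\<tau> > 0"
    show "exp (- \<tau> - w / \<tau>) * \<tau> powr (a - 1) \<le> (C1 + C2) * exp (- \<tau> / 2)"
    proof (cases "a \<ge> 1")
      case True
      have "exp (- \<tau> - w / \<tau>) * \<tau> powr (a - 1) \<le> exp (- \<tau>) * (C1 * exp (1 / 2 * \<tau>))"
        using C1(2)[OF t] True t w by (intro mult_mono) auto
      also have "\<dots> = C1 * exp (- \<tau> / 2)" by (simp add: exp_add[symmetric])
      also have "\<dots> \<le> (C1 + C2) * exp (- \<tau> / 2)" using C2 by (intro mult_right_mono) auto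
      finally show ?thesis .
    next
      case False
      have e: "\<tau> powr (a - 1) = (1 / \<tau>) powr \<bar>a - 1\<bar>"
        using False t by (simp add: powr_minus_divide[symmetric] powr_divide powr_minus)
      have "exp (- \<tau> - w / \<tau>) * \<tau> powr (a - 1) \<le> exp (- \<tau> - w / \<tau>) * (C2 * exp (w * (1 / \<tau>)))"
        unfolding e using C2(2)[of "1 / \<tau>"] t by (intro mult_left_mono) auto
      also have "\<dots> = C2 * exp (- \<tau>)" by (simp add: exp_add[symmetric])
      also have "\<dots> \<le> (C1 + C2) * exp (- \<tau> / 2)" using C1 C2 t by (intro mult_mono) auto
      finally show ?thesis .
    qed
  qed (use C1 C2 in auto)
qed

lemma bessel_kernel_integrable: "w > 0 \<Longrightarrow> integrable lborel (bessel_kernel a w)"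
proof -
  assume w: "w > 0"
  obtain C where C: "C > 0" "\<And>\<tau>. \<tau> > 0 \<Longrightarrow> exp (- \<tau> - w / \<tau>) * \<tau> powr (a - 1) \<le> C * exp (- \<tau> / 2)"
    using bessel_kernel_bound[OF w, of a] by metis
  show ?thesis
  proof (rule Bochner_Integration.integrable_bound)
    show "integrable lborel (\<lambda>\<tau>::real. C * (if \<tau> > 0 then exp (- (1 / 2) * \<tau>) else 0))"
      by (intro integrable_mult_right integrable_exp_decay) auto
    show "AE \<tau> in lborel. norm (bessel_kernel a w \<tau>) \<le> norm (C * (if \<tau> > 0 then exp (- (1 / 2) * \<tau>) else 0))"
      using C by (intro AE_I2) (auto simp: bessel_kernel_def)
  qed measurable
qed

lemma bessel_I_nonneg: "bessel_I a w \<ge> 0"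
  unfolding bessel_I_def by (intro integral_nonneg_AE) auto

text \<open>Convexity of \<open>w \<mapsto> exp (- w / \<tau>)\<close> squeezes the difference quotient.\<close>

lemma bessel_I_diff:
  assumes "0 < w" "w \<le> w'"
  shows "(w' - w) * bessel_I (a - 1) w' \<le> bessel_I a w - bessel_I a w'"
    and "bessel_I a w - bessel_I a w' \<le> (w' - w) * bessel_I (a - 1) w"
proof -
  have w': "w' > 0" using assms by simp
  have p: "\<tau> powr (a - 1) = \<tau> * \<tau> powr (a - 1 - 1)" if "\<tau> > 0" for \<tau>
    using that powr_mult_base[of \<tau> "a - 2"] by simp
  have k: "(w' - w) * bessel_kernel (a - 1) w' \<tau> \<le> bessel_kernel a w \<tau> - bessel_kernel a w' \<tau>"
    "bessel_kernel a w \<tau> - bessel_kernel a w' \<tau> \<le> (w' - w) * bessel_kernel (a - 1) w \<tau>" for \<tau>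
  proof -
    have "(w' - w) * bessel_kernel (a - 1) w' \<tau> \<le> bessel_kernel a w \<tau> - bessel_kernel a w' \<tau> \<and>
     bessel_kernel a w \<tau> - bessel_kernel a w' \<tau> \<le> (w' - w) * bessel_kernel (a - 1) w \<tau>"
    proof (cases "\<tau> > 0")
      case True
      define u where "u = (w' - w) / \<tau>"
      define E where "E = exp (- \<tau> - w' / \<tau>) * \<tau> powr (a - 1 - 1)"
      have E: "E \<ge> 0" by (simp add: E_def)
      have ww: "exp (- \<tau> - w / \<tau>) = exp (- \<tau> - w' / \<tau>) * exp u"
        by (simp add: exp_add[symmetric] u_def diff_divide_distrib)
      have b: "bessel_kernel a w' \<tau> = E * \<tau>" "bessel_kernel a w \<tau> = E * exp u * \<tau>"
        "bessel_kernel (a - 1) w' \<tau> = E" "bessel_kernel (a - 1) w \<tau> = E * exp u"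
        using True p[OF True] ww by (simp_all add: bessel_kernel_def E_def)
      have ut: "w' - w = u * \<tau>" using True by (simp add: u_def)
      have "u \<le> exp u - 1" using exp_ge_add_one_self[of u] by linarith
      hence "E * \<tau> * u \<le> E * \<tau> * (exp u - 1)" using E True by (intro mult_left_mono) auto
      moreover have "exp u - 1 \<le> u * exp u"
        using exp_ge_add_one_self[of "- u"] mult_left_mono[of "1 + - u" "exp (- u)" "exp u"] by (simp add: exp_minus algebra_simps)
      hence "E * \<tau> * (exp u - 1) \<le> E * \<tau> * (u * exp u)" using E True by (intro mult_left_mono) auto
      ultimately show ?thesis unfolding b ut by (simp add: algebra_simps)
    qed (auto simp: bessel_kernel_def)
    thus "(w' - w) * bessel_kernel (a - 1) w' \<tau> \<le> bessel_kernel a w \<tau> - bessel_kernel a w' \<tau>"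
     "bessel_kernel a w \<tau> - bessel_kernel a w' \<tau> \<le> (w' - w) * bessel_kernel (a - 1) w \<tau>" by auto
  qed
  note i = bessel_kernel_integrable[OF assms(1)] bessel_kernel_integrable[OF w']
  have d: "bessel_I a w - bessel_I a w' = (\<integral>\<tau>. bessel_kernel a w \<tau> - bessel_kernel a w' \<tau> \<partial>lborel)"
    unfolding bessel_I_def by (subst Bochner_Integration.integral_diff) (auto intro: i)
  show "(w' - w) * bessel_I (a - 1) w' \<le> bessel_I a w - bessel_I a w'"
    unfolding d unfolding bessel_I_def integral_mult_right_zero[symmetric]
    by (intro Bochner_Integration.integral_mono k integrable_mult_right Bochner_Integration.integrable_diff i)
  show "bessel_I a w - bessel_I a w' \<le> (w' - w) * bessel_I (a - 1) w"
    unfolding d unfolding bessel_I_def integral_mult_right_zero[symmetric]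
    by (intro Bochner_Integration.integral_mono k integrable_mult_right Bochner_Integration.integrable_diff i)
qed

lemma bessel_I_antimono: "0 < w \<Longrightarrow> w \<le> w' \<Longrightarrow> bessel_I a w' \<le> bessel_I a w"
  using bessel_I_diff(1)[of w w' a] bessel_I_nonneg[of "a - 1" w'] by (smt (verit) mult_nonneg_nonneg)

text \<open>Local Lipschitz continuity: near \<open>w\<close> the slopes are bounded by
  \<open>bessel_I (a - 1) (w / 2)\<close>.\<close>

lemma bessel_I_continuous: "continuous_on {0<..} (bessel_I a)"
proof -
  have "isCont (bessel_I a) w" if w: "w > 0" for w
    unfolding isCont_def
  proof (rule LIM_zero_cancel, rule Lim_null_comparison)
    define C where "C = bessel_I (a - 1) (w / 2)"
    show "((\<lambda>v. C * \<bar>v - w\<bar>) \<longlongrightarrow> 0) (at w)" by (rule tendsto_eq_intros refl | simp)+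
    have "\<forall>\<^sub>F v in at w. v > w / 2" using w by (intro order_tendstoD[OF tendsto_ident_at]) auto
    thus "\<forall>\<^sub>F v in at w. norm (bessel_I a v - bessel_I a w) \<le> C * \<bar>v - w\<bar>"
    proof eventually_elim
      case (elim v)
      have *: "\<bar>bessel_I a u' - bessel_I a u\<bar> \<le> C * (u' - u)" if "w / 2 < u" "u \<le> u'" for u u'
      proof -
        have "u > 0" using that w by linarith
        have "bessel_I (a - 1) u \<le> C" unfolding C_def using that w by (intro bessel_I_antimono) auto
        hence "(u' - u) * bessel_I (a - 1) u \<le> (u' - u) * C" using that by (intro mult_left_mono) auto
        with bessel_I_diff(2)[OF \<open>u > 0\<close> that(2), of a] bessel_I_antimono[OF \<open>u > 0\<close> that(2), of a] show ?thesis by (simp add: mult.commute)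
      qed
      show ?case using *[of v w] *[of w v] elim w by (cases "v \<le> w") (auto simp: abs_minus_commute)
    qed
  qed
  thus ?thesis by (auto intro!: continuous_at_imp_continuous_on)
qed

text \<open>Difference quotients lie between the values of \<open>- bessel_I (a - 1)\<close> at the
  two end points, and continuity of that function closes the gap.\<close>

lemma bessel_I_DERIV:
  assumes w: "w > 0"
  shows "(bessel_I a has_real_derivative - bessel_I (a - 1) w) (at w)"
proof -
  have c: "isCont (bessel_I (a - 1)) w" using bessel_I_continuous[of "a - 1"] w by (auto simp: continuous_on_eq_continuous_at open_greaterThan)
  have "((\<lambda>v. (bessel_I a v - bessel_I a w) / (v - w)) \<longlongrightarrow> - bessel_I (a - 1) w) (at w)"
  proof (rule tendsto_sandwich)
    have "\<forall>\<^sub>F v in at w. v > 0 \<and> v \<noteq> w" using w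
      by (intro eventually_conj order_tendstoD[OF tendsto_ident_at]) (auto simp: eventually_at_filter)
    hence "\<forall>\<^sub>F v in at w. - max (bessel_I (a - 1) v) (bessel_I (a - 1) w) \<le> (bessel_I a v - bessel_I a w) / (v - w)
       \<and> (bessel_I a v - bessel_I a w) / (v - w) \<le> - min (bessel_I (a - 1) v) (bessel_I (a - 1) w)"
    proof eventually_elim
      case (elim v)
      show ?case
      proof (cases "v < w")
        case True
        have "(bessel_I a v - bessel_I a w) / (v - w) = - ((bessel_I a v - bessel_I a w) / (w - v))"
          using True by (simp add: field_simps)
        moreover have "bessel_I (a - 1) w \<le> (bessel_I a v - bessel_I a w) / (w - v)" "(bessel_I a v - bessel_I a w) / (w - v) \<le> bessel_I (a - 1) v"
          using bessel_I_diff[of v w a] elim True by (auto simp: field_simps)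
        ultimately show ?thesis by (simp add: min_le_iff_disj le_max_iff_disj)
      next
        case False
        hence vw: "w < v" using elim by auto
        have "(bessel_I a v - bessel_I a w) / (v - w) = - ((bessel_I a w - bessel_I a v) / (v - w))"
          using vw by (simp add: field_simps)
        moreover have "bessel_I (a - 1) v \<le> (bessel_I a w - bessel_I a v) / (v - w)" "(bessel_I a w - bessel_I a v) / (v - w) \<le> bessel_I (a - 1) w"
          using bessel_I_diff[of w v a] w vw by (auto simp: field_simps)
        ultimately show ?thesis by (simp add: min_le_iff_disj le_max_iff_disj)
      qed
    qed
    thus "\<forall>\<^sub>F v in at w. - max (bessel_I (a - 1) v) (bessel_I (a - 1) w) \<le> (bessel_I a v - bessel_I a w) / (v - w)"
      "\<forall>\<^sub>F v in at w. (bessel_I a v - bessel_I a w) / (v - w) \<le> - min (bessel_I (a - 1) v) (bessel_I (a - 1) w)"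
      by (auto elim: eventually_mono)
    have "((\<lambda>v. - max (bessel_I (a - 1) v) (bessel_I (a - 1) w)) \<longlongrightarrow> - max (bessel_I (a - 1) w) (bessel_I (a - 1) w)) (at w)"
      using c unfolding isCont_def by (intro tendsto_intros)
    thus "((\<lambda>v. - max (bessel_I (a - 1) v) (bessel_I (a - 1) w)) \<longlongrightarrow> - bessel_I (a - 1) w) (at w)" by simp
    have "((\<lambda>v. - min (bessel_I (a - 1) v) (bessel_I (a - 1) w)) \<longlongrightarrow> - min (bessel_I (a - 1) w) (bessel_I (a - 1) w)) (at w)"
      using c unfolding isCont_def by (intro tendsto_intros)
    thus "((\<lambda>v. - min (bessel_I (a - 1) v) (bessel_I (a - 1) w)) \<longlongrightarrow> - bessel_I (a - 1) w) (at w)" by simp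
  qed
  thus ?thesis by (simp add: has_field_derivative_iff)
qed

text \<open>The integrand \<open>?f\<close> is the derivative of
  \<open>exp (- \<tau> - w / \<tau>) * \<tau> powr (a - 1)\<close>, which vanishes at both ends of
  the half-line. This is the three-term recurrence of Macdonald functions, and the source of the
  differential equation for \<open>F0\<close>.\<close>

lemma bessel_I_recurrence:
  assumes w: "w > 0"
  shows "bessel_I a w = w * bessel_I (a - 2) w + (a - 1) * bessel_I (a - 1) w"
proof -
  let ?F = "\<lambda>\<tau>. exp (- \<tau> - w / \<tau>) * \<tau> powr (a - 1)"
  let ?f = "\<lambda>\<tau>. - bessel_kernel a w \<tau> + w * bessel_kernel (a - 2) w \<tau> + (a - 1) * bessel_kernel (a - 1) w \<tau>"
  have i: "integrable lborel ?f" by (intro Bochner_Integration.integrable_add integrable_mult_right Bochner_Integration.integrable_minus bessel_kernel_integrable w)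
  have "(LBINT \<tau>=ereal 0..\<infinity>. ?f \<tau>) = 0 - 0"
  proof (rule interval_integral_FTC_integrable[where F = ?F])
    fix \<tau> assume "ereal 0 < ereal \<tau>"
    hence t: "\<tau> > 0" by simp
    have p: "\<tau> powr (a - 1) = \<tau> * \<tau> powr (a - 2)" "\<tau> powr (a - 2) = \<tau> * \<tau> powr (a - 3)"
      using t powr_mult_base[of \<tau> "a - 2"] powr_mult_base[of \<tau> "a - 3"] by simp_all
    have "(?F has_real_derivative ?f \<tau>) (at \<tau>)"
      using t by (auto intro!: derivative_eq_intros simp: bessel_kernel_def p power2_eq_square field_simps)
    thus "(?F has_vector_derivative ?f \<tau>) (at \<tau>)" by (simp add: has_real_derivative_iff_has_vector_derivative)
    have "isCont (\<lambda>\<tau>. - (exp (- \<tau> - w / \<tau>) * \<tau> powr (a - 1)) + w * (exp (- \<tau> - w / \<tau>) * \<tau> powr (a - 2 - 1)) + (a - 1) * (exp (- \<tau> - w / \<tau>) * \<tau> powr (a - 1 - 1))) \<tau>"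
      using t by (intro continuous_intros) auto
    moreover have "\<forall>\<^sub>F s in nhds \<tau>. ?f s = - (exp (- s - w / s) * s powr (a - 1)) + w * (exp (- s - w / s) * s powr (a - 2 - 1)) + (a - 1) * (exp (- s - w / s) * s powr (a - 1 - 1))"
    proof (rule eventually_mono[OF eventually_nhds_in_open[of "{0<..}"]])
    qed (use t in \<open>auto simp: bessel_kernel_def\<close>)
    ultimately show "isCont ?f \<tau>" using isCont_cong by fast
  next
    show "set_integrable lborel (einterval (ereal 0) \<infinity>) ?f"
      unfolding set_integrable_def using i by (intro integrable_mult_indicator) auto
    have "((\<lambda>\<tau>. exp (- \<tau> - w / \<tau>) * \<tau> powr (a - 1)) \<longlongrightarrow> 0) (at_right 0)" using w by real_asymp
    thus "((?F \<circ> real_of_ereal) \<longlongrightarrow> 0) (at_right (ereal 0))" by (simp add: ereal_tendsto_simps)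
    have "((\<lambda>\<tau>. exp (- \<tau> - w / \<tau>) * \<tau> powr (a - 1)) \<longlongrightarrow> 0) at_top" using w by real_asymp
    thus "((?F \<circ> real_of_ereal) \<longlongrightarrow> 0) (at_left \<infinity>)" by (simp add: ereal_tendsto_simps)
  qed auto
  also have "(LBINT \<tau>=ereal 0..\<infinity>. ?f \<tau>) = (\<integral>\<tau>. ?f \<tau> \<partial>lborel)"
    unfolding interval_lebesgue_integral_def set_lebesgue_integral_def
    by (simp add: zero_ereal_def[symmetric]) (intro Bochner_Integration.integral_cong refl, auto simp: bessel_kernel_def indicator_def einterval_def)
  also have "\<dots> = - bessel_I a w + w * bessel_I (a - 2) w + (a - 1) * bessel_I (a - 1) w"
    unfolding bessel_I_def by (simp add: bessel_kernel_integrable[OF w])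
  finally show ?thesis by simp
qed

lemma bessel_kernel_bound':
  fixes a b w :: real
  assumes w: "w > 0" and b: "b > 0"
  obtains C where "C > 0" "\<And>\<tau>. \<tau> > 0 \<Longrightarrow> exp (- b * \<tau> - w / \<tau>) * \<tau> powr (a - 1) \<le> C * exp (- (b / 2) * \<tau>)"
proof -
  have "b * w > 0" using b w by simp
  then obtain C where C: "C > 0" "\<And>\<tau>. \<tau> > 0 \<Longrightarrow> exp (- \<tau> - (b * w) / \<tau>) * \<tau> powr (a - 1) \<le> C * exp (- \<tau> / 2)"
    using bessel_kernel_bound[of "b * w" a] by metis
  show thesis
  proof (rule that[of "C * b powr (1 - a)"])
    fix \<tau> :: real assume t: "\<tau> > 0"
    have "exp (- (b * \<tau>) - (b * w) / (b * \<tau>)) * (b * \<tau>) powr (a - 1) \<le> C * exp (- (b * \<tau>) / 2)"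
      using C(2)[of "b * \<tau>"] b t by simp
    hence "exp (- b * \<tau> - w / \<tau>) * (b powr (a - 1) * \<tau> powr (a - 1)) \<le> C * exp (- (b / 2) * \<tau>)"
      using b t by (simp add: powr_mult)
    hence "b powr (1 - a) * (exp (- b * \<tau> - w / \<tau>) * (b powr (a - 1) * \<tau> powr (a - 1))) \<le> b powr (1 - a) * (C * exp (- (b / 2) * \<tau>))"
      by (intro mult_left_mono) auto
    moreover have "b powr (1 - a) * b powr (a - 1) = 1" using b by (simp add: powr_add[symmetric])
    ultimately show "exp (- b * \<tau> - w / \<tau>) * \<tau> powr (a - 1) \<le> C * b powr (1 - a) * exp (- (b / 2) * \<tau>)"
      by (simp add: mult_ac) (metis mult.assoc mult.left_neutral)
  qed (use b C in auto)
qed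

text \<open>Laplace's method for \<open>w = s\<^sup>2\<close>: the exponent peaks at
  \<open>\<tau> = s\<close> with value \<open>- 2 * s\<close>.\<close>

lemma bessel_exponent: "\<tau> > 0 \<Longrightarrow> - \<tau> - s\<^sup>2 / \<tau> = - 2 * s - (\<tau> - s)\<^sup>2 / \<tau>" for s \<tau> :: real
  by (simp add: field_simps power2_eq_square)

text \<open>On the window from \<open>s\<close> to \<open>s + sqrt s\<close> the exponent loses at
  most 1 from its peak, and \<open>\<tau> / s\<close> stays between 1 and \<open>B\<close> because
  \<open>s \<ge> c\<close>. The length \<open>sqrt s\<close> of the window raises the power from
  \<open>a - 1\<close> to \<open>a - 1 / 2\<close>.\<close>

lemma bessel_I_lower:
  assumes c: "c > 0"
  obtains k where "k > 0" "\<And>s. s \<ge> c \<Longrightarrow> k * (s powr (a - 1 / 2) * exp (- 2 * s)) \<le> bessel_I a (s\<^sup>2)"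
proof -
  define B where "B = 1 + 1 / sqrt c"
  have B: "B > 1" using c by (simp add: B_def)
  define m where "m = min 1 (B powr (a - 1))"
  have m: "m > 0" using B by (simp add: m_def)
  show thesis
  proof (rule that[of "exp (- 1) * m"])
    fix s assume s: "s \<ge> c"
    have s0: "s > 0" using s c by simp
    define k0 where "k0 = exp (- 2 * s) * exp (- 1) * (m * s powr (a - 1))"
    have k0: "k0 \<ge> 0" using m by (simp add: k0_def)
    have le: "k0 * indicator {s..s + sqrt s} \<tau> \<le> bessel_kernel a (s\<^sup>2) \<tau>" for \<tau>
    proof (cases "\<tau> \<in> {s..s + sqrt s}")
      case True
      have t: "\<tau> > 0" "\<tau> \<ge> s" using True s0 by auto
      have "(\<tau> - s)\<^sup>2 \<le> (sqrt s)\<^sup>2" using True by (intro power_mono) auto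
      hence "(\<tau> - s)\<^sup>2 / \<tau> \<le> 1" using t s0 by (simp add: divide_le_eq)
      hence e: "exp (- 2 * s) * exp (- 1) \<le> exp (- \<tau> - s\<^sup>2 / \<tau>)"
        unfolding bessel_exponent[OF t(1)] by (simp add: exp_add[symmetric])
      have q: "\<tau> / s \<ge> 1" "\<tau> / s \<le> B"
      proof -
        show "\<tau> / s \<ge> 1" using t s0 by simp
        have "\<tau> / s \<le> (s + sqrt s) / s" using True s0 by (intro divide_right_mono) auto
        also have "\<dots> = 1 + 1 / sqrt s"
        proof -
          have "sqrt s / s = sqrt s / (sqrt s * sqrt s)" using s0 by simp
          also have "\<dots> = 1 / sqrt s" using s0 by (subst nonzero_divide_mult_cancel_left) auto
          finally show ?thesis using s0 by (simp add: add_divide_distrib)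
        qed
        also have "\<dots> \<le> B" unfolding B_def using s c by (intro add_mono divide_left_mono) auto
        finally show "\<tau> / s \<le> B" .
      qed
      have "m \<le> (\<tau> / s) powr (a - 1)"
      proof (cases "a \<ge> 1")
        case True
        thus ?thesis using q by (simp add: m_def min_le_iff_disj ge_one_powr_ge_zero)
      next
        case False
        hence "B powr (a - 1) \<le> (\<tau> / s) powr (a - 1)" using q by (intro powr_mono2') auto
        thus ?thesis by (simp add: m_def min_le_iff_disj)
      qed
      hence "m * s powr (a - 1) \<le> (\<tau> / s) powr (a - 1) * s powr (a - 1)" by (intro mult_right_mono) auto
      also have "\<dots> = \<tau> powr (a - 1)" using t s0 by (simp add: powr_divide)
      finally have "k0 \<le> exp (- \<tau> - s\<^sup>2 / \<tau>) * \<tau> powr (a - 1)" unfolding k0_def using e m by (intro mult_mono) auto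
      thus ?thesis using True t by (simp add: bessel_kernel_def)
    qed simp
    have "k0 * sqrt s = (\<integral>\<tau>. k0 * indicator {s..s + sqrt s} \<tau> \<partial>lborel)" using s0 by simp
    also have "\<dots> \<le> bessel_I a (s\<^sup>2)" unfolding bessel_I_def
      using s0 by (intro Bochner_Integration.integral_mono le bessel_kernel_integrable integrable_mult_right) auto
    also have "k0 * sqrt s = exp (- 1) * m * (s powr (a - 1 / 2) * exp (- 2 * s))"
    proof -
      have "s powr (a - 1) * sqrt s = s powr (a - 1 / 2)" using s0 by (simp add: powr_half_sqrt[symmetric] powr_add[symmetric])
      thus ?thesis by (simp add: k0_def mult_ac)
    qed
    finally show "exp (- 1) * m * (s powr (a - 1 / 2) * exp (- 2 * s)) \<le> bessel_I a (s\<^sup>2)" .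
  qed (use m in auto)
qed

text \<open>Off the window from \<open>s / 2\<close> to \<open>2 * s\<close> the product
  \<open>(2 * \<tau> - s) * (\<tau> - 2 * s)\<close> is nonnegative. The quadratic loss then pays
  for a factor \<open>exp (- s / 5)\<close> and leaves enough decay at 0 and infinity for
  integrability.\<close>

lemma bessel_exponent_far:
  assumes t: "\<tau> > 0" and s: "s > (0::real)" and far: "\<not> (s / 2 \<le> \<tau> \<and> \<tau> \<le> 2 * s)"
  shows "(\<tau> - s)\<^sup>2 / \<tau> \<ge> s / 5 + \<tau> / 10 + s\<^sup>2 / (10 * \<tau>)"
proof -
  have sq: "(\<tau> - s)\<^sup>2 \<ge> (\<tau>\<^sup>2 + s\<^sup>2) / 5"
  proof -
    have "0 \<le> (2 * \<tau> - s) * (\<tau> - 2 * s)" using far s t by (auto simp: zero_le_mult_iff)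
    hence "\<tau>\<^sup>2 + s\<^sup>2 \<le> 5 * (\<tau> - s)\<^sup>2" by (simp add: power2_eq_square algebra_simps)
    thus ?thesis by simp
  qed
  have "0 \<le> (\<tau> - s)\<^sup>2" by simp
  hence "(\<tau>\<^sup>2 + s\<^sup>2) / 5 \<ge> \<tau> * s / 5 + \<tau>\<^sup>2 / 10 + s\<^sup>2 / 10" by (simp add: power2_eq_square algebra_simps)
  hence "(\<tau> - s)\<^sup>2 / \<tau> \<ge> (\<tau> * s / 5 + \<tau>\<^sup>2 / 10 + s\<^sup>2 / 10) / \<tau>" using sq t by (intro divide_right_mono) auto
  also have "(\<tau> * s / 5 + \<tau>\<^sup>2 / 10 + s\<^sup>2 / 10) / \<tau> = s / 5 + \<tau> / 10 + s\<^sup>2 / (10 * \<tau>)" using t by (simp add: field_simps power2_eq_square)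
  finally show ?thesis .
qed

text \<open>Between \<open>s / 2\<close> and \<open>2 * s\<close> the integrand is dominated by a
  normal density with mean and variance \<open>s\<close>, whose normalisation supplies
  \<open>sqrt s\<close>. The remainder carries the extra factor \<open>exp (- s / 5)\<close> and is
  of lower order.\<close>

lemma bessel_I_upper:
  assumes c: "c > 0"
  obtains k where "k > 0" "\<And>s. s \<ge> c \<Longrightarrow> bessel_I a (s\<^sup>2) \<le> k * (s powr (a - 1 / 2) * exp (- 2 * s))"
proof -
  have "c\<^sup>2 / 10 > 0" using c by simp
  then obtain C where C: "C > 0" "\<And>\<tau>. \<tau> > 0 \<Longrightarrow> exp (- (1/10) * \<tau> - (c\<^sup>2 / 10) / \<tau>) * \<tau> powr (a - 1) \<le> C * exp (- (1 / 10 / 2) * \<tau>)"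
    using bessel_kernel_bound'[of "c\<^sup>2 / 10" "1 / 10" a] by (metis less_divide_eq_numeral1(1) mult_zero_left zero_less_one)
  define g where "g \<tau> = (if \<tau> > 0 then exp (- (1 / 10 / 2) * \<tau>) else 0)" for \<tau> :: real
  have ig: "integrable lborel g" unfolding g_def by (rule integrable_exp_decay) simp
  define G where "G = (\<integral>\<tau>. g \<tau> \<partial>lborel)"
  have G: "G \<ge> 0" unfolding G_def g_def by (intro integral_nonneg_AE) auto
  define m where "m = 2 powr \<bar>a - 1\<bar>"
  \<comment> \<open>On \<open>[c, \<infinity>)\<close> the factor \<open>exp (- s / 5)\<close> is
    beaten by a multiple of any power of \<open>s\<close>, whatever the sign of the
    exponent.\<close>
  obtain D where D: "D > 0" "\<And>s. s \<ge> c \<Longrightarrow> exp (- s / 5) \<le> D * s powr (a - 1 / 2)"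
  proof (cases "a \<ge> 1 / 2")
    case True
    show ?thesis
    proof (rule that[of "c powr (1 / 2 - a)"])
      fix s assume s: "s \<ge> c"
      have "exp (- s / 5) \<le> 1" using s c by simp
      also have "1 = c powr (1 / 2 - a) * c powr (a - 1 / 2)" using c by (simp add: powr_add[symmetric])
      also have "\<dots> \<le> c powr (1 / 2 - a) * s powr (a - 1 / 2)" using s c True by (intro mult_left_mono powr_mono2) auto
      finally show "exp (- s / 5) \<le> c powr (1 / 2 - a) * s powr (a - 1 / 2)" .
    qed (use c in auto)
  next
    case False
    obtain D where D: "D > 0" "\<And>x. x > 0 \<Longrightarrow> x powr (1 / 2 - a) \<le> D * exp (1 / 5 * x)" by (rule powr_le_exp[of "1 / 5" "1 / 2 - a"]) (use False in auto)
    show ?thesis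
    proof (rule that[of D])
      fix s assume s: "s \<ge> c"
      have s0: "s > 0" using s c by simp
      have "exp (- s / 5) = exp (- s / 5) * (s powr (1 / 2 - a) * s powr (a - 1 / 2))" using s0 by (simp add: powr_add[symmetric])
      also have "\<dots> \<le> exp (- s / 5) * (D * exp (1 / 5 * s) * s powr (a - 1 / 2))" using D(2)[OF s0] by (intro mult_left_mono mult_right_mono) auto
      also have "\<dots> = D * s powr (a - 1 / 2)" by (simp add: exp_minus field_simps)
      finally show "exp (- s / 5) \<le> D * s powr (a - 1 / 2)" .
    qed (use D in auto)
  qed
  show thesis
  proof (rule that[of "m * sqrt (2 * pi) + C * G * D"])
    show "m * sqrt (2 * pi) + C * G * D > 0" using C D G by (intro add_pos_nonneg mult_pos_pos) (auto simp: m_def)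
  next
    fix s assume s: "s \<ge> c"
    have s0: "s > 0" using s c by simp
    have le: "bessel_kernel a (s\<^sup>2) \<tau> \<le> exp (- 2 * s) * (m * s powr (a - 1) * sqrt (2 * pi * s)) * normal_density s (sqrt s) \<tau> + exp (- 2 * s) * exp (- s / 5) * C * g \<tau>" for \<tau>
    proof (cases "\<tau> > 0")
      case t: True
      have N: "m * s powr (a - 1) * exp (- (\<tau> - s)\<^sup>2 / (2 * s)) = m * s powr (a - 1) * sqrt (2 * pi * s) * normal_density s (sqrt s) \<tau>"
        using s0 by (simp add: normal_density_def)
      have N0: "m * s powr (a - 1) * exp (- (\<tau> - s)\<^sup>2 / (2 * s)) \<ge> 0" by (simp add: m_def)
      have g0: "exp (- s / 5) * C * g \<tau> \<ge> 0" using C by (simp add: g_def)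
      have "exp (- (\<tau> - s)\<^sup>2 / \<tau>) * \<tau> powr (a - 1) \<le> m * s powr (a - 1) * exp (- (\<tau> - s)\<^sup>2 / (2 * s)) + exp (- s / 5) * C * g \<tau>"
      proof (cases "s / 2 \<le> \<tau> \<and> \<tau> \<le> 2 * s")
        case True
        have "(\<tau> / s) powr (a - 1) \<le> m"
        proof (cases "a \<ge> 1")
          case a: True
          have "(\<tau> / s) powr (a - 1) \<le> 2 powr (a - 1)" using True s0 t a by (intro powr_mono2) (auto simp: field_simps)
          thus ?thesis using a by (simp add: m_def)
        next
          case a: False
          have "(\<tau> / s) powr (a - 1) \<le> (1 / 2) powr (a - 1)" using True s0 t a by (intro powr_mono2') (auto simp: field_simps)
          also have "\<dots> = 2 powr \<bar>a - 1\<bar>" using a by (simp add: powr_divide powr_minus_divide[symmetric])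
          finally show ?thesis by (simp add: m_def)
        qed
        hence "(\<tau> / s) powr (a - 1) * s powr (a - 1) \<le> m * s powr (a - 1)" by (intro mult_right_mono) auto
        hence p: "\<tau> powr (a - 1) \<le> m * s powr (a - 1)" using s0 t by (simp add: powr_divide)
        have "(\<tau> - s)\<^sup>2 / (2 * s) \<le> (\<tau> - s)\<^sup>2 / \<tau>" using True t s0 by (intro divide_left_mono) auto
        hence "exp (- (\<tau> - s)\<^sup>2 / \<tau>) * \<tau> powr (a - 1) \<le> exp (- (\<tau> - s)\<^sup>2 / (2 * s)) * (m * s powr (a - 1))" using p by (intro mult_mono) auto
        thus ?thesis using g0 by (simp add: mult_ac)
      next
        case False
        note f = bessel_exponent_far[OF t s0 False]
        have "c\<^sup>2 \<le> s\<^sup>2" using s c by (intro power_mono) auto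
        hence "c\<^sup>2 / 10 / \<tau> \<le> s\<^sup>2 / (10 * \<tau>)" using t by (simp add: divide_right_mono)
        hence "exp (- (\<tau> - s)\<^sup>2 / \<tau>) \<le> exp (- s / 5 + (- (1/10) * \<tau> - (c\<^sup>2 / 10) / \<tau>))" using f by simp
        hence "exp (- (\<tau> - s)\<^sup>2 / \<tau>) * \<tau> powr (a - 1) \<le> exp (- s / 5 + (- (1/10) * \<tau> - (c\<^sup>2 / 10) / \<tau>)) * \<tau> powr (a - 1)" by (intro mult_right_mono) auto
        also have "\<dots> = exp (- s / 5) * (exp (- (1/10) * \<tau> - (c\<^sup>2 / 10) / \<tau>) * \<tau> powr (a - 1))" by (simp only: exp_add mult.assoc)
        also have "\<dots> \<le> exp (- s / 5) * (C * exp (- (1 / 10 / 2) * \<tau>))" by (intro mult_left_mono C t) auto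
        also have "\<dots> = exp (- s / 5) * C * g \<tau>" using t by (simp add: g_def)
        finally show ?thesis using N0 by linarith
      qed
      hence "exp (- 2 * s) * (exp (- (\<tau> - s)\<^sup>2 / \<tau>) * \<tau> powr (a - 1)) \<le> exp (- 2 * s) * (m * s powr (a - 1) * sqrt (2 * pi * s) * normal_density s (sqrt s) \<tau> + exp (- s / 5) * C * g \<tau>)"
        unfolding N by (intro mult_left_mono) auto
      moreover have "bessel_kernel a (s\<^sup>2) \<tau> = exp (- 2 * s) * (exp (- (\<tau> - s)\<^sup>2 / \<tau>) * \<tau> powr (a - 1))"
        using t bessel_exponent[OF t, of s] by (simp add: bessel_kernel_def exp_add[symmetric] mult.assoc[symmetric])
      ultimately show ?thesis by (simp add: algebra_simps)
    qed (use s0 in \<open>auto simp: bessel_kernel_def g_def m_def intro!: mult_nonneg_nonneg\<close>)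
    have "bessel_I a (s\<^sup>2) \<le> (\<integral>\<tau>. exp (- 2 * s) * (m * s powr (a - 1) * sqrt (2 * pi * s)) * normal_density s (sqrt s) \<tau> + exp (- 2 * s) * exp (- s / 5) * C * g \<tau> \<partial>lborel)"
      unfolding bessel_I_def using s0
      by (intro Bochner_Integration.integral_mono le bessel_kernel_integrable Bochner_Integration.integrable_add integrable_mult_right ig) auto
    also have "\<dots> = exp (- 2 * s) * (m * s powr (a - 1) * sqrt (2 * pi * s)) + exp (- 2 * s) * exp (- s / 5) * C * G"
      using s0 ig by (subst Bochner_Integration.integral_add) (auto simp: G_def)
    also have "s powr (a - 1) * sqrt (2 * pi * s) = sqrt (2 * pi) * s powr (a - 1 / 2)"
      using s0 by (simp add: real_sqrt_mult powr_half_sqrt[symmetric] powr_add[symmetric])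
    hence "exp (- 2 * s) * (m * s powr (a - 1) * sqrt (2 * pi * s)) = exp (- 2 * s) * (m * sqrt (2 * pi) * s powr (a - 1 / 2))" by (simp only: mult.assoc)
    also have "exp (- 2 * s) * (m * sqrt (2 * pi) * s powr (a - 1 / 2)) + exp (- 2 * s) * exp (- s / 5) * C * G
        \<le> exp (- 2 * s) * (m * sqrt (2 * pi) * s powr (a - 1 / 2)) + exp (- 2 * s) * (D * s powr (a - 1 / 2)) * C * G"
      using D(2)[OF s] C G by (intro add_left_mono mult_right_mono mult_left_mono) auto
    also have "\<dots> = (m * sqrt (2 * pi) + C * G * D) * (s powr (a - 1 / 2) * exp (- 2 * s))" by (simp add: algebra_simps)
    finally show "bessel_I a (s\<^sup>2) \<le> (m * sqrt (2 * pi) + C * G * D) * (s powr (a - 1 / 2) * exp (- 2 * s))" .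
  qed
qed

lemma bessel_I_pos: "w > 0 \<Longrightarrow> bessel_I a w > 0"
proof -
  assume w: "w > 0"
  have s: "sqrt w > 0" using w by simp
  obtain k where "k > 0" "\<And>s. s \<ge> sqrt w \<Longrightarrow> k * (s powr (a - 1 / 2) * exp (- 2 * s)) \<le> bessel_I a (s\<^sup>2)"
    using bessel_I_lower[OF s] by metis
  from this(1) this(2)[of "sqrt w"] s w show ?thesis
    by (smt (verit) exp_gt_zero mult_pos_pos powr_gt_zero real_sqrt_pow2)
qed

text \<open>The recurrence at \<open>a + 1\<close> gives
  \<open>a * bessel_I a w \<le> bessel_I (a + 1) w\<close>. The integrand of the right side is
  nonsingular at 0 and bounded uniformly in \<open>w\<close>.\<close>

lemma bessel_I_bounded:
  assumes a: "a > 0"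
  obtains C where "C > 0" "\<And>w. w > 0 \<Longrightarrow> bessel_I a w \<le> C"
proof -
  obtain C where C: "C > 0" "\<And>x. x > 0 \<Longrightarrow> x powr a \<le> C * exp (1 / 2 * x)" by (rule powr_le_exp[of "1 / 2" a]) (use a in auto)
  define g where "g \<tau> = (if \<tau> > 0 then exp (- (1 / 2) * \<tau>) else 0)" for \<tau> :: real
  have ig: "integrable lborel g" unfolding g_def by (rule integrable_exp_decay) simp
  define G where "G = (\<integral>\<tau>. g \<tau> \<partial>lborel)"
  have G: "G \<ge> 0" unfolding G_def g_def by (intro integral_nonneg_AE) auto
  show thesis
  proof (rule that[of "(C * G + 1) / a"])
    fix w :: real assume w: "w > 0"
    have le: "bessel_kernel (a + 1) w \<tau> \<le> C * g \<tau>" for \<tau>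
    proof (cases "\<tau> > 0")
      case True
      have "exp (- \<tau> - w / \<tau>) * \<tau> powr a \<le> exp (- \<tau>) * (C * exp (1 / 2 * \<tau>))" using True w C(2)[OF True] by (intro mult_mono) auto
      also have "\<dots> = C * g \<tau>" using True by (simp add: g_def exp_add[symmetric])
      finally show ?thesis using True by (simp add: bessel_kernel_def)
    qed (auto simp: bessel_kernel_def g_def)
    have "bessel_I (a + 1) w \<le> (\<integral>\<tau>. C * g \<tau> \<partial>lborel)" unfolding bessel_I_def
      by (intro Bochner_Integration.integral_mono le bessel_kernel_integrable w integrable_mult_right ig)
    hence "bessel_I (a + 1) w \<le> C * G" by (simp add: G_def)
    moreover have "bessel_I (a + 1) w = w * bessel_I (a - 1) w + a * bessel_I a w" using bessel_I_recurrence[OF w, of "a + 1"] by simp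
    moreover have "w * bessel_I (a - 1) w \<ge> 0" using w bessel_I_nonneg by simp
    ultimately have "bessel_I a w * a \<le> C * G + 1" by (simp add: mult.commute)
    thus "bessel_I a w \<le> (C * G + 1) / a" using a by (simp add: pos_le_divide_eq)
  qed (use a C G in \<open>auto intro!: divide_pos_pos add_nonneg_pos\<close>)
qed

text \<open>The substitution \<open>\<tau> = w * \<sigma>\<close> extracts \<open>w powr a\<close>
  and leaves an integrand dominated by \<open>g\<close>: integrable at infinity because
  \<open>a < 0\<close>, and bounded near 0 because of \<open>exp (- 1 / \<sigma>)\<close>.\<close>

lemma bessel_I_neg_upper:
  assumes a: "a < 0"
  obtains C where "C > 0" "\<And>w. w > 0 \<Longrightarrow> bessel_I a w \<le> C * w powr a"
proof -
  obtain C1 where C1: "C1 > 0" "\<And>x. x > 0 \<Longrightarrow> x powr (1 - a) \<le> C1 * exp (1 * x)" by (rule powr_le_exp[of 1 "1 - a"]) (use a in auto)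
  define g where "g \<sigma> = C1 * indicator {0..1} \<sigma> + indicator {1..} \<sigma> * \<sigma> powr (a - 1)" for \<sigma> :: real
  have "(\<integral>\<^sup>+ \<sigma>. ennreal (\<sigma> powr (a - 1)) * indicator {1..} \<sigma> \<partial>lborel) = ennreal (0 - 1 powr a / a)"
  proof (rule nn_integral_FTC_atLeast)
    fix \<sigma> :: real assume "1 \<le> \<sigma>"
    thus "((\<lambda>\<sigma>. \<sigma> powr a / a) has_real_derivative \<sigma> powr (a - 1)) (at \<sigma>)"
      using a by (auto intro!: derivative_eq_intros)
  next
    show "((\<lambda>\<sigma>. \<sigma> powr a / a) \<longlongrightarrow> 0) at_top" using a by real_asymp
  qed auto
  moreover have "(\<integral>\<^sup>+ \<sigma>. ennreal (\<sigma> powr (a - 1)) * indicator {1..} \<sigma> \<partial>lborel) = (\<integral>\<^sup>+ \<sigma>. ennreal (indicator {1..} \<sigma> * \<sigma> powr (a - 1)) \<partial>lborel)"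
    by (intro nn_integral_cong) (auto simp: indicator_def)
  ultimately have "integrable lborel (\<lambda>\<sigma>::real. indicator {1..} \<sigma> * \<sigma> powr (a - 1))"
    by (intro integrableI_nonneg) auto
  hence ig: "integrable lborel g" unfolding g_def by (intro Bochner_Integration.integrable_add integrable_mult_right) auto
  define G where "G = (\<integral>\<sigma>. g \<sigma> \<partial>lborel)"
  have G: "G \<ge> 0" unfolding G_def g_def using C1 by (intro integral_nonneg_AE) auto
  show thesis
  proof (rule that[of "G + 1"])
    fix w :: real assume w: "w > 0"
    have le: "bessel_kernel a w (0 + w * \<sigma>) \<le> w powr (a - 1) * g \<sigma>" for \<sigma>
    proof (cases "\<sigma> > 0")
      case True
      have "exp (- (w * \<sigma>) - 1 / \<sigma>) * \<sigma> powr (a - 1) \<le> g \<sigma>"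
      proof (cases "\<sigma> \<ge> 1")
        case s: True
        have "0 \<le> w * \<sigma>" "0 \<le> 1 / \<sigma>" using True w by auto
        hence "- (w * \<sigma>) - 1 / \<sigma> \<le> 0" by linarith
        hence "exp (- (w * \<sigma>) - 1 / \<sigma>) \<le> 1" by simp
        hence "exp (- (w * \<sigma>) - 1 / \<sigma>) * \<sigma> powr (a - 1) \<le> 1 * \<sigma> powr (a - 1)" by (intro mult_right_mono) auto
        also have "\<dots> \<le> g \<sigma>" using s C1(1) by (simp add: g_def)
        finally show ?thesis .
      next
        case False
        have "\<sigma> powr (a - 1) = (1 / \<sigma>) powr (1 - a)" using True powr_minus_divide[of \<sigma> "1 - a"] by (simp add: powr_divide)
        also have "\<dots> \<le> C1 * exp (1 / \<sigma>)" using C1(2)[of "1 / \<sigma>"] True by simp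
        finally have "exp (- (w * \<sigma>) - 1 / \<sigma>) * \<sigma> powr (a - 1) \<le> exp (- (w * \<sigma>) - 1 / \<sigma>) * (C1 * exp (1 / \<sigma>))" by (intro mult_left_mono) auto
        also have "\<dots> = C1 * exp (- (w * \<sigma>))" by (simp add: exp_add[symmetric])
        also have "\<dots> \<le> C1" using C1 w True by simp
        finally show ?thesis using False True by (simp add: g_def)
      qed
      hence "w powr (a - 1) * (exp (- (w * \<sigma>) - 1 / \<sigma>) * \<sigma> powr (a - 1)) \<le> w powr (a - 1) * g \<sigma>" by (intro mult_left_mono) auto
      thus ?thesis using True w by (simp add: bessel_kernel_def powr_mult mult_ac)
    next
      case False
      thus ?thesis using w C1 by (auto simp: bessel_kernel_def g_def zero_less_mult_iff)
    qed
    have "bessel_I a w = \<bar>w\<bar> *\<^sub>R (\<integral>\<sigma>. bessel_kernel a w (0 + w * \<sigma>) \<partial>lborel)"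
      unfolding bessel_I_def by (rule lborel_integral_real_affine) (use w in auto)
    also have "\<dots> \<le> \<bar>w\<bar> *\<^sub>R (\<integral>\<sigma>. w powr (a - 1) * g \<sigma> \<partial>lborel)"
      using w lborel_integrable_real_affine[OF bessel_kernel_integrable[OF w, of a], of w 0]
      by (intro scaleR_left_mono Bochner_Integration.integral_mono le integrable_mult_right ig) auto
    also have "\<dots> = w powr a * G" using w powr_mult_base[of w "a - 1"] by (simp add: G_def mult.assoc[symmetric])
    also have "\<dots> \<le> (G + 1) * w powr a" by (simp add: distrib_right)
    finally show "bessel_I a w \<le> (G + 1) * w powr a" .
  qed (use G in auto)
qed

text \<open>The window from \<open>w\<close> to \<open>2 * w\<close> alone contributes order
  \<open>w powr a\<close>; there the exponential is bounded below since
  \<open>w \<le> c\<close>.\<close>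

lemma bessel_I_neg_lower:
  assumes a: "a \<le> 1" and c: "c > 0"
  obtains k where "k > 0" "\<And>w. 0 < w \<Longrightarrow> w \<le> c \<Longrightarrow> k * w powr a \<le> bessel_I a w"
proof (rule that[of "exp (- 2 * c - 1) * 2 powr (a - 1)"])
  fix w assume w: "0 < w" "w \<le> c"
  define k where "k = exp (- 2 * c - 1) * (2 * w) powr (a - 1)"
  have le: "k * indicator {w..2 * w} \<tau> \<le> bessel_kernel a w \<tau>" for \<tau>
  proof (cases "\<tau> \<in> {w..2 * w}")
    case True
    hence t: "\<tau> > 0" using w by auto
    have "w / \<tau> \<le> 1" using True t by simp
    moreover have "\<tau> \<le> 2 * c" using True w by simp
    ultimately have "- 2 * c - 1 \<le> - \<tau> - w / \<tau>" by linarith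
    hence "exp (- 2 * c - 1) \<le> exp (- \<tau> - w / \<tau>)" by simp
    moreover have "(2 * w) powr (a - 1) \<le> \<tau> powr (a - 1)" using True t a by (intro powr_mono2') auto
    ultimately have "k \<le> exp (- \<tau> - w / \<tau>) * \<tau> powr (a - 1)" unfolding k_def by (intro mult_mono) auto
    thus ?thesis using True t by (simp add: bessel_kernel_def)
  qed simp
  have "k * w = (\<integral>\<tau>. k * indicator {w..2 * w} \<tau> \<partial>lborel)" using w by simp
  also have "\<dots> \<le> bessel_I a w" unfolding bessel_I_def
    using w by (intro Bochner_Integration.integral_mono le bessel_kernel_integrable integrable_mult_right) auto
  also have "k * w = exp (- 2 * c - 1) * 2 powr (a - 1) * w powr a"
    using w powr_mult_base[of w "a - 1"] by (simp add: k_def powr_mult mult_ac)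
  finally show "exp (- 2 * c - 1) * 2 powr (a - 1) * w powr a \<le> bessel_I a w" .
qed auto

context inv_pot begin

section \<open>The radial harmonic function\<close>

text \<open>The constant is chosen so that \<open>w = cc * r powr (- 2 * \<beta>)\<close> satisfies
  \<open>2 * sqrt w = sqrt \<kappa> / (\<beta> * r powr \<beta>)\<close>, the exponent in
  \<open>hfun\<close>.\<close>

definition cc :: real where "cc = \<kappa> / (4 * \<beta>\<^sup>2)"

definition nu :: "nat \<Rightarrow> real" where "nu d = (real d - 2) / (2 * \<beta>)"

text \<open>In the variable \<open>\<rho> = |x|\<^sup>2\<close>, \<open>F0\<close> is the positive solution of \<open>\<Delta>\<phi> = V \<phi>\<close> that vanishes at the
  origin; \<open>F1\<close> and \<open>F2\<close> are its first two derivatives.\<close>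

definition F0 :: "nat \<Rightarrow> real \<Rightarrow> real" where
  "F0 d \<rho> = bessel_I (nu d) (cc * \<rho> powr (- \<beta>))"

definition F1 :: "nat \<Rightarrow> real \<Rightarrow> real" where
  "F1 d \<rho> = \<beta> * cc * \<rho> powr (- \<beta> - 1) * bessel_I (nu d - 1) (cc * \<rho> powr (- \<beta>))"

definition F2 :: "nat \<Rightarrow> real \<Rightarrow> real" where
  "F2 d \<rho> = \<beta> * cc * (- \<beta> - 1) * \<rho> powr (- \<beta> - 2) * bessel_I (nu d - 1) (cc * \<rho> powr (- \<beta>))
     + (\<beta> * cc * \<rho> powr (- \<beta> - 1))\<^sup>2 * bessel_I (nu d - 2) (cc * \<rho> powr (- \<beta>))"

definition phi :: "nat \<Rightarrow> real \<Rightarrow> real" where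
  "phi d r = (if r > 0 then F0 d (r\<^sup>2) else 0)"

lemma cc_pos: "cc > 0" using beta kappa by (simp add: cc_def)

lemma F_DERIV:
  assumes r: "\<rho> > 0"
  shows "(F0 d has_real_derivative F1 d \<rho>) (at \<rho>)" "(F1 d has_real_derivative F2 d \<rho>) (at \<rho>)"
proof -
  have w: "cc * \<rho> powr (- \<beta>) > 0" using r cc_pos by simp
  have dw: "((\<lambda>\<rho>. cc * \<rho> powr (- \<beta>)) has_real_derivative - (\<beta> * cc * \<rho> powr (- \<beta> - 1))) (at \<rho>)"
    using r by (auto intro!: derivative_eq_intros)
  have dI: "((\<lambda>\<rho>. bessel_I a (cc * \<rho> powr (- \<beta>))) has_real_derivative (\<beta> * cc * \<rho> powr (- \<beta> - 1)) * bessel_I (a - 1) (cc * \<rho> powr (- \<beta>))) (at \<rho>)" for a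
    using DERIV_chain2[OF bessel_I_DERIV[OF w, of a] dw] by (simp add: mult.commute)
  show "(F0 d has_real_derivative F1 d \<rho>) (at \<rho>)" unfolding F0_def[abs_def] F1_def by (rule dI)
  have dp: "((\<lambda>\<rho>. \<beta> * cc * \<rho> powr (- \<beta> - 1)) has_real_derivative \<beta> * cc * (- \<beta> - 1) * \<rho> powr (- \<beta> - 2)) (at \<rho>)"
  proof -
    have "\<rho> powr (- 2 - \<beta>) = \<rho> powr (- \<beta> - 2)"
      by (rule arg_cong[where f = "(powr) \<rho>"]) simp
    thus ?thesis using r by (auto intro!: derivative_eq_intros)
  qed
  show "(F1 d has_real_derivative F2 d \<rho>) (at \<rho>)" unfolding F1_def[abs_def] F2_def
    using DERIV_mult[OF dp dI[of "nu d - 1"]] by (simp add: power2_eq_square mult_ac)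
qed

text \<open>The left side is the Laplacian of \<open>F0 d ((norm x)\<^sup>2)\<close> in dimension
  \<open>d\<close>. After substituting \<open>w\<close>, the equation is the Macdonald recurrence
  for the order \<open>nu d\<close>, and this fixes both \<open>nu\<close> and
  \<open>cc\<close>.\<close>

lemma F_ode:
  assumes r: "\<rho> > 0"
  shows "4 * \<rho> * F2 d \<rho> + 2 * real d * F1 d \<rho> = \<kappa> * \<rho> powr (- \<beta> - 1) * F0 d \<rho>"
proof -
  define w where "w = cc * \<rho> powr (- \<beta>)"
  have w: "w > 0" using r cc_pos by (simp add: w_def)
  have p1: "cc * \<rho> powr (- \<beta> - 1) = w / \<rho>" "cc * \<rho> powr (- \<beta> - 2) = w / \<rho>\<^sup>2"
    using r by (simp_all add: w_def powr_diff powr_numeral)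
  define A B where "A = bessel_I (nu d - 1) w" and "B = bessel_I (nu d - 2) w"
  have I: "F0 d \<rho> = w * B + (nu d - 1) * A"
    using bessel_I_recurrence[OF w, of "nu d"] by (simp add: F0_def w_def[symmetric] A_def B_def)
  have f1: "F1 d \<rho> = \<beta> * (w / \<rho>) * A" unfolding F1_def w_def[symmetric] A_def[symmetric] by (simp add: p1(1) mult.assoc)
  have f2: "F2 d \<rho> = \<beta> * (- \<beta> - 1) * (w / \<rho>\<^sup>2) * A + (\<beta> * (w / \<rho>))\<^sup>2 * B"
  proof -
    have "\<beta> * cc * (- \<beta> - 1) * \<rho> powr (- \<beta> - 2) = \<beta> * (- \<beta> - 1) * (cc * \<rho> powr (- \<beta> - 2))"
      "\<beta> * cc * \<rho> powr (- \<beta> - 1) = \<beta> * (cc * \<rho> powr (- \<beta> - 1))" by simp_all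
    thus ?thesis unfolding F2_def w_def[symmetric] A_def[symmetric] B_def[symmetric] by (simp only: p1)
  qed
  have k: "\<kappa> * \<rho> powr (- \<beta> - 1) = 4 * \<beta>\<^sup>2 * (w / \<rho>)" unfolding p1(1)[symmetric] using beta by (simp add: cc_def)
  have n: "2 * \<beta> * nu d = real d - 2" using beta by (simp add: nu_def)
  have "4 * \<rho> * F2 d \<rho> + 2 * real d * F1 d \<rho> = (w / \<rho>) * (4 * \<beta>\<^sup>2 * w * B + (4 * \<beta> * (- \<beta> - 1) + 2 * real d * \<beta>) * A)"
    unfolding f1 f2 using r by (simp add: field_simps power2_eq_square)
  also have "4 * \<beta> * (- \<beta> - 1) + 2 * real d * \<beta> = 4 * \<beta>\<^sup>2 * (nu d - 1)"
  proof -
    have "4 * \<beta>\<^sup>2 * nu d = 2 * \<beta> * (2 * \<beta> * nu d)" by (simp add: power2_eq_square)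
    thus ?thesis unfolding n by (simp add: power2_eq_square algebra_simps)
  qed
  finally have L: "4 * \<rho> * F2 d \<rho> + 2 * real d * F1 d \<rho> = (w / \<rho>) * (4 * \<beta>\<^sup>2 * w * B + 4 * \<beta>\<^sup>2 * (nu d - 1) * A)" .
  have "u * (4 * \<beta>\<^sup>2 * w * B + 4 * \<beta>\<^sup>2 * (nu d - 1) * A) = 4 * \<beta>\<^sup>2 * u * (w * B + (nu d - 1) * A)" for u
    by (simp add: algebra_simps)
  thus ?thesis unfolding k I L .
qed

lemma F0_pos: "\<rho> > 0 \<Longrightarrow> F0 d \<rho> > 0"
  unfolding F0_def using cc_pos by (intro bessel_I_pos) simp

lemma F0_mono: "0 < \<rho> \<Longrightarrow> \<rho> \<le> \<rho>' \<Longrightarrow> F0 d \<rho> \<le> F0 d \<rho>'"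
  unfolding F0_def using cc_pos beta by (intro bessel_I_antimono mult_left_mono powr_mono2') auto

lemma phi_pos: "r > 0 \<Longrightarrow> phi d r > 0" by (simp add: phi_def F0_pos)

lemma phi_nonneg [simp]: "phi d r \<ge> 0" by (simp add: phi_def F0_pos less_imp_le)

lemma phi_mono: "r \<le> r' \<Longrightarrow> phi d r \<le> phi d r'"
  by (auto simp: phi_def F0_pos less_imp_le intro!: F0_mono power_mono)

lemma phi_measurable [measurable]: "phi d \<in> borel_measurable borel"
  by (intro borel_measurable_mono monoI phi_mono)

lemma continuous_on_F:
  "continuous_on {0<..} (F0 d)" "continuous_on {0<..} (F1 d)" "continuous_on {0<..} (F2 d)"
proof -
  show "continuous_on {0<..} (F0 d)" "continuous_on {0<..} (F1 d)"
    using F_DERIV by (auto intro!: continuous_at_imp_continuous_on DERIV_isCont)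
  have I: "continuous_on {0<..} (\<lambda>\<rho>. bessel_I a (cc * \<rho> powr (- \<beta>)))" for a
    using cc_pos by (intro continuous_on_compose2[OF bessel_I_continuous] continuous_intros) auto
  show "continuous_on {0<..} (F2 d)" unfolding F2_def[abs_def] by (intro continuous_intros I) auto
qed

text \<open>The remainder in mean value form is
  \<open>(F2 t - F2 \<rho>) / 2 * \<xi>\<^sup>2\<close> with \<open>t\<close> between the two
  points; uniform continuity of \<open>F2\<close> on a compact neighbourhood makes it small
  uniformly in \<open>\<rho>\<close>.\<close>

lemma F0_taylor:
  assumes a: "a > 0" and e: "e > 0"
  obtains \<eta> where "\<eta> > 0" "\<eta> \<le> a / 2"
    "\<And>\<rho> \<xi>. a \<le> \<rho> \<Longrightarrow> \<rho> \<le> b \<Longrightarrow> \<bar>\<xi>\<bar> \<le> \<eta> \<Longrightarrow> \<bar>F0 d (\<rho> + \<xi>) - F0 d \<rho> - F1 d \<rho> * \<xi> - F2 d \<rho> * \<xi>\<^sup>2 / 2\<bar> \<le> e * \<xi>\<^sup>2"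
proof -
  let ?C = "{a / 2..b + a}"
  have "uniformly_continuous_on ?C (F2 d)"
    using a by (intro compact_uniformly_continuous continuous_on_subset[OF continuous_on_F(3)]) auto
  then obtain \<delta> where d: "\<delta> > 0" "\<And>x y. x \<in> ?C \<Longrightarrow> y \<in> ?C \<Longrightarrow> dist x y < \<delta> \<Longrightarrow> dist (F2 d x) (F2 d y) < e"
    unfolding uniformly_continuous_on_def using e by metis
  show thesis
  proof (rule that[of "min (a / 2) (\<delta> / 2)"])
    fix \<rho> \<xi> assume r: "a \<le> \<rho>" "\<rho> \<le> b" and x: "\<bar>\<xi>\<bar> \<le> min (a / 2) (\<delta> / 2)"
    show "\<bar>F0 d (\<rho> + \<xi>) - F0 d \<rho> - F1 d \<rho> * \<xi> - F2 d \<rho> * \<xi>\<^sup>2 / 2\<bar> \<le> e * \<xi>\<^sup>2"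
    proof (cases "\<xi> = 0")
      case False
      define diff where "diff m = (if m = (0::nat) then F0 d else if m = 1 then F1 d else F2 d)" for m
      have "\<exists>t. (if \<rho> + \<xi> < \<rho> then \<rho> + \<xi> < t \<and> t < \<rho> else \<rho> < t \<and> t < \<rho> + \<xi>) \<and>
          F0 d (\<rho> + \<xi>) = (\<Sum>m<2. diff m \<rho> / fact m * (\<rho> + \<xi> - \<rho>) ^ m) + diff 2 t / fact 2 * (\<rho> + \<xi> - \<rho>) ^ 2"
      proof (rule Taylor[where a = "\<rho> - \<bar>\<xi>\<bar>" and b = "\<rho> + \<bar>\<xi>\<bar>"])
        show "\<forall>m t. m < 2 \<and> \<rho> - \<bar>\<xi>\<bar> \<le> t \<and> t \<le> \<rho> + \<bar>\<xi>\<bar> \<longrightarrow> (diff m has_real_derivative diff (Suc m) t) (at t)"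
        proof (intro allI impI)
          fix m t assume "m < (2::nat) \<and> \<rho> - \<bar>\<xi>\<bar> \<le> t \<and> t \<le> \<rho> + \<bar>\<xi>\<bar>"
          moreover from this have "t > 0" using r x a by auto
          ultimately show "(diff m has_real_derivative diff (Suc m) t) (at t)"
            using F_DERIV[of t d] by (cases m) (auto simp: diff_def)
        qed
      qed (use False in \<open>auto simp: diff_def\<close>)
      then obtain t where t0: "if \<rho> + \<xi> < \<rho> then \<rho> + \<xi> < t \<and> t < \<rho> else \<rho> < t \<and> t < \<rho> + \<xi>"
        and t1: "F0 d (\<rho> + \<xi>) = (\<Sum>m<2. diff m \<rho> / fact m * (\<rho> + \<xi> - \<rho>) ^ m) + diff 2 t / fact 2 * (\<rho> + \<xi> - \<rho>) ^ 2" by blast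
      have "\<bar>t - \<rho>\<bar> \<le> \<bar>\<xi>\<bar>" using t0 by (auto split: if_splits)
      moreover have "F0 d (\<rho> + \<xi>) = F0 d \<rho> + F1 d \<rho> * \<xi> + F2 d t / 2 * \<xi>\<^sup>2"
        using t1 by (simp add: diff_def numeral_2_eq_2)
      ultimately have t: "\<bar>t - \<rho>\<bar> \<le> \<bar>\<xi>\<bar>" "F0 d (\<rho> + \<xi>) = F0 d \<rho> + F1 d \<rho> * \<xi> + F2 d t / 2 * \<xi>\<^sup>2" .
      have "dist (F2 d t) (F2 d \<rho>) < e"
        using t(1) r x a d(1) by (intro d(2)) (auto simp: dist_real_def abs_le_iff)
      hence "\<bar>F2 d t - F2 d \<rho>\<bar> / 2 * \<xi>\<^sup>2 \<le> e * \<xi>\<^sup>2" by (intro mult_right_mono) (auto simp: dist_real_def)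
      moreover have eq: "F0 d (\<rho> + \<xi>) - F0 d \<rho> - F1 d \<rho> * \<xi> - F2 d \<rho> * \<xi>\<^sup>2 / 2 = (F2 d t - F2 d \<rho>) / 2 * \<xi>\<^sup>2"
        unfolding t(2) by (simp add: field_simps)
      ultimately show ?thesis unfolding eq by (simp add: abs_mult)
    qed simp
  qed (use a d in auto)
qed

lemma phi_taylor:
  fixes dummy :: "'a::euclidean_space"
  assumes a: "a > 0" and e: "e > 0" and ab: "a \<le> b"
  obtains \<eta> where "\<eta> > 0" "\<eta> \<le> 1" "\<eta> \<le> a / 2"
    "\<And>x z :: 'a. a \<le> norm x \<Longrightarrow> norm x \<le> b \<Longrightarrow> norm z \<le> \<eta> \<Longrightarrow>
      \<bar>phi d (norm (x + z)) - (phi d (norm x) + 2 * F1 d ((norm x)\<^sup>2) * (x \<bullet> z) + F1 d ((norm x)\<^sup>2) * (norm z)\<^sup>2 + 2 * F2 d ((norm x)\<^sup>2) * (x \<bullet> z)\<^sup>2)\<bar> \<le> e * (norm z)\<^sup>2"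
proof -
  have b: "b > 0" using a ab by simp
  have a2: "a\<^sup>2 > 0" using a by simp
  have "compact (F2 d ` {a\<^sup>2..b\<^sup>2})" using less_le_trans[OF a2] by (intro compact_continuous_image continuous_on_subset[OF continuous_on_F(3)]) auto
  hence "bounded (F2 d ` {a\<^sup>2..b\<^sup>2})" by (rule compact_imp_bounded)
  then obtain B where B: "B > 0" "\<And>\<rho>. \<rho> \<in> {a\<^sup>2..b\<^sup>2} \<Longrightarrow> \<bar>F2 d \<rho>\<bar> \<le> B"
    unfolding bounded_pos by auto
  define L where "L = 2 * b + 1"
  have L: "L > 0" using b by (simp add: L_def)
  have "a\<^sup>2 > 0" "e / (2 * L\<^sup>2) > 0" using a e L by auto
  from F0_taylor[OF this, of "b\<^sup>2" d] obtain \<eta>0 where h: "\<eta>0 > 0"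
    "\<And>\<rho> \<xi>. a\<^sup>2 \<le> \<rho> \<Longrightarrow> \<rho> \<le> b\<^sup>2 \<Longrightarrow> \<bar>\<xi>\<bar> \<le> \<eta>0 \<Longrightarrow> \<bar>F0 d (\<rho> + \<xi>) - F0 d \<rho> - F1 d \<rho> * \<xi> - F2 d \<rho> * \<xi>\<^sup>2 / 2\<bar> \<le> e / (2 * L\<^sup>2) * \<xi>\<^sup>2"
    by metis
  \<comment> \<open>The increment of \<open>(norm x)\<^sup>2\<close> is
    \<open>\<xi> = 2 * s + n\<close>. The bound 1 gives \<open>n \<le> norm z\<close>;
    \<open>a / 2\<close> keeps \<open>x + z\<close> off the origin; \<open>\<eta>0 / L\<close> keeps
    \<open>\<xi>\<close> in the range of the one-variable expansion; the last bound makes the cubic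
    error from replacing \<open>\<xi>\<^sup>2\<close> by \<open>4 * s\<^sup>2\<close> at most
    \<open>e / 2 * n\<close>.\<close>
  define \<eta> where "\<eta> = min (min 1 (a / 2)) (min (\<eta>0 / L) (e / (B * (4 * b + 1))))"
  have eta: "\<eta> > 0" "\<eta> \<le> 1" "\<eta> \<le> a / 2" "\<eta> \<le> \<eta>0 / L" "\<eta> \<le> e / (B * (4 * b + 1))"
  proof -
    have m: "min (min p q) (min r s) \<le> p" "min (min p q) (min r s) \<le> q" "min (min p q) (min r s) \<le> r" "min (min p q) (min r s) \<le> s"
      for p q r s :: real by auto
    show "\<eta> \<le> 1" "\<eta> \<le> a / 2" "\<eta> \<le> \<eta>0 / L" "\<eta> \<le> e / (B * (4 * b + 1))" unfolding \<eta>_def by (rule m)+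
    show "\<eta> > 0" using a h(1) L e B(1) b by (simp add: \<eta>_def)
  qed
  show thesis
  proof (rule that[OF eta(1-3)])
    fix x z :: 'a assume x: "a \<le> norm x" "norm x \<le> b" and z: "norm z \<le> \<eta>"
    define \<rho> where "\<rho> = (norm x)\<^sup>2"
    define s where "s = x \<bullet> z"
    define n where "n = (norm z)\<^sup>2"
    define \<xi> where "\<xi> = 2 * s + n"
    have rho: "a\<^sup>2 \<le> \<rho>" "\<rho> \<le> b\<^sup>2" unfolding \<rho>_def using x a by (auto intro: power_mono)
    have z1: "norm z \<le> 1" using z eta by linarith
    have s: "\<bar>s\<bar> \<le> b * norm z" unfolding s_def using Cauchy_Schwarz_ineq2[of x z] x(2) by (meson mult_right_mono norm_ge_zero order_trans)
    have n: "0 \<le> n" "n \<le> norm z" unfolding n_def using z1 by (auto simp: power2_eq_square mult_left_le_one_le)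
    have xi: "\<bar>\<xi>\<bar> \<le> L * norm z" unfolding \<xi>_def L_def using s n by (simp add: distrib_right)
    also have "norm z \<le> \<eta>0 / L" using z eta(4) by linarith
    hence "L * norm z \<le> \<eta>0" using L by (simp add: field_simps)
    finally have xi0: "\<bar>\<xi>\<bar> \<le> \<eta>0" .
    have nx: "norm (x + z) > 0"
    proof -
      have "norm x - norm z \<le> norm (x + z)" by (metis norm_diff_ineq)
      moreover have "norm z < norm x" using z x eta(3) a by linarith
      ultimately show ?thesis by linarith
    qed
    have "(norm (x + z))\<^sup>2 = \<rho> + \<xi>" unfolding \<rho>_def \<xi>_def s_def n_def power2_norm_eq_inner by (simp add: inner_simps inner_commute)
    hence p: "phi d (norm (x + z)) = F0 d (\<rho> + \<xi>)" "phi d (norm x) = F0 d \<rho>" using nx x a by (auto simp: phi_def \<rho>_def)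
    have "\<xi>\<^sup>2 \<le> (L * norm z)\<^sup>2" using xi by (metis abs_ge_zero power2_abs power_mono)
    hence "e / (2 * L\<^sup>2) * \<xi>\<^sup>2 \<le> e / (2 * L\<^sup>2) * (L\<^sup>2 * n)" using e by (intro mult_left_mono) (auto simp: power_mult_distrib n_def)
    also have "\<dots> = e / 2 * n" using L by simp
    finally have 1: "\<bar>F0 d (\<rho> + \<xi>) - F0 d \<rho> - F1 d \<rho> * \<xi> - F2 d \<rho> * \<xi>\<^sup>2 / 2\<bar> \<le> e / 2 * n"
      using h(2)[OF rho xi0] by linarith
    have "F2 d \<rho> * \<xi>\<^sup>2 / 2 - 2 * F2 d \<rho> * s\<^sup>2 = F2 d \<rho> / 2 * ((4 * s + n) * n)"
      unfolding \<xi>_def by (simp add: power2_eq_square algebra_simps)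
    also have "\<bar>\<dots>\<bar> \<le> B / 2 * ((4 * b + 1) * norm z * n)"
    proof -
      have "\<bar>4 * s + n\<bar> \<le> (4 * b + 1) * norm z" using s n by (simp add: distrib_right)
      hence "\<bar>4 * s + n\<bar> * n \<le> (4 * b + 1) * norm z * n" using n by (intro mult_right_mono) auto
      moreover have "\<bar>F2 d \<rho> / 2 * ((4 * s + n) * n)\<bar> = \<bar>F2 d \<rho>\<bar> / 2 * (\<bar>4 * s + n\<bar> * n)" using n by (simp add: abs_mult)
      moreover have "\<bar>F2 d \<rho>\<bar> / 2 \<le> B / 2" using B(2) rho by simp
      ultimately show ?thesis using n B(1) by (metis abs_ge_zero divide_nonneg_nonneg less_imp_le mult_mono' mult_nonneg_nonneg zero_le_numeral)
    qed
    also have "\<dots> = (B * (4 * b + 1) * norm z) * n / 2" by simp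
    also have "\<dots> \<le> e * n / 2"
    proof -
      have "norm z \<le> e / (B * (4 * b + 1))" using z eta(5) by linarith
      hence "B * (4 * b + 1) * norm z \<le> e" using B(1) b by (simp add: pos_le_divide_eq mult.commute)
      thus ?thesis using n by (intro divide_right_mono mult_right_mono) auto
    qed
    finally have 2: "\<bar>F2 d \<rho> * \<xi>\<^sup>2 / 2 - 2 * F2 d \<rho> * s\<^sup>2\<bar> \<le> e / 2 * n" by simp
    have "F0 d (\<rho> + \<xi>) - (F0 d \<rho> + 2 * F1 d \<rho> * s + F1 d \<rho> * n + 2 * F2 d \<rho> * s\<^sup>2)
       = (F0 d (\<rho> + \<xi>) - F0 d \<rho> - F1 d \<rho> * \<xi> - F2 d \<rho> * \<xi>\<^sup>2 / 2) + (F2 d \<rho> * \<xi>\<^sup>2 / 2 - 2 * F2 d \<rho> * s\<^sup>2)"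
      unfolding \<xi>_def by (simp add: algebra_simps)
    with 1 2 show "\<bar>phi d (norm (x + z)) - (phi d (norm x) + 2 * F1 d ((norm x)\<^sup>2) * (x \<bullet> z) + F1 d ((norm x)\<^sup>2) * (norm z)\<^sup>2 + 2 * F2 d ((norm x)\<^sup>2) * (x \<bullet> z)\<^sup>2)\<bar> \<le> e * (norm z)\<^sup>2"
      unfolding p \<rho>_def[symmetric] s_def[symmetric] n_def[symmetric] by linarith
  qed
qed

end

section \<open>Growth of the harmonic function and comparison with H\<close>

definition ell :: "nat \<Rightarrow> real \<Rightarrow> real" where
  "ell d r = (if d \<ge> 3 then 1 else if d = 2 then Logf r else r)"

lemma Logf_ge_1: "r \<ge> 1 \<Longrightarrow> Logf r \<ge> 1"
proof -
  assume "r \<ge> 1"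
  hence "exp 1 \<le> exp 1 - 1 + r" by simp
  hence "ln (exp 1) \<le> ln (exp 1 - 1 + r)" by (intro ln_mono) auto
  thus ?thesis by (simp add: Logf_def)
qed

lemma Logf_bounds:
  assumes r: "r \<ge> 1"
  shows "ln r \<le> Logf r" "Logf r \<le> 1 + ln r"
proof -
  have e: "exp 1 > (1::real)" by simp
  show "ln r \<le> Logf r" unfolding Logf_def using r e by (intro ln_mono) linarith+
  have "exp 1 - 1 + r \<le> exp 1 * r"
  proof -
    have "0 \<le> (exp 1 - 1) * (r - 1)" using r e by (intro mult_nonneg_nonneg) linarith+
    thus ?thesis by (simp add: algebra_simps)
  qed
  hence "ln (exp 1 - 1 + r) \<le> ln (exp 1 * r)" using r e by (intro ln_mono) linarith+
  thus "Logf r \<le> 1 + ln r" unfolding Logf_def using r by (simp add: ln_mult)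
qed

lemma ell_ge_1: "r \<ge> 1 \<Longrightarrow> ell d r \<ge> 1"
  by (simp add: ell_def Logf_ge_1)

text \<open>The logarithmic case is \<open>ln l \<le> l - 1\<close> combined with
  \<open>Logf r \<ge> 1\<close>. Dimension one attains equality.\<close>

lemma ell_mult_le:
  assumes r: "r \<ge> 1" and l: "l \<ge> 1"
  shows "ell d (l * r) \<le> l * ell d r"
proof -
  have "Logf (l * r) \<le> l * Logf r"
  proof -
    have e: "exp 1 > (1::real)" by simp
    have "exp 1 - 1 + l * r \<le> l * (exp 1 - 1 + r)"
    proof -
      have "0 \<le> (l - 1) * (exp 1 - 1)" using l e by (intro mult_nonneg_nonneg) linarith+
      thus ?thesis by (simp add: algebra_simps)
    qed
    moreover have "0 < exp 1 - 1 + l * r"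
    proof -
      have "0 \<le> l * r" using r l by simp
      thus ?thesis using e by linarith
    qed
    ultimately have "Logf (l * r) \<le> ln (l * (exp 1 - 1 + r))" unfolding Logf_def by (rule ln_mono)
    also have "\<dots> = ln l + Logf r"
    proof -
      have "exp 1 - 1 + r > 0" using r e by linarith
      thus ?thesis unfolding Logf_def using l by (simp add: ln_mult)
    qed
    also have "\<dots> \<le> (l - 1) * 1 + Logf r" using ln_le_minus_one[of l] l by simp
    also have "\<dots> \<le> (l - 1) * Logf r + Logf r" using Logf_ge_1[OF r] l by (intro add_right_mono mult_left_mono) auto
    finally show ?thesis by (simp add: algebra_simps)
  qed
  thus ?thesis using l by (simp add: ell_def)
qed

context inv_pot begin

text \<open>For \<open>r \<le> 1\<close> the argument
  \<open>s = sqrt cc * r powr (- \<beta>)\<close> is at least \<open>sqrt cc\<close>, so both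
  Laplace bounds apply; their common right side equals \<open>hfun\<close> up to the constant
  \<open>A\<close>.\<close>

lemma phi_near:
  obtains k K where "k > 0" "K > 0" "\<And>r. 0 < r \<Longrightarrow> r \<le> 1 \<Longrightarrow> k * hfun d \<beta> \<kappa> r \<le> phi d r"
    "\<And>r. 0 < r \<Longrightarrow> r \<le> 1 \<Longrightarrow> phi d r \<le> K * hfun d \<beta> \<kappa> r"
proof -
  have sc: "sqrt cc > 0" using cc_pos by simp
  obtain k where k: "k > 0" "\<And>s. s \<ge> sqrt cc \<Longrightarrow> k * (s powr (nu d - 1 / 2) * exp (- 2 * s)) \<le> bessel_I (nu d) (s\<^sup>2)"
    using bessel_I_lower[OF sc, of "nu d"] by metis
  obtain K where K: "K > 0" "\<And>s. s \<ge> sqrt cc \<Longrightarrow> bessel_I (nu d) (s\<^sup>2) \<le> K * (s powr (nu d - 1 / 2) * exp (- 2 * s))"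
    using bessel_I_upper[OF sc, of "nu d"] by metis
  define A where "A = sqrt cc powr (nu d - 1 / 2)"
  have A: "A > 0" using sc by (simp add: A_def)
  have eq: "phi d r = bessel_I (nu d) ((sqrt cc * r powr (- \<beta>))\<^sup>2) \<and> sqrt cc * r powr (- \<beta>) \<ge> sqrt cc \<and>
     (sqrt cc * r powr (- \<beta>)) powr (nu d - 1 / 2) * exp (- 2 * (sqrt cc * r powr (- \<beta>))) = A * hfun d \<beta> \<kappa> r"
    if r: "0 < r" "r \<le> 1" for r
  proof (intro conjI)
    have "(r\<^sup>2) powr (- \<beta>) = (r powr (- \<beta>))\<^sup>2" using r by (simp add: power2_eq_square powr_mult)
    thus "phi d r = bessel_I (nu d) ((sqrt cc * r powr (- \<beta>))\<^sup>2)"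
      using r cc_pos by (simp add: phi_def F0_def power_mult_distrib)
    have "1 powr (- \<beta>) \<le> r powr (- \<beta>)" using r beta by (intro powr_mono2') auto
    hence "sqrt cc * 1 \<le> sqrt cc * r powr (- \<beta>)" using sc by (intro mult_left_mono) auto
    thus "sqrt cc * r powr (- \<beta>) \<ge> sqrt cc" by simp
    have e: "- \<beta> * (nu d - 1 / 2) = - (real d - 2 - \<beta>) / 2" using beta by (simp add: nu_def field_simps)
    have s: "2 * sqrt cc = sqrt \<kappa> / \<beta>" using beta by (simp add: cc_def real_sqrt_divide real_sqrt_mult)
    have "- 2 * (sqrt cc * r powr (- \<beta>)) = - sqrt \<kappa> / (\<beta> * r powr \<beta>)"
    proof -
      have "- 2 * (sqrt cc * r powr (- \<beta>)) = - ((2 * sqrt cc) * r powr (- \<beta>))" by simp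
      also have "\<dots> = - sqrt \<kappa> / (\<beta> * r powr \<beta>)" unfolding s using r by (simp add: powr_minus_divide)
      finally show ?thesis .
    qed
    moreover have "(sqrt cc * r powr (- \<beta>)) powr (nu d - 1 / 2) = A * r powr (- (real d - 2 - \<beta>) / 2)"
      using r sc powr_mult[of "sqrt cc" "r powr (- \<beta>)" "nu d - 1 / 2"] powr_powr[of r "- \<beta>" "nu d - 1 / 2", unfolded e] by (simp add: A_def)
    ultimately show "(sqrt cc * r powr (- \<beta>)) powr (nu d - 1 / 2) * exp (- 2 * (sqrt cc * r powr (- \<beta>))) = A * hfun d \<beta> \<kappa> r"
      using r by (simp add: hfun_def min_def)
  qed
  show thesis
  proof (rule that[of "k * A" "K * A"])
    fix r :: real assume r: "0 < r" "r \<le> 1"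
    show "k * A * hfun d \<beta> \<kappa> r \<le> phi d r" "phi d r \<le> K * A * hfun d \<beta> \<kappa> r"
      using eq[OF r] k(2)[of "sqrt cc * r powr (- \<beta>)"] K(2)[of "sqrt cc * r powr (- \<beta>)"] by (auto simp: mult.assoc)
  qed (use k K A in auto)
qed

text \<open>In dimension two \<open>nu\<close> is 0. In the logarithmic variable
  \<open>u = ln \<rho>\<close> the derivative is \<open>\<beta> * bessel_I 1 w\<close>, because the
  recurrence at order 1 has no middle term; it lies between positive constants, so growth is linear
  in \<open>ln r\<close>.\<close>

lemma phi_far_2:
  obtains k K where "k > 0" "K > 0" "\<And>r. r \<ge> 1 \<Longrightarrow> k * Logf r \<le> phi 2 r" "\<And>r. r \<ge> 1 \<Longrightarrow> phi 2 r \<le> K * Logf r"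
proof -
  obtain C where C: "C > 0" "\<And>w. w > 0 \<Longrightarrow> bessel_I 1 w \<le> C" by (rule bessel_I_bounded[of 1]) auto
  define c where "c = bessel_I 1 cc"
  have c: "c > 0" unfolding c_def by (rule bessel_I_pos[OF cc_pos])
  define g where "g u = F0 2 (exp u)" for u
  have dg: "(g has_real_derivative exp u * F1 2 (exp u)) (at u)" for u
    unfolding g_def using DERIV_chain2[OF F_DERIV(1)[of "exp u" 2] DERIV_exp] by (simp add: mult.commute)
  have bd: "\<beta> * c \<le> exp u * F1 2 (exp u) \<and> exp u * F1 2 (exp u) \<le> \<beta> * C" if u: "u \<ge> 0" for u
  proof -
    define w where "w = cc * exp u powr (- \<beta>)"
    have w: "w > 0" "w \<le> cc"
    proof -
      show "w > 0" using cc_pos by (simp add: w_def)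
      have "exp u powr (- \<beta>) \<le> 1" using u beta by (simp add: powr_def)
      thus "w \<le> cc" unfolding w_def using cc_pos by (simp add: mult_left_le)
    qed
    have "exp u * exp u powr (- \<beta> - 1) = exp u powr (- \<beta>)" using powr_mult_base[of "exp u" "- \<beta> - 1"] by simp
    hence "exp u * F1 2 (exp u) = \<beta> * (w * bessel_I (0 - 1) w)"
      by (simp add: F1_def nu_def w_def mult_ac)
    also have "w * bessel_I (0 - 1) w = bessel_I 1 w" using bessel_I_recurrence[OF w(1), of 1] by simp
    finally show ?thesis using C(2)[OF w(1)] bessel_I_antimono[OF w, of 1] beta by (simp add: c_def)
  qed
  have grow: "g 0 + \<beta> * c * u \<le> g u \<and> g u \<le> g 0 + \<beta> * C * u" if u: "u \<ge> 0" for u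
  proof (cases "u = 0")
    case False
    hence "0 < u" using u by simp
    from MVT2[OF this dg] obtain z where z: "0 < z" "z < u" "g u - g 0 = u * (exp z * F1 2 (exp z))" by auto
    have "u * (\<beta> * c) \<le> u * (exp z * F1 2 (exp z))" "u * (exp z * F1 2 (exp z)) \<le> u * (\<beta> * C)"
      using z bd[of z] u by (auto intro!: mult_left_mono)
    moreover have "\<beta> * c * u = u * (\<beta> * c)" "\<beta> * C * u = u * (\<beta> * C)" by simp_all
    ultimately show ?thesis using z(3) by linarith
  qed simp
  have g0: "g 0 > 0" by (simp add: g_def F0_pos)
  have pg: "phi 2 r = g (2 * ln r)" if "r \<ge> 1" for r
  proof -
    have "exp (2 * ln r) = r\<^sup>2" using that exp_double[of "ln r"] by simp
    thus ?thesis using that by (simp add: phi_def g_def)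
  qed
  define k where "k = min (g 0) (2 * (\<beta> * c))"
  have k: "k > 0" using g0 beta c by (simp add: k_def)
  have K: "g 0 + 2 * (\<beta> * C) > 0" using g0 beta C by (simp add: add_pos_pos)
  show thesis
  proof (rule that[OF k K])
    fix r :: real assume r: "r \<ge> 1"
    have l: "ln r \<ge> 0" using r by simp
    have "k * Logf r \<le> k * (1 + ln r)" using Logf_bounds[OF r] k by (intro mult_left_mono) auto
    also have "\<dots> = k + k * ln r" by (simp add: distrib_left)
    also have "\<dots> \<le> g 0 + (2 * (\<beta> * c)) * ln r" using l by (intro add_mono mult_right_mono) (auto simp: k_def)
    also have "\<dots> \<le> phi 2 r" unfolding pg[OF r] using grow[of "2 * ln r"] l by (simp add: mult_ac)
    finally show "k * Logf r \<le> phi 2 r" .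
    have "phi 2 r \<le> g 0 * 1 + (2 * (\<beta> * C)) * ln r" unfolding pg[OF r] using grow[of "2 * ln r"] l by (simp add: mult_ac)
    also have "\<dots> \<le> g 0 * Logf r + (2 * (\<beta> * C)) * Logf r" using Logf_bounds[OF r] Logf_ge_1[OF r] g0 C beta
      by (intro add_mono mult_left_mono) auto
    finally show "phi 2 r \<le> (g 0 + 2 * (\<beta> * C)) * Logf r" by (simp add: distrib_right)
  qed
qed

text \<open>As \<open>r\<close> grows, \<open>w\<close> tends to 0 and the sign of
  \<open>nu d\<close> decides: boundedness for positive order, a logarithm for order 0, and in
  dimension one \<open>w powr nu d\<close>, which is proportional to \<open>r\<close>.\<close>

lemma phi_far:
  assumes d: "d \<ge> 1"
  obtains k K where "k > 0" "K > 0" "\<And>r. r \<ge> 1 \<Longrightarrow> k * ell d r \<le> phi d r" "\<And>r. r \<ge> 1 \<Longrightarrow> phi d r \<le> K * ell d r"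
proof -
  consider "d \<ge> 3" | "d = 2" | "d = 1" using d by linarith
  thus thesis
  proof cases
    case 1
    hence "nu d > 0" using beta by (simp add: nu_def)
    then obtain C where C: "C > 0" "\<And>w. w > 0 \<Longrightarrow> bessel_I (nu d) w \<le> C" using bessel_I_bounded by metis
    show thesis
    proof (rule that[of "phi d 1" C])
      fix r :: real assume r: "r \<ge> 1"
      show "phi d 1 * ell d r \<le> phi d r" using phi_mono[OF r, of d] 1 by (simp add: ell_def)
      show "phi d r \<le> C * ell d r" using C(2)[of "cc * (r\<^sup>2) powr (- \<beta>)"] r 1 cc_pos by (simp add: ell_def phi_def F0_def)
    qed (use C phi_pos[of 1 d] in auto)
  next
    case 2
    show thesis
    proof (rule phi_far_2)
      fix k K assume "k > 0" "K > 0" "\<And>r. r \<ge> 1 \<Longrightarrow> k * Logf r \<le> phi 2 r" "\<And>r. r \<ge> 1 \<Longrightarrow> phi 2 r \<le> K * Logf r"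
      thus thesis using that[of k K] 2 by (simp add: ell_def)
    qed
  next
    case 3
    have "nu d < 0" using 3 beta by (auto simp: nu_def divide_neg_pos)
    hence n: "nu d < 0" "nu d \<le> 1" by auto
    obtain C where C: "C > 0" "\<And>w. w > 0 \<Longrightarrow> bessel_I (nu d) w \<le> C * w powr nu d" using bessel_I_neg_upper[OF n(1)] by metis
    obtain k where k: "k > 0" "\<And>w. 0 < w \<Longrightarrow> w \<le> cc \<Longrightarrow> k * w powr nu d \<le> bessel_I (nu d) w" using bessel_I_neg_lower[OF n(2) cc_pos] by metis
    define A where "A = cc powr nu d"
    have A: "A > 0" using cc_pos by (simp add: A_def)
    show thesis
    proof (rule that[of "k * A" "C * A"])
      fix r :: real assume r: "r \<ge> 1"
      define w where "w = cc * (r\<^sup>2) powr (- \<beta>)"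
      have w: "w > 0" using r cc_pos by (simp add: w_def)
      have "(r\<^sup>2) powr (- \<beta>) \<le> 1 powr (- \<beta>)" using r beta by (intro powr_mono2') auto
      hence wc: "w \<le> cc" unfolding w_def using cc_pos by (simp add: mult_left_le)
      have "(r\<^sup>2) powr (- \<beta>) = r powr (2 * (- \<beta>))"
        using r powr_powr[of r 2 "- \<beta>"] by (simp add: powr_numeral)
      hence "w powr nu d = A * r powr (2 * (- \<beta>) * nu d)" using r cc_pos by (simp add: w_def A_def powr_mult powr_powr)
      also have "2 * (- \<beta>) * nu d = 1" using 3 beta by (simp add: nu_def)
      finally have wn: "w powr nu d = A * r" using r by simp
      have p: "phi d r = bessel_I (nu d) w" using r by (simp add: phi_def F0_def w_def)
      show "k * A * ell d r \<le> phi d r" using k(2)[OF w wc] 3 unfolding wn p by (simp add: ell_def mult.assoc)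
      show "phi d r \<le> C * A * ell d r" using C(2)[OF w] 3 unfolding wn p by (simp add: ell_def mult.assoc)
    qed (use C k A in auto)
  qed
qed

text \<open>At most linear growth under dilation. From radius 1 on this is inherited from
  \<open>ell\<close>; between \<open>r0\<close> and 1 the monotone \<open>phi\<close> varies by a
  bounded factor, which is \<open>B\<close>.\<close>

lemma phi_growth:
  assumes d: "d \<ge> 1" and r0: "r0 > 0"
  obtains C where "C \<ge> 1" "\<And>r l. r \<ge> r0 \<Longrightarrow> l \<ge> 1 \<Longrightarrow> phi d (l * r) \<le> C * l * phi d r"
proof -
  obtain k K where kK: "k > 0" "K > 0" "\<And>r. r \<ge> 1 \<Longrightarrow> k * ell d r \<le> phi d r" "\<And>r. r \<ge> 1 \<Longrightarrow> phi d r \<le> K * ell d r"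
    using phi_far[OF d] by metis
  define r1 where "r1 = min r0 1"
  have r1: "r1 > 0" "r1 \<le> 1" "r1 \<le> r0" using r0 by (auto simp: r1_def)
  define A where "A = max 1 (K / k)"
  define B where "B = phi d 1 / phi d r1"
  have B: "B \<ge> 1" unfolding B_def using phi_mono[OF r1(2), of d] phi_pos[OF r1(1), of d] by simp
  have A: "A \<ge> 1" "A * k \<ge> K" using kK by (auto simp: A_def max_def field_simps)
  have big: "phi d (l * r) \<le> A * l * phi d r" if "r \<ge> 1" "l \<ge> 1" for r l
  proof -
    have "l * r \<ge> 1" using that by (metis mult_mono' mult_1 zero_le_one)
    hence "phi d (l * r) \<le> K * ell d (l * r)" by (rule kK)
    also have "\<dots> \<le> K * (l * ell d r)" using ell_mult_le[OF that, of d] kK by (intro mult_left_mono) auto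
    also have "\<dots> \<le> (A * k) * (l * ell d r)" using A that ell_ge_1[OF that(1), of d] by (intro mult_right_mono) auto
    also have "\<dots> = A * l * (k * ell d r)" by simp
    also have "\<dots> \<le> A * l * phi d r" using kK(3)[OF that(1)] A that by (intro mult_left_mono) auto
    finally show ?thesis .
  qed
  show thesis
  proof (rule that[of "A * B"])
    show "1 \<le> A * B" using A B by (metis mult_mono' mult_1 zero_le_one)
    fix r l :: real assume r: "r \<ge> r0" and l: "l \<ge> 1"
    show "phi d (l * r) \<le> A * B * l * phi d r"
    proof (cases "r \<ge> 1")
      case True
      have "phi d (l * r) \<le> A * l * phi d r" by (rule big[OF True l])
      also have "\<dots> \<le> B * (A * l * phi d r)" using B A l mult_right_mono[of 1 B "A * l * phi d r"] by simp
      finally show ?thesis by (simp add: mult_ac)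
    next
      case False
      have "phi d (l * r) \<le> phi d (l * 1)" using False l by (intro phi_mono mult_left_mono) auto
      also have "\<dots> \<le> A * l * phi d 1" by (rule big[OF _ l]) simp
      also have "phi d 1 = B * phi d r1" using phi_pos[OF r1(1), of d] by (simp add: B_def)
      also have "A * l * (B * phi d r1) \<le> A * l * (B * phi d r)" using A B l r1 r by (intro mult_left_mono phi_mono) auto
      finally show ?thesis by (simp add: mult_ac)
    qed
  qed
qed

text \<open>Near the origin \<open>x = r powr (- \<beta>)\<close> is at least 1 and dominates both
  constants and \<open>ln x\<close>, so the prefactor and the power in \<open>hfun\<close> can be
  absorbed into the exponential by enlarging \<open>A\<close>.\<close>

lemma phi_lower_exp:
  obtains A where "A > 0" "\<And>r. 0 < r \<Longrightarrow> r \<le> 1 \<Longrightarrow> exp (- A * r powr (- \<beta>)) \<le> phi d r"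
proof -
  obtain k K where k: "k > 0" "\<And>r. 0 < r \<Longrightarrow> r \<le> 1 \<Longrightarrow> k * hfun d \<beta> \<kappa> r \<le> phi d r"
    using phi_near[of d] by metis
  define p where "p = max 0 (- (real d - 2 - \<beta>) / 2)"
  define A where "A = \<bar>ln k\<bar> + p / \<beta> + sqrt \<kappa> / \<beta>"
  have A: "A > 0" using beta kappa by (simp add: A_def p_def add_nonneg_pos)
  show thesis
  proof (rule that[OF A])
    fix r :: real assume r: "0 < r" "r \<le> 1"
    define x where "x = r powr (- \<beta>)"
    have x: "x \<ge> 1" unfolding x_def using powr_mono2'[of "- \<beta>" r 1] r beta by simp
    have "exp (- \<bar>ln k\<bar> * x) \<le> exp (ln k)"
    proof -
      have "\<bar>ln k\<bar> * 1 \<le> \<bar>ln k\<bar> * x" using x by (intro mult_left_mono) auto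
      thus ?thesis by simp
    qed
    hence 1: "exp (- \<bar>ln k\<bar> * x) \<le> k" using k by simp
    have "exp (- (p / \<beta>) * x) \<le> r powr p"
    proof -
      have "ln x \<le> x" using ln_le_minus_one[of x] x by linarith
      moreover have "ln x = - \<beta> * ln r" using r by (simp add: x_def ln_powr)
      ultimately have "- (1 / \<beta>) * x \<le> ln r" using beta by (simp add: field_simps)
      hence "p * (- (1 / \<beta>) * x) \<le> p * ln r" by (intro mult_left_mono) (auto simp: p_def)
      thus ?thesis using r by (simp add: powr_def)
    qed
    also have "r powr p \<le> r powr (- (real d - 2 - \<beta>) / 2)" using r by (intro powr_mono') (auto simp: p_def)
    finally have 2: "exp (- (p / \<beta>) * x) \<le> r powr (- (real d - 2 - \<beta>) / 2)" .
    have 3: "- sqrt \<kappa> / (\<beta> * r powr \<beta>) = - (sqrt \<kappa> / \<beta>) * x" using r by (simp add: x_def powr_minus_divide)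
    have "exp (- A * x) = exp (- \<bar>ln k\<bar> * x) * (exp (- (p / \<beta>) * x) * exp (- (sqrt \<kappa> / \<beta>) * x))"
      by (simp add: A_def exp_add[symmetric] algebra_simps)
    also have "\<dots> \<le> k * (r powr (- (real d - 2 - \<beta>) / 2) * exp (- (sqrt \<kappa> / \<beta>) * x))"
      using 1 2 k by (intro mult_mono) auto
    also have "\<dots> = k * hfun d \<beta> \<kappa> r"
    proof -
      have "min r 1 = r" using r by simp
      thus ?thesis unfolding hfun_def by (simp only: 3)
    qed
    also have "\<dots> \<le> phi d r" by (rule k(2)[OF r])
    finally show "exp (- A * r powr (- \<beta>)) \<le> phi d r" by (simp add: x_def)
  qed
qed

text \<open>A form of \<open>H\<close> common to all dimensions:
  \<open>phi d r / phi d (sqrt t)\<close> inside the parabolic ball and 1 outside it.\<close>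

definition mfun :: "nat \<Rightarrow> real \<Rightarrow> real \<Rightarrow> real" where
  "mfun d t r = min 1 (phi d r / phi d (sqrt t))"

lemma Hfun_mfun:
  assumes d: "d \<ge> 1"
  obtains k K where "k > 0" "K > 0" "\<And>t r. t \<ge> 1 \<Longrightarrow> r > 0 \<Longrightarrow> k * Hfun d \<beta> \<kappa> t r \<le> mfun d t r"
    "\<And>t r. t \<ge> 1 \<Longrightarrow> r > 0 \<Longrightarrow> mfun d t r \<le> K * Hfun d \<beta> \<kappa> t r"
proof -
  obtain k1 K1 where n: "k1 > 0" "K1 > 0" "\<And>r. 0 < r \<Longrightarrow> r \<le> 1 \<Longrightarrow> k1 * hfun d \<beta> \<kappa> r \<le> phi d r"
    "\<And>r. 0 < r \<Longrightarrow> r \<le> 1 \<Longrightarrow> phi d r \<le> K1 * hfun d \<beta> \<kappa> r"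
    using phi_near[of d] by metis
  obtain k2 K2 where f: "k2 > 0" "K2 > 0" "\<And>r. r \<ge> 1 \<Longrightarrow> k2 * ell d r \<le> phi d r" "\<And>r. r \<ge> 1 \<Longrightarrow> phi d r \<le> K2 * ell d r"
    using phi_far[OF d] by metis
  define H1 where "H1 = hfun d \<beta> \<kappa> 1"
  have H1: "H1 > 0" by (simp add: H1_def hfun_def)
  define g where "g r = (if r < 1 then hfun d \<beta> \<kappa> r else if d \<ge> 3 then H1 else ell d r)" for r
  have h0: "hfun d \<beta> \<kappa> r \<ge> 0" for r by (simp add: hfun_def)
  define k3 where "k3 = min k1 (if d \<ge> 3 then k2 / H1 else k2)"
  define K3 where "K3 = max K1 (if d \<ge> 3 then K2 / H1 else K2)"
  have k3: "k3 > 0" and K3: "K3 > 0" using n f H1 by (auto simp: k3_def K3_def)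
  have g0: "g r \<ge> 0" if "r > 0" for r using h0[of r] H1 ell_ge_1[of r d] by (auto simp: g_def)
  have g: "k3 * g r \<le> phi d r \<and> phi d r \<le> K3 * g r" if r: "r > 0" for r
  proof (cases "r < 1")
    case True
    have "k3 * g r \<le> k1 * g r" "K1 * g r \<le> K3 * g r" using g0[OF r] by (auto simp: k3_def K3_def intro!: mult_right_mono)
    thus ?thesis using n(3,4)[OF r] True by (auto simp: g_def)
  next
    case False
    define c where "c = (if d \<ge> 3 then H1 else 1)"
    have c: "c > 0" using H1 by (simp add: c_def)
    have ge: "g r = c * ell d r" using False by (simp add: g_def c_def ell_def)
    have kc: "k3 \<le> k2 / c" "K2 / c \<le> K3" by (auto simp: k3_def K3_def c_def)
    have "k3 * g r \<le> k2 / c * g r" "K2 / c * g r \<le> K3 * g r" using kc by (auto intro!: mult_right_mono[OF _ g0[OF r]] simp del: times_divide_eq_left)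
    thus ?thesis using f(3,4)[of r] False c by (auto simp: ge)
  qed
  define L where "L t = (if d \<ge> 3 then 1 else ell d (sqrt t))" for t
  have Leq: "L t = ell d (sqrt t)" for t by (simp add: L_def ell_def)
  have L: "k2 * L t \<le> phi d (sqrt t) \<and> phi d (sqrt t) \<le> K2 * L t \<and> L t > 0 \<and> phi d (sqrt t) > 0" if "t \<ge> 1" for t
    using f(3,4)[of "sqrt t"] ell_ge_1[of "sqrt t" d] phi_pos[of "sqrt t" d] that by (auto simp: Leq)
  have H: "Hfun d \<beta> \<kappa> t r = (if d \<ge> 3 then g r else min 1 (g r / L t))" if "r > 0" for t r
  proof -
    have "hfun d \<beta> \<kappa> r = H1" if "\<not> r < 1" using that by (simp add: H1_def hfun_def min_def)
    thus ?thesis using d by (auto simp: Hfun_def g_def L_def ell_def H1_def)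
  qed
  \<comment> \<open>For \<open>d \<ge> 3\<close> the function \<open>Hfun\<close> contains no
    minimum with 1. Since \<open>g\<close> is bounded, introducing the minimum costs only a
    constant.\<close>
  have gb: "g r \<le> max H1 (K2 * 1 / k3)" if "r > 0" "d \<ge> 3" for r
  proof (cases "r < 1")
    case True
    have "k3 * g r \<le> phi d 1" using g[OF that(1)] phi_mono[of r 1 d] True by linarith
    also have "phi d 1 \<le> K2" using f(4)[of 1] that by (simp add: ell_def)
    finally have "g r \<le> K2 * 1 / k3" using k3 by (simp add: field_simps)
    thus ?thesis by simp
  qed (use that in \<open>auto simp: g_def\<close>)
  define D where "D = max H1 (K2 * 1 / k3)"
  have D: "D > 0" using H1 by (simp add: D_def)
  have minle: "min 1 a \<le> c * min 1 b" if "a \<le> c * b" "c \<ge> 1" "b \<ge> 0" for a b c :: real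
    using that by (auto simp: min_def mult_le_cancel_right1)
  define C where "C = max 1 (max (K3 / k2) (K2 / k3))"
  have C: "C \<ge> 1" "K3 / k2 \<le> C" "K2 / k3 \<le> C" by (auto simp: C_def)
  have le1: "phi d r / phi d (sqrt t) \<le> C * (g r / L t)" if "t \<ge> 1" "r > 0" for t r
  proof -
    have "phi d r / phi d (sqrt t) \<le> (K3 * g r) / (k2 * L t)"
      using g[OF that(2)] L[OF that(1)] f K3 g0[OF that(2)] by (intro frac_le) auto
    also have "\<dots> = K3 / k2 * (g r / L t)" by simp
    also have "\<dots> \<le> C * (g r / L t)" using C g0[OF that(2)] L[OF that(1)] by (intro mult_right_mono) auto
    finally show ?thesis .
  qed
  have le2: "g r / L t \<le> C * (phi d r / phi d (sqrt t))" if "t \<ge> 1" "r > 0" for t r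
  proof -
    have "(k3 * g r) / (K2 * L t) \<le> phi d r / phi d (sqrt t)"
      using g[OF that(2)] L[OF that(1)] f K3 g0[OF that(2)] by (intro frac_le) auto
    hence "K2 / k3 * ((k3 * g r) / (K2 * L t)) \<le> K2 / k3 * (phi d r / phi d (sqrt t))" using f k3 by (intro mult_left_mono) auto
    also have "K2 / k3 * ((k3 * g r) / (K2 * L t)) = g r / L t" using f k3 by simp
    also have "K2 / k3 * (phi d r / phi d (sqrt t)) \<le> C * (phi d r / phi d (sqrt t))" using C by (intro mult_right_mono) auto
    finally show ?thesis .
  qed
  show thesis
  proof (rule that[of "1 / (C * max 1 D)" C])
    fix t r :: real assume t: "t \<ge> 1" and r: "r > 0"
    have q0: "phi d r / phi d (sqrt t) \<ge> 0" "g r / L t \<ge> 0" using g0[OF r] L[OF t] by auto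
    have m1: "min 1 (g r / L t) \<le> C * mfun d t r" unfolding mfun_def using le2[OF t r] C q0 by (intro minle) auto
    have m2: "mfun d t r \<le> C * min 1 (g r / L t)" unfolding mfun_def using le1[OF t r] C q0 by (intro minle) auto
    have m3: "min 1 (g r / L t) \<le> Hfun d \<beta> \<kappa> t r" unfolding H[OF r] by (auto simp: L_def)
    show "mfun d t r \<le> C * Hfun d \<beta> \<kappa> t r" using m2 m3 C by (meson mult_left_mono order_trans zero_le_one)
    have "Hfun d \<beta> \<kappa> t r \<le> max 1 D * min 1 (g r / L t)"
    proof (cases "d \<ge> 3")
      case True
      have "g r \<le> max 1 D * min 1 (g r)" using gb[OF r True] g0[OF r] by (auto simp: D_def min_def mult_le_cancel_right1)
      thus ?thesis using True by (simp add: H[OF r] L_def)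
    next
      case False
      have "0 \<le> min 1 (g r / L t)" using q0 by simp
      hence "1 * min 1 (g r / L t) \<le> max 1 D * min 1 (g r / L t)" by (intro mult_right_mono) auto
      thus ?thesis using False by (simp add: H[OF r])
    qed
    also have "\<dots> \<le> max 1 D * (C * mfun d t r)" using m1 by (intro mult_left_mono) auto
    finally show "1 / (C * max 1 D) * Hfun d \<beta> \<kappa> t r \<le> mfun d t r" using C by (simp add: field_simps)
  qed (use C in auto)
qed

end

section \<open>Barriers\<close>

text \<open>Truncating negative values can only increase the integral. This lets signed lower
  barriers enter estimates in \<open>ennreal\<close>.\<close>

lemma ennreal_integral_le_nn_integral:
  assumes "integrable M f"
  shows "ennreal (\<integral>x. f x \<partial>M) \<le> (\<integral>\<^sup>+ x. ennreal (f x) \<partial>M)"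
proof -
  have i: "integrable M (\<lambda>x. max 0 (f x))" using assms by auto
  have "ennreal (\<integral>x. f x \<partial>M) \<le> ennreal (\<integral>x. max 0 (f x) \<partial>M)"
    using assms i by (intro ennreal_leI Bochner_Integration.integral_mono) auto
  also have "\<dots> = (\<integral>\<^sup>+ x. ennreal (max 0 (f x)) \<partial>M)" using i by (subst nn_integral_eq_integral) auto
  also have "\<dots> = (\<integral>\<^sup>+ x. ennreal (f x) \<partial>M)" by (intro nn_integral_cong) (auto simp: max_def ennreal_neg)
  finally show ?thesis .
qed

text \<open>Outside a ball of radius \<open>\<eta>\<close> every lower power is a multiple of the
  fourth, so one quartic term makes a local expansion global.\<close>

lemma powers_far:
  fixes r \<eta> :: real
  assumes "\<eta> > 0" "r > \<eta>"
  shows "1 \<le> r ^ 4 / \<eta> ^ 4" "r \<le> r ^ 4 / \<eta> ^ 3" "r\<^sup>2 \<le> r ^ 4 / \<eta>\<^sup>2"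
proof -
  have p: "\<eta> ^ k \<le> r ^ k" for k using assms by (intro power_mono) auto
  have r: "r > 0" using assms by linarith
  show "1 \<le> r ^ 4 / \<eta> ^ 4" using p[of 4] assms by simp
  show "r \<le> r ^ 4 / \<eta> ^ 3" using p[of 3] assms r by (simp add: pos_le_divide_eq power4_eq_xxxx power3_eq_cube)
  show "r\<^sup>2 \<le> r ^ 4 / \<eta>\<^sup>2" using p[of 2] assms r by (simp add: pos_le_divide_eq power4_eq_xxxx power2_eq_square)
qed

text \<open>One Gaussian step multiplies the harmonic function by about \<open>1 + y\<close> with
  \<open>y = \<delta> * pot x\<close>, and the killing multiplies it by \<open>exp (- y)\<close>.
  The product lies between \<open>1 - y\<^sup>2\<close> and 1, which makes \<open>phi\<close> an
  approximate fixed point of a step.\<close>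

lemma exp_mult_one_plus_le: "exp (- y) * (1 + y) \<le> (1::real)"
  using mult_left_mono[OF exp_ge_add_one_self[of y], of "exp (- y)"] by (simp add: exp_minus)

lemma exp_mult_one_plus_ge:
  fixes y :: real
  assumes "y \<ge> 0" shows "1 - y\<^sup>2 \<le> exp (- y) * (1 + y)"
  using mult_right_mono[OF exp_ge_add_one_self[of "- y"], of "1 + y"] assms by (simp add: power2_eq_square algebra_simps)

context inv_pot begin

lemma F1_nonneg: "\<rho> > 0 \<Longrightarrow> F1 d \<rho> \<ge> 0"
  unfolding F1_def using beta cc_pos bessel_I_nonneg by (intro mult_nonneg_nonneg) auto

lemma F_bounded:
  assumes a: "a > 0"
  obtains C where "C > 0" "\<And>\<rho>. \<rho> \<in> {a\<^sup>2..b\<^sup>2} \<Longrightarrow> \<bar>F1 d \<rho>\<bar> \<le> C" "\<And>\<rho>. \<rho> \<in> {a\<^sup>2..b\<^sup>2} \<Longrightarrow> \<bar>F2 d \<rho>\<bar> \<le> C"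
proof -
  have a2: "a\<^sup>2 > 0" using a by simp
  have "bounded (F1 d ` {a\<^sup>2..b\<^sup>2})" "bounded (F2 d ` {a\<^sup>2..b\<^sup>2})"
    using less_le_trans[OF a2] by (auto intro!: compact_imp_bounded compact_continuous_image continuous_on_subset[OF continuous_on_F(2)] continuous_on_subset[OF continuous_on_F(3)])
  then obtain A B where "A > 0" "\<forall>y\<in>F1 d ` {a\<^sup>2..b\<^sup>2}. norm y \<le> A" "B > 0" "\<forall>y\<in>F2 d ` {a\<^sup>2..b\<^sup>2}. norm y \<le> B"
    unfolding bounded_pos by blast
  thus thesis by (intro that[of "max A B"]) (auto simp: le_max_iff_disj)
qed

lemma phi_ode:
  fixes x :: "'a::euclidean_space"
  assumes "x \<noteq> 0"
  shows "2 * real d * F1 d ((norm x)\<^sup>2) + 4 * F2 d ((norm x)\<^sup>2) * (norm x)\<^sup>2 = pot x * phi d (norm x)"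
proof -
  have n: "norm x > 0" using assms by simp
  have e: "2 * (- \<beta> - 1) = - (2 + 2 * \<beta>)" by simp
  have "((norm x)\<^sup>2) powr (- \<beta> - 1) = norm x powr (- (2 + 2 * \<beta>))"
    using n powr_powr[of "norm x" 2 "- \<beta> - 1"] unfolding e by (simp add: powr_numeral)
  thus ?thesis using F_ode[of "(norm x)\<^sup>2" d] n by (simp add: pot_def phi_def algebra_simps)
qed

text \<open>The second-order Taylor polynomial, corrected by a multiple of \<open>|z|\<^sup>4\<close>, dominates globally; its
  Gaussian average is explicit.\<close>

lemma Gop_phi_upper:
  fixes dummy :: "'a::euclidean_space"
  assumes a: "a > 0" and ab: "a \<le> b" and bb: "b < b'" and A: "A \<ge> 0" and B: "B \<ge> 0" and e: "e > 0"
  obtains D where "D \<ge> 0"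
    "\<And>\<delta> (x::'a) r g. \<delta> > 0 \<Longrightarrow> a \<le> norm x \<Longrightarrow> norm x \<le> b \<Longrightarrow> g \<in> borel_measurable borel \<Longrightarrow> r \<ge> 0 \<Longrightarrow>
      (\<And>y. norm y < b' \<Longrightarrow> g y \<le> ennreal (A * phi DIM('a) (norm y) + r)) \<Longrightarrow> (\<And>y. g y \<le> ennreal (B + r)) \<Longrightarrow>
      Gop \<delta> g x \<le> ennreal (A * phi DIM('a) (norm x) * (1 + \<delta> * pot x) + r + e * \<delta> + D * \<delta>\<^sup>2)"
proof -
  let ?d = "DIM('a)"
  \<comment> \<open>The Gaussian mean of \<open>A * e' * (norm z)\<^sup>2\<close> is
    \<open>2 * real ?d * (A * e') * \<delta>\<close>, which must be at most
    \<open>e * \<delta>\<close>; \<open>A + 1\<close> keeps the divisor positive when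
    \<open>A = 0\<close>.\<close>
  define e' where "e' = e / (2 * real ?d * (A + 1))"
  have e': "e' > 0" "2 * real ?d * (A * e') \<le> e"
  proof -
    have P: "2 * real ?d * (A + 1) > 0" using A DIM_positive[where 'a = 'a] by (intro mult_pos_pos) auto
    show "e' > 0" unfolding e'_def using e P by (rule divide_pos_pos)
    hence "2 * real ?d * (A * e') \<le> 2 * real ?d * ((A + 1) * e')" by (intro mult_left_mono mult_right_mono) auto
    also have "\<dots> = 2 * real ?d * (A + 1) * e'" by simp
    also have "\<dots> = e" unfolding e'_def using P by (subst nonzero_mult_div_cancel_left[symmetric, of "2 * real ?d * (A + 1)"]) auto
    finally show "2 * real ?d * (A * e') \<le> e" .
  qed
  obtain \<eta>0 where h0: "\<eta>0 > 0" "\<And>x z :: 'a. a \<le> norm x \<Longrightarrow> norm x \<le> b \<Longrightarrow> norm z \<le> \<eta>0 \<Longrightarrow>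
      \<bar>phi ?d (norm (x + z)) - (phi ?d (norm x) + 2 * F1 ?d ((norm x)\<^sup>2) * (x \<bullet> z) + F1 ?d ((norm x)\<^sup>2) * (norm z)\<^sup>2 + 2 * F2 ?d ((norm x)\<^sup>2) * (x \<bullet> z)\<^sup>2)\<bar> \<le> e' * (norm z)\<^sup>2"
    using phi_taylor[OF a e'(1) ab, of ?d] by metis
  \<comment> \<open>Small increments must also stay below radius \<open>b'\<close>, where
    \<open>g\<close> is controlled by \<open>phi\<close>.\<close>
  define \<eta> where "\<eta> = min \<eta>0 ((b' - b) / 2)"
  have h: "\<eta> > 0" "\<eta> \<le> \<eta>0" "b + \<eta> < b'" using h0 bb by (auto simp: \<eta>_def min_def field_simps)
  obtain C0 where C0: "C0 > 0" "\<And>\<rho>. \<rho> \<in> {a\<^sup>2..b\<^sup>2} \<Longrightarrow> \<bar>F1 ?d \<rho>\<bar> \<le> C0" "\<And>\<rho>. \<rho> \<in> {a\<^sup>2..b\<^sup>2} \<Longrightarrow> \<bar>F2 ?d \<rho>\<bar> \<le> C0"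
    using F_bounded[OF a, of b ?d] by metis
  have b0: "b > 0" using a ab by simp
  \<comment> \<open>For large increments the first summand pays for the crude bound
    \<open>B\<close>, the other two for possibly negative linear and quadratic terms of the
    expansion.\<close>
  define C where "C = B / \<eta> ^ 4 + A * (2 * C0 * b / \<eta> ^ 3 + 2 * C0 * b\<^sup>2 / \<eta>\<^sup>2)"
  have C: "C \<ge> 0" using B A C0 b0 h by (simp add: C_def)
  define K4 where "K4 = 128 * 2 powr (real ?d / 2)"
  show thesis
  proof (rule that[of "C * K4"])
    show "C * K4 \<ge> 0" using C by (simp add: K4_def)
    fix \<delta> r :: real and x :: 'a and g :: "'a \<Rightarrow> ennreal"
    assume d: "\<delta> > 0" and x: "a \<le> norm x" "norm x \<le> b" and g [measurable]: "g \<in> borel_measurable borel" and r: "r \<ge> 0"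
      and g1: "\<And>y. norm y < b' \<Longrightarrow> g y \<le> ennreal (A * phi ?d (norm y) + r)" and g2: "\<And>y. g y \<le> ennreal (B + r)"
    define p q where "p = F1 ?d ((norm x)\<^sup>2)" and "q = F2 ?d ((norm x)\<^sup>2)"
    have x2: "(norm x)\<^sup>2 \<in> {a\<^sup>2..b\<^sup>2}" using x a by (auto intro: power_mono)
    have x0: "x \<noteq> 0" using x a by auto
    have p: "0 \<le> p" "p \<le> C0" "\<bar>q\<bar> \<le> C0" using C0(2,3)[OF x2] F1_nonneg[of "(norm x)\<^sup>2" ?d] x0 by (auto simp: p_def q_def)
    define Q where "Q z = (A * phi ?d (norm x) + r) + 2 * (A * p) * (x \<bullet> z) + (A * (p + e')) * (norm z)\<^sup>2 + 2 * (A * q) * (x \<bullet> z)\<^sup>2 + C * norm z ^ 4" for z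
    have Q: "(if norm z \<le> \<eta> then A * phi ?d (norm (x + z)) + r else B + r) \<le> Q z" for z
    proof (cases "norm z \<le> \<eta>")
      case True
      have "phi ?d (norm (x + z)) \<le> phi ?d (norm x) + 2 * p * (x \<bullet> z) + (p + e') * (norm z)\<^sup>2 + 2 * q * (x \<bullet> z)\<^sup>2"
        using h0(2)[OF x, of z] True h unfolding p_def q_def by (simp add: distrib_right abs_le_iff)
      hence "A * phi ?d (norm (x + z)) \<le> A * (phi ?d (norm x) + 2 * p * (x \<bullet> z) + (p + e') * (norm z)\<^sup>2 + 2 * q * (x \<bullet> z)\<^sup>2)" using A by (rule mult_left_mono)
      also have "\<dots> = Q z - r - C * norm z ^ 4" by (simp add: Q_def algebra_simps)
      finally have "A * phi ?d (norm (x + z)) + r \<le> Q z" using C by (smt (verit) mult_nonneg_nonneg zero_le_power norm_ge_zero)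
      thus ?thesis using True by simp
    next
      case False
      define n where "n = norm z"
      have n: "n > \<eta>" using False by (simp add: n_def)
      note pf = powers_far[OF h(1) n]
      have n0: "n > 0" using n h(1) by linarith
      have s: "\<bar>x \<bullet> z\<bar> \<le> b * n" unfolding n_def using Cauchy_Schwarz_ineq2[of x z] x(2) by (meson mult_right_mono norm_ge_zero order_trans)
      have s2: "(x \<bullet> z)\<^sup>2 \<le> b\<^sup>2 * n\<^sup>2" using power_mono[OF s, of 2] by (simp add: power_mult_distrib)
      have 1: "- (2 * C0 * b / \<eta> ^ 3 * n ^ 4) \<le> 2 * p * (x \<bullet> z)"
      proof -
        have "\<bar>2 * p * (x \<bullet> z)\<bar> \<le> 2 * C0 * (b * n)" unfolding abs_mult using p s C0 by (intro mult_mono) auto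
        also have "\<dots> \<le> 2 * C0 * (b * (n ^ 4 / \<eta> ^ 3))" using pf(2) C0 b0 by (intro mult_left_mono) auto
        finally show ?thesis by (simp add: abs_le_iff)
      qed
      have 2: "- (2 * C0 * b\<^sup>2 / \<eta>\<^sup>2 * n ^ 4) \<le> 2 * q * (x \<bullet> z)\<^sup>2"
      proof -
        have "\<bar>2 * q * (x \<bullet> z)\<^sup>2\<bar> \<le> 2 * C0 * (b\<^sup>2 * n\<^sup>2)" unfolding abs_mult using p s2 C0 by (intro mult_mono) auto
        also have "\<dots> \<le> 2 * C0 * (b\<^sup>2 * (n ^ 4 / \<eta>\<^sup>2))" using pf(3) C0 b0 by (intro mult_left_mono) auto
        finally show ?thesis by (simp add: abs_le_iff)
      qed
      have 3: "0 \<le> phi ?d (norm x) + (p + e') * n\<^sup>2" using p e' by simp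
      have "A * (- (2 * C0 * b / \<eta> ^ 3 * n ^ 4) - (2 * C0 * b\<^sup>2 / \<eta>\<^sup>2 * n ^ 4)) \<le> A * (phi ?d (norm x) + (p + e') * n\<^sup>2 + 2 * p * (x \<bullet> z) + 2 * q * (x \<bullet> z)\<^sup>2)"
        using 1 2 3 A by (intro mult_left_mono) linarith+
      moreover have "B * 1 \<le> B * (n ^ 4 / \<eta> ^ 4)" using pf(1) B by (intro mult_left_mono) auto
      moreover have "C * n ^ 4 = B * (n ^ 4 / \<eta> ^ 4) + A * (2 * C0 * b / \<eta> ^ 3 * n ^ 4 + 2 * C0 * b\<^sup>2 / \<eta>\<^sup>2 * n ^ 4)"
        unfolding C_def by (simp add: algebra_simps)
      moreover have "Q z = A * (phi ?d (norm x) + (p + e') * n\<^sup>2 + 2 * p * (x \<bullet> z) + 2 * q * (x \<bullet> z)\<^sup>2) + r + C * n ^ 4"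
        unfolding Q_def n_def by (simp add: algebra_simps)
      moreover have "A * (- X - Y) = - (A * (X + Y))" for X Y by (simp add: algebra_simps)
      ultimately have "B + r \<le> Q z" by (smt (verit))
      thus ?thesis using False by simp
    qed
    have Q0: "0 \<le> Q z" for z
    proof -
      have "0 \<le> A * phi ?d (norm (x + z)) + r" "0 \<le> B + r" using A B r by auto
      thus ?thesis using Q[of z] by (auto split: if_splits)
    qed
    have gQ: "g (x + z) \<le> ennreal (Q z)" for z
    proof (cases "norm z \<le> \<eta>")
      case True
      have "norm (x + z) < b'" using norm_triangle_ineq[of x z] True x h by linarith
      hence "g (x + z) \<le> ennreal (A * phi ?d (norm (x + z)) + r)" by (rule g1)
      thus ?thesis using Q[of z] True by (auto intro: order_trans[OF _ ennreal_leI])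
    next
      case False
      thus ?thesis using Q[of z] g2[of "x + z"] by (auto intro: order_trans[OF _ ennreal_leI])
    qed
    note int = gauss_quartic[OF d, of "A * phi ?d (norm x) + r" "A * p" x "A * (p + e')" "A * q" C, folded Q_def]
    have qeq: "(\<integral>z. Q z \<partial>gauss \<delta>) \<le> A * phi ?d (norm x) * (1 + \<delta> * pot x) + r + e * \<delta> + C * K4 * \<delta>\<^sup>2"
    proof -
      have "(\<integral>z. Q z \<partial>gauss \<delta>) = A * phi ?d (norm x) + r + \<delta> * (A * (2 * real ?d * p + 4 * q * (norm x)\<^sup>2)) + \<delta> * (2 * real ?d * (A * e')) + C * (\<integral>(z::'a). norm z ^ 4 \<partial>gauss \<delta>)"
        unfolding int(2) by (simp add: algebra_simps)
      also have "2 * real ?d * p + 4 * q * (norm x)\<^sup>2 = pot x * phi ?d (norm x)"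
        unfolding p_def q_def using x a by (intro phi_ode) auto
      also have "A * phi ?d (norm x) + r + \<delta> * (A * (pot x * phi ?d (norm x))) + \<delta> * (2 * real ?d * (A * e')) + C * (\<integral>(z::'a). norm z ^ 4 \<partial>gauss \<delta>)
         \<le> A * phi ?d (norm x) + r + \<delta> * (A * (pot x * phi ?d (norm x))) + \<delta> * e + C * (K4 * \<delta>\<^sup>2)"
        using gauss_norm_4[OF d, where 'a = 'a] C e'(2) d unfolding K4_def by (intro add_mono mult_left_mono order_refl) auto
      finally show ?thesis by (simp add: algebra_simps)
    qed
    have "Gop \<delta> g x = (\<integral>\<^sup>+ z. g (x + z) \<partial>gauss \<delta>)" by (rule Gop_gauss) measurable
    also have "\<dots> \<le> (\<integral>\<^sup>+ z. ennreal (Q z) \<partial>gauss \<delta>)" by (intro nn_integral_mono gQ)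
    also have "\<dots> = ennreal (\<integral>z. Q z \<partial>gauss \<delta>)"
      by (rule nn_integral_eq_integral[OF int(1)]) (simp add: Q0)
    also have "\<dots> \<le> ennreal (A * phi ?d (norm x) * (1 + \<delta> * pot x) + r + e * \<delta> + C * K4 * \<delta>\<^sup>2)"
      by (rule ennreal_leI[OF qeq])
    finally show "Gop \<delta> g x \<le> ennreal (A * phi ?d (norm x) * (1 + \<delta> * pot x) + r + e * \<delta> + C * K4 * \<delta>\<^sup>2)" .
  qed
qed

text \<open>The counterpart from below for the subsolution
  \<open>phi - \<epsilon>' * (norm y)\<^sup>2 - c\<close>. The quadratic term is averaged exactly
  and gains \<open>2 * d * \<delta>\<close> per step; far away the lowered polynomial is
  nonpositive, hence below \<open>phi\<close>.\<close>

lemma Gop_phi_lower: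
  fixes dummy :: "'a::euclidean_space"
  assumes a: "a > 0" and ab: "a \<le> b" and e: "e > 0" and \<epsilon>: "\<epsilon>' \<ge> 0"
  obtains D where "D \<ge> 0"
    "\<And>\<delta> (x::'a) c g. \<delta> > 0 \<Longrightarrow> a \<le> norm x \<Longrightarrow> norm x \<le> b \<Longrightarrow> g \<in> borel_measurable borel \<Longrightarrow>
      (\<And>y. ennreal (phi DIM('a) (norm y) - \<epsilon>' * (norm y)\<^sup>2 - c) \<le> g y) \<Longrightarrow>
      ennreal (phi DIM('a) (norm x) * (1 + \<delta> * pot x) - \<epsilon>' * ((norm x)\<^sup>2 + 2 * real DIM('a) * \<delta>) - c - e * \<delta> - D * \<delta>\<^sup>2) \<le> Gop \<delta> g x"
proof -
  let ?d = "DIM('a)"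
  define e' where "e' = e / (2 * real ?d)"
  have e': "e' > 0" "2 * real ?d * e' = e" using e by (auto simp: e'_def)
  obtain \<eta> where h: "\<eta> > 0" "\<And>x z :: 'a. a \<le> norm x \<Longrightarrow> norm x \<le> b \<Longrightarrow> norm z \<le> \<eta> \<Longrightarrow>
      \<bar>phi ?d (norm (x + z)) - (phi ?d (norm x) + 2 * F1 ?d ((norm x)\<^sup>2) * (x \<bullet> z) + F1 ?d ((norm x)\<^sup>2) * (norm z)\<^sup>2 + 2 * F2 ?d ((norm x)\<^sup>2) * (x \<bullet> z)\<^sup>2)\<bar> \<le> e' * (norm z)\<^sup>2"
    using phi_taylor[OF a e'(1) ab, of ?d] by metis
  obtain C0 where C0: "C0 > 0" "\<And>\<rho>. \<rho> \<in> {a\<^sup>2..b\<^sup>2} \<Longrightarrow> \<bar>F1 ?d \<rho>\<bar> \<le> C0" "\<And>\<rho>. \<rho> \<in> {a\<^sup>2..b\<^sup>2} \<Longrightarrow> \<bar>F2 ?d \<rho>\<bar> \<le> C0"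
    using F_bounded[OF a, of b ?d] by metis
  have b0: "b > 0" using a ab by simp
  define B where "B = phi ?d b"
  define C where "C = B / \<eta> ^ 4 + (2 * C0 * b / \<eta> ^ 3 + (C0 + 2 * C0 * b\<^sup>2) / \<eta>\<^sup>2)"
  have C: "C \<ge> 0" using C0 b0 h by (simp add: C_def B_def)
  define K4 where "K4 = 128 * 2 powr (real ?d / 2)"
  show thesis
  proof (rule that[of "C * K4"])
    show "C * K4 \<ge> 0" using C by (simp add: K4_def)
    fix \<delta> c :: real and x :: 'a and g :: "'a \<Rightarrow> ennreal"
    assume d: "\<delta> > 0" and x: "a \<le> norm x" "norm x \<le> b" and g [measurable]: "g \<in> borel_measurable borel"
      and gl: "\<And>y. ennreal (phi ?d (norm y) - \<epsilon>' * (norm y)\<^sup>2 - c) \<le> g y"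
    define p q where "p = F1 ?d ((norm x)\<^sup>2)" and "q = F2 ?d ((norm x)\<^sup>2)"
    have x2: "(norm x)\<^sup>2 \<in> {a\<^sup>2..b\<^sup>2}" using x a by (auto intro: power_mono)
    have x0: "x \<noteq> 0" using x a by auto
    have p: "0 \<le> p" "p \<le> C0" "\<bar>q\<bar> \<le> C0" using C0(2,3)[OF x2] F1_nonneg[of "(norm x)\<^sup>2" ?d] x0 by (auto simp: p_def q_def)
    define R where "R z = phi ?d (norm x) + 2 * p * (x \<bullet> z) + (p - e') * (norm z)\<^sup>2 + 2 * q * (x \<bullet> z)\<^sup>2 - C * norm z ^ 4" for z
    have R: "R z \<le> phi ?d (norm (x + z))" for z
    proof (cases "norm z \<le> \<eta>")
      case True
      have "phi ?d (norm x) + 2 * p * (x \<bullet> z) + (p - e') * (norm z)\<^sup>2 + 2 * q * (x \<bullet> z)\<^sup>2 \<le> phi ?d (norm (x + z))"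
        using h(2)[OF x, of z] True unfolding p_def q_def by (simp add: left_diff_distrib abs_le_iff)
      moreover have "0 \<le> C * norm z ^ 4" using C by simp
      ultimately show ?thesis unfolding R_def by linarith
    next
      case False
      define n where "n = norm z"
      have n: "n > \<eta>" using False by (simp add: n_def)
      note pf = powers_far[OF h(1) n]
      have n0: "n > 0" using n h(1) by linarith
      have s: "\<bar>x \<bullet> z\<bar> \<le> b * n" unfolding n_def using Cauchy_Schwarz_ineq2[of x z] x(2) by (meson mult_right_mono norm_ge_zero order_trans)
      have s2: "(x \<bullet> z)\<^sup>2 \<le> b\<^sup>2 * n\<^sup>2" using power_mono[OF s, of 2] by (simp add: power_mult_distrib)
      have 1: "2 * p * (x \<bullet> z) \<le> 2 * C0 * b / \<eta> ^ 3 * n ^ 4"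
      proof -
        have "\<bar>2 * p * (x \<bullet> z)\<bar> \<le> 2 * C0 * (b * n)" unfolding abs_mult using p s C0 by (intro mult_mono) auto
        also have "\<dots> \<le> 2 * C0 * (b * (n ^ 4 / \<eta> ^ 3))" using pf(2) C0 b0 by (intro mult_left_mono) auto
        finally show ?thesis by (simp add: abs_le_iff)
      qed
      have 2: "2 * q * (x \<bullet> z)\<^sup>2 \<le> 2 * C0 * b\<^sup>2 * (n ^ 4 / \<eta>\<^sup>2)"
      proof -
        have "\<bar>2 * q * (x \<bullet> z)\<^sup>2\<bar> \<le> 2 * C0 * (b\<^sup>2 * n\<^sup>2)" unfolding abs_mult using p s2 C0 by (intro mult_mono) auto
        also have "\<dots> \<le> 2 * C0 * (b\<^sup>2 * (n ^ 4 / \<eta>\<^sup>2))" using pf(3) C0 b0 by (intro mult_left_mono) auto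
        finally show ?thesis by (simp add: abs_le_iff)
      qed
      have 3: "(p - e') * n\<^sup>2 \<le> C0 * (n ^ 4 / \<eta>\<^sup>2)"
      proof -
        have "(p - e') * n\<^sup>2 \<le> C0 * n\<^sup>2" using p e' by (intro mult_right_mono) auto
        also have "\<dots> \<le> C0 * (n ^ 4 / \<eta>\<^sup>2)" using pf(3) C0 by (intro mult_left_mono) auto
        finally show ?thesis .
      qed
      have 4: "phi ?d (norm x) \<le> B * (n ^ 4 / \<eta> ^ 4)"
      proof -
        have "phi ?d (norm x) \<le> B * 1" unfolding B_def using x(2) by (simp add: phi_mono)
        also have "\<dots> \<le> B * (n ^ 4 / \<eta> ^ 4)" using pf(1) by (intro mult_left_mono) (auto simp: B_def)
        finally show ?thesis .
      qed
      have "C * n ^ 4 = B * (n ^ 4 / \<eta> ^ 4) + 2 * C0 * b / \<eta> ^ 3 * n ^ 4 + C0 * (n ^ 4 / \<eta>\<^sup>2) + 2 * C0 * b\<^sup>2 * (n ^ 4 / \<eta>\<^sup>2)"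
        unfolding C_def by (simp add: algebra_simps add_divide_distrib)
      hence "R z \<le> 0" unfolding R_def n_def[symmetric] using 1 2 3 4 by linarith
      thus ?thesis using phi_nonneg[of ?d "norm (x + z)"] by linarith
    qed
    define Q where "Q z = (phi ?d (norm x) - \<epsilon>' * (norm x)\<^sup>2 - c) + 2 * (p - \<epsilon>') * (x \<bullet> z) + (p - e' - \<epsilon>') * (norm z)\<^sup>2 + 2 * q * (x \<bullet> z)\<^sup>2 + (- C) * norm z ^ 4" for z
    have gQ: "ennreal (Q z) \<le> g (x + z)" for z
    proof -
      have "(norm (x + z))\<^sup>2 = (norm x)\<^sup>2 + 2 * (x \<bullet> z) + (norm z)\<^sup>2"
        unfolding power2_norm_eq_inner by (simp add: inner_simps inner_commute)
      hence "Q z = R z - \<epsilon>' * (norm (x + z))\<^sup>2 - c" unfolding Q_def R_def by (simp add: algebra_simps)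
      hence "ennreal (Q z) \<le> ennreal (phi ?d (norm (x + z)) - \<epsilon>' * (norm (x + z))\<^sup>2 - c)"
        using R[of z] by (intro ennreal_leI) auto
      thus ?thesis using gl order_trans by blast
    qed
    note int = gauss_quartic[OF d, of "phi ?d (norm x) - \<epsilon>' * (norm x)\<^sup>2 - c" "p - \<epsilon>'" x "p - e' - \<epsilon>'" q "- C", folded Q_def]
    have qeq: "phi ?d (norm x) * (1 + \<delta> * pot x) - \<epsilon>' * ((norm x)\<^sup>2 + 2 * real ?d * \<delta>) - c - e * \<delta> - C * K4 * \<delta>\<^sup>2 \<le> (\<integral>z. Q z \<partial>gauss \<delta>)"
    proof -
      have "(\<integral>z. Q z \<partial>gauss \<delta>) = phi ?d (norm x) + \<delta> * (2 * real ?d * p + 4 * q * (norm x)\<^sup>2) - \<epsilon>' * ((norm x)\<^sup>2 + 2 * real ?d * \<delta>) - c - \<delta> * (2 * real ?d * e') - C * (\<integral>(z::'a). norm z ^ 4 \<partial>gauss \<delta>)"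
        unfolding int(2) by (simp add: algebra_simps)
      also have "2 * real ?d * p + 4 * q * (norm x)\<^sup>2 = pot x * phi ?d (norm x)"
        unfolding p_def q_def using x0 by (intro phi_ode)
      also have "2 * real ?d * e' = e" by (rule e'(2))
      finally have "(\<integral>z. Q z \<partial>gauss \<delta>) = phi ?d (norm x) * (1 + \<delta> * pot x) - \<epsilon>' * ((norm x)\<^sup>2 + 2 * real ?d * \<delta>) - c - e * \<delta> - C * (\<integral>(z::'a). norm z ^ 4 \<partial>gauss \<delta>)"
        by (simp add: algebra_simps)
      moreover have "C * (\<integral>(z::'a). norm z ^ 4 \<partial>gauss \<delta>) \<le> C * (K4 * \<delta>\<^sup>2)"
        using gauss_norm_4[OF d, where 'a = 'a] C unfolding K4_def by (intro mult_left_mono) auto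
      ultimately show ?thesis by (simp add: mult.assoc)
    qed
    have "ennreal (phi ?d (norm x) * (1 + \<delta> * pot x) - \<epsilon>' * ((norm x)\<^sup>2 + 2 * real ?d * \<delta>) - c - e * \<delta> - C * K4 * \<delta>\<^sup>2) \<le> ennreal (\<integral>z. Q z \<partial>gauss \<delta>)"
      by (rule ennreal_leI[OF qeq])
    also have "\<dots> \<le> (\<integral>\<^sup>+ z. ennreal (Q z) \<partial>gauss \<delta>)" by (rule ennreal_integral_le_nn_integral[OF int(1)])
    also have "\<dots> \<le> (\<integral>\<^sup>+ z. g (x + z) \<partial>gauss \<delta>)" by (intro nn_integral_mono gQ)
    also have "\<dots> = Gop \<delta> g x" by (rule Gop_gauss[symmetric]) measurable
    finally show "ennreal (phi ?d (norm x) * (1 + \<delta> * pot x) - \<epsilon>' * ((norm x)\<^sup>2 + 2 * real ?d * \<delta>) - c - e * \<delta> - C * K4 * \<delta>\<^sup>2) \<le> Gop \<delta> g x" .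
  qed
qed

lemma Top_funpow_le_Gop:
  assumes d: "\<delta> > 0" and [measurable]: "f \<in> borel_measurable borel" and n: "n > 0"
  shows "(Top \<epsilon> \<delta> ^^ n) f x \<le> Gop (real n * \<delta>) f x"
  using n
proof (induction n arbitrary: x rule: nat_induct_non_zero)
  case 1
  have "cut \<epsilon> \<delta> x * Gop \<delta> f x \<le> 1 * Gop \<delta> f x" using d by (intro mult_right_mono cut_le_1) auto
  thus ?case by (simp add: Top_def)
next
  case (Suc n)
  have nd: "real n * \<delta> > 0" using d Suc by simp
  have "Top \<epsilon> \<delta> ((Top \<epsilon> \<delta> ^^ n) f) x \<le> 1 * Gop \<delta> (Gop (real n * \<delta>) f) x"
    by (subst Top_def, intro mult_mono cut_le_1 Gop_mono Suc.IH) (use d in auto)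
  also have "\<dots> = Gop (\<delta> + real n * \<delta>) f x" using d nd by (simp add: Gop_Gop)
  finally show ?case by (simp add: algebra_simps)
qed

text \<open>The discrete maximum principle. Inside the ball one step preserves the barrier up to the
  error \<open>e * \<delta> + D * \<delta>\<^sup>2\<close>, accumulated over the steps. On the shell
  from \<open>b\<close> to \<open>b'\<close> the iterate is bounded through the free Gaussian
  average. The shell has positive width so that small increments from inside the ball do not leave
  the controlled region.\<close>

lemma Top_funpow_phi_upper:
  fixes dummy :: "'a::euclidean_space"
  assumes \<epsilon>: "\<epsilon> > 0" "\<epsilon> \<le> b" and b: "b < b'" and A: "A \<ge> 0" and B: "B \<ge> 0" and e: "e > 0"
  obtains D where "D \<ge> 0"
    "\<And>\<delta> n x f. \<delta> > 0 \<Longrightarrow> (f :: 'a \<Rightarrow> ennreal) \<in> borel_measurable borel \<Longrightarrow> (\<And>y. norm y < b \<Longrightarrow> f y = 0) \<Longrightarrow> (\<And>y. f y \<le> ennreal B) \<Longrightarrow>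
      (\<And>y. b \<le> norm y \<Longrightarrow> norm y < b' \<Longrightarrow> f y \<le> ennreal (A * phi DIM('a) b)) \<Longrightarrow>
      (\<And>k y. 0 < k \<Longrightarrow> k \<le> n \<Longrightarrow> b \<le> norm y \<Longrightarrow> norm y < b' \<Longrightarrow> Gop (real k * \<delta>) f y \<le> ennreal (A * phi DIM('a) b)) \<Longrightarrow>
      norm x < b \<Longrightarrow> (Top \<epsilon> \<delta> ^^ n) f x \<le> ennreal (A * phi DIM('a) (norm x) + real n * (e * \<delta> + D * \<delta>\<^sup>2))"
proof -
  obtain D where D: "D \<ge> 0"
    "\<And>\<delta> (x::'a) r g. \<delta> > 0 \<Longrightarrow> \<epsilon> \<le> norm x \<Longrightarrow> norm x \<le> b \<Longrightarrow> g \<in> borel_measurable borel \<Longrightarrow> r \<ge> 0 \<Longrightarrow>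
      (\<And>y. norm y < b' \<Longrightarrow> g y \<le> ennreal (A * phi DIM('a) (norm y) + r)) \<Longrightarrow> (\<And>y. g y \<le> ennreal (B + r)) \<Longrightarrow>
      Gop \<delta> g x \<le> ennreal (A * phi DIM('a) (norm x) * (1 + \<delta> * pot x) + r + e * \<delta> + D * \<delta>\<^sup>2)"
    using Gop_phi_upper[OF \<epsilon> b A B e, where 'a = 'a] by metis
  show thesis
  proof (rule that[OF D(1)])
    fix \<delta> :: real and n and x :: 'a and f :: "'a \<Rightarrow> ennreal"
    assume d: "\<delta> > 0" and f [measurable]: "f \<in> borel_measurable borel" and f0: "\<And>y. norm y < b \<Longrightarrow> f y = 0" and fB: "\<And>y. f y \<le> ennreal B"
      and f1: "\<And>y. b \<le> norm y \<Longrightarrow> norm y < b' \<Longrightarrow> f y \<le> ennreal (A * phi DIM('a) b)"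
      and G: "\<And>k y. 0 < k \<Longrightarrow> k \<le> n \<Longrightarrow> b \<le> norm y \<Longrightarrow> norm y < b' \<Longrightarrow> Gop (real k * \<delta>) f y \<le> ennreal (A * phi DIM('a) b)"
      and x: "norm x < b"
    define r where "r k = real k * (e * \<delta> + D * \<delta>\<^sup>2)" for k
    have r0: "r k \<ge> 0" for k using e d D by (simp add: r_def)
    \<comment> \<open>Freezing the barrier at \<open>phi b\<close> on the shell makes the inner and
      outer estimates a single statement for the induction.\<close>
    have "(Top \<epsilon> \<delta> ^^ k) f y \<le> ennreal (A * phi DIM('a) (min (norm y) b) + r k)" if "k \<le> n" "norm y < b'" for k y
      using that
    proof (induction k arbitrary: y)
      case 0
      thus ?case using f0[of y] f1[of y] by (cases "norm y < b") (auto simp: r_def min_def)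
    next
      case (Suc k)
      show ?case
      proof (cases "norm y < b")
        case False
        have "(Top \<epsilon> \<delta> ^^ Suc k) f y \<le> Gop (real (Suc k) * \<delta>) f y" by (rule Top_funpow_le_Gop[OF d f]) simp
        also have "\<dots> \<le> ennreal (A * phi DIM('a) b)" using False Suc.prems by (intro G) auto
        also have "\<dots> \<le> ennreal (A * phi DIM('a) (min (norm y) b) + r (Suc k))" using False r0[of "Suc k"] by (intro ennreal_leI) (simp add: min_def)
        finally show ?thesis .
      next
        case yb: True
        show ?thesis
        proof (cases "norm y > \<epsilon>")
          case True
          have "Gop \<delta> ((Top \<epsilon> \<delta> ^^ k) f) y \<le> ennreal (A * phi DIM('a) (norm y) * (1 + \<delta> * pot y) + r k + e * \<delta> + D * \<delta>\<^sup>2)"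
          proof (rule D(2)[OF d])
            show "(Top \<epsilon> \<delta> ^^ k) f w \<le> ennreal (A * phi DIM('a) (norm w) + r k)" if "norm w < b'" for w
            proof -
              have "(Top \<epsilon> \<delta> ^^ k) f w \<le> ennreal (A * phi DIM('a) (min (norm w) b) + r k)" using Suc that by auto
              also have "\<dots> \<le> ennreal (A * phi DIM('a) (norm w) + r k)" using A by (intro ennreal_leI add_mono mult_left_mono phi_mono) auto
              finally show ?thesis .
            qed
            show "(Top \<epsilon> \<delta> ^^ k) f w \<le> ennreal (B + r k)" for w
              using r0[of k] by (intro order_trans[OF Top_funpow_le_const[OF d fB] ennreal_leI]) simp
          qed (use True yb r0 in auto)
          hence "Top \<epsilon> \<delta> ((Top \<epsilon> \<delta> ^^ k) f) y \<le> ennreal (exp (- \<delta> * pot y)) * ennreal (A * phi DIM('a) (norm y) * (1 + \<delta> * pot y) + r k + e * \<delta> + D * \<delta>\<^sup>2)"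
            using True by (subst Top_def) (auto simp: cut_def intro!: mult_left_mono)
          also have "\<dots> = ennreal (exp (- \<delta> * pot y) * (A * phi DIM('a) (norm y) * (1 + \<delta> * pot y) + r k + e * \<delta> + D * \<delta>\<^sup>2))"
            by (simp add: ennreal_mult')
          also have "\<dots> \<le> ennreal (A * phi DIM('a) (min (norm y) b) + r (Suc k))"
          proof (rule ennreal_leI)
            define E where "E = exp (- \<delta> * pot y)"
            have E: "0 \<le> E" "E \<le> 1" using d by (auto simp: E_def)
            have "E * (1 + \<delta> * pot y) \<le> 1" using exp_mult_one_plus_le[of "\<delta> * pot y"] by (simp add: E_def)
            hence "A * phi DIM('a) (norm y) * (E * (1 + \<delta> * pot y)) \<le> A * phi DIM('a) (norm y) * 1" using A by (intro mult_left_mono) auto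
            moreover have "E * (r k + e * \<delta> + D * \<delta>\<^sup>2) \<le> 1 * (r k + e * \<delta> + D * \<delta>\<^sup>2)" using E r0[of k] e d D by (intro mult_right_mono) auto
            ultimately have "E * (A * phi DIM('a) (norm y) * (1 + \<delta> * pot y) + r k + e * \<delta> + D * \<delta>\<^sup>2) \<le> A * phi DIM('a) (norm y) + (r k + e * \<delta> + D * \<delta>\<^sup>2)"
              by (simp add: algebra_simps)
            also have "r k + e * \<delta> + D * \<delta>\<^sup>2 = r (Suc k)" by (simp add: r_def algebra_simps)
            finally show "exp (- \<delta> * pot y) * (A * phi DIM('a) (norm y) * (1 + \<delta> * pot y) + r k + e * \<delta> + D * \<delta>\<^sup>2) \<le> A * phi DIM('a) (min (norm y) b) + r (Suc k)"
              using yb by (simp add: E_def min_def)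
          qed
          finally show ?thesis by simp
        next
          case False
          have "(Top \<epsilon> \<delta> ^^ Suc k) f y = 0" using False by (simp add: Top_def cut_def)
          thus ?thesis by simp
        qed
      qed
    qed
    from this[of n x] x b show "(Top \<epsilon> \<delta> ^^ n) f x \<le> ennreal (A * phi DIM('a) (norm x) + real n * (e * \<delta> + D * \<delta>\<^sup>2))"
      by (simp add: r_def min_def)
  qed
qed

end

context fk_kernel begin

abbreviation phx :: "'a \<Rightarrow> real" where "phx x \<equiv> phi DIM('a) (norm x)"

text \<open>Localised maximum principle: on the ball of radius \<open>b\<close> the solution is dominated by the multiple
  of \<open>\<phi>\<close> that dominates it on the shell outside.\<close>

lemma K_le_phi:
  assumes b: "0 < b" "b < b'" and A: "A \<ge> 0" and B: "B \<ge> 0" and t: "t > 0"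
    and f [measurable]: "f \<in> borel_measurable borel" and f0: "\<And>y. norm y < b \<Longrightarrow> f y = 0" and fB: "\<And>y. f y \<le> ennreal B"
    and f1: "\<And>y. b \<le> norm y \<Longrightarrow> norm y < b' \<Longrightarrow> f y \<le> ennreal (A * phi DIM('a) b)"
    and G: "\<And>s y. 0 < s \<Longrightarrow> s \<le> t \<Longrightarrow> b \<le> norm y \<Longrightarrow> norm y < b' \<Longrightarrow> Gop s f y \<le> ennreal (A * phi DIM('a) b)"
    and x: "norm x < b"
  shows "K t f x \<le> ennreal (A * phx x)"
proof (rule ennreal_le_epsilon)
  fix e :: real assume e: "e > 0"
  \<comment> \<open>With \<open>n\<close> steps of length \<open>t / n\<close> the accumulated error
    is \<open>e + D * t\<^sup>2 / n\<close>, which tends to \<open>e\<close>.\<close>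
  define e1 where "e1 = e / t"
  have e1: "e1 > 0" "t * e1 = e" using e t by (auto simp: e1_def)
  have bound: "liminf (\<lambda>n. (Top (1 / real (Suc j)) (t / real n) ^^ n) f x) \<le> ennreal (A * phx x) + ennreal e" if j: "1 / real (Suc j) \<le> b" for j
  proof -
    have "1 / real (Suc j) > 0" by simp
    from Top_funpow_phi_upper[OF this j b(2) A B e1(1), where 'a = 'a] obtain D where D: "D \<ge> 0"
      "\<And>\<delta> n x f. \<delta> > 0 \<Longrightarrow> (f :: 'a \<Rightarrow> ennreal) \<in> borel_measurable borel \<Longrightarrow> (\<And>y. norm y < b \<Longrightarrow> f y = 0) \<Longrightarrow> (\<And>y. f y \<le> ennreal B) \<Longrightarrow>
      (\<And>y. b \<le> norm y \<Longrightarrow> norm y < b' \<Longrightarrow> f y \<le> ennreal (A * phi DIM('a) b)) \<Longrightarrow>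
      (\<And>k y. 0 < k \<Longrightarrow> k \<le> n \<Longrightarrow> b \<le> norm y \<Longrightarrow> norm y < b' \<Longrightarrow> Gop (real k * \<delta>) f y \<le> ennreal (A * phi DIM('a) b)) \<Longrightarrow>
      norm x < b \<Longrightarrow> (Top (1 / real (Suc j)) \<delta> ^^ n) f x \<le> ennreal (A * phi DIM('a) (norm x) + real n * (e1 * \<delta> + D * \<delta>\<^sup>2))" by metis
    have ev: "(Top (1 / real (Suc j)) (t / real n) ^^ n) f x \<le> ennreal (A * phx x + (e + D * t * (t / real n)))" if n: "n > 0" for n
    proof -
      have "(Top (1 / real (Suc j)) (t / real n) ^^ n) f x \<le> ennreal (A * phx x + real n * (e1 * (t / real n) + D * (t / real n)\<^sup>2))"
      proof (rule D(2)[OF _ f f0 fB f1 _ x])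
        show "Gop (real k * (t / real n)) f y \<le> ennreal (A * phi DIM('a) b)" if "0 < k" "k \<le> n" "b \<le> norm y" "norm y < b'" for k y
        proof (rule G[OF _ _ that(3,4)])
          show "0 < real k * (t / real n)" using that n t by simp
          have "real k * t \<le> real n * t" using that t by (intro mult_right_mono) auto
          thus "real k * (t / real n) \<le> t" using n by (simp add: divide_le_eq mult.commute)
        qed
      qed (use n t in auto)
      also have "real n * (e1 * (t / real n) + D * (t / real n)\<^sup>2) = e + D * t * (t / real n)"
        using n e1(2) by (simp add: field_simps power2_eq_square)
      finally show ?thesis .
    qed
    have "liminf (\<lambda>n. (Top (1 / real (Suc j)) (t / real n) ^^ n) f x) \<le> liminf (\<lambda>n. ennreal (A * phx x + (e + D * t * (t / real n))))"
      by (intro Liminf_mono eventually_mono[OF eventually_gt_at_top[of 0]] ev)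
    also have "\<dots> = ennreal (A * phx x + (e + D * t * 0))"
      by (intro lim_imp_Liminf tendsto_ennrealI tendsto_intros lim_const_over_n) auto
    also have "\<dots> = ennreal (A * phx x) + ennreal e" using A e by (simp add: ennreal_plus)
    finally show ?thesis .
  qed
  obtain J where J: "1 / real (Suc J) < b" using nat_approx_posE[OF b(1)] by metis
  have "P t f x \<le> liminf (\<lambda>j. liminf (\<lambda>n. (Top (1 / real (Suc j)) (t / real n) ^^ n) f x))"
    by (rule P_le_liminf[OF t]) (auto simp: Liminf_const)
  also have "\<dots> \<le> liminf (\<lambda>j::nat. ennreal (A * phx x) + ennreal e)"
  proof (intro Liminf_mono eventually_mono[OF eventually_ge_at_top[of J]] bound)
    fix j assume "J \<le> j"
    hence "1 / real (Suc j) \<le> 1 / real (Suc J)" by (simp add: frac_le)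
    thus "1 / real (Suc j) \<le> b" using J by linarith
  qed
  finally show "K t f x \<le> ennreal (A * phx x) + ennreal e" using t by (simp add: P_eq_K' Liminf_const)
qed

text \<open>The maximum principle with the trivial shell bound 1, that is with
  \<open>A = 1 / phi b\<close>. For \<open>norm x \<ge> b\<close> the right side is at least
  1.\<close>

lemma K_outside_le:
  assumes b: "b > 0" and t: "t > 0"
  shows "K t (indicator {y. b \<le> norm y}) x \<le> ennreal (phx x / phi DIM('a) b)"
proof (cases "norm x < b")
  case True
  have pb: "phi DIM('a) b > 0" using b by (rule phi_pos)
  have m [measurable]: "(indicator {y. b \<le> norm y} :: 'a \<Rightarrow> ennreal) \<in> borel_measurable borel" by measurable
  have i1: "(indicator {y. b \<le> norm y} y :: ennreal) \<le> 1" for y :: 'a by (rule indicator_le_1_ennreal)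
  have "K t (indicator {y. b \<le> norm y}) x \<le> ennreal (1 / phi DIM('a) b * phx x)"
  proof (rule K_le_phi[of b "b + 1" _ 1])
    fix s :: real and y :: 'a assume "0 < s"
    have "Gop s (indicator {y. b \<le> norm y}) y \<le> Gop s (\<lambda>_. 1) y" by (intro Gop_mono i1)
    thus "Gop s (indicator {y. b \<le> norm y}) y \<le> ennreal (1 / phi DIM('a) b * phi DIM('a) b)" using \<open>0 < s\<close> pb by (simp add: Gop_const)
  qed (use b t True pb i1 in \<open>auto simp: indicator_def\<close>)
  thus ?thesis by simp
next
  case False
  have pb: "phi DIM('a) b > 0" using b by (rule phi_pos)
  have "K t (indicator {y. b \<le> norm y}) x \<le> Gop t (\<lambda>_. 1) x"
    by (rule order_trans[OF K_le_Gop[OF t] Gop_mono]) (simp add: indicator_le_1_ennreal)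
  also have "\<dots> = ennreal 1" using t by (simp add: Gop_const)
  also have "\<dots> \<le> ennreal (phx x / phi DIM('a) b)" using False phi_mono[of b "norm x" "DIM('a)"] pb by (intro ennreal_leI) simp
  finally show ?thesis .
qed

lemma phi_tendsto_0:
  assumes e: "e > 0" obtains a where "a > 0" "a \<le> 1" "phi d a \<le> e"
proof -
  obtain k K where K: "K > 0" "\<And>r. 0 < r \<Longrightarrow> r \<le> 1 \<Longrightarrow> phi d r \<le> K * hfun d \<beta> \<kappa> r" using phi_near[of d] by metis
  define p where "p = - (real d - 2 - \<beta>) / 2"
  define c where "c = sqrt \<kappa> / \<beta>"
  have c: "c > 0" using beta kappa by (simp add: c_def)
  \<comment> \<open>The exponent contains one more power of \<open>x = a powr (- \<beta>)\<close>
    than the prefactor requires; it is left over as \<open>1 / x = a powr \<beta>\<close>, which is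
    small.\<close>
  obtain C where C: "C > 0" "\<And>x. x > 0 \<Longrightarrow> x powr (\<bar>p\<bar> / \<beta> + 1) \<le> C * exp (c * x)" using powr_le_exp[OF c, of "\<bar>p\<bar> / \<beta> + 1"] beta by (metis abs_ge_zero add_nonneg_nonneg divide_nonneg_pos zero_le_one)
  define a where "a = min 1 ((e / (K * C)) powr (1 / \<beta>))"
  have a: "a > 0" "a \<le> 1" using e K C by (auto simp: a_def)
  define x where "x = a powr (- \<beta>)"
  have x: "x > 0" using a by (simp add: x_def)
  have "a powr p \<le> x powr (\<bar>p\<bar> / \<beta>)"
  proof -
    have "x powr (\<bar>p\<bar> / \<beta>) = a powr (- \<bar>p\<bar>)" using beta by (simp add: x_def powr_powr)
    thus ?thesis using a by (simp add: powr_mono')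
  qed
  have "phi d a \<le> K * (a powr p * exp (- (c * x)))"
  proof -
    have "- sqrt \<kappa> / (\<beta> * a powr \<beta>) = - (c * x)" using a by (simp add: c_def x_def powr_minus_divide)
    moreover have "min a 1 = a" using a by simp
    ultimately have "hfun d \<beta> \<kappa> a = a powr p * exp (- (c * x))" unfolding hfun_def p_def by (simp only:)
    thus ?thesis using K(2)[OF a] by simp
  qed
  also have "\<dots> \<le> K * (x powr (\<bar>p\<bar> / \<beta>) * exp (- (c * x)))" using \<open>a powr p \<le> _\<close> K by (intro mult_left_mono mult_right_mono) auto
  also have "\<dots> = K * (x powr (\<bar>p\<bar> / \<beta> + 1) * exp (- (c * x)) / x)" using x by (simp add: powr_add)
  also have "\<dots> \<le> K * (C * exp (c * x) * exp (- (c * x)) / x)" using C(2)[OF x] K x by (intro mult_left_mono divide_right_mono mult_right_mono) auto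
  also have "\<dots> = K * C * a powr \<beta>" using a by (simp add: exp_minus x_def powr_minus field_simps)
  also have "\<dots> \<le> K * C * (e / (K * C))"
  proof -
    have "a powr \<beta> \<le> ((e / (K * C)) powr (1 / \<beta>)) powr \<beta>" using a beta by (intro powr_mono2) (auto simp: a_def)
    also have "\<dots> = e / (K * C)" using beta e K C by (simp add: powr_powr)
    finally show ?thesis using K C by (intro mult_left_mono) auto
  qed
  also have "\<dots> = e" using K C by simp
  finally show thesis using that a by blast
qed

text \<open>At most linear growth is eventually beaten by any quadratic.\<close>

lemma phi_le_square:
  assumes e: "e > 0" obtains b where "b \<ge> 1" "\<And>r. r \<ge> b \<Longrightarrow> phi DIM('a) r \<le> e * r\<^sup>2"
proof -
  have "DIM('a) \<ge> 1" by (simp add: Suc_le_eq)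
  then obtain C where C: "C \<ge> 1" "\<And>r l. r \<ge> 1 \<Longrightarrow> l \<ge> 1 \<Longrightarrow> phi DIM('a) (l * r) \<le> C * l * phi DIM('a) r" using phi_growth[of "DIM('a)" 1] by (metis zero_less_one)
  define b where "b = max 1 (C * phi DIM('a) 1 / e)"
  show thesis
  proof (rule that[of b])
    fix r assume r: "r \<ge> b"
    hence r1: "r \<ge> 1" "C * phi DIM('a) 1 / e \<le> r" by (auto simp: b_def)
    have "phi DIM('a) r \<le> C * phi DIM('a) 1 * r" using C(2)[of 1 r] r1 by (simp add: mult_ac)
    also have "\<dots> \<le> (e * r) * r" using r1 e by (intro mult_right_mono) (auto simp: field_simps)
    finally show "phi DIM('a) r \<le> e * r\<^sup>2" by (simp add: power2_eq_square mult.assoc)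
  qed (simp add: b_def)
qed

text \<open>Subtracting \<open>\<epsilon> (1 + |x|\<^sup>2 + 2 d s)\<close> makes the subsolution positive only on a compact annulus, away
  from the cut-off.\<close>

lemma phi_le_K:
  assumes t: "t > 0" and x: "x \<noteq> 0"
  shows "ennreal (phx x) \<le> K t (\<lambda>y. ennreal (phx y)) x"
proof -
  let ?d = "real DIM('a)"
  have main: "ennreal (phx x - \<epsilon>' * (1 + (norm x)\<^sup>2 + 2 * ?d * t) - t * e) \<le> K t (\<lambda>y. ennreal (phx y)) x"
    if e: "e > 0" and ep: "\<epsilon>' > 0" for e \<epsilon>'
  proof -
    obtain a where a: "a > 0" "a \<le> 1" "phi DIM('a) a \<le> \<epsilon>'" using phi_tendsto_0[OF ep] by metis
    obtain b where b: "b \<ge> 1" "\<And>r. r \<ge> b \<Longrightarrow> phi DIM('a) r \<le> \<epsilon>' * r\<^sup>2" using phi_le_square[OF ep] by metis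
    have ab: "a \<le> b" using a b by linarith
    obtain D where D: "D \<ge> 0"
      "\<And>\<delta> (x::'a) c g. \<delta> > 0 \<Longrightarrow> a \<le> norm x \<Longrightarrow> norm x \<le> b \<Longrightarrow> g \<in> borel_measurable borel \<Longrightarrow>
      (\<And>y. ennreal (phi DIM('a) (norm y) - \<epsilon>' * (norm y)\<^sup>2 - c) \<le> g y) \<Longrightarrow>
      ennreal (phi DIM('a) (norm x) * (1 + \<delta> * pot x) - \<epsilon>' * ((norm x)\<^sup>2 + 2 * real DIM('a) * \<delta>) - c - e * \<delta> - D * \<delta>\<^sup>2) \<le> Gop \<delta> g x"
      using Gop_phi_lower[OF a(1) ab e less_imp_le[OF ep], where 'a = 'a] by metis
    \<comment> \<open>The addition absorbs the defect in
      \<open>1 - y\<^sup>2 \<le> exp (- y) * (1 + y)\<close> for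
      \<open>y = \<delta> * pot x\<close>, with the potential bounded on the annulus by its value at
      radius \<open>a\<close>.\<close>
    define D' where "D' = D + phi DIM('a) b * (\<kappa> * a powr (- (2 + 2 * \<beta>)))\<^sup>2"
    have D': "D' \<ge> 0" using D by (simp add: D'_def)
    define f where "f y = ennreal (phx y - \<epsilon>' * (1 + (norm y)\<^sup>2))" for y :: 'a
    have fm [measurable]: "f \<in> borel_measurable borel" unfolding f_def[abs_def] by measurable
    have small: "phx y \<le> \<epsilon>' * (1 + (norm y)\<^sup>2)" if "\<not> (a \<le> norm y \<and> norm y \<le> b)" for y
    proof (cases "norm y < a")
      case True
      hence "phx y \<le> \<epsilon>' * 1" using a phi_mono[of "norm y" a "DIM('a)"] by simp
      also have "\<dots> \<le> \<epsilon>' * (1 + (norm y)\<^sup>2)" using ep by (intro mult_left_mono) auto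
      finally show ?thesis .
    next
      case False
      hence "phx y \<le> \<epsilon>' * (norm y)\<^sup>2" using that b(2)[of "norm y"] by simp
      also have "\<dots> \<le> \<epsilon>' * (1 + (norm y)\<^sup>2)" using ep by (intro mult_left_mono) auto
      finally show ?thesis .
    qed
    define r where "r \<delta> k = real k * (e * \<delta> + D' * \<delta>\<^sup>2)" for \<delta> k
    \<comment> \<open>Outside the annulus from \<open>a\<close> to \<open>b\<close> the left side is
      0. On it the cut-off at radius \<open>a / 2\<close> does not act, and one step loses
      \<open>2 * ?d * \<epsilon>' * \<delta>\<close> by averaging the quadratic, besides the step
      error.\<close>
    have iter: "ennreal (phx y - \<epsilon>' * (1 + (norm y)\<^sup>2 + 2 * ?d * (real k * \<delta>)) - r \<delta> k) \<le> (Top (a / 2) \<delta> ^^ k) f y" if d: "\<delta> > 0" for k y \<delta>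
    proof (induction k arbitrary: y)
      case 0
      show ?case by (simp add: f_def r_def)
    next
      case (Suc k)
      define s where "s = real k * \<delta>"
      have s: "s \<ge> 0" "real (Suc k) * \<delta> = s + \<delta>" using d by (auto simp: s_def algebra_simps)
      have r0: "r \<delta> k \<ge> 0" "r \<delta> (Suc k) = r \<delta> k + e * \<delta> + D' * \<delta>\<^sup>2" using e d D' by (auto simp: r_def algebra_simps)
      show ?case
      proof (cases "a \<le> norm y \<and> norm y \<le> b")
        case False
        have "0 \<le> \<epsilon>' * (2 * ?d * (real (Suc k) * \<delta>))" using ep d by simp
        moreover have "r \<delta> (Suc k) \<ge> 0" using r0 e d D' by simp
        moreover have "\<epsilon>' * (1 + (norm y)\<^sup>2 + 2 * ?d * (real (Suc k) * \<delta>)) = \<epsilon>' * (1 + (norm y)\<^sup>2) + \<epsilon>' * (2 * ?d * (real (Suc k) * \<delta>))" by (simp add: algebra_simps)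
        ultimately have "phx y - \<epsilon>' * (1 + (norm y)\<^sup>2 + 2 * ?d * (real (Suc k) * \<delta>)) - r \<delta> (Suc k) \<le> 0" using small[OF False] by linarith
        thus ?thesis by (simp only: ennreal_neg) simp
      next
        case True
        define c where "c = \<epsilon>' * (1 + 2 * ?d * s) + r \<delta> k"
        have c0: "c \<ge> 0" using ep s r0 by (simp add: c_def)
        define X where "X = \<epsilon>' * ((norm y)\<^sup>2 + 2 * ?d * \<delta>) + c + e * \<delta> + D * \<delta>\<^sup>2"
        have X0: "X \<ge> 0" unfolding X_def using ep d c0 e D by simp
        have "ennreal (phx y * (1 + \<delta> * pot y) - \<epsilon>' * ((norm y)\<^sup>2 + 2 * ?d * \<delta>) - c - e * \<delta> - D * \<delta>\<^sup>2) \<le> Gop \<delta> ((Top (a / 2) \<delta> ^^ k) f) y"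
        proof (rule D(2)[OF d])
          show "ennreal (phx w - \<epsilon>' * (norm w)\<^sup>2 - c) \<le> (Top (a / 2) \<delta> ^^ k) f w" for w
            using Suc.IH[of w] by (simp add: c_def s_def algebra_simps)
        qed (use True in auto)
        hence G: "ennreal (phx y * (1 + \<delta> * pot y) - X) \<le> Gop \<delta> ((Top (a / 2) \<delta> ^^ k) f) y" by (simp add: X_def diff_diff_eq add.assoc)
        define E where "E = exp (- \<delta> * pot y)"
        have E: "0 \<le> E" "E \<le> 1" using d by (auto simp: E_def)
        have y0: "norm y > 0" using True a by linarith
        have "pot y \<le> \<kappa> * a powr (- (2 + 2 * \<beta>))" unfolding pot_def using True a kappa beta by (intro mult_left_mono powr_mono2') auto
        hence "(\<delta> * pot y)\<^sup>2 \<le> (\<delta> * (\<kappa> * a powr (- (2 + 2 * \<beta>))))\<^sup>2" using d by (intro power_mono mult_left_mono) auto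
        hence "phx y * (\<delta> * pot y)\<^sup>2 \<le> phi DIM('a) b * (\<delta> * (\<kappa> * a powr (- (2 + 2 * \<beta>))))\<^sup>2" using True by (intro mult_mono phi_mono) auto
        also have "\<dots> = (D' - D) * \<delta>\<^sup>2" by (simp add: D'_def power_mult_distrib)
        finally have q: "phx y * (\<delta> * pot y)\<^sup>2 \<le> (D' - D) * \<delta>\<^sup>2" .
        have "1 - (\<delta> * pot y)\<^sup>2 \<le> E * (1 + \<delta> * pot y)" using exp_mult_one_plus_ge[of "\<delta> * pot y"] d by (simp add: E_def)
        hence "phx y * (1 - (\<delta> * pot y)\<^sup>2) \<le> phx y * (E * (1 + \<delta> * pot y))" by (intro mult_left_mono) auto
        moreover have "E * X \<le> 1 * X" using E X0 by (intro mult_right_mono) auto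
        ultimately have "phx y - (D' - D) * \<delta>\<^sup>2 - X \<le> E * (phx y * (1 + \<delta> * pot y) - X)" using q by (simp add: algebra_simps)
        moreover have "phx y - (D' - D) * \<delta>\<^sup>2 - X = phx y - \<epsilon>' * (1 + (norm y)\<^sup>2 + 2 * ?d * (real (Suc k) * \<delta>)) - r \<delta> (Suc k)"
          unfolding X_def c_def s(2) r0(2) by (simp add: algebra_simps)
        ultimately have "ennreal (phx y - \<epsilon>' * (1 + (norm y)\<^sup>2 + 2 * ?d * (real (Suc k) * \<delta>)) - r \<delta> (Suc k)) \<le> ennreal (E * (phx y * (1 + \<delta> * pot y) - X))" by (intro ennreal_leI) simp
        also have "\<dots> = ennreal E * ennreal (phx y * (1 + \<delta> * pot y) - X)" using E by (simp add: ennreal_mult')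
        also have "\<dots> \<le> ennreal E * Gop \<delta> ((Top (a / 2) \<delta> ^^ k) f) y" by (intro mult_left_mono G) auto
        also have "\<dots> = (Top (a / 2) \<delta> ^^ Suc k) f y" using True a by (simp add: Top_def cut_def E_def)
        finally show ?thesis .
      qed
    qed
    have "ennreal (phx x - \<epsilon>' * (1 + (norm x)\<^sup>2 + 2 * ?d * t) - t * e) \<le> limsup (\<lambda>n. (Top (a / 2) (t / real n) ^^ n) f x)"
    proof -
      have lim: "(\<lambda>n. ennreal (phx x - \<epsilon>' * (1 + (norm x)\<^sup>2 + 2 * ?d * t) - (t * e + D' * t * (t / real n)))) \<longlonglongrightarrow> ennreal (phx x - \<epsilon>' * (1 + (norm x)\<^sup>2 + 2 * ?d * t) - (t * e + D' * t * 0))"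
        by (intro tendsto_ennrealI tendsto_intros lim_const_over_n)
      have "ennreal (phx x - \<epsilon>' * (1 + (norm x)\<^sup>2 + 2 * ?d * t) - t * e) = limsup (\<lambda>n. ennreal (phx x - \<epsilon>' * (1 + (norm x)\<^sup>2 + 2 * ?d * t) - (t * e + D' * t * (t / real n))))"
        using lim_imp_Limsup[OF _ lim] by simp
      also have "\<dots> \<le> limsup (\<lambda>n. (Top (a / 2) (t / real n) ^^ n) f x)"
      proof (intro Limsup_mono eventually_mono[OF eventually_gt_at_top[of 0]])
        fix n :: nat assume n: "0 < n"
        have tn: "t / real n > 0" "real n * (t / real n) = t" using n t by auto
        have "r (t / real n) n = t * e + D' * t * (t / real n)" using n by (simp add: r_def field_simps power2_eq_square)
        thus "ennreal (phx x - \<epsilon>' * (1 + (norm x)\<^sup>2 + 2 * ?d * t) - (t * e + D' * t * (t / real n))) \<le> (Top (a / 2) (t / real n) ^^ n) f x"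
          using iter[OF tn(1), of x n] unfolding tn(2) by simp
      qed
      finally show ?thesis .
    qed
    also have "\<dots> \<le> P t f x"
    proof (rule limsup_le_P[OF t, where g = "\<lambda>_. f" and K = "ennreal (phi DIM('a) b)"])
      fix z :: 'a
      show "f z \<le> ennreal (phi DIM('a) b)"
      proof (cases "norm z \<le> b")
        case True
        have "0 \<le> \<epsilon>' * (1 + (norm z)\<^sup>2)" using ep by simp
        thus ?thesis unfolding f_def using phi_mono[OF True, of "DIM('a)"] by (intro ennreal_leI) linarith
      next
        case False
        hence "phx z - \<epsilon>' * (1 + (norm z)\<^sup>2) \<le> 0" using small[of z] by simp
        thus ?thesis unfolding f_def by (simp add: ennreal_neg)
      qed
    qed (use a in \<open>auto simp: Limsup_const\<close>)
    also have "\<dots> = K t f x" using t by (simp add: P_eq_K')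
    also have "\<dots> \<le> K t (\<lambda>y. ennreal (phx y)) x" unfolding f_def using ep by (intro K_mono ennreal_leI) simp
    finally show ?thesis .
  qed
  show ?thesis
  proof (rule ennreal_le_epsilon)
    fix \<epsilon> :: real assume \<epsilon>: "\<epsilon> > 0"
    define Y where "Y = 1 + (norm x)\<^sup>2 + 2 * ?d * t"
    have Y: "Y > 0" unfolding Y_def using t by (intro add_pos_nonneg) auto
    have "ennreal (phx x - \<epsilon> / (2 * Y) * Y - t * (\<epsilon> / (2 * t))) \<le> K t (\<lambda>y. ennreal (phx y)) x"
      unfolding Y_def[symmetric] using main[of "\<epsilon> / (2 * t)" "\<epsilon> / (2 * Y)"] \<epsilon> t Y by (simp add: Y_def)
    hence "ennreal (phx x - \<epsilon>) \<le> K t (\<lambda>y. ennreal (phx y)) x" using Y t by simp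
    hence "ennreal (phx x - \<epsilon>) + ennreal \<epsilon> \<le> K t (\<lambda>y. ennreal (phx y)) x + ennreal \<epsilon>" by (rule add_right_mono)
    moreover have "ennreal (phx x) \<le> ennreal (phx x - \<epsilon>) + ennreal \<epsilon>"
    proof (cases "phx x \<ge> \<epsilon>")
      case True
      thus ?thesis using \<epsilon> by (simp add: ennreal_plus[symmetric] del: ennreal_plus)
    next
      case False
      thus ?thesis by (simp add: add_increasing ennreal_leI)
    qed
    ultimately show "ennreal (phx x) \<le> K t (\<lambda>y. ennreal (phx y)) x + ennreal \<epsilon>" by (rule order_trans[rotated])
  qed
qed

end

section \<open>Instant decay of mass near the origin\<close>

context inv_pot begin

lemma Top_funpow_add:
  assumes [measurable]: "f \<in> borel_measurable borel" "g \<in> borel_measurable borel"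
  shows "(Top \<epsilon> \<delta> ^^ n) (\<lambda>y. f y + g y) x = (Top \<epsilon> \<delta> ^^ n) f x + (Top \<epsilon> \<delta> ^^ n) g x"
proof (induction n arbitrary: x)
  case (Suc n)
  have "(Top \<epsilon> \<delta> ^^ n) (\<lambda>y. f y + g y) = (\<lambda>y. (Top \<epsilon> \<delta> ^^ n) f y + (Top \<epsilon> \<delta> ^^ n) g y)" using Suc.IH by auto
  thus ?case by (simp add: Top_def[of _ _ "\<lambda>y. _ y + _ y"] Gop_add distrib_left) (simp add: Top_def)
qed simp

lemma Top_funpow_cmult:
  assumes [measurable]: "f \<in> borel_measurable borel"
  shows "(Top \<epsilon> \<delta> ^^ n) (\<lambda>y. c * f y) x = c * (Top \<epsilon> \<delta> ^^ n) f x"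
proof (induction n arbitrary: x)
  case (Suc n)
  have "(Top \<epsilon> \<delta> ^^ n) (\<lambda>y. c * f y) = (\<lambda>y. c * (Top \<epsilon> \<delta> ^^ n) f y)" using Suc.IH by auto
  thus ?case by (simp add: Top_def[of _ _ "\<lambda>y. c * _ y"] Gop_cmult) (simp add: Top_def mult_ac)
qed simp

text \<open>Inside radius \<open>r\<close> the killing rate is at least \<open>v\<close>, so a step
  keeps at most the fraction \<open>E\<close> of the mass there, while the mass outside is at most
  \<open>w\<close>. The total mass \<open>V\<close> therefore obeys
  \<open>V (Suc k) \<le> E * V k + (1 - E) * w\<close>. The conclusion is this relaxation towards
  \<open>w\<close> summed over \<open>m\<close> steps in implicit form, with the final value on the
  left.\<close>

lemma Top_drop:
  fixes x :: "'a::euclidean_space"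
  assumes d: "\<delta> > 0" and r: "r > 0" and e: "\<epsilon> > 0" and w: "w \<ge> 0"
  defines "v \<equiv> \<kappa> * r powr (- (2 + 2 * \<beta>))"
  assumes dv: "\<delta> * v \<le> 1"
    and W: "\<And>k. k < a + m \<Longrightarrow> (Top \<epsilon> \<delta> ^^ k) (indicator {y. r \<le> norm y}) x \<le> ennreal w"
  shows "enn2real ((Top \<epsilon> \<delta> ^^ (a + m)) (\<lambda>_. 1) x) * (1 + real m * (\<delta> * v / 2))
    \<le> enn2real ((Top \<epsilon> \<delta> ^^ a) (\<lambda>_. 1) x) + real m * (\<delta> * v / 2) * w"
proof -
  define T where "T k f = (Top \<epsilon> \<delta> ^^ k) f x" for k and f :: "'a \<Rightarrow> ennreal"
  define V where "V k = enn2real (T k (\<lambda>_. 1))" for k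
  let ?o = "indicator {y::'a. r \<le> norm y} :: 'a \<Rightarrow> ennreal" and ?i = "indicator {y::'a. norm y < r} :: 'a \<Rightarrow> ennreal"
  have [measurable]: "?o \<in> borel_measurable borel" "?i \<in> borel_measurable borel" by measurable
  have v0: "v > 0" using kappa r by (simp add: v_def)
  define E where "E = exp (- (\<delta> * v))"
  have E: "E > 0" "E \<le> 1" "1 - E \<ge> \<delta> * v / 2"
  proof -
    show "E > 0" "E \<le> 1" using d v0 by (auto simp: E_def)
    define y where "y = \<delta> * v"
    have y: "0 \<le> y" "y \<le> 1" using d v0 dv by (auto simp: y_def)
    have "E * (1 + y) \<le> 1" using exp_mult_one_plus_le[of y] by (simp add: E_def y_def)
    \<comment> \<open>Valid for \<open>0 \<le> y \<le> 1\<close>; it converts the exponential loss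
      into the linear one \<open>y / 2\<close>, hence the requirement
      \<open>\<delta> * v \<le> 1\<close>.\<close>
    moreover have "(1 - y / 2) * (1 + y) \<ge> 1"
    proof -
      have "0 \<le> y * (1 - y)" using y by (intro mult_nonneg_nonneg) auto
      thus ?thesis by (simp add: field_simps)
    qed
    ultimately have "E * (1 + y) \<le> (1 - y / 2) * (1 + y)" by linarith
    hence "E \<le> 1 - y / 2" using y by (simp add: mult_le_cancel_right)
    thus "1 - E \<ge> \<delta> * v / 2" by (simp add: y_def)
  qed
  have T1: "T k f \<le> 1" if "\<And>y. f y \<le> 1" for k f unfolding T_def by (rule Top_funpow_le_const[OF d that])
  have top1: "Top \<epsilon> \<delta> (\<lambda>_. 1) y \<le> ennreal E * ?i y + ?o y" for y
  proof (cases "norm y < r")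
    case True
    have "cut \<epsilon> \<delta> y \<le> ennreal E"
    proof (cases "norm y > \<epsilon>")
      case c: True
      have "v \<le> pot y" unfolding v_def pot_def using True c e beta kappa by (intro mult_left_mono powr_mono2') auto
      hence "\<delta> * v \<le> \<delta> * pot y" using d by simp
      thus ?thesis using c by (simp add: cut_def E_def)
    qed (simp add: cut_def)
    thus ?thesis using True d by (simp add: Top_def Gop_const)
  next
    case False
    thus ?thesis using d cut_le_1[of \<delta> \<epsilon> y] by (simp add: Top_def Gop_const)
  qed
  have step: "V (Suc k) \<le> V k \<and> V (Suc k) \<le> E * V k + (1 - E) * w" if k: "k < a + m" for k
  proof -
    define p q where "p = enn2real (T k ?i)" and "q = enn2real (T k ?o)"
    have le: "T k ?i \<le> 1" "T k ?o \<le> 1" by (auto intro!: T1 indicator_le_1_ennreal)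
    have fin: "T k ?i < \<top>" "T k ?o < \<top>" using le by (auto intro: order.strict_trans1[OF _ ennreal_one_less_top])
    have p: "T k ?i = ennreal p" "T k ?o = ennreal q" "p \<ge> 0" "q \<ge> 0"
      unfolding p_def q_def using fin by (auto simp: ennreal_enn2real less_top[symmetric])
    have q: "q \<le> w" using W[OF k] p w unfolding T_def[symmetric] by simp
    have "(\<lambda>_. 1) = (\<lambda>y::'a. ?i y + ?o y)" by (auto simp: indicator_def fun_eq_iff)
    hence "T k (\<lambda>_. 1) = T k ?i + T k ?o" unfolding T_def by (simp add: Top_funpow_add)
    hence Vk: "V k = p + q" unfolding V_def p using p(3,4) by (simp add: ennreal_plus[symmetric] del: ennreal_plus)
    have "T (Suc k) (\<lambda>_. 1) = (Top \<epsilon> \<delta> ^^ k) (Top \<epsilon> \<delta> (\<lambda>_. 1)) x" unfolding T_def by (simp add: funpow_swap1)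
    also have "\<dots> \<le> (Top \<epsilon> \<delta> ^^ k) (\<lambda>y. ennreal E * ?i y + ?o y) x" by (intro Top_funpow_mono top1)
    also have "\<dots> = ennreal E * T k ?i + T k ?o" unfolding T_def by (simp add: Top_funpow_add Top_funpow_cmult)
    also have "\<dots> = ennreal (E * p + q)" unfolding p using E p by (simp add: ennreal_mult ennreal_plus)
    finally have "V (Suc k) \<le> E * p + q" unfolding V_def using E p by (simp add: enn2real_leI)
    moreover have "E * p \<le> 1 * p" using E p by (intro mult_right_mono) auto
    moreover have "E * p + q = E * V k + (1 - E) * q" unfolding Vk by (simp add: algebra_simps)
    moreover have "(1 - E) * q \<le> (1 - E) * w" using E q by (intro mult_left_mono) auto
    ultimately show ?thesis using Vk by linarith
  qed
  have dec: "V (a + i) \<le> V (a + j)" if "j \<le> i" "i \<le> m" for i j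
    using that
  proof (induction i)
    case (Suc i)
    show ?case
    proof (cases "j = Suc i")
      case False
      hence "V (a + i) \<le> V (a + j)" using Suc by auto
      thus ?thesis using step[of "a + i"] Suc.prems by (simp add: Suc_le_eq)
    qed simp
  qed simp
  define h where "h = \<delta> * v / 2"
  have h: "h \<ge> 0" using d v0 by (simp add: h_def)
  \<comment> \<open>If the final mass is at most \<open>w\<close>, monotonicity suffices. Otherwise
    all \<open>m\<close> earlier values exceed \<open>w\<close> by at least the final excess, and
    each step loses at least \<open>h\<close> times that excess.\<close>
  have "V (a + m) * (1 + real m * h) \<le> V a + real m * h * w"
  proof (cases "V (a + m) \<le> w")
    case True
    have "real m * h * V (a + m) \<le> real m * h * w" using True h by (intro mult_left_mono) auto
    thus ?thesis using dec[of 0 m] by (simp add: algebra_simps)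
  next
    case False
    have "V (a + i) + real i * (h * (V (a + m) - w)) \<le> V a" if "i \<le> m" for i
      using that
    proof (induction i)
      case (Suc i)
      have "V (a + Suc i) \<le> E * V (a + i) + (1 - E) * w" using step[of "a + i"] Suc.prems by auto
      also have "\<dots> = V (a + i) - (1 - E) * (V (a + i) - w)" by (simp add: algebra_simps)
      also have "\<dots> \<le> V (a + i) - h * (V (a + m) - w)"
      proof -
        have "V (a + m) \<le> V (a + i)" using dec[of i m] Suc.prems by simp
        hence "h * (V (a + m) - w) \<le> (1 - E) * (V (a + i) - w)" using False E h unfolding h_def[symmetric] by (intro mult_mono) auto
        thus ?thesis by simp
      qed
      finally show ?case using Suc by (simp add: algebra_simps)
    qed simp
    from this[of m] show ?thesis by (simp add: algebra_simps)
  qed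
  thus ?thesis unfolding V_def T_def h_def .
qed

end

context fk_kernel begin

lemma K_one_le_1: "t > 0 \<Longrightarrow> K t (\<lambda>_. 1) x \<le> 1"
  using K_le_Gop[of t "\<lambda>_. 1" x] by (simp add: Gop_const)

lemma K_one_antimono:
  assumes s: "0 < s" "s \<le> t" shows "K t (\<lambda>_. 1) x \<le> K s (\<lambda>_. 1) x"
proof -
  have w: "fk_weight W \<beta> \<kappa> t \<omega> \<le> fk_weight W \<beta> \<kappa> s \<omega>" for \<omega>
  proof -
    define I where "I u = (\<integral>\<^sup>+ r. indicator {0..u} r * ennreal (\<kappa> * norm (W r \<omega>) powr (- (2 + 2 * \<beta>))) \<partial>lborel)" for u
    have le: "I s \<le> I t" unfolding I_def using s by (intro nn_integral_mono mult_right_mono) (auto simp: indicator_def)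
    have "I t \<noteq> \<infinity> \<Longrightarrow> enn2real (I s) \<le> enn2real (I t)" using le by (intro enn2real_mono) (auto simp: less_top[symmetric] top_unique)
    thus ?thesis using le unfolding fk_weight_def I_def[symmetric] Let_def by (auto simp: top_unique)
  qed
  have "P t (\<lambda>_. 1) x \<le> P s (\<lambda>_. 1) x"
    unfolding fk_semigroup_def
  proof (intro nn_integral_mono mult_right_mono mult_mono w)
    fix \<omega>
    have "ereal s < exit_time W \<omega>" if "ereal t < exit_time W \<omega>" using that s by (meson ereal_less_eq(3) order_le_less_trans)
    thus "(indicator {\<omega>. ereal t < exit_time W \<omega>} \<omega> :: ennreal) \<le> indicator {\<omega>. ereal s < exit_time W \<omega>} \<omega>" by (auto simp: indicator_def)
  qed auto
  thus ?thesis using s by (simp add: P_eq_K')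
qed

text \<open>Relaxation between the times \<open>1 / (j + 1)\<close> and \<open>1 / j\<close>, whose
  difference is \<open>1 / (j * (j + 1))\<close>. The mass outside radius \<open>r\<close> is at
  most \<open>phx x / phi r\<close> by the barrier. These times are chosen because
  \<open>j * m\<close> and \<open>(j + 1) * m\<close> steps of one common length realise both of
  them.\<close>

lemma K_decay:
  assumes j: "j \<ge> (1::nat)" and r: "r > 0"
  defines "\<theta> \<equiv> \<kappa> * r powr (- (2 + 2 * \<beta>)) / (real j * (real j + 1)) / 2"
  shows "ennreal (1 + \<theta>) * K (1 / real j) (\<lambda>_. 1) x \<le> K (1 / (real j + 1)) (\<lambda>_. 1) x + ennreal (\<theta> * (phx x / phi DIM('a) r))"
proof (cases "norm x < r")
  case False
  have pr: "phi DIM('a) r > 0" using r by (rule phi_pos)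
  have th: "\<theta> \<ge> 0" using kappa by (simp add: \<theta>_def)
  have k: "K (1 / real j) (\<lambda>_. 1) x \<le> 1" "K (1 / real j) (\<lambda>_. 1) x \<le> K (1 / (real j + 1)) (\<lambda>_. 1) x"
    using j by (auto intro!: K_one_le_1 K_one_antimono simp: frac_le)
  have "ennreal (1 + \<theta>) * K (1 / real j) (\<lambda>_. 1) x = K (1 / real j) (\<lambda>_. 1) x + ennreal \<theta> * K (1 / real j) (\<lambda>_. 1) x"
    using th by (simp add: ennreal_plus distrib_right)
  also have "\<dots> \<le> K (1 / (real j + 1)) (\<lambda>_. 1) x + ennreal \<theta> * 1" using k by (intro add_mono mult_left_mono) auto
  also have "ennreal \<theta> * 1 \<le> ennreal (\<theta> * (phx x / phi DIM('a) r))"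
  proof -
    have "1 \<le> phx x / phi DIM('a) r" using False pr phi_mono[of r "norm x" "DIM('a)"] by simp
    hence "\<theta> * 1 \<le> \<theta> * (phx x / phi DIM('a) r)" using th by (intro mult_left_mono) auto
    thus ?thesis by (simp add: ennreal_leI)
  qed
  finally show ?thesis by (simp add: add_left_mono)
next
  case xr: True
  define v where "v = \<kappa> * r powr (- (2 + 2 * \<beta>))"
  have v: "v > 0" using kappa r by (simp add: v_def)
  have th: "\<theta> = v / (real j * (real j + 1)) / 2" "\<theta> \<ge> 0" using kappa by (auto simp: \<theta>_def v_def)
  have pr: "phi DIM('a) r > 0" using r by (rule phi_pos)
  define w0 where "w0 = phx x / phi DIM('a) r"
  have w0: "w0 \<ge> 0" using pr by (simp add: w0_def)
  let ?Ta = "\<lambda>i n. (Top (1 / real (Suc i)) (1 / (real j + 1) / real n) ^^ n) (\<lambda>_. 1) x"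
  let ?Tb = "\<lambda>i n. (Top (1 / real (Suc i)) (1 / real j / real n) ^^ n) (\<lambda>_. 1) x"
  obtain J where J: "1 / real (Suc J) < r" using nat_approx_posE[OF r] by metis
  \<comment> \<open>Any strict upper bound \<open>y\<close> for the mass at the earlier time also
    bounds the approximating iterates eventually, by \<open>limsup_le_P\<close>; this makes the
    discrete inequality usable along a subsequence.\<close>
  have main: "ennreal (1 + \<theta>) * liminf (?Tb i) \<le> y + ennreal (\<theta> * (w0 + e))" if i: "i \<ge> J" and e: "e > 0" and y: "K (1 / (real j + 1)) (\<lambda>_. 1) x < y" for i y e
  proof -
    have ei: "0 < 1 / real (Suc i)" "1 / real (Suc i) \<le> r"
    proof -
      have "1 / real (Suc i) \<le> 1 / real (Suc J)" using i by (simp add: frac_le)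
      thus "1 / real (Suc i) \<le> r" using J by linarith
    qed simp
    obtain D where D: "D \<ge> 0"
    "\<And>\<delta> n x f. \<delta> > 0 \<Longrightarrow> (f :: 'a \<Rightarrow> ennreal) \<in> borel_measurable borel \<Longrightarrow> (\<And>y. norm y < r \<Longrightarrow> f y = 0) \<Longrightarrow> (\<And>y. f y \<le> ennreal 1) \<Longrightarrow>
      (\<And>y. r \<le> norm y \<Longrightarrow> norm y < r + 1 \<Longrightarrow> f y \<le> ennreal (1 / phi DIM('a) r * phi DIM('a) r)) \<Longrightarrow>
      (\<And>k y. 0 < k \<Longrightarrow> k \<le> n \<Longrightarrow> r \<le> norm y \<Longrightarrow> norm y < r + 1 \<Longrightarrow> Gop (real k * \<delta>) f y \<le> ennreal (1 / phi DIM('a) r * phi DIM('a) r)) \<Longrightarrow>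
      norm x < r \<Longrightarrow> (Top (1 / real (Suc i)) \<delta> ^^ n) f x \<le> ennreal (1 / phi DIM('a) r * phi DIM('a) (norm x) + real n * (e / 2 * \<delta> + D * \<delta>\<^sup>2))"
      using Top_funpow_phi_upper[OF ei, of "r + 1" "1 / phi DIM('a) r" 1 "e / 2", where 'a = 'a] e pr by (metis add.commute divide_nonneg_pos half_gt_zero less_add_one less_imp_le zero_le_one)
    have lim: "(\<lambda>m. real 1 / real j / (real j + 1) / real m) \<longlonglongrightarrow> 0" by (rule lim_const_over_n)
    have ev: "\<forall>\<^sub>F m in sequentially. ennreal (1 + \<theta>) * ?Tb i ((j + 1) * m) \<le> ?Ta i (j * m) + ennreal (\<theta> * (w0 + e))"
    proof -
      have c: "min (1 / v) (e / (2 * (D + 1))) > 0" using v e D by simp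
      have "\<forall>\<^sub>F m in sequentially. real 1 / real j / (real j + 1) / real m < min (1 / v) (e / (2 * (D + 1)))"
        by (rule order_tendstoD(2)[OF lim c])
      thus ?thesis using eventually_gt_at_top[of 0]
      proof eventually_elim
        case (elim m)
        define \<delta> where "\<delta> = 1 / real j / (real j + 1) / real m"
        have d: "\<delta> > 0" using j elim by (simp add: \<delta>_def)
        have d1: "\<delta> < 1 / v" "\<delta> < e / (2 * (D + 1))" using elim by (auto simp: \<delta>_def)
        have dv: "\<delta> * v \<le> 1" using d1 v by (simp add: field_simps)
        have dD: "D * \<delta> \<le> e / 2"
        proof -
          have "(D + 1) * \<delta> \<le> e / 2" using d1(2) D by (simp add: field_simps)
          moreover have "D * \<delta> \<le> (D + 1) * \<delta>" using d by (intro mult_right_mono) auto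
          ultimately show ?thesis by linarith
        qed
        \<comment> \<open>The two discretisations share the step \<open>\<delta>\<close>, so one
          chain of iterates contains both.\<close>
        have da: "1 / (real j + 1) / real (j * m) = \<delta>" "1 / real j / real ((j + 1) * m) = \<delta>"
          using j by (simp_all add: \<delta>_def algebra_simps)
        have tot: "real ((j + 1) * m) * \<delta> \<le> 1"
        proof -
          have "real ((j + 1) * m) * \<delta> = real ((j + 1) * m) * (1 / real j / real ((j + 1) * m))" by (simp only: da(2))
          also have "\<dots> = 1 / real j" using elim by (simp del: of_nat_mult of_nat_add)
          finally show ?thesis using j by simp
        qed
        have W: "(Top (1 / real (Suc i)) \<delta> ^^ k) (indicator {y. r \<le> norm y}) x \<le> ennreal (w0 + e)" if k: "k < j * m + m" for k :: nat
        proof -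
          have "(Top (1 / real (Suc i)) \<delta> ^^ k) (indicator {y. r \<le> norm y}) x \<le> ennreal (1 / phi DIM('a) r * phi DIM('a) (norm x) + real k * (e / 2 * \<delta> + D * \<delta>\<^sup>2))"
          proof (rule D(2)[OF d _ _ _ _ _ xr])
            show "(indicator {y. r \<le> norm y} :: 'a \<Rightarrow> ennreal) \<in> borel_measurable borel" by measurable
            fix k :: nat and y :: 'a assume "0 < k"
            have "Gop (real k * \<delta>) (indicator {y. r \<le> norm y}) y \<le> Gop (real k * \<delta>) (\<lambda>_. 1) y" by (intro Gop_mono indicator_le_1_ennreal)
            thus "Gop (real k * \<delta>) (indicator {y. r \<le> norm y}) y \<le> ennreal (1 / phi DIM('a) r * phi DIM('a) r)" using \<open>0 < k\<close> d pr by (simp add: Gop_const)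
          qed (use pr in \<open>auto simp: indicator_def\<close>)
          also have "\<dots> \<le> ennreal (w0 + e)"
          proof (rule ennreal_leI)
            have "k \<le> (j + 1) * m" using k by simp
            hence "real k * \<delta> \<le> real ((j + 1) * m) * \<delta>" using d by (intro mult_right_mono of_nat_mono) auto
            hence kd: "real k * \<delta> \<le> 1" using tot by linarith
            have "real k * (e / 2 * \<delta> + D * \<delta>\<^sup>2) = (real k * \<delta>) * (e / 2 + D * \<delta>)" by (simp add: algebra_simps power2_eq_square)
            also have "\<dots> \<le> 1 * (e / 2 + e / 2)" using kd dD d D e by (intro mult_mono) auto
            finally show "1 / phi DIM('a) r * phi DIM('a) (norm x) + real k * (e / 2 * \<delta> + D * \<delta>\<^sup>2) \<le> w0 + e" by (simp add: w0_def)
          qed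
          finally show ?thesis .
        qed
        define Va Vb where "Va = ?Ta i (j * m)" and "Vb = ?Tb i ((j + 1) * m)"
        have le1: "Va \<le> 1" "Vb \<le> 1" unfolding Va_def Vb_def da by (intro Top_funpow_le_const d, simp)+
        have jm: "(j + 1) * m = j * m + m" by simp
        have "enn2real Vb * (1 + real m * (\<delta> * v / 2)) \<le> enn2real Va + real m * (\<delta> * v / 2) * (w0 + e)"
          unfolding Va_def Vb_def da unfolding jm v_def
          by (rule Top_drop[OF d r ei(1) _ _ W]) (use w0 e dv in \<open>auto simp: v_def\<close>)
        also have "real m * (\<delta> * v / 2) = \<theta>" using j elim by (simp add: \<delta>_def th)
        finally have "ennreal (enn2real Vb * (1 + \<theta>)) \<le> ennreal (enn2real Va + \<theta> * (w0 + e))" by (rule ennreal_leI)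
        moreover have "ennreal (enn2real Vb * (1 + \<theta>)) = ennreal (1 + \<theta>) * Vb" using le1 th(2) by (simp add: ennreal_mult ennreal_enn2real order.strict_trans1[OF _ ennreal_one_less_top] mult.commute)
        moreover have "ennreal (enn2real Va + \<theta> * (w0 + e)) = Va + ennreal (\<theta> * (w0 + e))" using le1 th(2) w0 e by (simp add: ennreal_plus ennreal_enn2real order.strict_trans1[OF _ ennreal_one_less_top])
        ultimately show "ennreal (1 + \<theta>) * ?Tb i ((j + 1) * m) \<le> ?Ta i (j * m) + ennreal (\<theta> * (w0 + e))" unfolding Va_def Vb_def by simp
      qed
    qed
    have "limsup (?Ta i) \<le> P (1 / (real j + 1)) (\<lambda>_. 1) x"
      by (rule limsup_le_P[where g = "\<lambda>_ _. 1" and K = 1]) (use ei in \<open>auto simp: Limsup_const\<close>)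
    hence "limsup (?Ta i) < y" using y by (simp add: P_eq_K')
    hence "\<forall>\<^sub>F n in sequentially. ?Ta i n < y" by (rule Limsup_lessD)
    moreover have "filterlim (\<lambda>m. j * m) at_top sequentially" using j by (intro filterlim_subseq) (auto simp: strict_mono_def)
    ultimately have "\<forall>\<^sub>F m in sequentially. ?Ta i (j * m) < y" by (rule eventually_compose_filterlim)
    with ev have ev2: "\<forall>\<^sub>F m in sequentially. ennreal (1 + \<theta>) * ?Tb i ((j + 1) * m) \<le> y + ennreal (\<theta> * (w0 + e))"
    proof eventually_elim
      case (elim m)
      thus ?case by (meson add_right_mono less_imp_le order_trans)
    qed
    have "ennreal (1 + \<theta>) * liminf (?Tb i) \<le> ennreal (1 + \<theta>) * liminf (?Tb i \<circ> (\<lambda>m. (j + 1) * m))"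
      by (intro mult_left_mono liminf_subseq_mono) (auto simp: strict_mono_def intro!: add_less_le_mono)
    also have "\<dots> \<le> liminf (\<lambda>m. ennreal (1 + \<theta>) * (?Tb i \<circ> (\<lambda>m. (j + 1) * m)) m)"
      using th(2) by (intro Liminf_mult_ennreal[OF tendsto_const]) (auto simp del: ennreal_plus)
    also have "\<dots> \<le> liminf (\<lambda>m::nat. y + ennreal (\<theta> * (w0 + e)))" using ev2 by (intro Liminf_mono) (simp add: comp_def)
    finally show ?thesis by (simp add: Liminf_const)
  qed
  have c1: "ennreal (1 + \<theta>) * K (1 / real j) (\<lambda>_. 1) x \<le> y + ennreal (\<theta> * (w0 + e))" if e: "e > 0" and y: "K (1 / (real j + 1)) (\<lambda>_. 1) x < y" for y e
  proof -
    have "P (1 / real j) (\<lambda>_. 1) x \<le> liminf (\<lambda>i. liminf (?Tb i))"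
      using j by (intro P_le_liminf) (auto simp: Liminf_const)
    hence "ennreal (1 + \<theta>) * K (1 / real j) (\<lambda>_. 1) x \<le> ennreal (1 + \<theta>) * liminf (\<lambda>i. liminf (?Tb i))"
      using j by (intro mult_left_mono) (auto simp: P_eq_K')
    also have "\<dots> \<le> liminf (\<lambda>i. ennreal (1 + \<theta>) * liminf (?Tb i))"
      using th(2) by (intro Liminf_mult_ennreal[OF tendsto_const]) (auto simp del: ennreal_plus)
    also have "\<dots> \<le> liminf (\<lambda>i::nat. y + ennreal (\<theta> * (w0 + e)))"
      by (intro Liminf_mono eventually_mono[OF eventually_ge_at_top[of J]] main e y)
    finally show ?thesis by (simp add: Liminf_const)
  qed
  have kf: "K (1 / (real j + 1)) (\<lambda>_. 1) x < \<top>" using K_one_le_1[of "1 / (real j + 1)" x] by (auto intro: order.strict_trans1[OF _ ennreal_one_less_top])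
  show ?thesis
  proof (rule ennreal_le_epsilon)
    fix e :: real assume e: "e > 0"
    define e1 where "e1 = e / 2 / (\<theta> + 1)"
    have e1: "e1 > 0" "\<theta> * e1 \<le> e / 2" using e th(2) by (auto simp: e1_def field_simps)
    have "K (1 / (real j + 1)) (\<lambda>_. 1) x < K (1 / (real j + 1)) (\<lambda>_. 1) x + ennreal (e / 2)" using kf e ennreal_add_left_cancel_less[of "K (1 / (real j + 1)) (\<lambda>_. 1) x" 0 "ennreal (e / 2)"] by auto
    from c1[OF e1(1) this] have "ennreal (1 + \<theta>) * K (1 / real j) (\<lambda>_. 1) x \<le> K (1 / (real j + 1)) (\<lambda>_. 1) x + (ennreal (e / 2) + ennreal (\<theta> * (w0 + e1)))"
      by (simp add: add.assoc)
    also have "ennreal (e / 2) + ennreal (\<theta> * (w0 + e1)) \<le> ennreal (\<theta> * w0) + ennreal e"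
    proof -
      have "e / 2 + \<theta> * (w0 + e1) \<le> \<theta> * w0 + e" using e1(2) by (simp add: algebra_simps)
      thus ?thesis using e e1 th(2) w0 by (simp add: ennreal_plus[symmetric] ennreal_leI del: ennreal_plus)
    qed
    finally show "ennreal (1 + \<theta>) * K (1 / real j) (\<lambda>_. 1) x \<le> K (1 / (real j + 1)) (\<lambda>_. 1) x + ennreal (\<theta> * (phx x / phi DIM('a) r)) + ennreal e"
      by (simp add: add_left_mono add.assoc w0_def)
  qed
qed

lemma DIM_ge_1: "DIM('a) \<ge> 1"
  by (simp add: Suc_le_eq)

text \<open>Since \<open>V\<close> grows like a power larger than \<open>2\<close> of \<open>ln (1 / \<phi>)\<close>, the levels \<open>\<phi> = exp (- j)\<close> are crossed in
  summable times, so that the bound comes down from infinity.\<close>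

lemma K_one_le_phi:
  obtains C j0 where "C > 0" "j0 \<ge> (2::nat)" "\<And>x. x \<noteq> 0 \<Longrightarrow> K (1 / real j0) (\<lambda>_. 1) x \<le> ennreal (C * phx x)"
proof -
  obtain A where A: "A > 0" "\<And>r. 0 < r \<Longrightarrow> r \<le> 1 \<Longrightarrow> exp (- A * r powr (- \<beta>)) \<le> phi DIM('a) r"
    using phi_lower_exp by metis
  \<comment> \<open>The radius at which \<open>A * r powr (- \<beta>) = j\<close>, so that
    \<open>phi\<close> is at least \<open>exp (- j)\<close> there.\<close>
  define rr where "rr j = (A / real j) powr (1 / \<beta>)" for j :: nat
  define th where "th j = \<kappa> * rr j powr (- (2 + 2 * \<beta>)) / (real j * (real j + 1)) / 2" for j
  \<comment> \<open>At radius \<open>rr j\<close> the potential has order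
    \<open>j powr (2 / \<beta> + 2)\<close>, against a time gap of order
    \<open>1 / j\<^sup>2\<close>. The relaxation strength \<open>th j\<close> thus tends to infinity
    and eventually exceeds \<open>2 * exp 1\<close>.\<close>
  have "filterlim (\<lambda>j::nat. \<kappa> * (A powr (- (2 / \<beta> + 2))) / 4 * real j powr (2 / \<beta>)) at_top sequentially"
  proof -
    have c: "\<kappa> * (A powr (- (2 / \<beta> + 2))) / 4 > 0" using kappa A by simp
    have b: "2 / \<beta> > 0" using beta by simp
    show ?thesis using c b by real_asymp
  qed
  hence "\<forall>\<^sub>F j in sequentially. \<kappa> * (A powr (- (2 / \<beta> + 2))) / 4 * real j powr (2 / \<beta>) \<ge> 2 * exp 1" unfolding filterlim_at_top by blast
  then obtain N where N: "\<And>j. j \<ge> N \<Longrightarrow> \<kappa> * (A powr (- (2 / \<beta> + 2))) / 4 * real j powr (2 / \<beta>) \<ge> 2 * exp 1"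
    unfolding eventually_sequentially by blast
  define j0 where "j0 = max (max 2 N) (nat \<lceil>A\<rceil>)"
  have j0: "j0 \<ge> 2" "j0 \<ge> N" "real j0 \<ge> A" unfolding j0_def by linarith+
  have big: "th j \<ge> 2 * exp 1 \<and> 0 < rr j \<and> exp (- real j) \<le> phi DIM('a) (rr j)" if j: "j \<ge> j0" for j
  proof (intro conjI)
    have j1: "real j \<ge> 1" "real j \<ge> A" "j \<ge> N" using j j0 by linarith+
    have ne: "A \<noteq> 0" "j \<noteq> 0" using A j1 by auto
    have jA: "0 < A / real j" "A / real j \<le> 1" using A j1 by auto
    show r0: "0 < rr j" using ne by (simp add: rr_def)
    have r1: "rr j \<le> 1" using jA beta by (simp add: rr_def powr_le1)
    have "rr j powr (- \<beta>) = (A / real j) powr (- 1)" using beta by (simp add: rr_def powr_powr)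
    hence "A * rr j powr (- \<beta>) = real j" using ne A by (simp add: powr_minus_divide)
    thus "exp (- real j) \<le> phi DIM('a) (rr j)" using A(2)[OF r0 r1] by simp
    have e: "1 / \<beta> * (- (2 + 2 * \<beta>)) = - (2 / \<beta> + 2)" using beta by (simp add: field_simps)
    have "rr j powr (- (2 + 2 * \<beta>)) = (A / real j) powr (- (2 / \<beta> + 2))" unfolding rr_def powr_powr e ..
    also have "\<dots> = A powr (- (2 / \<beta> + 2)) * real j powr (2 / \<beta> + 2)"
    proof -
      have "(A / real j) powr (- c) = A powr (- c) * real j powr c" for c
        using A j1 powr_divide[of A "real j" "- c"] by (simp add: powr_minus divide_inverse)
      thus ?thesis .
    qed
    also have "real j powr (2 / \<beta> + 2) = real j powr (2 / \<beta>) * (real j)\<^sup>2" using j1 by (simp add: powr_add powr_numeral)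
    finally have v: "\<kappa> * rr j powr (- (2 + 2 * \<beta>)) = \<kappa> * (A powr (- (2 / \<beta> + 2))) * real j powr (2 / \<beta>) * (real j)\<^sup>2" by simp
    have "real j * (real j + 1) \<le> real j * (2 * real j)" using j1 by (intro mult_left_mono) auto
    hence jj: "real j * (real j + 1) \<le> 2 * (real j)\<^sup>2" by (simp add: power2_eq_square)
    have pos: "0 \<le> \<kappa> * (A powr (- (2 / \<beta> + 2))) * real j powr (2 / \<beta>)" using kappa by simp
    have "\<kappa> * (A powr (- (2 / \<beta> + 2))) * real j powr (2 / \<beta>) / 4 = \<kappa> * rr j powr (- (2 + 2 * \<beta>)) / (2 * (real j)\<^sup>2) / 2"
      unfolding v using j1 by simp
    also have "\<dots> \<le> th j" unfolding th_def using jj j1 kappa by (intro divide_right_mono divide_left_mono) auto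
    finally show "2 * exp 1 \<le> th j" using N[OF j1(3)] by simp
  qed
  show thesis
  proof (rule that[of "2 * exp (real j0)" j0])
    fix x :: 'a assume x: "x \<noteq> 0"
    have px: "phx x > 0" using x by (simp add: phi_pos)
    define u where "u j = enn2real (K (1 / real j) (\<lambda>_. 1) x)" for j
    have K1: "K (1 / real j) (\<lambda>_. 1) x \<le> 1" if "j \<ge> 1" for j using that by (intro K_one_le_1) auto
    have u: "K (1 / real j) (\<lambda>_. 1) x = ennreal (u j)" "0 \<le> u j" "u j \<le> 1" if "j \<ge> 1" for j
    proof -
      have "K (1 / real j) (\<lambda>_. 1) x < \<top>" using K1[OF that] by (auto intro: order.strict_trans1[OF _ ennreal_one_less_top])
      thus "K (1 / real j) (\<lambda>_. 1) x = ennreal (u j)" by (simp add: u_def ennreal_enn2real less_top[symmetric])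
      show "0 \<le> u j" by (simp add: u_def)
      show "u j \<le> 1" unfolding u_def using enn2real_mono[OF K1[OF that]] by simp
    qed
    \<comment> \<open>The bound is lost by a factor \<open>exp 1\<close> from \<open>j\<close> to
      \<open>Suc j\<close>; the relaxation restores it because
      \<open>2 * exp 1 + th j \<le> 2 * (1 + th j)\<close>. The induction therefore runs downwards
      in \<open>j\<close>, that is forwards in time.\<close>
    have step: "u j \<le> 2 * exp (real j) * phx x" if j: "j \<ge> j0" and IH: "u (Suc j) \<le> 2 * exp (real (Suc j)) * phx x" for j
    proof -
      have j1: "j \<ge> 1" using j j0 by linarith
      note b = big[OF j]
      have th0: "th j \<ge> 0" using b exp_gt_zero[of "1::real"] by linarith
      have pr: "phi DIM('a) (rr j) > 0" using b by (auto intro: phi_pos)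
      have "ennreal (1 + th j) * K (1 / real j) (\<lambda>_. 1) x \<le> K (1 / (real j + 1)) (\<lambda>_. 1) x + ennreal (th j * (phx x / phi DIM('a) (rr j)))"
        using K_decay[OF j1, of "rr j" x] b unfolding th_def by blast
      hence "ennreal ((1 + th j) * u j) \<le> ennreal (u (Suc j) + th j * (phx x / phi DIM('a) (rr j)))"
        using u[OF j1] u[of "Suc j"] th0 pr by (simp add: ennreal_mult ennreal_plus add.commute)
      hence "(1 + th j) * u j \<le> u (Suc j) + th j * (phx x / phi DIM('a) (rr j))"
        using u(2)[of "Suc j"] th0 pr by (subst (asm) ennreal_le_iff) auto
      also have "phx x / phi DIM('a) (rr j) \<le> exp (real j) * phx x"
      proof -
        have "phx x / phi DIM('a) (rr j) \<le> phx x / exp (- real j)" using b by (intro divide_left_mono) (use pr in simp_all)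
        thus ?thesis by (simp add: exp_minus field_simps)
      qed
      hence "u (Suc j) + th j * (phx x / phi DIM('a) (rr j)) \<le> 2 * exp (real (Suc j)) * phx x + th j * (exp (real j) * phx x)"
        using IH th0 by (intro add_mono mult_left_mono) auto
      also have "\<dots> = (2 * exp 1 + th j) * (exp (real j) * phx x)" by (simp add: exp_add algebra_simps)
      also have "\<dots> \<le> (2 * (1 + th j)) * (exp (real j) * phx x)" using b by (intro mult_right_mono) auto
      finally have "(1 + th j) * u j \<le> (1 + th j) * (2 * exp (real j) * phx x)" by (simp add: algebra_simps)
      thus ?thesis using th0 by (simp add: mult_le_cancel_left)
    qed
    \<comment> \<open>Start of the downward induction: once
      \<open>exp (real m) * phx x \<ge> 1\<close> the claim follows from total mass at most 1. The
      starting index depends on \<open>x\<close>, the resulting constant does not.\<close>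
    obtain M where M: "real M > ln (1 / phx x)" using reals_Archimedean2 by blast
    define m where "m = max M j0"
    have "1 / phx x = exp (ln (1 / phx x))" using px by simp
    also have "\<dots> \<le> exp (real m)" using M by (simp add: m_def)
    also have "\<dots> \<le> 2 * exp (real m)" by simp
    finally have "1 \<le> 2 * exp (real m) * phx x" using px by (simp add: field_simps)
    hence um: "u m \<le> 2 * exp (real m) * phx x" proof -
      have "m \<ge> 1" using j0 by (simp add: m_def)
      thus ?thesis using u(3)[of m] \<open>1 \<le> 2 * exp (real m) * phx x\<close> by linarith
    qed
    have "u j0 \<le> 2 * exp (real j0) * phx x"
    proof (rule inc_induct[of j0 m "\<lambda>j. u j \<le> 2 * exp (real j) * phx x"])
      show "j0 \<le> m" by (simp add: m_def)
    qed (use um step in auto)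
    thus "K (1 / real j0) (\<lambda>_. 1) x \<le> ennreal (2 * exp (real j0) * phx x)" using u(1)[of j0] j0 by (simp add: ennreal_leI)
  qed (use j0 in auto)
qed

section \<open>Upper bounds\<close>

definition omega :: real where "omega = unit_ball_vol (real DIM('a))"

lemma omega_pos: "omega > 0" by (simp add: omega_def)

lemma emeasure_ball: "r \<ge> 0 \<Longrightarrow> emeasure lborel (ball (c::'a) r) = ennreal (omega * r ^ DIM('a))"
  by (simp add: omega_def emeasure_ball)

definition cd :: "real \<Rightarrow> real" where "cd t = (4 * pi * t) powr (- real DIM('a) / 2)"

lemma cd_pos: "t > 0 \<Longrightarrow> cd t > 0" by (simp add: cd_def)

lemma cd_scale: "t > 0 \<Longrightarrow> s > 0 \<Longrightarrow> cd (s * t) = s powr (- real DIM('a) / 2) * cd t"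
  using powr_mult[of "4 * pi * t" s "- real DIM('a) / 2"] by (simp add: cd_def mult_ac)

lemma cd_volume: "t > 0 \<Longrightarrow> cd t * (sqrt t) ^ DIM('a) = (4 * pi) powr (- real DIM('a) / 2)"
proof -
  assume t: "t > 0"
  have "(sqrt t) ^ DIM('a) = t powr (real DIM('a) / 2)" using t by (simp add: powr_half_sqrt[symmetric] powr_powr powr_realpow[symmetric])
  moreover have "cd t = (4 * pi) powr (- real DIM('a) / 2) * t powr (- real DIM('a) / 2)" using t powr_mult[of "4 * pi" t "- real DIM('a) / 2"] by (simp add: cd_def)
  moreover have "t powr (- real DIM('a) / 2) * t powr (real DIM('a) / 2) = 1" using t by (simp add: powr_add[symmetric])
  ultimately show ?thesis by (simp add: mult.assoc)
qed

text \<open>Split at the midpoint: over the second half the kernel is at most \<open>cd t\<close>,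
  so the ball receives at most \<open>cd t\<close> times its volume from any point, and the first
  half contributes the surviving mass.\<close>

lemma K_ball_le:
  assumes t: "t > 0" and r: "r \<ge> 0" and a: "a \<ge> 0"
  shows "K (2 * t) (\<lambda>y. ennreal a * indicator (ball 0 r) y) x \<le> ennreal (a * (cd t * omega * r ^ DIM('a))) * K t (\<lambda>_. 1) x"
proof -
  have [measurable]: "(indicator (ball 0 r) :: 'a \<Rightarrow> ennreal) \<in> borel_measurable borel" by (rule borel_measurable_indicator) simp
  have "K t (\<lambda>y. ennreal a * indicator (ball 0 r) y) z \<le> ennreal (a * (cd t * omega * r ^ DIM('a)))" for z
  proof -
    have "K t (\<lambda>y. ennreal a * indicator (ball 0 r) y) z \<le> (\<integral>\<^sup>+ (y::'a). ennreal (cd t) * (ennreal a * indicator (ball 0 r) y) \<partial>lborel)"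
      unfolding K_def
    proof (rule nn_integral_mono)
      fix y
      have "ennreal (pp t z y) \<le> ennreal (cd t)" using pp_le_const[OF t, of z y] by (intro ennreal_leI) (simp add: cd_def)
      thus "ennreal (pp t z y) * (ennreal a * indicator (ball 0 r) y) \<le> ennreal (cd t) * (ennreal a * indicator (ball 0 r) y)" by (rule mult_right_mono) simp
    qed
    also have "\<dots> = ennreal (cd t) * (ennreal a * emeasure lborel (ball (0::'a) r))"
    proof -
      have "(\<integral>\<^sup>+ (y::'a). indicator (ball 0 r) y \<partial>lborel) = emeasure lborel (ball (0::'a) r)" by (rule nn_integral_indicator) simp
      thus ?thesis by (simp add: nn_integral_cmult)
    qed
    also have "\<dots> = ennreal (a * (cd t * omega * r ^ DIM('a)))"
      using r a cd_pos[OF t] omega_pos by (simp add: emeasure_ball ennreal_mult[symmetric] mult_ac)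
    finally show ?thesis .
  qed
  hence "K t (K t (\<lambda>y. ennreal a * indicator (ball 0 r) y)) x \<le> K t (\<lambda>_. ennreal (a * (cd t * omega * r ^ DIM('a))) * 1) x"
    by (intro K_mono) simp
  also have "\<dots> = ennreal (a * (cd t * omega * r ^ DIM('a))) * K t (\<lambda>_. 1) x" using t by (subst K_cmult) auto
  finally show ?thesis using t by (simp add: K_double)
qed

text \<open>Induction over dyadic time scales. At time \<open>t\<close> the mass inside radius
  \<open>a * sqrt t\<close> is a small multiple of the mass at \<open>t / 2\<close>, and the mass
  outside is bounded by the barrier.\<close>

lemma K_one_upper:
  obtains C where "C > 0" "\<And>t x. t \<ge> 1 / 2 \<Longrightarrow> x \<noteq> 0 \<Longrightarrow> K t (\<lambda>_. 1) x \<le> ennreal (C * (phx x / phi DIM('a) (sqrt t)))"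
proof -
  obtain C0 j0 where C0: "C0 > 0" "j0 \<ge> (2::nat)" "\<And>x. x \<noteq> 0 \<Longrightarrow> K (1 / real j0) (\<lambda>_. 1) x \<le> ennreal (C0 * phx x)"
    using K_one_le_phi by metis
  obtain C1 where C1: "C1 \<ge> 1" "\<And>r l. r \<ge> 1 / 2 \<Longrightarrow> l \<ge> 1 \<Longrightarrow> phi DIM('a) (l * r) \<le> C1 * l * phi DIM('a) r"
    using phi_growth[OF DIM_ge_1, of "1 / 2"] by (metis half_gt_zero_iff zero_less_one)
  define \<Omega> where "\<Omega> = 2 powr (real DIM('a) / 2) * (4 * pi) powr (- real DIM('a) / 2) * omega"
  have Om: "\<Omega> > 0" using omega_pos by (simp add: \<Omega>_def)
  define C2 where "C2 = 2 * C1"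
  \<comment> \<open>Chosen so that the inner ball returns at most \<open>1 / (2 * C2)\<close> of the
    earlier mass. As \<open>phi (sqrt t) \<le> C2 * phi (sqrt (t / 2))\<close>, it uses up half of
    the constant \<open>C\<close>.\<close>
  define a where "a = min 1 (1 / (2 * C2 * \<Omega>))"
  have a: "0 < a" "a \<le> 1" "\<Omega> * a \<le> 1 / (2 * C2)"
  proof -
    show "0 < a" "a \<le> 1" using C1 Om by (auto simp: a_def C2_def)
    have "\<Omega> * a \<le> \<Omega> * (1 / (2 * C2 * \<Omega>))" using Om by (intro mult_left_mono) (auto simp: a_def)
    thus "\<Omega> * a \<le> 1 / (2 * C2)" using Om by simp
  qed
  have a2: "a / 2 > 0" using a by simp
  obtain C3 where C3: "C3 \<ge> 1" "\<And>r l. r \<ge> a / 2 \<Longrightarrow> l \<ge> 1 \<Longrightarrow> phi DIM('a) (l * r) \<le> C3 * l * phi DIM('a) r"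
    using phi_growth[OF DIM_ge_1 a2] by metis
  \<comment> \<open>The first entry covers times up to 1; the second leaves room for the barrier
    term in the other half of \<open>C\<close>.\<close>
  define C where "C = max (C0 * phi DIM('a) 1) (2 * (C3 / a))"
  have C: "C > 0" "C0 * phi DIM('a) 1 \<le> C" "2 * (C3 / a) \<le> C" using C3 a by (auto simp: C_def less_max_iff_disj)
  have half: "sqrt t \<ge> 1 / 2" if "t \<ge> 1 / 2" for t
    using that by (intro real_le_rsqrt) (simp add: power2_eq_square)
  have main: "\<forall>t x. 1 / 2 \<le> t \<and> t \<le> 2 ^ n \<and> x \<noteq> 0 \<longrightarrow> K t (\<lambda>_. 1) x \<le> ennreal (C * (phx x / phi DIM('a) (sqrt t)))" for n
  proof (induction n)
    case 0
    show ?case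
    proof (intro allI impI)
      fix t :: real and x :: 'a assume t: "1 / 2 \<le> t \<and> t \<le> 2 ^ 0 \<and> x \<noteq> 0"
      have "1 / real j0 \<le> t" using t C0(2) by (auto simp: field_simps intro: order_trans[of _ "real j0 * (1 / 2)"])
      hence "K t (\<lambda>_. 1) x \<le> ennreal (C0 * phx x)" using C0 t by (intro order_trans[OF K_one_antimono C0(3)]) auto
      also have "\<dots> \<le> ennreal (C * (phx x / phi DIM('a) (sqrt t)))"
      proof (rule ennreal_leI)
        have p: "0 < phi DIM('a) (sqrt t)" "phi DIM('a) (sqrt t) \<le> phi DIM('a) 1" using t by (auto intro!: phi_pos phi_mono)
        have "C0 * phx x = C0 * phi DIM('a) (sqrt t) * (phx x / phi DIM('a) (sqrt t))" using p by simp
        also have "\<dots> \<le> C0 * phi DIM('a) 1 * (phx x / phi DIM('a) (sqrt t))" using p C0 by (intro mult_right_mono mult_left_mono) auto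
        also have "\<dots> \<le> C * (phx x / phi DIM('a) (sqrt t))" using C p by (intro mult_right_mono) auto
        finally show "C0 * phx x \<le> C * (phx x / phi DIM('a) (sqrt t))" .
      qed
      finally show "K t (\<lambda>_. 1) x \<le> ennreal (C * (phx x / phi DIM('a) (sqrt t)))" .
    qed
  next
    case (Suc n)
    show ?case
    proof (intro allI impI)
      fix t :: real and x :: 'a assume t: "1 / 2 \<le> t \<and> t \<le> 2 ^ Suc n \<and> x \<noteq> 0"
      show "K t (\<lambda>_. 1) x \<le> ennreal (C * (phx x / phi DIM('a) (sqrt t)))"
      proof (cases "t \<le> 2 ^ n")
        case True
        thus ?thesis using Suc t by auto
      next
        case False
        have "(1::real) \<le> 2 ^ n" by simp
        hence t1: "t \<ge> 1" using False by linarith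
        define s where "s = t / 2"
        have s: "1 / 2 \<le> s" "s \<le> 2 ^ n" "s > 0" "2 * s = t" using t t1 by (auto simp: s_def)
        have st: "sqrt t = sqrt 2 * sqrt s" using s(4) by (metis real_sqrt_mult)
        define r where "r = a * sqrt t"
        have r: "r > 0" "r \<ge> a / 2"
        proof -
          have "a * 1 \<le> a * sqrt t" using a t1 by (intro mult_left_mono) auto
          thus "r > 0" "r \<ge> a / 2" unfolding r_def using a by linarith+
        qed
        have [measurable]: "(indicator (ball 0 r) :: 'a \<Rightarrow> ennreal) \<in> borel_measurable borel" by (rule borel_measurable_indicator) simp
        have [measurable]: "(indicator {y. r \<le> norm y} :: 'a \<Rightarrow> ennreal) \<in> borel_measurable borel" by measurable
        have ps: "phi DIM('a) (sqrt t) > 0" "phi DIM('a) (sqrt s) > 0" "phi DIM('a) r > 0" using t1 s r by (auto intro!: phi_pos)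
        have g1: "phi DIM('a) (sqrt t) \<le> C2 * phi DIM('a) (sqrt s)"
        proof -
          have "phi DIM('a) (sqrt t) \<le> C1 * sqrt 2 * phi DIM('a) (sqrt s)" unfolding st using half[OF s(1)] by (intro C1(2)) auto
          also have "\<dots> \<le> C2 * phi DIM('a) (sqrt s)" using C1 sqrt2_less_2 ps(2) unfolding C2_def by (intro mult_right_mono) auto
          finally show ?thesis .
        qed
        have g2: "phi DIM('a) (sqrt t) \<le> C3 / a * phi DIM('a) r"
          using C3(2)[OF r(2), of "1 / a"] a by (simp add: r_def)
        have "(\<lambda>_. 1) = (\<lambda>y::'a. ennreal 1 * indicator (ball 0 r) y + indicator {y. r \<le> norm y} y)"
          by (auto simp: indicator_def fun_eq_iff)
        hence "K t (\<lambda>_. 1) x = K t (\<lambda>y. ennreal 1 * indicator (ball 0 r) y) x + K t (indicator {y. r \<le> norm y}) x"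
          using t1 by (subst K_add[symmetric]) auto
        also have "\<dots> \<le> ennreal (1 * (cd s * omega * r ^ DIM('a))) * K s (\<lambda>_. 1) x + ennreal (phx x / phi DIM('a) r)"
          using K_ball_le[OF s(3) less_imp_le[OF r(1)] zero_le_one] K_outside_le[OF r(1), of t x] t1 unfolding s(4) by (intro add_mono) auto
        also have "\<dots> \<le> ennreal (1 / (2 * C2)) * ennreal (C * (phx x / phi DIM('a) (sqrt s))) + ennreal (phx x / phi DIM('a) r)"
        proof (intro add_mono mult_mono ennreal_leI order_refl)
          have "cd s * omega * r ^ DIM('a) = \<Omega> * a ^ DIM('a)"
          proof -
            have "sqrt 2 ^ DIM('a) = 2 powr (real DIM('a) / 2)" by (simp add: powr_half_sqrt[symmetric] powr_powr powr_realpow[symmetric])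
            hence "r ^ DIM('a) = a ^ DIM('a) * 2 powr (real DIM('a) / 2) * (sqrt s) ^ DIM('a)" by (simp add: r_def st power_mult_distrib)
            thus ?thesis using cd_volume[OF s(3)] by (simp add: \<Omega>_def mult_ac)
          qed
          also have "\<dots> \<le> \<Omega> * a ^ 1" using a Om DIM_ge_1 by (intro mult_left_mono power_decreasing) auto
          also have "\<dots> \<le> 1 / (2 * C2)" using a by simp
          finally show "1 * (cd s * omega * r ^ DIM('a)) \<le> 1 / (2 * C2)" by simp
          show "K s (\<lambda>_. 1) x \<le> ennreal (C * (phx x / phi DIM('a) (sqrt s)))" using Suc s t by auto
        qed auto
        also have "\<dots> = ennreal (1 / (2 * C2) * (C * (phx x / phi DIM('a) (sqrt s))) + phx x / phi DIM('a) r)"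
          using C C1 by (simp add: C2_def ennreal_mult[symmetric] ennreal_plus[symmetric] del: ennreal_plus)
        also have "\<dots> \<le> ennreal (C * (phx x / phi DIM('a) (sqrt t)))"
        proof (rule ennreal_leI)
          have "phx x / phi DIM('a) (sqrt s) \<le> C2 * (phx x / phi DIM('a) (sqrt t))"
            using mult_left_mono[OF g1, of "phx x"] ps by (simp add: field_simps)
          hence "1 / (2 * C2) * (C * (phx x / phi DIM('a) (sqrt s))) \<le> 1 / (2 * C2) * (C * (C2 * (phx x / phi DIM('a) (sqrt t))))"
            using C C1 by (intro mult_left_mono) (auto simp: C2_def)
          also have "\<dots> = C / 2 * (phx x / phi DIM('a) (sqrt t))" using C1 by (simp add: C2_def)
          finally have 1: "1 / (2 * C2) * (C * (phx x / phi DIM('a) (sqrt s))) \<le> C / 2 * (phx x / phi DIM('a) (sqrt t))" .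
          have "phx x / phi DIM('a) r \<le> C3 / a * (phx x / phi DIM('a) (sqrt t))"
          proof -
            have "phx x * phi DIM('a) (sqrt t) \<le> phx x * (C3 / a * phi DIM('a) r)" using g2 by (intro mult_left_mono) auto
            hence "phx x \<le> phx x * (C3 / a * phi DIM('a) r) / phi DIM('a) (sqrt t)" using ps by (simp only: pos_le_divide_eq)
            hence "phx x \<le> C3 / a * (phx x / phi DIM('a) (sqrt t)) * phi DIM('a) r" by (simp add: mult_ac)
            thus ?thesis using ps by (simp only: pos_divide_le_eq)
          qed
          also have "\<dots> \<le> C / 2 * (phx x / phi DIM('a) (sqrt t))"
          proof (rule mult_right_mono)
            show "C3 / a \<le> C / 2" using C(3) by linarith
          qed (use ps in simp)
          finally show "1 / (2 * C2) * (C * (phx x / phi DIM('a) (sqrt s))) + phx x / phi DIM('a) r \<le> C * (phx x / phi DIM('a) (sqrt t))" using 1 by linarith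
        qed
        finally show ?thesis .
      qed
    qed
  qed
  show thesis
  proof (rule that[OF C(1)])
    fix t :: real and x :: 'a assume t: "t \<ge> 1 / 2" "x \<noteq> 0"
    obtain n where "t < 2 ^ n" using real_arch_pow[of 2 t] by auto
    thus "K t (\<lambda>_. 1) x \<le> ennreal (C * (phx x / phi DIM('a) (sqrt t)))" using main[of n] t by auto
  qed
qed

text \<open>Splitting \<open>(norm (y + z))\<^sup>2\<close> doubles the rate
  \<open>1 / (16 * t)\<close> to \<open>1 / (8 * t)\<close>, which is still within the available
  exponential moment for every \<open>s \<le> t\<close>.\<close>

lemma Gop_exp_sq:
  assumes s: "0 < s" "s \<le> t"
  shows "Gop s (\<lambda>z. ennreal (exp ((norm z)\<^sup>2 / (16 * t)))) (y::'a) \<le> ennreal (exp ((norm y)\<^sup>2 / (8 * t)) * 2 powr (real DIM('a) / 2))"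
proof -
  have t: "t > 0" using s by simp
  have "Gop s (\<lambda>z. ennreal (exp ((norm z)\<^sup>2 / (16 * t)))) y = (\<integral>\<^sup>+ z. ennreal (exp ((norm (y + z))\<^sup>2 / (16 * t))) \<partial>gauss s)"
    by (rule Gop_gauss) measurable
  also have "\<dots> \<le> (\<integral>\<^sup>+ (z::'a). ennreal (exp ((norm y)\<^sup>2 / (8 * t))) * ennreal (exp ((norm z)\<^sup>2 / (8 * s))) \<partial>gauss s)"
  proof (rule nn_integral_mono)
    fix z
    have "(norm (y + z))\<^sup>2 \<le> (norm y + norm z)\<^sup>2" by (intro power_mono norm_triangle_ineq) auto
    also have "\<dots> \<le> 2 * (norm y)\<^sup>2 + 2 * (norm z)\<^sup>2" using zero_le_power2[of "norm y - norm z"] unfolding power2_sum power2_diff by linarith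
    finally have "(norm (y + z))\<^sup>2 / (16 * t) \<le> (2 * (norm y)\<^sup>2 + 2 * (norm z)\<^sup>2) / (16 * t)" using t by (intro divide_right_mono) auto
    also have "\<dots> = (norm y)\<^sup>2 / (8 * t) + (norm z)\<^sup>2 / (8 * t)" by (simp add: add_divide_distrib)
    also have "(norm z)\<^sup>2 / (8 * t) \<le> (norm z)\<^sup>2 / (8 * s)" using s by (intro divide_left_mono) auto
    finally have "exp ((norm (y + z))\<^sup>2 / (16 * t)) \<le> exp ((norm y)\<^sup>2 / (8 * t) + (norm z)\<^sup>2 / (8 * s))" by simp
    thus "ennreal (exp ((norm (y + z))\<^sup>2 / (16 * t))) \<le> ennreal (exp ((norm y)\<^sup>2 / (8 * t))) * ennreal (exp ((norm z)\<^sup>2 / (8 * s)))"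
      unfolding exp_add by (simp add: ennreal_mult[symmetric] ennreal_leI)
  qed
  also have "\<dots> = ennreal (exp ((norm y)\<^sup>2 / (8 * t))) * (\<integral>\<^sup>+ z. ennreal (exp ((norm (z::'a))\<^sup>2 / (8 * s))) \<partial>gauss s)"
    by (rule nn_integral_cmult) measurable
  also have "\<dots> = ennreal (exp ((norm y)\<^sup>2 / (8 * t)) * 2 powr (real DIM('a) / 2))"
    unfolding nn_integral_gauss_exp_sq[OF s(1)] by (simp add: ennreal_mult)
  finally show ?thesis .
qed

lemma K_SUP:
  assumes t: "t > 0" and [measurable]: "\<And>n. f n \<in> borel_measurable borel" and f: "\<And>y. incseq (\<lambda>n. f n y)"
  shows "K t (\<lambda>y. SUP n. f n y) x = (SUP n. K t (f n) x)"
proof -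
  note [measurable] = pp_measurable_snd[OF t]
  have "K t (\<lambda>y. SUP n. f n y) x = (\<integral>\<^sup>+ y. (SUP n. ennreal (pp t x y) * f n y) \<partial>lborel)"
    unfolding K_def by (simp add: SUP_mult_left_ennreal)
  also have "\<dots> = (SUP n. K t (f n) x)"
    unfolding K_def using f by (intro nn_integral_monotone_convergence_SUP) (auto simp: incseq_def le_fun_def intro!: mult_left_mono)
  finally show ?thesis .
qed

text \<open>The maximum principle at radius \<open>sqrt t\<close>, with the shell reaching to
  \<open>2 * sqrt t\<close>, where the Gaussian average of the weight is bounded by a constant.
  Inside radius \<open>sqrt t\<close> the weight is at most \<open>exp 1\<close>, and that part is
  covered by the bound on total mass.\<close>

lemma K_exp_sq_inner:
  obtains C where "C > 0" "\<And>t x. t \<ge> 1 / 2 \<Longrightarrow> x \<noteq> 0 \<Longrightarrow> norm x < sqrt t \<Longrightarrow>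
    K t (\<lambda>z. ennreal (exp ((norm z)\<^sup>2 / (16 * t)))) x \<le> ennreal (C * (phx x / phi DIM('a) (sqrt t)))"
proof -
  obtain C1 where C1: "C1 > 0" "\<And>t x. t \<ge> 1 / 2 \<Longrightarrow> x \<noteq> 0 \<Longrightarrow> K t (\<lambda>_. 1) x \<le> ennreal (C1 * (phx x / phi DIM('a) (sqrt t)))"
    using K_one_upper by metis
  define Cg where "Cg = exp (1 / 2) * 2 powr (real DIM('a) / 2)"
  have Cg: "Cg > 0" "exp (1 / 2) \<le> Cg"
  proof -
    have "(1::real) \<le> 2 powr (real DIM('a) / 2)" by (intro ge_one_powr_ge_zero) auto
    thus "exp (1 / 2) \<le> Cg" unfolding Cg_def by simp
  qed (simp add: Cg_def)
  show thesis
  proof (rule that[of "exp 1 * C1 + Cg"])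
    show "exp 1 * C1 + Cg > 0" using C1 Cg by (simp add: add_pos_pos)
    fix t :: real and x :: 'a assume t: "t \<ge> 1 / 2" and x: "x \<noteq> 0" "norm x < sqrt t"
    have t0: "t > 0" "sqrt t > 0" using t by auto
    have p: "phi DIM('a) (sqrt t) > 0" using t0 by (intro phi_pos)
    let ?e = "\<lambda>z::'a. ennreal (exp ((norm z)\<^sup>2 / (16 * t)))"
    \<comment> \<open>The maximum principle requires a bounded function vanishing inside the ball;
      the truncation at \<open>N\<close> is removed by monotone convergence.\<close>
    define g where "g N z = ?e z * indicator {z. sqrt t \<le> norm z \<and> norm z < real N} z" for N :: nat and z :: 'a
    have gm [measurable]: "g N \<in> borel_measurable borel" for N unfolding g_def by measurable
    have ge: "g N z \<le> ?e z" for N z by (auto simp: g_def indicator_def)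
    have gK: "K t (g N) x \<le> ennreal (Cg / phi DIM('a) (sqrt t) * phx x)" for N
    proof (rule K_le_phi[where b = "sqrt t" and b' = "2 * sqrt t" and B = "exp ((real N)\<^sup>2 / (16 * t))"])
      show "g N y \<le> ennreal (exp ((real N)\<^sup>2 / (16 * t)))" for y
      proof (cases "norm y < real N")
        case True
        hence "(norm y)\<^sup>2 / (16 * t) \<le> (real N)\<^sup>2 / (16 * t)" using t0 by (intro divide_right_mono power_mono) auto
        thus ?thesis by (auto simp: g_def indicator_def ennreal_leI)
      qed (simp add: g_def)
      have sq: "exp ((norm y)\<^sup>2 / (8 * t)) \<le> exp (1 / 2)" "exp ((norm y)\<^sup>2 / (16 * t)) \<le> exp (1 / 2)" if "norm y < 2 * sqrt t" for y :: 'a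
      proof -
        have "(norm y)\<^sup>2 \<le> (2 * sqrt t)\<^sup>2" using that by (intro power_mono) auto
        hence "(norm y)\<^sup>2 \<le> 4 * t" using t0 by (simp add: power_mult_distrib)
        thus "exp ((norm y)\<^sup>2 / (8 * t)) \<le> exp (1 / 2)" "exp ((norm y)\<^sup>2 / (16 * t)) \<le> exp (1 / 2)" using t0 by (auto simp: field_simps)
      qed
      show "g N y \<le> ennreal (Cg / phi DIM('a) (sqrt t) * phi DIM('a) (sqrt t))" if "norm y < 2 * sqrt t" for y
      proof -
        have "?e y \<le> ennreal Cg" using sq(2)[OF that] Cg by (intro ennreal_leI) linarith
        thus ?thesis using ge[of N y] p by (simp add: order_trans)
      qed
      show "Gop s (g N) y \<le> ennreal (Cg / phi DIM('a) (sqrt t) * phi DIM('a) (sqrt t))" if s: "0 < s" "s \<le> t" and y: "norm y < 2 * sqrt t" for s y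
      proof -
        have "Gop s (g N) y \<le> Gop s ?e y" by (intro Gop_mono ge)
        also have "\<dots> \<le> ennreal (exp ((norm y)\<^sup>2 / (8 * t)) * 2 powr (real DIM('a) / 2))" by (rule Gop_exp_sq[OF s])
        also have "\<dots> \<le> ennreal Cg" unfolding Cg_def by (intro ennreal_leI mult_right_mono sq(1)[OF y]) simp
        finally show ?thesis using p by simp
      qed
    qed (use t0 p Cg x gm in \<open>auto simp: g_def\<close>)
    have "K t ?e x \<le> K t (\<lambda>z. ennreal (exp 1) * 1 + (SUP N. g N z)) x"
    proof (rule K_mono)
      fix z :: 'a
      show "?e z \<le> ennreal (exp 1) * 1 + (SUP N. g N z)"
      proof (cases "norm z < sqrt t")
        case True
        hence "(norm z)\<^sup>2 \<le> (sqrt t)\<^sup>2" by (intro power_mono) auto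
        hence "(norm z)\<^sup>2 / (16 * t) \<le> 1" using t0 by (simp add: field_simps)
        hence "?e z \<le> ennreal (exp 1) * 1" by (simp add: ennreal_leI)
        thus ?thesis by (rule order_trans) simp
      next
        case False
        obtain N :: nat where N: "norm z < real N" using reals_Archimedean2 by blast
        have "?e z = g N z" using N False by (simp add: g_def)
        also have "\<dots> \<le> (SUP N. g N z)" by (rule SUP_upper) simp
        finally show ?thesis by (rule order_trans) simp
      qed
    qed
    also have "\<dots> = ennreal (exp 1) * K t (\<lambda>_. 1) x + (SUP N. K t (g N) x)"
    proof -
      have inc: "incseq (\<lambda>N. g N z)" for z by (auto simp: g_def incseq_def indicator_def)
      have "K t (\<lambda>z. ennreal (exp 1) * 1 + (SUP N. g N z)) x = K t (\<lambda>z. ennreal (exp 1) * 1) x + K t (\<lambda>z. SUP N. g N z) x"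
        using t0 by (intro K_add) auto
      also have "K t (\<lambda>z. ennreal (exp 1) * 1) x = ennreal (exp 1) * K t (\<lambda>z. 1) x" using t0 by (intro K_cmult) auto
      also have "K t (\<lambda>z. SUP N. g N z) x = (SUP N. K t (g N) x)" using t0 inc by (intro K_SUP) auto
      finally show ?thesis .
    qed
    also have "\<dots> \<le> ennreal (exp 1) * ennreal (C1 * (phx x / phi DIM('a) (sqrt t))) + ennreal (Cg / phi DIM('a) (sqrt t) * phx x)"
      using C1(2)[OF t x(1)] by (intro add_mono mult_left_mono SUP_least gK) auto
    also have "\<dots> = ennreal ((exp 1 * C1 + Cg) * (phx x / phi DIM('a) (sqrt t)))"
      using C1 Cg p by (simp add: ennreal_mult[symmetric] ennreal_plus[symmetric] algebra_simps add_divide_distrib del: ennreal_plus)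
    finally show "K t ?e x \<le> ennreal ((exp 1 * C1 + Cg) * (phx x / phi DIM('a) (sqrt t)))" .
  qed
qed

lemma mfun_near: "t > 0 \<Longrightarrow> r \<le> sqrt t \<Longrightarrow> mfun d t r = phi d r / phi d (sqrt t)"
  using phi_mono[of r "sqrt t" d] phi_pos[of "sqrt t" d] by (simp add: mfun_def min_def)

lemma mfun_far: "t > 0 \<Longrightarrow> r \<ge> sqrt t \<Longrightarrow> mfun d t r = 1"
  using phi_mono[of "sqrt t" r d] phi_pos[of "sqrt t" d] by (simp add: mfun_def min_def)

lemma mfun_nonneg: "t > 0 \<Longrightarrow> mfun d t r \<ge> 0"
  by (simp add: mfun_def)

text \<open>Recentring the weight at the starting point. Inside the parabolic ball
  \<open>(norm x)\<^sup>2 \<le> t\<close> costs only a constant factor; outside it, where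
  \<open>mfun\<close> is 1, the free Gaussian bound suffices.\<close>

lemma K_exp_sq:
  obtains C where "C > 0" "\<And>t x. t \<ge> 1 / 2 \<Longrightarrow> x \<noteq> 0 \<Longrightarrow>
    K t (\<lambda>z. ennreal (exp ((norm (z - x))\<^sup>2 / (64 * t)))) x \<le> ennreal (C * mfun DIM('a) t (norm x))"
proof -
  obtain C where C: "C > 0" "\<And>t x. t \<ge> 1 / 2 \<Longrightarrow> x \<noteq> 0 \<Longrightarrow> norm x < sqrt t \<Longrightarrow>
    K t (\<lambda>z. ennreal (exp ((norm z)\<^sup>2 / (16 * t)))) x \<le> ennreal (C * (phx x / phi DIM('a) (sqrt t)))"
    using K_exp_sq_inner by metis
  show thesis
  proof (rule that[of "max (exp 1 * C) (2 powr (real DIM('a) / 2))"])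
    show "max (exp 1 * C) (2 powr (real DIM('a) / 2)) > 0" using C by (simp add: less_max_iff_disj)
    fix t :: real and x :: 'a assume t: "t \<ge> 1 / 2" and x: "x \<noteq> 0"
    have t0: "t > 0" using t by simp
    let ?e = "\<lambda>z. ennreal (exp ((norm (z - x))\<^sup>2 / (64 * t)))"
    show "K t ?e x \<le> ennreal (max (exp 1 * C) (2 powr (real DIM('a) / 2)) * mfun DIM('a) t (norm x))"
    proof (cases "norm x < sqrt t")
      case True
      have "K t ?e x \<le> K t (\<lambda>z. ennreal (exp 1) * ennreal (exp ((norm z)\<^sup>2 / (16 * t)))) x"
      proof (rule K_mono)
        fix z
        have xt: "(norm x)\<^sup>2 \<le> t" using True t0 by (metis less_imp_le norm_ge_zero power_mono real_sqrt_pow2)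
        have "(norm (z - x))\<^sup>2 \<le> (norm z + norm x)\<^sup>2" by (intro power_mono norm_triangle_ineq4) auto
        also have "\<dots> \<le> 2 * (norm z)\<^sup>2 + 2 * (norm x)\<^sup>2" using zero_le_power2[of "norm z - norm x"] unfolding power2_sum power2_diff by linarith
        also have "\<dots> \<le> 4 * (norm z)\<^sup>2 + 64 * t" using xt t0 zero_le_power2[of "norm z"] by linarith
        finally have "(norm (z - x))\<^sup>2 / (64 * t) \<le> (4 * (norm z)\<^sup>2 + 64 * t) / (64 * t)" using t0 by (intro divide_right_mono) auto
        also have "\<dots> = 1 + (norm z)\<^sup>2 / (16 * t)" using t0 by (simp add: field_simps)
        finally have "exp ((norm (z - x))\<^sup>2 / (64 * t)) \<le> exp (1 + (norm z)\<^sup>2 / (16 * t))" by simp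
        thus "?e z \<le> ennreal (exp 1) * ennreal (exp ((norm z)\<^sup>2 / (16 * t)))"
          unfolding exp_add by (simp add: ennreal_mult[symmetric] ennreal_leI)
      qed
      also have "\<dots> = ennreal (exp 1) * K t (\<lambda>z. ennreal (exp ((norm z)\<^sup>2 / (16 * t)))) x" using t0 by (intro K_cmult) auto
      also have "\<dots> \<le> ennreal (exp 1) * ennreal (C * (phx x / phi DIM('a) (sqrt t)))" by (intro mult_left_mono C(2) t x True) auto
      also have "\<dots> = ennreal (exp 1 * C * mfun DIM('a) t (norm x))"
        using True t0 C by (simp add: mfun_near ennreal_mult[symmetric] mult.assoc)
      also have "\<dots> \<le> ennreal (max (exp 1 * C) (2 powr (real DIM('a) / 2)) * mfun DIM('a) t (norm x))"
        by (intro ennreal_leI mult_right_mono mfun_nonneg t0) auto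
      finally show ?thesis .
    next
      case False
      have "K t ?e x \<le> Gop t ?e x" by (rule K_le_Gop[OF t0])
      also have "\<dots> = (\<integral>\<^sup>+ (z::'a). ennreal (exp ((norm z)\<^sup>2 / (64 * t))) \<partial>gauss t)" by (subst Gop_gauss) auto
      also have "\<dots> \<le> (\<integral>\<^sup>+ (z::'a). ennreal (exp ((norm z)\<^sup>2 / (8 * t))) \<partial>gauss t)"
        using t0 by (intro nn_integral_mono ennreal_leI) (simp add: frac_le)
      also have "\<dots> = ennreal (2 powr (real DIM('a) / 2))" by (rule nn_integral_gauss_exp_sq[OF t0])
      also have "\<dots> \<le> ennreal (max (exp 1 * C) (2 powr (real DIM('a) / 2)) * mfun DIM('a) t (norm x))"
        using False t0 by (intro ennreal_leI) (simp add: mfun_far)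
      finally show ?thesis .
    qed
  qed
qed

text \<open>Time is split into a quarter, a half and a quarter. By symmetry the last factor is
  written as \<open>pp t y w\<close>, so that both outer quarters run away from the points
  \<open>x\<close> and \<open>y\<close>.\<close>

lemma pp_quadruple:
  assumes t: "t > 0" and x: "x \<noteq> 0" and y: "y \<noteq> 0"
  shows "ennreal (pp (4 * t) x y) = K t (K (2 * t) (\<lambda>w. ennreal (pp t y w))) x"
proof -
  note [measurable] = pp_measurable_snd[OF t]
  have "ennreal (pp (4 * t) x y) = K (2 * t) (\<lambda>u. ennreal (pp (2 * t) u y)) x"
    using pp_double[of "2 * t" x y] t x y by (simp add: K_def)
  also have "\<dots> = K (2 * t) (K t (\<lambda>w. ennreal (pp t y w))) x"
  proof -
    have "ennreal (pp (2 * t) u y) = K t (\<lambda>w. ennreal (pp t y w)) u" if "u \<noteq> 0" for u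
      using pp_double[OF t that y] by (simp add: K_def pp_commute[OF t, of y])
    thus ?thesis by (intro antisym K_mono) simp_all
  qed
  also have "\<dots> = K t (K t (K t (\<lambda>w. ennreal (pp t y w)))) x" using t by (intro K_double) auto
  also have "\<dots> = K t (K (2 * t) (\<lambda>w. ennreal (pp t y w))) x"
    using t by (intro arg_cong[where f = "\<lambda>h. K t h x"] ext K_double[symmetric]) auto
  finally show ?thesis .
qed

lemma heat_q_cd: "heat_q t x y = cd t * exp (- (norm (x - y))\<^sup>2 / (4 * t))" for x y :: 'a
  by (simp add: heat_q_def cd_def)

text \<open>The middle factor is at most \<open>heat_q (2 * t) z w\<close>. From
  \<open>norm (x - y)\<close> at most the sum of three distances, the square is at most 3 times the
  sum of the squares, whence \<open>192 = 3 * 64\<close>: the Gaussian in \<open>x - y\<close>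
  factors out and the weights of \<open>K_exp_sq\<close> appear at both ends.\<close>

lemma pp_upper:
  obtains C where "C > 0" "\<And>t x y. t \<ge> 1 / 2 \<Longrightarrow> x \<noteq> 0 \<Longrightarrow> y \<noteq> 0 \<Longrightarrow>
    pp (4 * t) x y \<le> C * (cd (2 * t) * exp (- (norm (x - y))\<^sup>2 / (192 * t))) * mfun DIM('a) t (norm x) * mfun DIM('a) t (norm y)"
proof -
  obtain C where C: "C > 0" "\<And>t x. t \<ge> 1 / 2 \<Longrightarrow> x \<noteq> 0 \<Longrightarrow>
    K t (\<lambda>z. ennreal (exp ((norm (z - x))\<^sup>2 / (64 * t)))) x \<le> ennreal (C * mfun DIM('a) t (norm x))"
    using K_exp_sq by metis
  show thesis
  proof (rule that[of "C\<^sup>2"])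
    show "C\<^sup>2 > 0" using C by simp
    fix t :: real and x y :: 'a assume t: "t \<ge> 1 / 2" and x: "x \<noteq> 0" and y: "y \<noteq> 0"
    have t0: "t > 0" "2 * t > 0" using t by auto
    note [measurable] = pp_measurable_snd[OF t0(1)] pp_measurable_snd[OF t0(2)]
    define D where "D = cd (2 * t) * exp (- (norm (x - y))\<^sup>2 / (192 * t))"
    have D: "D > 0" using cd_pos[OF t0(2)] by (simp add: D_def)
    let ?e = "\<lambda>x z::'a. exp ((norm (z - x))\<^sup>2 / (64 * t))"
    have ker: "pp (2 * t) z w \<le> D * ?e x z * ?e y w" for z w
    proof -
      have "norm (x - y) \<le> norm (z - x) + norm (z - w) + norm (w - y)"
        using norm_triangle_ineq[of "x - z" "z - w"] norm_triangle_ineq[of "x - w" "w - y"] by (simp add: norm_minus_commute)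
      hence "(norm (x - y))\<^sup>2 \<le> (norm (z - x) + norm (z - w) + norm (w - y))\<^sup>2" by (intro power_mono) auto
      also have "\<dots> \<le> 3 * ((norm (z - x))\<^sup>2 + (norm (z - w))\<^sup>2 + (norm (w - y))\<^sup>2)"
      proof -
        have "(a + b + c)\<^sup>2 \<le> 3 * (a\<^sup>2 + b\<^sup>2 + c\<^sup>2)" for a b c :: real
          using zero_le_power2[of "a - b"] zero_le_power2[of "b - c"] zero_le_power2[of "a - c"] by (simp add: power2_eq_square algebra_simps)
        thus ?thesis .
      qed
      finally have "(norm (x - y))\<^sup>2 / (192 * t) \<le> (3 * ((norm (z - x))\<^sup>2 + (norm (z - w))\<^sup>2 + (norm (w - y))\<^sup>2)) / (192 * t)"
        using t0 by (intro divide_right_mono) auto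
      also have "\<dots> = (norm (z - x))\<^sup>2 / (64 * t) + (norm (z - w))\<^sup>2 / (64 * t) + (norm (w - y))\<^sup>2 / (64 * t)"
        using t0 by (simp add: field_simps)
      also have "(norm (z - w))\<^sup>2 / (64 * t) \<le> (norm (z - w))\<^sup>2 / (4 * (2 * t))" using t0 by (intro divide_left_mono) auto
      finally have "- (norm (z - w))\<^sup>2 / (4 * (2 * t)) \<le> - (norm (x - y))\<^sup>2 / (192 * t) + (norm (z - x))\<^sup>2 / (64 * t) + (norm (w - y))\<^sup>2 / (64 * t)"
        by simp
      hence "exp (- (norm (z - w))\<^sup>2 / (4 * (2 * t))) \<le> exp (- (norm (x - y))\<^sup>2 / (192 * t) + (norm (z - x))\<^sup>2 / (64 * t) + (norm (w - y))\<^sup>2 / (64 * t))"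
        by (simp only: exp_le_cancel_iff)
      hence "heat_q (2 * t) z w \<le> cd (2 * t) * exp (- (norm (x - y))\<^sup>2 / (192 * t) + (norm (z - x))\<^sup>2 / (64 * t) + (norm (w - y))\<^sup>2 / (64 * t))"
        unfolding heat_q_cd using cd_pos[OF t0(2)] by (intro mult_left_mono) auto
      also have "\<dots> = D * ?e x z * ?e y w" by (simp only: exp_add D_def mult.assoc)
      finally show ?thesis using pp_le_heat_q[OF t0(2), of z w] by linarith
    qed
    have "K (2 * t) (\<lambda>w. ennreal (pp t y w)) z \<le> ennreal (D * (C * mfun DIM('a) t (norm y))) * ennreal (?e x z)" for z
    proof -
      have "K (2 * t) (\<lambda>w. ennreal (pp t y w)) z \<le> (\<integral>\<^sup>+ w. ennreal (D * ?e x z) * (ennreal (pp t y w) * ennreal (?e y w)) \<partial>lborel)"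
        unfolding K_def
      proof (rule nn_integral_mono)
        fix w
        have "pp (2 * t) z w * pp t y w \<le> (D * ?e x z * ?e y w) * pp t y w" by (intro mult_right_mono ker) simp
        also have "\<dots> = D * ?e x z * (pp t y w * ?e y w)" by simp
        finally show "ennreal (pp (2 * t) z w) * ennreal (pp t y w) \<le> ennreal (D * ?e x z) * (ennreal (pp t y w) * ennreal (?e y w))"
          using D by (simp add: ennreal_mult[symmetric] ennreal_leI del: mult.assoc)
      qed
      also have "\<dots> = ennreal (D * ?e x z) * K t (\<lambda>w. ennreal (?e y w)) y" unfolding K_def by (intro nn_integral_cmult) measurable
      also have "\<dots> \<le> ennreal (D * ?e x z) * ennreal (C * mfun DIM('a) t (norm y))" by (intro mult_left_mono C t y) auto
      also have "\<dots> = ennreal (D * (C * mfun DIM('a) t (norm y))) * ennreal (?e x z)"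
        using D C mfun_nonneg[OF t0(1)] by (simp add: ennreal_mult[symmetric] mult_ac)
      finally show ?thesis .
    qed
    hence "K t (K (2 * t) (\<lambda>w. ennreal (pp t y w))) x \<le> K t (\<lambda>z. ennreal (D * (C * mfun DIM('a) t (norm y))) * ennreal (?e x z)) x"
      by (intro K_mono)
    also have "\<dots> = ennreal (D * (C * mfun DIM('a) t (norm y))) * K t (\<lambda>z. ennreal (?e x z)) x" using t0 by (intro K_cmult) auto
    also have "\<dots> \<le> ennreal (D * (C * mfun DIM('a) t (norm y))) * ennreal (C * mfun DIM('a) t (norm x))" by (intro mult_left_mono C t x) auto
    also have "\<dots> = ennreal (C\<^sup>2 * D * mfun DIM('a) t (norm x) * mfun DIM('a) t (norm y))"
      using D C mfun_nonneg[OF t0(1)] by (simp add: ennreal_mult[symmetric] mult_ac power2_eq_square)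
    finally have "ennreal (pp (4 * t) x y) \<le> ennreal (C\<^sup>2 * D * mfun DIM('a) t (norm x) * mfun DIM('a) t (norm y))"
      using t0 x y by (simp add: pp_quadruple)
    thus "pp (4 * t) x y \<le> C\<^sup>2 * (cd (2 * t) * exp (- (norm (x - y))\<^sup>2 / (192 * t))) * mfun DIM('a) t (norm x) * mfun DIM('a) t (norm y)"
      using D C mfun_nonneg[OF t0(1)] unfolding D_def[symmetric] by (subst (asm) ennreal_le_iff) auto
  qed
qed

section \<open>Lower bounds\<close>

text \<open>Start from \<open>phx x \<le> K t phx x\<close> and split the integral at radii
  \<open>a * sqrt t\<close> and \<open>b * sqrt t\<close>. The inner and outer parts are each at
  most a quarter of \<open>phx x\<close> by the upper bounds, and on the annulus \<open>phi\<close>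
  is at most a multiple of \<open>phi (sqrt t)\<close>.\<close>

lemma K_annulus_lower:
  obtains a b c where "0 < a" "a \<le> 1" "1 \<le> b" "c > 0" "\<And>t x. t \<ge> 1 \<Longrightarrow> x \<noteq> 0 \<Longrightarrow> norm x < sqrt t \<Longrightarrow>
    ennreal (c * (phx x / phi DIM('a) (sqrt t))) \<le> K t (indicator {z. a * sqrt t \<le> norm z \<and> norm z \<le> b * sqrt t}) x"
proof -
  obtain C0 where C0: "C0 > 0" "\<And>t x. t \<ge> 1 / 2 \<Longrightarrow> x \<noteq> 0 \<Longrightarrow> K t (\<lambda>_. 1) x \<le> ennreal (C0 * (phx x / phi DIM('a) (sqrt t)))"
    using K_one_upper by metis
  obtain C1 where C1: "C1 \<ge> 1" "\<And>r l. r \<ge> 1 / 2 \<Longrightarrow> l \<ge> 1 \<Longrightarrow> phi DIM('a) (l * r) \<le> C1 * l * phi DIM('a) r"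
    using phi_growth[OF DIM_ge_1, of "1 / 2"] by (metis half_gt_zero_iff zero_less_one)
  obtain C2 where C2: "C2 > 0" "\<And>t x. t \<ge> 1 / 2 \<Longrightarrow> x \<noteq> 0 \<Longrightarrow> norm x < sqrt t \<Longrightarrow>
    K t (\<lambda>z. ennreal (exp ((norm z)\<^sup>2 / (16 * t)))) x \<le> ennreal (C2 * (phx x / phi DIM('a) (sqrt t)))"
    using K_exp_sq_inner by metis
  define \<Omega> where "\<Omega> = (1 / 2) powr (- real DIM('a) / 2) * (4 * pi) powr (- real DIM('a) / 2) * omega"
  have Om: "\<Omega> > 0" using omega_pos by (simp add: \<Omega>_def)
  define A where "A = \<Omega> * C0 * (C1 * 2)"
  define B where "B = 16 * C1 * C2"
  have AB: "A > 0" "B > 0" using Om C0 C1 C2 by (auto simp: A_def B_def)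
  \<comment> \<open>The inner part is at most \<open>A * a * phx x\<close>; likewise the outer part
    is at most \<open>B / b * phx x\<close> for the \<open>b\<close> below.\<close>
  define a where "a = min 1 (1 / (4 * A))"
  define b where "b = max 1 (4 * B)"
  have a: "0 < a" "a \<le> 1" "A * a \<le> 1 / 4"
  proof -
    have "A * a \<le> A * (1 / (4 * A))" using AB by (intro mult_left_mono) (auto simp: a_def)
    thus "A * a \<le> 1 / 4" using AB by simp
  qed (use AB in \<open>auto simp: a_def\<close>)
  have b: "1 \<le> b" "B / b \<le> 1 / 4" using AB by (auto simp: b_def field_simps)
  define c where "c = 1 / (2 * (C1 * b))"
  have c: "c > 0" using C1 b by (simp add: c_def)
  show thesis
  proof (rule that[OF a(1,2) b(1) c])
    fix t :: real and x :: 'a assume t: "t \<ge> 1" and x: "x \<noteq> 0" "norm x < sqrt t"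
    have t0: "t > 0" "t / 2 > 0" "sqrt t \<ge> 1" "t \<ge> 1 / 2" "t / 2 \<ge> 1 / 2" using t by auto
    have p: "phi DIM('a) (sqrt t) > 0" "phi DIM('a) (sqrt (t / 2)) > 0" "phx x > 0" using t0 x by (auto intro!: phi_pos)
    let ?A = "{z::'a. a * sqrt t \<le> norm z \<and> norm z \<le> b * sqrt t}"
    let ?f1 = "\<lambda>z::'a. ennreal (phi DIM('a) (sqrt t)) * indicator (ball 0 (a * sqrt t)) z"
    let ?f2 = "\<lambda>z::'a. ennreal (C1 * b * phi DIM('a) (sqrt t)) * indicator ?A z"
    let ?f3 = "\<lambda>z::'a. ennreal (C1 * (16 / b) * phi DIM('a) (sqrt t)) * ennreal (exp ((norm z)\<^sup>2 / (16 * t)))"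
    have [measurable]: "(indicator (ball 0 (a * sqrt t)) :: 'a \<Rightarrow> ennreal) \<in> borel_measurable borel" by (rule borel_measurable_indicator) simp
    have [measurable]: "(indicator ?A :: 'a \<Rightarrow> ennreal) \<in> borel_measurable borel" by measurable
    have gr: "phi DIM('a) (norm z) \<le> C1 * (norm z / sqrt t) * phi DIM('a) (sqrt t)" if "norm z \<ge> sqrt t" for z :: 'a
      using C1(2)[of "sqrt t" "norm z / sqrt t"] that t0 by auto
    have pt: "ennreal (phx z) \<le> ?f1 z + ?f2 z + ?f3 z" for z
    proof -
      consider "norm z < a * sqrt t" | "a * sqrt t \<le> norm z" "norm z \<le> b * sqrt t" | "norm z > b * sqrt t" by linarith
      thus ?thesis
      proof cases
        case 1
        have "a * sqrt t \<le> 1 * sqrt t" using a t0 by (intro mult_right_mono) auto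
        hence "ennreal (phx z) \<le> ?f1 z" using 1 by (auto intro!: ennreal_leI phi_mono)
        thus ?thesis by (rule order_trans) (simp add: add.assoc)
      next
        case 2
        have "phx z \<le> phi DIM('a) (b * sqrt t)" using 2 by (intro phi_mono)
        also have "\<dots> \<le> C1 * b * phi DIM('a) (sqrt t)" using b \<open>sqrt t \<ge> 1\<close> by (intro C1(2)) linarith+
        finally have "ennreal (phx z) \<le> ?f2 z" using 2 by (simp add: ennreal_leI)
        moreover have "?f2 z \<le> ?f1 z + ?f2 z + ?f3 z" by (simp add: add.assoc add_increasing)
        ultimately show ?thesis by (rule order_trans)
      next
        case 3
        define u where "u = norm z / sqrt t"
        have u: "u > b" using 3 t0 by (simp add: u_def field_simps)
        have "1 * sqrt t \<le> b * sqrt t" using b t0 by (intro mult_right_mono) auto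
        hence "phx z \<le> C1 * u * phi DIM('a) (sqrt t)" using 3 gr[of z] by (simp add: u_def)
        also have "u \<le> 16 / b * exp (u\<^sup>2 / 16)"
        proof -
          have "u * b \<le> u * u" using u b by (intro mult_left_mono) auto
          also have "u * u = 16 * (u\<^sup>2 / 16)" by (simp add: power2_eq_square)
          also have "\<dots> \<le> 16 * exp (u\<^sup>2 / 16)" using exp_ge_add_one_self[of "u\<^sup>2 / 16"] by (intro mult_left_mono) linarith+
          finally show ?thesis using b by (simp add: field_simps)
        qed
        hence "C1 * u * phi DIM('a) (sqrt t) \<le> C1 * (16 / b * exp (u\<^sup>2 / 16)) * phi DIM('a) (sqrt t)"
          using C1 p by (intro mult_left_mono mult_right_mono) auto
        also have "u\<^sup>2 / 16 = (norm z)\<^sup>2 / (16 * t)" using t0 by (simp add: u_def power_divide)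
        also have "C1 * (16 / b * exp ((norm z)\<^sup>2 / (16 * t))) * phi DIM('a) (sqrt t) = C1 * (16 / b) * phi DIM('a) (sqrt t) * exp ((norm z)\<^sup>2 / (16 * t))" by simp
        finally have "ennreal (phx z) \<le> ?f3 z" using C1 b p by (subst ennreal_mult[symmetric]) (auto intro: ennreal_leI)
        moreover have "?f3 z \<le> ?f1 z + ?f2 z + ?f3 z" by (simp add: add_increasing)
        ultimately show ?thesis by (rule order_trans)
      qed
    qed
    have f1: "K t ?f1 x \<le> ennreal (phx x / 4)"
    proof -
      have "K t ?f1 x \<le> ennreal (phi DIM('a) (sqrt t) * (cd (t / 2) * omega * (a * sqrt t) ^ DIM('a))) * K (t / 2) (\<lambda>_. 1) x"
        using K_ball_le[OF t0(2), of "a * sqrt t" "phi DIM('a) (sqrt t)" x] a t0 by simp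
      also have "\<dots> \<le> ennreal (phi DIM('a) (sqrt t) * (\<Omega> * a)) * ennreal (C0 * (phx x / phi DIM('a) (sqrt (t / 2))))"
      proof (rule mult_mono)
        have "cd (t / 2) * omega * (a * sqrt t) ^ DIM('a) = \<Omega> * a ^ DIM('a)"
          using cd_scale[OF t0(1), of "1 / 2"] cd_volume[OF t0(1)] by (simp add: \<Omega>_def power_mult_distrib mult_ac)
        also have "\<dots> \<le> \<Omega> * a ^ 1" using a Om DIM_ge_1 by (intro mult_left_mono power_decreasing) auto
        finally show "ennreal (phi DIM('a) (sqrt t) * (cd (t / 2) * omega * (a * sqrt t) ^ DIM('a))) \<le> ennreal (phi DIM('a) (sqrt t) * (\<Omega> * a))"
          using p by (intro ennreal_leI mult_left_mono) auto
        show "K (t / 2) (\<lambda>_. 1) x \<le> ennreal (C0 * (phx x / phi DIM('a) (sqrt (t / 2))))" by (intro C0(2) x t0)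
      qed auto
      also have "\<dots> = ennreal (phi DIM('a) (sqrt t) * (\<Omega> * a) * (C0 * (phx x / phi DIM('a) (sqrt (t / 2)))))"
        using p Om a C0 by (intro ennreal_mult[symmetric]) auto
      also have "\<dots> \<le> ennreal (phx x / 4)"
      proof (rule ennreal_leI)
        have st: "sqrt t = sqrt 2 * sqrt (t / 2)" by (simp add: real_sqrt_mult[symmetric])
        have "sqrt (t / 2) \<ge> 1 / 2" using t by (intro real_le_rsqrt) (simp add: power2_eq_square)
        hence "phi DIM('a) (sqrt t) \<le> C1 * sqrt 2 * phi DIM('a) (sqrt (t / 2))" unfolding st by (intro C1) auto
        also have "\<dots> \<le> C1 * 2 * phi DIM('a) (sqrt (t / 2))" using C1 p sqrt2_less_2 by (intro mult_right_mono mult_left_mono) auto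
        finally have "phi DIM('a) (sqrt t) * (\<Omega> * a) * (C0 * (phx x / phi DIM('a) (sqrt (t / 2)))) \<le>
          C1 * 2 * phi DIM('a) (sqrt (t / 2)) * (\<Omega> * a) * (C0 * (phx x / phi DIM('a) (sqrt (t / 2))))"
          using p Om a C0 by (intro mult_right_mono) auto
        also have "\<dots> = A * a * phx x" using p(2) by (simp add: A_def)
        also have "\<dots> \<le> 1 / 4 * phx x" using a p by (intro mult_right_mono) auto
        finally show "phi DIM('a) (sqrt t) * (\<Omega> * a) * (C0 * (phx x / phi DIM('a) (sqrt (t / 2)))) \<le> phx x / 4" by simp
      qed
      finally show ?thesis .
    qed
    have f3: "K t ?f3 x \<le> ennreal (phx x / 4)"
    proof -
      have "K t ?f3 x = ennreal (C1 * (16 / b) * phi DIM('a) (sqrt t)) * K t (\<lambda>z. ennreal (exp ((norm z)\<^sup>2 / (16 * t)))) x"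
        using t0 by (intro K_cmult) auto
      also have "\<dots> \<le> ennreal (C1 * (16 / b) * phi DIM('a) (sqrt t)) * ennreal (C2 * (phx x / phi DIM('a) (sqrt t)))"
        by (intro mult_left_mono C2 t0 x) auto
      also have "\<dots> = ennreal (C1 * (16 / b) * phi DIM('a) (sqrt t) * (C2 * (phx x / phi DIM('a) (sqrt t))))"
        using p C1 C2 b by (intro ennreal_mult[symmetric]) auto
      also have "C1 * (16 / b) * phi DIM('a) (sqrt t) * (C2 * (phx x / phi DIM('a) (sqrt t))) = B / b * phx x" using p(1) by (simp add: B_def)
      also have "ennreal \<dots> \<le> ennreal (1 / 4 * phx x)" using b p by (intro ennreal_leI mult_right_mono) auto
      finally show ?thesis by simp
    qed
    have "ennreal (phx x) \<le> K t (\<lambda>y. ennreal (phx y)) x" by (rule phi_le_K[OF t0(1) x(1)])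
    also have "\<dots> \<le> K t (\<lambda>z. ?f1 z + ?f2 z + ?f3 z) x" by (rule K_mono) (rule pt)
    also have "\<dots> = K t ?f1 x + K t ?f2 x + K t ?f3 x"
    proof -
      have "K t (\<lambda>z. ?f1 z + ?f2 z + ?f3 z) x = K t (\<lambda>z. ?f1 z + ?f2 z) x + K t ?f3 x" using t0 by (intro K_add) auto
      moreover have "K t (\<lambda>z. ?f1 z + ?f2 z) x = K t ?f1 x + K t ?f2 x" using t0 by (intro K_add) auto
      ultimately show ?thesis by simp
    qed
    also have "\<dots> \<le> ennreal (phx x / 4) + K t ?f2 x + ennreal (phx x / 4)" by (intro add_mono f1 f3) simp
    also have "K t ?f2 x = ennreal (C1 * b * phi DIM('a) (sqrt t)) * K t (indicator ?A) x" using t0 by (subst K_cmult) auto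
    finally have main: "ennreal (phx x) \<le> ennreal (phx x / 4) + ennreal (C1 * b * phi DIM('a) (sqrt t)) * K t (indicator ?A) x + ennreal (phx x / 4)" .
    have "K t (indicator ?A) x \<le> K t (\<lambda>_. 1) x" by (intro K_mono) (simp add: indicator_le_1_ennreal)
    also have "\<dots> \<le> 1" by (rule K_one_le_1[OF t0(1)])
    finally have fin: "K t (indicator ?A) x < \<top>" by (rule order.strict_trans1[OF _ ennreal_one_less_top])
    then obtain k where k: "K t (indicator ?A) x = ennreal k" "k \<ge> 0" by (cases "K t (indicator ?A) x" rule: ennreal_cases) auto
    have "ennreal (phx x) \<le> ennreal (phx x / 4 + C1 * b * phi DIM('a) (sqrt t) * k + phx x / 4)"
      using main k p C1 b by (simp add: ennreal_mult[symmetric] ennreal_plus[symmetric] del: ennreal_plus)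
    hence "phx x \<le> phx x / 4 + C1 * b * phi DIM('a) (sqrt t) * k + phx x / 4"
      using k p C1 b by (subst (asm) ennreal_le_iff) auto
    hence "phx x / 2 \<le> C1 * b * phi DIM('a) (sqrt t) * k" by simp
    hence "c * (phx x / phi DIM('a) (sqrt t)) \<le> k" using p C1 b by (simp add: c_def field_simps)
    thus "ennreal (c * (phx x / phi DIM('a) (sqrt t))) \<le> K t (indicator ?A) x" unfolding k by (rule ennreal_leI)
  qed
qed

text \<open>Two points at an angle of at most 120 degrees both project onto their bisector with at
  least half their length, so they lie well inside a half-space at distance of order
  \<open>sqrt t\<close> from the origin. There the potential is of order
  \<open>t powr (- 1 - \<beta>)\<close>, at most of order \<open>1 / t\<close> since
  \<open>t \<ge> 1\<close>, and costs a constant over time \<open>s \<le> 2 * t\<close>.\<close>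

lemma pp_cone:
  assumes a: "a > 0"
  obtains c where "c > 0" "\<And>t s z w. t \<ge> 1 \<Longrightarrow> t \<le> s \<Longrightarrow> s \<le> 2 * t \<Longrightarrow> a * sqrt t \<le> norm z \<Longrightarrow> a * sqrt t \<le> norm w \<Longrightarrow>
    z \<bullet> w \<ge> - (norm z * norm w) / 2 \<Longrightarrow> c * cd t * exp (- (norm (z - w))\<^sup>2 / (4 * t)) \<le> pp s z w"
proof -
  define L where "L = 2 * \<kappa> * (a / 4) powr (- (2 + 2 * \<beta>))"
  define c where "c = exp (- L) * (1 - exp (- (a\<^sup>2 / 32))) * 2 powr (- real DIM('a) / 2)"
  have e1: "1 - exp (- (a\<^sup>2 / 32)) > 0" using a by simp
  have c: "c > 0" using e1 by (simp add: c_def)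
  show thesis
  proof (rule that[OF c])
    fix t s :: real and z w :: 'a
    assume t: "t \<ge> 1" "t \<le> s" "s \<le> 2 * t" and z: "a * sqrt t \<le> norm z" and w: "a * sqrt t \<le> norm w"
      and zw: "z \<bullet> w \<ge> - (norm z * norm w) / 2"
    have t0: "t > 0" "s > 0" "sqrt t > 0" using t by auto
    have at: "a * sqrt t > 0" using a t0 by simp
    have nz: "norm z > 0" "norm w > 0" using at z w by linarith+
    define z' w' where "z' = z /\<^sub>R norm z" and "w' = w /\<^sub>R norm w"
    have n1: "norm z' = 1" "norm w' = 1" using nz by (auto simp: z'_def w'_def)
    have i1: "z' \<bullet> w' \<ge> - 1 / 2"
    proof -
      have "z' \<bullet> w' = (z \<bullet> w) / (norm z * norm w)" by (simp add: z'_def w'_def divide_inverse)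
      also have "\<dots> \<ge> (- (norm z * norm w) / 2) / (norm z * norm w)" using zw nz by (intro divide_right_mono) auto
      also have "(- (norm z * norm w) / 2) / (norm z * norm w) = - 1 / 2" using nz by simp
      finally show ?thesis .
    qed
    define N where "N = norm (z' + w')"
    have ii: "z' \<bullet> z' = 1" "w' \<bullet> w' = 1" using n1 by (simp_all add: dot_square_norm)
    have N2: "N\<^sup>2 = 2 + 2 * (z' \<bullet> w')" unfolding N_def power2_norm_eq_inner using ii by (simp add: inner_add_left inner_add_right inner_commute)
    have N1: "N \<ge> 1"
    proof (rule power2_le_imp_le)
      show "1\<^sup>2 \<le> N\<^sup>2" using N2 i1 by simp
    qed (simp add: N_def)
    define v where "v = (z' + w') /\<^sub>R N"
    have nv: "norm v = 1" using N1 unfolding v_def by (simp add: N_def[symmetric])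
    have vz: "z' \<bullet> v \<ge> 1 / 2" "w' \<bullet> v \<ge> 1 / 2"
    proof -
      have "z' \<bullet> v = (1 + z' \<bullet> w') / N" "w' \<bullet> v = (1 + z' \<bullet> w') / N" using ii by (simp_all add: v_def inner_add_right inner_commute divide_inverse mult.commute)
      moreover have "(1 + z' \<bullet> w') / N = N / 2" using N2 N1 by (simp add: field_simps power2_eq_square)
      ultimately show "z' \<bullet> v \<ge> 1 / 2" "w' \<bullet> v \<ge> 1 / 2" using N1 by auto
    qed
    \<comment> \<open>Half of the guaranteed projection \<open>a * sqrt t / 2\<close>, so that both
      points keep distance at least \<open>l\<close> from the hyperplane.\<close>
    define l where "l = a * sqrt t / 4"
    have l: "l > 0" using at by (simp add: l_def)
    have zv: "z \<bullet> v \<ge> 2 * l"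
    proof -
      have "z \<bullet> v = norm z * (z' \<bullet> v)" using nz by (simp add: z'_def)
      also have "\<dots> \<ge> norm z * (1 / 2)" using vz by (intro mult_left_mono) auto
      finally show ?thesis using z by (simp add: l_def)
    qed
    have wv: "w \<bullet> v \<ge> 2 * l"
    proof -
      have "w \<bullet> v = norm w * (w' \<bullet> v)" using nz by (simp add: w'_def)
      also have "\<dots> \<ge> norm w * (1 / 2)" using vz by (intro mult_left_mono) auto
      finally show ?thesis using w by (simp add: l_def)
    qed
    have pots: "exp (- L) \<le> exp (- \<kappa> * l powr (- (2 + 2 * \<beta>)) * s)"
    proof -
      have "l powr (- (2 + 2 * \<beta>)) = (a / 4) powr (- (2 + 2 * \<beta>)) * sqrt t powr (- (2 + 2 * \<beta>))"
        using a t0 powr_mult[of "a / 4" "sqrt t"] by (simp add: l_def)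
      also have "sqrt t powr (- (2 + 2 * \<beta>)) = t powr (- 1 - \<beta>)"
      proof -
        have "1 / 2 * (- (2 + 2 * \<beta>)) = - 1 - \<beta>" by simp
        thus ?thesis using t0 by (simp only: powr_half_sqrt[symmetric] less_imp_le powr_powr)
      qed
      finally have eq: "l powr (- (2 + 2 * \<beta>)) = (a / 4) powr (- (2 + 2 * \<beta>)) * t powr (- 1 - \<beta>)" .
      have "t powr (- 1 - \<beta>) \<le> t powr (- 1)" using t beta by (intro powr_mono) auto
      also have "\<dots> = 1 / t" using t0 by (simp add: powr_minus_divide)
      finally have "l powr (- (2 + 2 * \<beta>)) \<le> (a / 4) powr (- (2 + 2 * \<beta>)) * (1 / t)" unfolding eq by (intro mult_left_mono powr_ge_zero)
      hence k: "\<kappa> * l powr (- (2 + 2 * \<beta>)) \<le> \<kappa> * ((a / 4) powr (- (2 + 2 * \<beta>)) * (1 / t))" using kappa by (intro mult_left_mono) auto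
      have "\<kappa> * l powr (- (2 + 2 * \<beta>)) * s \<le> \<kappa> * ((a / 4) powr (- (2 + 2 * \<beta>)) * (1 / t)) * (2 * t)"
        using t kappa by (intro mult_mono[OF k]) auto
      also have "\<dots> = L" using t0 by (simp add: L_def)
      finally show ?thesis by simp
    qed
    have prod: "1 - exp (- (a\<^sup>2 / 32)) \<le> 1 - exp (- (w \<bullet> v - l) * (z \<bullet> v - l) / s)"
    proof -
      have "l\<^sup>2 = a\<^sup>2 * t / 16" using t0 by (simp add: l_def power_divide power_mult_distrib)
      have "a\<^sup>2 / 32 = l\<^sup>2 / (2 * t)" by (simp only: \<open>l\<^sup>2 = a\<^sup>2 * t / 16\<close>) (use t0 in simp)
      also have "\<dots> = l * l / (2 * t)" by (simp only: power2_eq_square)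
      also have "\<dots> \<le> l * l / s" using t t0 l by (intro divide_left_mono) auto
      also have "\<dots> \<le> (w \<bullet> v - l) * (z \<bullet> v - l) / s" using zv wv l t0 by (intro divide_right_mono mult_mono) auto
      finally have le: "a\<^sup>2 / 32 \<le> (w \<bullet> v - l) * (z \<bullet> v - l) / s" .
      have eq: "- (w \<bullet> v - l) * (z \<bullet> v - l) / s = - ((w \<bullet> v - l) * (z \<bullet> v - l) / s)" by (simp only: minus_mult_left[symmetric] minus_divide_left[symmetric])
      show ?thesis unfolding eq by (intro diff_left_mono iffD2[OF exp_le_cancel_iff] le_imp_neg_le le)
    qed
    have hq: "2 powr (- real DIM('a) / 2) * cd t * exp (- (norm (z - w))\<^sup>2 / (4 * t)) \<le> heat_q s z w"
    proof -
      have "2 powr (- real DIM('a) / 2) * cd t = cd (2 * t)" using cd_scale[OF t0(1), of 2] by simp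
      also have "\<dots> \<le> cd s" using t t0 unfolding cd_def by (intro powr_mono2') auto
      finally have "2 powr (- real DIM('a) / 2) * cd t * exp (- (norm (z - w))\<^sup>2 / (4 * t)) \<le> cd s * exp (- (norm (z - w))\<^sup>2 / (4 * t))"
        by (intro mult_right_mono) auto
      also have "\<dots> \<le> cd s * exp (- (norm (z - w))\<^sup>2 / (4 * s))"
        using t t0 less_imp_le[OF cd_pos[OF t0(2)]] by (intro mult_left_mono) (auto intro!: divide_left_mono)
      finally show ?thesis by (simp add: heat_q_cd)
    qed
    have "c * cd t * exp (- (norm (z - w))\<^sup>2 / (4 * t)) =
      exp (- L) * (1 - exp (- (a\<^sup>2 / 32))) * (2 powr (- real DIM('a) / 2) * cd t * exp (- (norm (z - w))\<^sup>2 / (4 * t)))"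
      by (simp add: c_def)
    also have "\<dots> \<le> exp (- \<kappa> * l powr (- (2 + 2 * \<beta>)) * s) * (1 - exp (- (w \<bullet> v - l) * (z \<bullet> v - l) / s)) * heat_q s z w"
      using e1 cd_pos[OF t0(1)] order_trans[OF less_imp_le[OF e1] prod] by (intro mult_mono pots prod hq mult_nonneg_nonneg) auto
    also have "\<dots> \<le> pp s z w" using zv wv l by (intro pp_half_space nv l t0) auto
    finally show "c * cd t * exp (- (norm (z - w))\<^sup>2 / (4 * t)) \<le> pp s z w" .
  qed
qed

text \<open>When the angle is too wide for a single half-space, the path is routed through a ball
  around a point orthogonal to \<open>z\<close>; both legs then satisfy the angle condition of
  \<open>pp_cone\<close>. Such a detour exists from dimension two on, while in dimension one the
  sign condition excludes wide angles.\<close>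

lemma pp_interior:
  assumes a: "0 < a" "a \<le> 1"
  obtains c where "c > 0" "\<And>t z w. t \<ge> 1 \<Longrightarrow> a * sqrt t \<le> norm z \<Longrightarrow> a * sqrt t \<le> norm w \<Longrightarrow>
    DIM('a) \<ge> 2 \<or> z \<bullet> w > 0 \<Longrightarrow> c * cd t * exp (- (norm (z - w))\<^sup>2 / t) \<le> pp (2 * t) z w"
proof -
  have a2: "a / 2 > 0" using a by simp
  obtain c0 where c0: "c0 > 0" "\<And>t s z w. t \<ge> 1 \<Longrightarrow> t \<le> s \<Longrightarrow> s \<le> 2 * t \<Longrightarrow> a / 2 * sqrt t \<le> norm z \<Longrightarrow> a / 2 * sqrt t \<le> norm w \<Longrightarrow>
    z \<bullet> w \<ge> - (norm z * norm w) / 2 \<Longrightarrow> c0 * cd t * exp (- (norm (z - w))\<^sup>2 / (4 * t)) \<le> pp s z w"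
    using pp_cone[OF a2] by metis
  define \<Omega> where "\<Omega> = omega * (1 / 4) ^ DIM('a) * (4 * pi) powr (- real DIM('a) / 2)"
  have Om: "\<Omega> > 0" using omega_pos by (simp add: \<Omega>_def)
  define c where "c = min c0 (c0\<^sup>2 * exp (- 4) * \<Omega>)"
  have c: "c > 0" "c \<le> c0" "c \<le> c0\<^sup>2 * exp (- 4) * \<Omega>" using c0 Om by (auto simp: c_def)
  show thesis
  proof (rule that[OF c(1)])
    fix t :: real and z w :: 'a
    assume t: "t \<ge> 1" and z: "a * sqrt t \<le> norm z" and w: "a * sqrt t \<le> norm w" and d: "DIM('a) \<ge> 2 \<or> z \<bullet> w > 0"
    have t0: "t > 0" "sqrt t > 0" "2 * t > 0" using t by auto
    have cdt: "cd t > 0" by (rule cd_pos[OF t0(1)])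
    have at: "a * sqrt t > 0" "a / 2 * sqrt t \<le> a * sqrt t" "a / 2 * sqrt t \<le> sqrt t / 2" using a t0 by auto
    have nz: "norm z > 0" "norm w > 0" using at z w by linarith+
    show "c * cd t * exp (- (norm (z - w))\<^sup>2 / t) \<le> pp (2 * t) z w"
    proof (cases "z \<bullet> w \<ge> - (norm z * norm w) / 2")
      case True
      have "c * cd t * exp (- (norm (z - w))\<^sup>2 / t) \<le> c0 * cd t * exp (- (norm (z - w))\<^sup>2 / (4 * t))"
      proof (intro mult_mono)
        have "(norm (z - w))\<^sup>2 / (4 * t) \<le> (norm (z - w))\<^sup>2 / t" using t0 by (intro divide_left_mono) auto
        thus "exp (- (norm (z - w))\<^sup>2 / t) \<le> exp (- (norm (z - w))\<^sup>2 / (4 * t))" by simp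
      qed (use c c0 cdt in auto)
      also have "\<dots> \<le> pp (2 * t) z w" using True t at z w by (intro c0(2)) auto
      finally show ?thesis .
    next
      case False
      have "norm z * norm w \<ge> 0" by simp
      hence zw: "z \<bullet> w \<le> 0" using False by linarith
      hence "DIM('a) \<ge> 2" using d by linarith
      then obtain u0 where u0: "u0 \<noteq> 0" "orthogonal z u0" using orthogonal_to_vector_exists by metis
      \<comment> \<open>A vector orthogonal to \<open>z\<close>, with its sign chosen so that it
        does not point away from \<open>w\<close>.\<close>
      obtain v where v: "norm v = sqrt t" "z \<bullet> v = 0" "w \<bullet> v \<ge> 0"
      proof -
        define v0 where "v0 = (sqrt t / norm u0) *\<^sub>R u0"
        have v0: "norm v0 = sqrt t" "z \<bullet> v0 = 0" using u0 t0 by (auto simp: v0_def orthogonal_def)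
        show ?thesis
        proof (cases "w \<bullet> v0 \<ge> 0")
          case True thus ?thesis using that[of v0] v0 by blast
        next
          case False thus ?thesis using that[of "- v0"] v0 by auto
        qed
      qed
      define B where "B = ball v (sqrt t / 4)"
      have [measurable]: "(indicator B :: 'a \<Rightarrow> ennreal) \<in> borel_measurable borel" unfolding B_def by (rule borel_measurable_indicator) simp
      have zw2: "(norm z)\<^sup>2 + (norm w)\<^sup>2 \<le> (norm (z - w))\<^sup>2"
        using zw by (simp add: power2_norm_eq_inner inner_diff_left inner_diff_right inner_commute)
      \<comment> \<open>Because \<open>z \<bullet> w \<le> 0\<close>, the squared norms of
        \<open>z\<close> and \<open>w\<close> sum to at most \<open>(norm (z - w))\<^sup>2\<close>,
        so the detour of size \<open>sqrt t\<close> costs a constant and a larger Gaussian rate, but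
        no unbounded factor.\<close>
      define E where "E = exp (- 4) * exp (- (norm (z - w))\<^sup>2 / t)"
      have low: "(c0 * cd t)\<^sup>2 * E \<le> pp t z u * pp t u w" if u: "u \<in> B" for u
      proof -
        have uv: "norm (u - v) < sqrt t / 4" using u by (simp add: B_def dist_norm norm_minus_commute)
        have nu: "norm u \<ge> 3 / 4 * sqrt t" "norm u \<le> 5 / 4 * sqrt t"
          using uv v(1) norm_triangle_ineq2[of v "v - u"] norm_triangle_ineq[of v "u - v"] by (auto simp: norm_minus_commute)
        have ip: "x \<bullet> u \<ge> - (norm x * norm u) / 2" if "x \<bullet> v \<ge> 0" for x
        proof -
          have "\<bar>x \<bullet> (u - v)\<bar> \<le> norm x * norm (u - v)" by (rule Cauchy_Schwarz_ineq2)
          also have "\<dots> \<le> norm x * (norm u / 2)" using uv nu by (intro mult_left_mono) auto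
          finally have "\<bar>x \<bullet> u - x \<bullet> v\<bar> \<le> norm x * (norm u / 2)" by (simp only: inner_diff_right)
          moreover have "norm x * (norm u / 2) = norm x * norm u / 2" "- (norm x * norm u) / 2 = - (norm x * norm u / 2)" by simp_all
          ultimately show ?thesis using that by linarith
        qed
        have tri: "(norm (x - u))\<^sup>2 \<le> 2 * (norm x)\<^sup>2 + 8 * t" for x
        proof -
          have "(norm (x - u))\<^sup>2 \<le> (norm x + norm u)\<^sup>2" by (intro power_mono norm_triangle_ineq4) auto
          also have "\<dots> \<le> 2 * (norm x)\<^sup>2 + 2 * (norm u)\<^sup>2" using zero_le_power2[of "norm x - norm u"] unfolding power2_sum power2_diff by linarith
          also have "(norm u)\<^sup>2 \<le> (5 / 4 * sqrt t)\<^sup>2" using nu by (intro power_mono) auto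
          also have "(5 / 4 * sqrt t)\<^sup>2 = 25 / 16 * t" unfolding power_mult_distrib using t0 by (simp add: power2_eq_square)
          finally show ?thesis using t0 by linarith
        qed
        have "E \<le> exp (- (norm (z - u))\<^sup>2 / (4 * t)) * exp (- (norm (u - w))\<^sup>2 / (4 * t))"
        proof -
          have "(norm (z - u))\<^sup>2 + (norm (u - w))\<^sup>2 \<le> 2 * (norm (z - w))\<^sup>2 + 16 * t"
            using tri[of z] tri[of w] zw2 by (simp add: norm_minus_commute)
          also have "\<dots> \<le> 4 * (norm (z - w))\<^sup>2 + 16 * t" by simp
          finally have "((norm (z - u))\<^sup>2 + (norm (u - w))\<^sup>2) / (4 * t) \<le> (4 * (norm (z - w))\<^sup>2 + 16 * t) / (4 * t)"
            using t0 by (intro divide_right_mono) auto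
          also have "\<dots> = (norm (z - w))\<^sup>2 / t + 4" using t0 by (simp add: field_simps)
          finally have "- 4 + - (norm (z - w))\<^sup>2 / t \<le> - (norm (z - u))\<^sup>2 / (4 * t) + - (norm (u - w))\<^sup>2 / (4 * t)" by (simp add: add_divide_distrib)
          thus ?thesis unfolding E_def exp_add[symmetric] by simp
        qed
        hence "(c0 * cd t)\<^sup>2 * E \<le> (c0 * cd t)\<^sup>2 * (exp (- (norm (z - u))\<^sup>2 / (4 * t)) * exp (- (norm (u - w))\<^sup>2 / (4 * t)))"
          by (intro mult_left_mono) auto
        also have "\<dots> = (c0 * cd t * exp (- (norm (z - u))\<^sup>2 / (4 * t))) * (c0 * cd t * exp (- (norm (u - w))\<^sup>2 / (4 * t)))"
          by (simp add: power2_eq_square)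
        also have "\<dots> \<le> pp t z u * pp t u w"
        proof (intro mult_mono)
          have nu': "a / 2 * sqrt t \<le> norm u" using nu at(3) by linarith
          have nzw: "a / 2 * sqrt t \<le> norm z" "a / 2 * sqrt t \<le> norm w" using at z w by linarith+
          show "c0 * cd t * exp (- (norm (z - u))\<^sup>2 / (4 * t)) \<le> pp t z u"
            by (intro c0(2)) (use t nu' nzw ip[of z] v in auto)
          show "c0 * cd t * exp (- (norm (u - w))\<^sup>2 / (4 * t)) \<le> pp t u w"
            by (intro c0(2)) (use t nu' nzw ip[of w] v in \<open>auto simp: inner_commute mult.commute\<close>)
        qed (use c0 cdt in auto)
        finally show ?thesis .
      qed
      have "ennreal (c * cd t * exp (- (norm (z - w))\<^sup>2 / t)) \<le> ennreal ((c0 * cd t)\<^sup>2 * E * (omega * (sqrt t / 4) ^ DIM('a)))"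
      proof (rule ennreal_leI)
        have "cd t * (omega * (sqrt t / 4) ^ DIM('a)) = \<Omega>"
          using cd_volume[OF t0(1)] by (simp add: \<Omega>_def power_divide mult_ac)
        hence "(c0 * cd t)\<^sup>2 * E * (omega * (sqrt t / 4) ^ DIM('a)) = c0\<^sup>2 * exp (- 4) * \<Omega> * cd t * exp (- (norm (z - w))\<^sup>2 / t)"
          by (simp add: power2_eq_square E_def mult_ac)
        moreover have "c * cd t * exp (- (norm (z - w))\<^sup>2 / t) \<le> c0\<^sup>2 * exp (- 4) * \<Omega> * cd t * exp (- (norm (z - w))\<^sup>2 / t)"
          using c cdt by (intro mult_right_mono) auto
        ultimately show "c * cd t * exp (- (norm (z - w))\<^sup>2 / t) \<le> (c0 * cd t)\<^sup>2 * E * (omega * (sqrt t / 4) ^ DIM('a))" by simp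
      qed
      also have "\<dots> = ennreal ((c0 * cd t)\<^sup>2 * E) * (\<integral>\<^sup>+ u. indicator B u \<partial>lborel)"
      proof -
        have "(\<integral>\<^sup>+ u. indicator B u \<partial>lborel) = emeasure lborel B" by (rule nn_integral_indicator) (simp add: B_def)
        thus ?thesis using t0 omega_pos by (simp add: B_def emeasure_ball ennreal_mult E_def)
      qed
      also have "\<dots> = (\<integral>\<^sup>+ u. ennreal ((c0 * cd t)\<^sup>2 * E) * indicator B u \<partial>lborel)" by (rule nn_integral_cmult[symmetric]) simp
      also have "\<dots> \<le> (\<integral>\<^sup>+ u. ennreal (pp t z u) * ennreal (pp t u w) \<partial>lborel)"
      proof (rule nn_integral_mono)
        fix u show "ennreal ((c0 * cd t)\<^sup>2 * E) * indicator B u \<le> ennreal (pp t z u) * ennreal (pp t u w)"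
          using low[of u] by (cases "u \<in> B") (simp_all add: ennreal_mult[symmetric] ennreal_leI)
      qed
      also have "\<dots> = ennreal (pp (2 * t) z w)" using nz t0 by (intro pp_double[symmetric]) auto
      finally show ?thesis by (simp add: ennreal_le_iff)
    qed
  qed
qed

lemma inner_DIM_1:
  assumes "DIM('a) = 1" obtains b :: 'a where "\<And>x y::'a. x \<bullet> y = (x \<bullet> b) * (y \<bullet> b)"
proof -
  obtain b :: 'a where b: "Basis = {b}" using assms by (auto simp: card_1_singleton_iff)
  show thesis
  proof (rule that)
    fix x y :: 'a
    have "x \<bullet> y = (\<Sum>i\<in>Basis. (x \<bullet> i) * (y \<bullet> i))" by (rule euclidean_inner)
    also have "\<dots> = (x \<bullet> b) * (y \<bullet> b)" unfolding b by simp
    finally show "x \<bullet> y = (x \<bullet> b) * (y \<bullet> b)" .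
  qed
qed

text \<open>Supplies the intermediate set for the lower bound: within \<open>R * sqrt t\<close> of
  \<open>x\<close>, at distance of order \<open>sqrt t\<close> from the origin, and reached with
  probability of order \<open>mfun\<close>. For \<open>norm x < sqrt t\<close> it comes from the
  annulus estimate, otherwise it is a ball around \<open>x\<close>.\<close>

lemma relay:
  obtains a R c where "0 < a" "a \<le> 1" "R > 0" "c > 0"
    "\<And>t x. t \<ge> 1 \<Longrightarrow> x \<noteq> 0 \<Longrightarrow> \<exists>A. (indicator A :: 'a \<Rightarrow> ennreal) \<in> borel_measurable borel \<and>
      (\<forall>z\<in>A. a * sqrt t \<le> norm z \<and> norm (z - x) \<le> R * sqrt t \<and> (DIM('a) \<ge> 2 \<or> z \<bullet> x > 0)) \<and>
      ennreal (c * mfun DIM('a) t (norm x)) \<le> K t (indicator A) x"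
proof -
  obtain a b c1 where abc: "0 < a" "a \<le> 1" "1 \<le> b" "c1 > 0" "\<And>t x. t \<ge> 1 \<Longrightarrow> x \<noteq> 0 \<Longrightarrow> norm x < sqrt t \<Longrightarrow>
    ennreal (c1 * (phx x / phi DIM('a) (sqrt t))) \<le> K t (indicator {z. a * sqrt t \<le> norm z \<and> norm z \<le> b * sqrt t}) x"
    by (rule K_annulus_lower) blast
  obtain c2 where c2: "c2 > 0" "\<And>t s z w. t \<ge> 1 \<Longrightarrow> t \<le> s \<Longrightarrow> s \<le> 2 * t \<Longrightarrow> 1 / 2 * sqrt t \<le> norm z \<Longrightarrow> 1 / 2 * sqrt t \<le> norm w \<Longrightarrow>
    z \<bullet> w \<ge> - (norm z * norm w) / 2 \<Longrightarrow> c2 * cd t * exp (- (norm (z - w))\<^sup>2 / (4 * t)) \<le> pp s z w"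
    using pp_cone[of "1 / 2"] by (metis half_gt_zero_iff zero_less_one)
  define c3 where "c3 = c2 * exp (- 1) * (omega * (1 / 2) ^ DIM('a) * (4 * pi) powr (- real DIM('a) / 2))"
  have c3: "c3 > 0" using c2 omega_pos by (simp add: c3_def)
  show thesis
  proof (rule that[of "min a (1 / 2)" "b + 1" "min c1 c3"])
    fix t :: real and x :: 'a assume t: "t \<ge> 1" and x: "x \<noteq> 0"
    have t0: "t > 0" "sqrt t > 0" using t by auto
    have mc: "min c1 c3 * mfun DIM('a) t (norm x) \<le> c1 * mfun DIM('a) t (norm x)" "min c1 c3 * mfun DIM('a) t (norm x) \<le> c3 * mfun DIM('a) t (norm x)"
      using mfun_nonneg[OF t0(1)] by (intro mult_right_mono; simp)+
    have ma: "min a (1 / 2) * sqrt t \<le> a * sqrt t" "min a (1 / 2) * sqrt t \<le> 1 / 2 * sqrt t" using t0 by (intro mult_right_mono; simp)+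
    show "\<exists>A. (indicator A :: 'a \<Rightarrow> ennreal) \<in> borel_measurable borel \<and>
      (\<forall>z\<in>A. min a (1 / 2) * sqrt t \<le> norm z \<and> norm (z - x) \<le> (b + 1) * sqrt t \<and> (DIM('a) \<ge> 2 \<or> z \<bullet> x > 0)) \<and>
      ennreal (min c1 c3 * mfun DIM('a) t (norm x)) \<le> K t (indicator A) x"
    proof (cases "norm x < sqrt t")
      case True
      let ?A = "{z::'a. a * sqrt t \<le> norm z \<and> norm z \<le> b * sqrt t}"
      let ?B = "{z::'a. (a * sqrt t \<le> norm z \<and> norm z \<le> b * sqrt t) \<and> (DIM('a) \<ge> 2 \<or> z \<bullet> x > 0)}"
      have m: "(indicator ?B :: 'a \<Rightarrow> ennreal) \<in> borel_measurable borel" by measurable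
      have geo: "min a (1 / 2) * sqrt t \<le> norm z \<and> norm (z - x) \<le> (b + 1) * sqrt t \<and> (DIM('a) \<ge> 2 \<or> z \<bullet> x > 0)" if "z \<in> ?B" for z
        using that ma True norm_triangle_ineq4[of z x] by (auto simp: algebra_simps)
      have "ennreal (min c1 c3 * mfun DIM('a) t (norm x)) \<le> ennreal (c1 * (phx x / phi DIM('a) (sqrt t)))"
        using mc(1) mfun_near[of t "norm x" "DIM('a)"] t0 True by (intro ennreal_leI) simp
      also have "\<dots> \<le> K t (indicator ?A) x" by (rule abc(5)[OF t x True])
      also have "\<dots> \<le> K t (indicator ?B) x" unfolding K_def
      proof (rule nn_integral_mono)
        fix z :: 'a
        \<comment> \<open>In dimension one the annulus has a component on the far side of the
          origin; the kernel vanishes there, so the restriction to the side of \<open>x\<close>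
          loses no mass.\<close>
        have "pp t x z = 0" if "z \<in> ?A" "z \<notin> ?B"
        proof -
          have z: "z \<noteq> 0" "z \<bullet> x \<le> 0" "\<not> DIM('a) \<ge> 2" using that abc t0 by (auto simp: mult_le_0_iff)
          have D: "DIM('a) = 1" using z(3) DIM_ge_1 by linarith
          obtain e :: 'a where e: "\<And>x y::'a. x \<bullet> y = (x \<bullet> e) * (y \<bullet> e)" using inner_DIM_1[OF D] by metis
          have "z \<bullet> x \<noteq> 0" using e[of z z] e[of x x] e[of z x] z(1) x by auto
          hence "x \<bullet> z < 0" using z(2) by (simp add: inner_commute)
          thus ?thesis by (rule pp_opposite[OF D t0(1)])
        qed
        thus "ennreal (pp t x z) * indicator ?A z \<le> ennreal (pp t x z) * indicator ?B z"
          by (cases "z \<in> ?B") (auto simp: indicator_def)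
      qed
      finally show ?thesis using m geo by (intro exI[of _ ?B] conjI ballI) (blast | assumption)+
    next
      case False
      let ?B = "ball x (sqrt t / 2)"
      have m: "(indicator ?B :: 'a \<Rightarrow> ennreal) \<in> borel_measurable borel" by (rule borel_measurable_indicator) simp
      have geo: "1 / 2 * sqrt t \<le> norm z \<and> norm (z - x) < sqrt t / 2 \<and> x \<bullet> z > 0" if "z \<in> ?B" for z
      proof -
        have d: "norm (z - x) < sqrt t / 2" using that by (simp add: dist_norm norm_minus_commute)
        have "norm z \<ge> sqrt t / 2" using d False norm_triangle_ineq2[of x "x - z"] by (simp add: norm_minus_commute)
        moreover have "x \<bullet> z > 0"
        proof -
          have "\<bar>x \<bullet> (z - x)\<bar> \<le> norm x * norm (z - x)" by (rule Cauchy_Schwarz_ineq2)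
          also have "norm (z - x) < norm x" using d False t0(2) by linarith
          hence "norm x * norm (z - x) < norm x * norm x" using x by (intro mult_strict_left_mono) auto
          also have "\<dots> = x \<bullet> x" by (simp add: dot_square_norm power2_eq_square)
          finally show ?thesis by (simp add: inner_diff_right)
        qed
        ultimately show ?thesis using d by simp
      qed
      have low: "c2 * exp (- 1) * cd t \<le> pp t x z" if z: "z \<in> ?B" for z
      proof -
        have "norm (x - z) \<le> sqrt t" using geo[OF z] t0(2) norm_minus_commute[of x z] by linarith
        hence "(norm (x - z))\<^sup>2 \<le> (sqrt t)\<^sup>2" by (intro power_mono) auto
        hence "exp (- 1) \<le> exp (- (norm (x - z))\<^sup>2 / (4 * t))" using t0 by (simp add: field_simps)
        hence "c2 * cd t * exp (- 1) \<le> c2 * cd t * exp (- (norm (x - z))\<^sup>2 / (4 * t))" using c2 cd_pos[OF t0(1)] by (intro mult_left_mono) auto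
        also have "\<dots> \<le> pp t x z"
        proof (rule c2(2)[OF t])
          have "norm x * norm z \<ge> 0" by simp
          thus "- (norm x * norm z) / 2 \<le> x \<bullet> z" using geo[OF z] by linarith
          show "1 / 2 * sqrt t \<le> norm x" using False t0(2) by linarith
        qed (use geo[OF z] t0 in auto)
        finally show ?thesis by (simp add: mult_ac)
      qed
      have "min c1 c3 * mfun DIM('a) t (norm x) \<le> c3"
        using mc(2) mfun_far[of t "norm x" "DIM('a)"] t0 False by simp
      also have "c3 = c2 * exp (- 1) * cd t * (omega * (sqrt t / 2) ^ DIM('a))"
        using cd_volume[OF t0(1)] by (simp add: c3_def power_divide mult_ac)
      finally have "ennreal (min c1 c3 * mfun DIM('a) t (norm x)) \<le> ennreal (c2 * exp (- 1) * cd t * (omega * (sqrt t / 2) ^ DIM('a)))"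
        by (rule ennreal_leI)
      also have "\<dots> = ennreal (c2 * exp (- 1) * cd t) * (\<integral>\<^sup>+ z. indicator ?B z \<partial>lborel)"
      proof -
        have "(\<integral>\<^sup>+ z. indicator ?B z \<partial>lborel) = emeasure lborel ?B" by (rule nn_integral_indicator) simp
        thus ?thesis using t0 omega_pos c2 cd_pos[OF t0(1)] by (simp add: emeasure_ball ennreal_mult[symmetric])
      qed
      also have "\<dots> = (\<integral>\<^sup>+ z. ennreal (c2 * exp (- 1) * cd t) * indicator ?B z \<partial>lborel)" using m by (intro nn_integral_cmult[symmetric]) simp
      also have "\<dots> \<le> K t (indicator ?B) x" unfolding K_def
      proof (rule nn_integral_mono)
        fix z show "ennreal (c2 * exp (- 1) * cd t) * indicator ?B z \<le> ennreal (pp t x z) * indicator ?B z"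
          using low[of z] by (cases "z \<in> ?B") (simp_all add: ennreal_leI)
      qed
      finally have "ennreal (min c1 c3 * mfun DIM('a) t (norm x)) \<le> K t (indicator ?B) x" .
      moreover have "\<forall>z\<in>?B. min a (1 / 2) * sqrt t \<le> norm z \<and> norm (z - x) \<le> (b + 1) * sqrt t \<and> (DIM('a) \<ge> 2 \<or> z \<bullet> x > 0)"
      proof
        fix z assume z: "z \<in> ?B"
        have "1 / 2 * sqrt t \<le> (b + 1) * sqrt t" using abc t0 by (intro mult_right_mono) auto
        thus "min a (1 / 2) * sqrt t \<le> norm z \<and> norm (z - x) \<le> (b + 1) * sqrt t \<and> (DIM('a) \<ge> 2 \<or> z \<bullet> x > 0)"
          using geo[OF z] ma(2) by (auto simp: inner_commute)
      qed
      ultimately show ?thesis using m by blast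
    qed
  qed (use abc c3 in auto)
qed

text \<open>Both end points move to their relay sets, and the middle half of the time joins the sets
  by \<open>pp_interior\<close>. Distances change by at most \<open>2 * R * sqrt t\<close>, which
  costs \<open>exp (- 8 * R\<^sup>2)\<close> and a factor 2 in the Gaussian exponent.\<close>

lemma pp_lower:
  obtains c where "c > 0" "\<And>t x y. t \<ge> 1 \<Longrightarrow> x \<noteq> 0 \<Longrightarrow> y \<noteq> 0 \<Longrightarrow> DIM('a) \<ge> 2 \<or> x \<bullet> y > 0 \<Longrightarrow>
    c * (cd t * exp (- 2 * (norm (x - y))\<^sup>2 / t)) * mfun DIM('a) t (norm x) * mfun DIM('a) t (norm y) \<le> pp (4 * t) x y"
proof -
  obtain a R c1 where relay: "0 < a" "a \<le> 1" "R > 0" "c1 > 0"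
    "\<And>t x. t \<ge> 1 \<Longrightarrow> x \<noteq> 0 \<Longrightarrow> \<exists>A. (indicator A :: 'a \<Rightarrow> ennreal) \<in> borel_measurable borel \<and>
      (\<forall>z\<in>A. a * sqrt t \<le> norm z \<and> norm (z - x) \<le> R * sqrt t \<and> (DIM('a) \<ge> 2 \<or> z \<bullet> x > 0)) \<and>
      ennreal (c1 * mfun DIM('a) t (norm x)) \<le> K t (indicator A) x"
    by (rule relay) blast
  obtain c2 where c2: "c2 > 0" "\<And>t z w. t \<ge> 1 \<Longrightarrow> a * sqrt t \<le> norm z \<Longrightarrow> a * sqrt t \<le> norm w \<Longrightarrow>
    DIM('a) \<ge> 2 \<or> z \<bullet> w > 0 \<Longrightarrow> c2 * cd t * exp (- (norm (z - w))\<^sup>2 / t) \<le> pp (2 * t) z w"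
    using pp_interior[OF relay(1,2)] by metis
  show thesis
  proof (rule that[of "c2 * exp (- 8 * R\<^sup>2) * c1\<^sup>2"])
    show "c2 * exp (- 8 * R\<^sup>2) * c1\<^sup>2 > 0" using c2 relay by simp
    fix t :: real and x y :: 'a assume t: "t \<ge> 1" and x: "x \<noteq> 0" and y: "y \<noteq> 0" and d: "DIM('a) \<ge> 2 \<or> x \<bullet> y > 0"
    have t0: "t > 0" "2 * t > 0" "sqrt t > 0" using t by auto
    note [measurable] = pp_measurable_snd[OF t0(1)] pp_measurable_snd[OF t0(2)]
    obtain A where A [measurable]: "(indicator A :: 'a \<Rightarrow> ennreal) \<in> borel_measurable borel"
      and A1: "\<And>z. z \<in> A \<Longrightarrow> a * sqrt t \<le> norm z \<and> norm (z - x) \<le> R * sqrt t \<and> (DIM('a) \<ge> 2 \<or> z \<bullet> x > 0)"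
      and A2: "ennreal (c1 * mfun DIM('a) t (norm x)) \<le> K t (indicator A) x" using relay(5)[OF t x] by blast
    obtain B where B [measurable]: "(indicator B :: 'a \<Rightarrow> ennreal) \<in> borel_measurable borel"
      and B1: "\<And>z. z \<in> B \<Longrightarrow> a * sqrt t \<le> norm z \<and> norm (z - y) \<le> R * sqrt t \<and> (DIM('a) \<ge> 2 \<or> z \<bullet> y > 0)"
      and B2: "ennreal (c1 * mfun DIM('a) t (norm y)) \<le> K t (indicator B) y" using relay(5)[OF t y] by blast
    define D where "D = c2 * cd t * exp (- 8 * R\<^sup>2) * exp (- 2 * (norm (x - y))\<^sup>2 / t)"
    have D: "D > 0" using c2 cd_pos[OF t0(1)] by (simp add: D_def)
    have ker: "D \<le> pp (2 * t) z w" if z: "z \<in> A" and w: "w \<in> B" for z w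
    proof -
      have zw: "DIM('a) \<ge> 2 \<or> z \<bullet> w > 0"
      proof (cases "DIM('a) \<ge> 2")
        case False
        hence i: "z \<bullet> x > 0" "w \<bullet> y > 0" "x \<bullet> y > 0" using A1[OF z] B1[OF w] d by auto
        obtain e :: 'a where e: "\<And>x y::'a. x \<bullet> y = (x \<bullet> e) * (y \<bullet> e)" using inner_DIM_1 False DIM_ge_1 by (metis le_antisym not_less_eq_eq one_add_one plus_1_eq_Suc)
        \<comment> \<open>On a line the inner product is a product of coordinates, so the three
          positive signs force the fourth.\<close>
        have "(z \<bullet> w) * (x \<bullet> y)\<^sup>2 = (z \<bullet> x) * (w \<bullet> y) * (x \<bullet> y)"
          unfolding e[of z w] e[of x y] e[of z x] e[of w y] by (simp add: power2_eq_square)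
        also have "\<dots> > 0" using i by simp
        finally show ?thesis using i(3) by (simp add: zero_less_mult_iff)
      qed simp
      have "norm (z - w) \<le> norm (x - y) + 2 * R * sqrt t"
        using norm_triangle_ineq[of "z - x" "x - w"] norm_triangle_ineq[of "x - y" "y - w"] A1[OF z] B1[OF w] by (simp add: norm_minus_commute)
      hence "(norm (z - w))\<^sup>2 \<le> (norm (x - y) + 2 * R * sqrt t)\<^sup>2" by (intro power_mono) auto
      also have "\<dots> \<le> 2 * (norm (x - y))\<^sup>2 + 2 * (2 * R * sqrt t)\<^sup>2"
        using zero_le_power2[of "norm (x - y) - 2 * R * sqrt t"] unfolding power2_sum power2_diff by linarith
      also have "(2 * R * sqrt t)\<^sup>2 = 4 * R\<^sup>2 * t" using t0 by (simp add: power_mult_distrib)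
      finally have "(norm (z - w))\<^sup>2 / t \<le> (2 * (norm (x - y))\<^sup>2 + 2 * (4 * R\<^sup>2 * t)) / t" using t0 by (intro divide_right_mono) auto
      also have "\<dots> = 2 * (norm (x - y))\<^sup>2 / t + 8 * R\<^sup>2" using t0 by (simp add: add_divide_distrib)
      finally have "- 8 * R\<^sup>2 + - 2 * (norm (x - y))\<^sup>2 / t \<le> - (norm (z - w))\<^sup>2 / t" by simp
      hence "exp (- 8 * R\<^sup>2) * exp (- 2 * (norm (x - y))\<^sup>2 / t) \<le> exp (- (norm (z - w))\<^sup>2 / t)" unfolding exp_add[symmetric] by simp
      hence "D \<le> c2 * cd t * exp (- (norm (z - w))\<^sup>2 / t)"
        unfolding D_def mult.assoc using c2 cd_pos[OF t0(1)] by (intro mult_left_mono) auto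
      also have "\<dots> \<le> pp (2 * t) z w" using A1[OF z] B1[OF w] zw t by (intro c2(2)) auto
      finally show ?thesis .
    qed
    have mn: "mfun DIM('a) t r \<ge> 0" for r by (rule mfun_nonneg[OF t0(1)])
    have in1: "ennreal (D * (c1 * mfun DIM('a) t (norm y))) * indicator A z \<le> K (2 * t) (\<lambda>w. ennreal (pp t y w)) z" for z
    proof (cases "z \<in> A")
      case True
      have "ennreal (D * (c1 * mfun DIM('a) t (norm y))) \<le> ennreal D * K t (indicator B) y"
        using B2 D relay(4) mn by (simp add: ennreal_mult mult_left_mono)
      also have "\<dots> = (\<integral>\<^sup>+ w. ennreal D * (ennreal (pp t y w) * indicator B w) \<partial>lborel)" unfolding K_def by (rule nn_integral_cmult[symmetric]) measurable
      also have "\<dots> \<le> K (2 * t) (\<lambda>w. ennreal (pp t y w)) z" unfolding K_def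
      proof (rule nn_integral_mono)
        fix w show "ennreal D * (ennreal (pp t y w) * indicator B w) \<le> ennreal (pp (2 * t) z w) * ennreal (pp t y w)"
          using ker[OF True, of w] by (cases "w \<in> B") (auto intro!: mult_right_mono ennreal_leI)
      qed
      finally show ?thesis using True by simp
    qed simp
    have "ennreal (D * (c1 * mfun DIM('a) t (norm y)) * (c1 * mfun DIM('a) t (norm x))) =
      ennreal (D * (c1 * mfun DIM('a) t (norm y))) * ennreal (c1 * mfun DIM('a) t (norm x))"
      using D relay(4) mn by (intro ennreal_mult) auto
    also have "\<dots> \<le> ennreal (D * (c1 * mfun DIM('a) t (norm y))) * K t (indicator A) x" by (intro mult_left_mono A2) auto
    also have "\<dots> = K t (\<lambda>z. ennreal (D * (c1 * mfun DIM('a) t (norm y))) * indicator A z) x" using t0 by (intro K_cmult[symmetric]) auto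
    also have "\<dots> \<le> K t (K (2 * t) (\<lambda>w. ennreal (pp t y w))) x" by (intro K_mono in1)
    also have "\<dots> = ennreal (pp (4 * t) x y)" using t0 x y by (simp add: pp_quadruple)
    finally have "D * (c1 * mfun DIM('a) t (norm y)) * (c1 * mfun DIM('a) t (norm x)) \<le> pp (4 * t) x y"
      by (simp add: ennreal_le_iff)
    thus "c2 * exp (- 8 * R\<^sup>2) * c1\<^sup>2 * (cd t * exp (- 2 * (norm (x - y))\<^sup>2 / t)) * mfun DIM('a) t (norm x) * mfun DIM('a) t (norm y) \<le> pp (4 * t) x y"
      by (simp add: D_def power2_eq_square mult_ac)
  qed
qed

section \<open>Passage to the stated form\<close>

lemma mfun_pos: "t > 0 \<Longrightarrow> r > 0 \<Longrightarrow> mfun d t r > 0"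
  by (simp add: mfun_def phi_pos)

text \<open>Both kernel bounds are for time \<open>4 * s\<close> with \<open>mfun\<close> at time
  \<open>s\<close>. Doubling the radius multiplies \<open>phi\<close> by at most a constant, so the
  quarter time may be replaced by the full one.\<close>

lemma mfun_quarter:
  assumes d: "d \<ge> 1"
  obtains C where "C > 0" "\<And>t r. t \<ge> 4 \<Longrightarrow> mfun d (t / 4) r \<le> C * mfun d t r" "\<And>t r. t \<ge> 4 \<Longrightarrow> mfun d t r \<le> mfun d (t / 4) r"
proof -
  obtain C1 where C1: "C1 \<ge> 1" "\<And>r l. r \<ge> 1 \<Longrightarrow> l \<ge> 1 \<Longrightarrow> phi d (l * r) \<le> C1 * l * phi d r"
    using phi_growth[OF d zero_less_one] by metis
  have ph: "0 < phi d (sqrt (t / 4))" "0 < phi d (sqrt t)" "phi d (sqrt (t / 4)) \<le> phi d (sqrt t)" "phi d (sqrt t) \<le> 2 * C1 * phi d (sqrt (t / 4))"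
    if t: "t \<ge> 4" for t
  proof -
    show "0 < phi d (sqrt (t / 4))" "0 < phi d (sqrt t)" "phi d (sqrt (t / 4)) \<le> phi d (sqrt t)" using t by (auto intro!: phi_pos phi_mono)
    have "sqrt (t / 4) \<ge> 1" using t real_sqrt_ge_1_iff[of "t / 4"] by linarith
    moreover have "sqrt t = 2 * sqrt (t / 4)" by (simp add: real_sqrt_divide)
    ultimately show "phi d (sqrt t) \<le> 2 * C1 * phi d (sqrt (t / 4))" using C1(2)[of "sqrt (t / 4)" 2] by (simp add: mult.commute)
  qed
  show thesis
  proof (rule that[of "2 * C1"])
    show "2 * C1 > 0" using C1 by simp
    fix t r :: real assume t: "t \<ge> 4"
    have "phi d r / phi d (sqrt t) \<le> phi d r / phi d (sqrt (t / 4))" using ph[OF t] by (intro divide_left_mono) auto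
    thus "mfun d t r \<le> mfun d (t / 4) r" unfolding mfun_def by linarith
    have "phi d r * phi d (sqrt t) \<le> phi d r * (2 * C1 * phi d (sqrt (t / 4)))" using ph[OF t] by (intro mult_left_mono) auto
    hence "phi d r / phi d (sqrt (t / 4)) \<le> 2 * C1 * (phi d r / phi d (sqrt t))" using ph[OF t] by (simp add: field_simps)
    thus "mfun d (t / 4) r \<le> 2 * C1 * mfun d t r" using C1 unfolding mfun_def min_def by (auto simp: not_le)
  qed
qed

lemma heat_kernel_bounds:
  "\<exists>c1>0. \<exists>c2>0. \<exists>c3>0. \<exists>c4>0. \<forall>t\<ge>4. \<forall>x y. x \<noteq> 0 \<longrightarrow> y \<noteq> 0 \<longrightarrow>
    (DIM('a) \<ge> 2 \<or> x \<bullet> y > 0) \<longrightarrow>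
    c1 * heat_q (c2 * t) x y * Hfun DIM('a) \<beta> \<kappa> t (norm x) * Hfun DIM('a) \<beta> \<kappa> t (norm y) \<le> p t x y \<and>
    p t x y \<le> c3 * heat_q (c4 * t) x y * Hfun DIM('a) \<beta> \<kappa> t (norm x) * Hfun DIM('a) \<beta> \<kappa> t (norm y)"
proof -
  let ?d = "real DIM('a)"
  let ?H = "Hfun DIM('a) \<beta> \<kappa>"
  let ?m = "mfun DIM('a)"
  obtain U where U: "U > 0" "\<And>t x y. t \<ge> 1 / 2 \<Longrightarrow> x \<noteq> 0 \<Longrightarrow> y \<noteq> 0 \<Longrightarrow>
    pp (4 * t) x y \<le> U * (cd (2 * t) * exp (- (norm (x - y))\<^sup>2 / (192 * t))) * ?m t (norm x) * ?m t (norm y)"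
    by (rule pp_upper) blast
  obtain l where l: "l > 0" "\<And>t x y. t \<ge> 1 \<Longrightarrow> x \<noteq> 0 \<Longrightarrow> y \<noteq> 0 \<Longrightarrow> DIM('a) \<ge> 2 \<or> x \<bullet> y > 0 \<Longrightarrow>
    l * (cd t * exp (- 2 * (norm (x - y))\<^sup>2 / t)) * ?m t (norm x) * ?m t (norm y) \<le> pp (4 * t) x y"
    by (rule pp_lower) blast
  obtain k K where H: "k > 0" "K > 0" "\<And>t r. t \<ge> 1 \<Longrightarrow> r > 0 \<Longrightarrow> k * ?H t r \<le> ?m t r"
    "\<And>t r. t \<ge> 1 \<Longrightarrow> r > 0 \<Longrightarrow> ?m t r \<le> K * ?H t r"
    by (rule Hfun_mfun[OF DIM_ge_1]) blast
  obtain Q where Q: "Q > 0" "\<And>t r. t \<ge> 4 \<Longrightarrow> ?m (t / 4) r \<le> Q * ?m t r" "\<And>t r. t \<ge> 4 \<Longrightarrow> ?m t r \<le> ?m (t / 4) r"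
    by (rule mfun_quarter[OF DIM_ge_1]) blast
  \<comment> \<open>With \<open>s = t / 4\<close> the lower exponent \<open>2 / s\<close> equals
    \<open>1 / (4 * (t / 32))\<close>, and the upper \<open>192 * s\<close> equals
    \<open>4 * (12 * t)\<close>. The powers of 8 and 1/24 adjust the normalisations
    \<open>cd (t / 4)\<close> and \<open>cd (t / 2)\<close> to the times \<open>t / 32\<close> and
    \<open>12 * t\<close>.\<close>
  define c1 where "c1 = l * 8 powr (- ?d / 2) * k\<^sup>2"
  define c3 where "c3 = U * (1 / 24) powr (- ?d / 2) * (Q * K)\<^sup>2"
  have c: "c1 > 0" "c3 > 0" using l U H Q by (auto simp: c1_def c3_def)
  have main: "c1 * heat_q (1 / 32 * t) x y * ?H t (norm x) * ?H t (norm y) \<le> p t x y \<and>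
      p t x y \<le> c3 * heat_q (12 * t) x y * ?H t (norm x) * ?H t (norm y)"
    if t: "t \<ge> 4" and x: "x \<noteq> 0" and y: "y \<noteq> 0" and d: "DIM('a) \<ge> 2 \<or> x \<bullet> y > 0" for t and x y :: 'a
  proof -
    have t0: "t > 0" "t \<ge> 1" "t / 4 \<ge> 1" "t / 4 \<ge> 1 / 2" using t by auto
    have n: "norm x > 0" "norm y > 0" using x y by auto
    have Hp: "?H t r > 0" if "r > 0" for r
      using H(4)[OF t0(2) that] mfun_pos[OF t0(1) that] H(2) by (metis order.strict_trans2 zero_less_mult_pos)
    have up: "?m (t / 4) r \<le> Q * K * ?H t r" if "r > 0" for r
    proof -
      have "Q * ?m t r \<le> Q * (K * ?H t r)" using H(4)[OF t0(2) that] Q by (intro mult_left_mono) auto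
      thus ?thesis using Q(2)[OF t, of r] by simp
    qed
    have lo: "k * ?H t r \<le> ?m (t / 4) r" if "r > 0" for r
      using H(3)[OF t0(2) that] Q(3)[OF t, of r] by linarith
    have mp: "?m (t / 4) r \<ge> 0" for r using t0 by (intro mfun_nonneg) auto
    have "c1 * heat_q (1 / 32 * t) x y * ?H t (norm x) * ?H t (norm y) =
      l * (cd (t / 4) * exp (- 2 * (norm (x - y))\<^sup>2 / (t / 4))) * (k * ?H t (norm x)) * (k * ?H t (norm y))"
    proof -
      have "cd (t / 4) = 8 powr (- ?d / 2) * cd (1 / 32 * t)" using cd_scale[of "1 / 32 * t" 8] t0 by simp
      thus ?thesis by (simp add: c1_def heat_q_cd power2_eq_square mult_ac)
    qed
    also have "\<dots> \<le> l * (cd (t / 4) * exp (- 2 * (norm (x - y))\<^sup>2 / (t / 4))) * ?m (t / 4) (norm x) * ?m (t / 4) (norm y)"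
    proof (rule mult_mono[OF mult_left_mono])
      have "cd (t / 4) > 0" using t0 by (intro cd_pos) simp
      thus "0 \<le> l * (cd (t / 4) * exp (- 2 * (norm (x - y))\<^sup>2 / (t / 4)))" using l by simp
      thus "0 \<le> l * (cd (t / 4) * exp (- 2 * (norm (x - y))\<^sup>2 / (t / 4))) * ?m (t / 4) (norm x)" using mp by simp
      show "0 \<le> k * ?H t (norm y)" using Hp[OF n(2)] H by simp
    qed (use lo n in auto)
    also have "\<dots> \<le> pp (4 * (t / 4)) x y" by (rule l(2)[OF t0(3) x y d])
    finally have low: "c1 * heat_q (1 / 32 * t) x y * ?H t (norm x) * ?H t (norm y) \<le> pp t x y" by simp
    have "pp (4 * (t / 4)) x y \<le> U * (cd (2 * (t / 4)) * exp (- (norm (x - y))\<^sup>2 / (192 * (t / 4)))) * ?m (t / 4) (norm x) * ?m (t / 4) (norm y)"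
      by (rule U(2)[OF t0(4) x y])
    also have "\<dots> \<le> U * (cd (2 * (t / 4)) * exp (- (norm (x - y))\<^sup>2 / (192 * (t / 4)))) * (Q * K * ?H t (norm x)) * (Q * K * ?H t (norm y))"
    proof (rule mult_mono[OF mult_left_mono])
      have "cd (2 * (t / 4)) > 0" using t0 by (intro cd_pos) simp
      thus *: "0 \<le> U * (cd (2 * (t / 4)) * exp (- (norm (x - y))\<^sup>2 / (192 * (t / 4))))" using U by simp
      have "0 \<le> Q * K * ?H t (norm x)" using Hp[OF n(1)] H Q by simp
      with * show "0 \<le> U * (cd (2 * (t / 4)) * exp (- (norm (x - y))\<^sup>2 / (192 * (t / 4)))) * (Q * K * ?H t (norm x))" by (rule mult_nonneg_nonneg)
    qed (use up n mp in auto)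
    also have "\<dots> = c3 * heat_q (12 * t) x y * ?H t (norm x) * ?H t (norm y)"
    proof -
      have "cd (2 * (t / 4)) = (1 / 24) powr (- ?d / 2) * cd (12 * t)" using cd_scale[of "12 * t" "1 / 24"] t0 by simp
      moreover have "192 * (t / 4) = 4 * (12 * t)" by simp
      ultimately show ?thesis by (simp only: c3_def heat_q_cd power2_eq_square mult_ac)
    qed
    finally have "pp t x y \<le> c3 * heat_q (12 * t) x y * ?H t (norm x) * ?H t (norm y)" by simp
    \<comment> \<open>The estimates concern the positive part; the strictly positive lower bound
      forces \<open>p t x y\<close> to coincide with it.\<close>
    moreover have pp: "pp t x y = max 0 (p t x y)" using x y by (simp add: pp_def)
    moreover have "0 < c1 * heat_q (1 / 32 * t) x y * ?H t (norm x) * ?H t (norm y)"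
      using c Hp n t0 heat_q_pos[of "1 / 32 * t" x y] by simp
    ultimately show ?thesis using low by linarith
  qed
  show ?thesis
    by (rule exI[of _ c1], rule conjI[OF c(1)], rule exI[of _ "1 / 32"], rule conjI, simp, rule exI[of _ c3], rule conjI[OF c(2)],
        rule exI[of _ 12], rule conjI, simp) (use main in blast)
qed

end

theorem theorem1p2:
  fixes \<beta> \<kappa> :: real
    and M :: "'a::euclidean_space \<Rightarrow> 'b measure"
    and W :: "real \<Rightarrow> 'b \<Rightarrow> 'a"
    and p :: "real \<Rightarrow> 'a \<Rightarrow> 'a \<Rightarrow> real"
  assumes "\<beta> > 0" and "\<kappa> > 0"
    and "\<forall>x. is_BM (M x) W x"
    and "is_fk_density M W \<beta> \<kappa> p"
    and "continuous_on ({0<..} \<times> ((- {0}) \<times> (- {0}))) (\<lambda>(t, x, y). p t x y)"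
  shows "\<exists>c1>0. \<exists>c2>0. \<exists>c3>0. \<exists>c4>0. \<forall>t\<ge>4. \<forall>x y. x \<noteq> 0 \<longrightarrow> y \<noteq> 0 \<longrightarrow>
           (DIM('a) \<ge> 2 \<or> x \<bullet> y > 0) \<longrightarrow>
           c1 * heat_q (c2 * t) x y * Hfun DIM('a) \<beta> \<kappa> t (norm x) * Hfun DIM('a) \<beta> \<kappa> t (norm y) \<le> p t x y \<and>
           p t x y \<le> c3 * heat_q (c4 * t) x y * Hfun DIM('a) \<beta> \<kappa> t (norm x) * Hfun DIM('a) \<beta> \<kappa> t (norm y)"
proof -
  interpret fk_kernel \<beta> \<kappa> M W p
    by unfold_locales (use assms in auto)
  show ?thesis by (rule heat_kernel_bounds)
qed

end
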